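(* Let $\alpha\in(0,\tfrac12)$ and assume that for some $\sigma>0$, $\operatorname{Tr}[A_\alpha^{\rho_0}GG^*]<\infty$ with $\rho_0=\frac{5+2\sigma-2\alpha}{2\alpha}$. Let $T>0$ and $K>1$. Then there exist $\gamma\in(0,1)$, a $\mathbf P$-a.s. strictly positive $(\mathcal F_t)$-stopping time $\mathfrak t=\mathfrak t(T,K)$ with $\mathbf P(\mathfrak t\ge T)>\tfrac12$, and an $(\mathcal F_t)$-adapted process $u$ which is an analytically weak solution to (HNSE) on $[0,\mathfrak t]$, such that $u(\cdot\wedge\mathfrak t)\in C(\mathbb R_+;H^\gamma)$ $\mathbf P$-a.s., $u(0)\in L^2_\sigma$ is deterministic, $$\operatorname*{ess\,sup}_{\omega\in\Omega}\sup_{t\ge0}\|u(t\wedge\mathfrak t)\|_{H^\gamma}<\infty,$$ and on the event $\{\mathfrak t\ge T\}$ one has pathwise $$\|u(T)\|_{L^2}^2>K\big(\|u(0)\|_{L^2}^2+T\operatorname{Tr}(GG^* )\big).$$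
   Context: $\mathbb T^3=(\mathbb R/2\pi\mathbb Z)^3$; $L^2_\sigma$ is the space of divergence-free fields in $L^2(\mathbb T^3;\mathbb R^3)$ with norm $\|f\|_{L^2}^2=(2\pi)^{-3}\int_{[-\pi,\pi]^3}|f|^2dx$; $H^s$ ($s\ge0$) the divergence-free Sobolev spaces defined via Fourier weights $(1+|k|^2)^s$, $H^{-s}$ their duals. $(-\Delta)^\alpha$ is the Fourier multiplier $|k|^{2\alpha}$, $A_\alpha=\mathbb P(-\Delta)^\alpha$ on $L^2_\sigma$. $F_\alpha:L^2_\sigma\to H^{-3}$, $\langle F_\alpha(y),e\rangle_{(-3,3)}=\langle y\otimes y,\nabla e\rangle_{L^2}-\langle y,(-\Delta)^\alpha e\rangle_{L^2}$. $(\Omega,\mathcal F,(\mathcal F_t)_{t\ge0},\mathbf P)$ is a probability space carrying a $GG^*$-Wiener process $B$ on $L^2_\sigma$, $G\in L_2(U,L^2_\sigma)$, and $(\mathcal F_t)$ is the normal (augmented) filtration generated by $B$. An $L^2_\sigma$-valued process $u$ is an analytically weak solution to (HNSE) on $[0,\tau]$ ($\tau$ a stopping time) if $\mathbf P$-a.s. for all $e\in H^3$ and $t\in[0,\tau]$: $\langle u(t),e\rangle_{L^2}=\langle u(0),e\rangle_{L^2}+\int_0^t\langle F_\alpha(u(r)),e\rangle_{(-3,3)}dr+\langle B_t,e\rangle_{L^2}$. *)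

theory Defs
  imports "HOL-Analysis.Analysis" "HOL-Probability.Probability" "HOL-Library.Function_Algebras"
begin

text \<open>Divergence-free vector fields on the torus T^3 are represented by their Fourier
 coefficients: a field y is a map from frequencies k in Z^3 to coefficient vectors in C^3,
 y(x) = sum_k y(k) exp(i k.x).  With the normalised measure (2 pi)^(-3) dx, Parseval gives
 the L^2 norm squared as the sum of the squared moduli of the coefficients.\<close>

type_synonym freq = "int ^ 3"
type_synonym field = "freq \<Rightarrow> complex ^ 3"

definition knorm2 :: "freq \<Rightarrow> real" where
  "knorm2 k = real_of_int (\<Sum>i\<in>UNIV. (k $ i)^2)"

text \<open>L^2_sigma: real-valued (Hermitian symmetry), divergence-free, square summable.\<close>
definition L2sigma :: "field set" where
  "L2sigma = {f. (\<forall>k. f (-k) = (\<chi> i. cnj (f k $ i)))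
               \<and> (\<forall>k. (\<Sum>i\<in>UNIV. of_int (k $ i) * f k $ i) = 0)
               \<and> (\<lambda>k. (norm (f k))^2) summable_on UNIV}"

definition Hs_norm2 :: "real \<Rightarrow> field \<Rightarrow> ennreal" where
  "Hs_norm2 s f = (\<Sum>\<^sub>\<infinity> k. ennreal ((1 + knorm2 k) powr s * (norm (f k))^2))"

definition Hs :: "real \<Rightarrow> field set" where
  "Hs s = {f \<in> L2sigma. Hs_norm2 s f < \<infinity>}"

definition L2norm2 :: "field \<Rightarrow> real" where
  "L2norm2 f = enn2real (Hs_norm2 0 f)"

definition inner_L2 :: "field \<Rightarrow> field \<Rightarrow> real" where
  "inner_L2 f g = Re (\<Sum>\<^sub>\<infinity> k. (\<Sum>i\<in>UNIV. f k $ i * cnj (g k $ i)))"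

text \<open>The pairing < y, (-Delta)^alpha e >; (-Delta)^alpha is the multiplier |k|^(2 alpha).\<close>
definition frac_pair :: "real \<Rightarrow> field \<Rightarrow> field \<Rightarrow> real" where
  "frac_pair \<alpha> y e = Re (\<Sum>\<^sub>\<infinity> k. of_real (knorm2 k powr \<alpha>) *
                         (\<Sum>i\<in>UNIV. y k $ i * cnj (e k $ i)))"

text \<open>The pairing < y (x) y, grad e > = sum_{i,j} (2pi)^(-3) int y_i y_j d_j e_i dx, in Fourier form.\<close>
definition nonlin_pair :: "field \<Rightarrow> field \<Rightarrow> real" where
  "nonlin_pair y e = Re (\<Sum>\<^sub>\<infinity> (k, l). (\<Sum>i\<in>UNIV. \<Sum>j\<in>UNIV.
        y k $ i * y l $ j * (- \<i> * of_int ((k + l) $ j)) * cnj (e (k + l) $ i)))"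

definition F_pair :: "real \<Rightarrow> field \<Rightarrow> field \<Rightarrow> real" where
  "F_pair \<alpha> y e = nonlin_pair y e - frac_pair \<alpha> y e"

text \<open>Borel sigma-algebra of L^2_sigma (generated by the Fourier coordinates, which coincides
 with the Borel sigma-algebra of the separable Hilbert space L^2_sigma).\<close>
definition L2meas :: "field measure" where
  "L2meas = sigma L2sigma
     {(\<lambda>f. f k $ i) -` A \<inter> L2sigma | k i A. A \<in> sets (borel :: complex measure)}"

text \<open>G in L_2(U, L^2_sigma) is represented by the images g n = G e_n of an orthonormal
 basis (e_n) of U = l^2; then G G^* h = sum_n <h, g n> g n.\<close>
definition HS_family :: "(nat \<Rightarrow> field) \<Rightarrow> bool" where
  "HS_family g \<longleftrightarrow> (\<forall>n. g n \<in> L2sigma) \<and> summable (\<lambda>n. L2norm2 (g n))"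

definition trGG :: "(nat \<Rightarrow> field) \<Rightarrow> real" where
  "trGG g = (\<Sum>n. L2norm2 (g n))"

text \<open>Tr[A_alpha^rho G G^*] = ||A_alpha^(rho/2) G||_HS^2; A_alpha^rho is the multiplier |k|^(2 alpha rho).\<close>
definition trApow_GG :: "real \<Rightarrow> real \<Rightarrow> (nat \<Rightarrow> field) \<Rightarrow> ennreal" where
  "trApow_GG \<alpha> \<rho> g = (\<Sum>\<^sub>\<infinity> n. \<Sum>\<^sub>\<infinity> k. ennreal (knorm2 k powr (\<alpha> * \<rho>) * (norm (g n k))^2))"

definition natF :: "'a measure \<Rightarrow> (real \<Rightarrow> 'a \<Rightarrow> field) \<Rightarrow> real \<Rightarrow> 'a measure" where
  "natF M B t = sigma (space M)
     {B s -` E \<inter> space M | s E. 0 \<le> s \<and> s \<le> t \<and> E \<in> sets L2meas}"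

definition augF :: "'a measure \<Rightarrow> (real \<Rightarrow> 'a \<Rightarrow> field) \<Rightarrow> real \<Rightarrow> 'a measure" where
  "augF M B t = sigma (space M)
     (\<Inter>r\<in>{t<..}. sets (sigma (space M) (sets (natF M B r) \<union> null_sets M)))"

definition q_wiener :: "'a measure \<Rightarrow> (real \<Rightarrow> 'a measure) \<Rightarrow> (nat \<Rightarrow> field)
                         \<Rightarrow> (real \<Rightarrow> 'a \<Rightarrow> field) \<Rightarrow> bool" where
  "q_wiener M F g B \<longleftrightarrow>
     (\<forall>t. B t \<in> measurable M L2meas)
   \<and> (\<forall>t\<ge>0. B t \<in> measurable (F t) L2meas)
   \<and> (AE \<omega> in M. B 0 \<omega> = 0 \<and>
        (\<forall>t\<ge>0. ((\<lambda>s. L2norm2 (B s \<omega> - B t \<omega>)) \<longlongrightarrow> 0) (at t within {0..})))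
   \<and> (\<forall>s t. 0 \<le> s \<and> s \<le> t \<longrightarrow>
        (\<forall>A\<in>sets (F s). \<forall>E\<in>sets L2meas.
           measure M (A \<inter> ((\<lambda>\<omega>. B t \<omega> - B s \<omega>) -` E \<inter> space M))
           = measure M A * measure M ((\<lambda>\<omega>. B t \<omega> - B s \<omega>) -` E \<inter> space M)))
   \<and> (\<forall>s t h. 0 \<le> s \<and> s \<le> t \<and> h \<in> L2sigma \<longrightarrow>
        (\<forall>\<theta>. char (distr M borel (\<lambda>\<omega>. inner_L2 (B t \<omega> - B s \<omega>) h)) \<theta>
             = of_real (exp (- ((t - s) * (\<Sum>n. (inner_L2 h (g n))^2)) * \<theta>^2 / 2))))"

definition weak_solution :: "'a measure \<Rightarrow> real \<Rightarrow> (real \<Rightarrow> 'a \<Rightarrow> field)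
                              \<Rightarrow> (real \<Rightarrow> 'a \<Rightarrow> field) \<Rightarrow> ('a \<Rightarrow> real) \<Rightarrow> bool" where
  "weak_solution M \<alpha> B u \<tau> \<longleftrightarrow>
     (AE \<omega> in M. \<forall>e\<in>Hs 3. \<forall>t. 0 \<le> t \<and> t \<le> \<tau> \<omega> \<longrightarrow>
        set_integrable lborel {0..t} (\<lambda>r. F_pair \<alpha> (u r \<omega>) e)
      \<and> inner_L2 (u t \<omega>) e = inner_L2 (u 0 \<omega>) e
          + (LINT r:{0..t}|lborel. F_pair \<alpha> (u r \<omega>) e) + inner_L2 (B t \<omega>) e)"

end

theory Submission
  imports Defs "HOL-Library.Poly_Mapping"
begin

text \<open>
  The solution is built by convex integration, path by path, around the noise.

  The Wiener process is stopped at the first violation of a bound on its dyadic increments in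
  \<open>H^2\<close>. Fourth moments of Gaussian variables make a violation before \<open>T\<close> improbable, and by
  chaining the stopped path \<open>b\<close> is bounded and \<open>1/8\<close>-Hoelder in \<open>H^2\<close>.

  The approximate solutions are trigonometric polynomials. They start from \<open>b\<close> (truncated) plus the
  shear flow \<open>A sin (t/T) cos x_2 e_1\<close>, and they solve the equation up to the divergence of a stress
  \<open>\<Sum> r_ab \<xi>_ab \<otimes> \<xi>_ab\<close> with \<open>\<xi>_ab = e_a + e_b\<close> and \<open>\<xi>_aa = e_a\<close>. One step removes one coefficient
  \<open>r = r_ab\<close>: it adds a wave in direction \<open>\<xi>_ab\<close> whose wave vector is orthogonal to \<open>\<xi>_ab\<close> and whose
  squared amplitude is \<open>K - r\<close>; the constant \<open>K\<close> has no divergence. The phase of the wave follows the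
  velocity frozen at a reset time. Two families of waves, of frequencies \<open>lam\<close> and \<open>2 lam\<close>, are
  multiplied by time cut-offs with squares adding up to one, so that each of them can be reset while
  it is switched off. The dissipation of the wave is an error of lower order because \<open>\<alpha> < 1/2\<close>. Only the term
  with the derivative of the cut-offs needs the sup norm; all others are estimated by the sum of
  the moduli of the Fourier coefficients.

  The nine coefficients are treated cyclically, with frequencies growing doubly exponentially, so
  that the steps are summable in \<open>H^\<gamma>\<close> for a small \<open>\<gamma>\<close>. All steps together change the \<open>L^2\<close> norm by
  \<open>O(sqrt A)\<close>: the initial energy is \<open>O(A)\<close> while the energy at time \<open>T\<close> is at least of order \<open>A^2\<close>.
\<close>

text \<open>The phase of a wave has to follow the velocity, since otherwise a transport term of size
  \<open>lam\<close> survives; a velocity that is only Hoelder in time allows a frozen phase for a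
  time of order 1/\<open>om\<close> only. Two errors compete: \<open>om\<close>^(-1/8) times a power
  of L from freezing, and \<open>om\<close>/\<open>lam\<close> from switching. Passing from the sup
  norm to the coefficient sum costs the number of modes, a large power of L. With \<open>om\<close>
  = \<open>lam\<close>/L^3 and \<open>lam\<close> a huge power of L the first error beats every such
  loss; the second has only L^3 to spare, hence its separate treatment. The shear flow is chosen
  because its self-interaction has no divergence: the first stress is linear in A, so the waves have
  amplitude O(sqrt A). A step leaves the Fourier coefficients in a growing box unchanged. Each mode
  of the limit is therefore reached after finitely many steps and inherits adaptedness. All bounds
  are deterministic, because up to the stopping time the noise is bounded by a constant; this gives
  the essential supremum.\<close>

type_synonym tpoly = "(freq, complex) poly_mapping"
type_synonym tvec = "3 \<Rightarrow> tpoly"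
type_synonym tmat = "3 \<Rightarrow> 3 \<Rightarrow> tpoly"
type_synonym 'w proc = "real \<Rightarrow> 'w \<Rightarrow> tpoly"

section \<open>Trigonometric polynomials as finitely supported coefficient families\<close>

abbreviation jb :: "freq \<Rightarrow> real" where "jb k \<equiv> 1 + knorm2 k"
abbreviation wS :: "freq set \<Rightarrow> field \<Rightarrow> real" where "wS A f \<equiv> \<Sum>k\<in>A. jb k^2 * (norm (f k))^2"
abbreviation lk :: "tpoly \<Rightarrow> freq \<Rightarrow> complex" where "lk \<equiv> Poly_Mapping.lookup"
abbreviation ks :: "tpoly \<Rightarrow> freq set" where "ks \<equiv> Poly_Mapping.keys"
abbreviation sg :: "freq \<Rightarrow> complex \<Rightarrow> tpoly" where "sg \<equiv> Poly_Mapping.single"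

definition dotk :: "freq \<Rightarrow> real^3 \<Rightarrow> real" where
  "dotk k x = (\<Sum>i\<in>UNIV. of_int (k $ i) * x $ i)"

definition ev :: "tpoly \<Rightarrow> real^3 \<Rightarrow> complex" where
  "ev f x = (\<Sum>k\<in>ks f. lk f k * cis (dotk k x))"

text \<open>The norm of the Wiener algebra. It is submultiplicative, dominates the sup norm, and
  every bounded Fourier multiplier acts boundedly on it; hence it is the default norm of the
  construction.\<close>

definition an :: "tpoly \<Rightarrow> real" where
  "an f = (\<Sum>k\<in>ks f. cmod (lk f k))"

definition kbox :: "nat \<Rightarrow> freq set" where
  "kbox D = {k. \<forall>i. \<bar>k $ i\<bar> \<le> int D}"

definition dg :: "nat \<Rightarrow> tpoly \<Rightarrow> bool" where
  "dg D f \<longleftrightarrow> ks f \<subseteq> kbox D"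

text \<open>A predicate with an explicit bound instead of a supremum, so that estimates compose by
  rules such as \<open>sn_add\<close> and \<open>sn_mult\<close>.\<close>

definition sn :: "real \<Rightarrow> tpoly \<Rightarrow> bool" where
  "sn c f \<longleftrightarrow> (\<forall>x. cmod (ev f x) \<le> c)"

definition rl :: "tpoly \<Rightarrow> bool" where
  "rl f \<longleftrightarrow> (\<forall>x. Im (ev f x) = 0)"

definition cst :: "complex \<Rightarrow> tpoly" where "cst c = sg 0 c"

definition mulp :: "(freq \<Rightarrow> complex) \<Rightarrow> tpoly \<Rightarrow> tpoly" where
  "mulp mu f = Poly_Mapping.mapp (\<lambda>k c. mu k * c) f"

text \<open>Coefficients of the complex conjugate function; conjugation reverses the
  frequencies.\<close>

definition cn :: "tpoly \<Rightarrow> tpoly" where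
  "cn f = Poly_Mapping.map cnj (Poly_Mapping.map_key uminus f)"

lemma lk_mulp [simp]: "lk (mulp mu f) k = mu k * lk f k"
  by (auto simp: mulp_def lookup_mapp when_def in_keys_iff)

lemma lk_cn [simp]: "lk (cn f) k = cnj (lk f (-k))"
proof -
  have "inj (uminus :: freq \<Rightarrow> freq)" by (simp add: inj_def)
  thus ?thesis by (simp add: cn_def map.rep_eq map_key.rep_eq when_def)
qed

lemma ks_lk: "k \<notin> ks f \<Longrightarrow> lk f k = 0"
  by (simp add: in_keys_iff)

lemma ks_mulp: "ks (mulp mu f) \<subseteq> ks f"
  by (auto simp: in_keys_iff)

lemma kbox_image: "kbox D = vec_lambda ` (PiE UNIV (\<lambda>_. {- int D..int D}))"
proof
  show "kbox D \<subseteq> vec_lambda ` (PiE UNIV (\<lambda>_. {- int D..int D}))"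
  proof
    fix k assume "k \<in> kbox D"
    hence "k $ i \<in> {- int D..int D}" for i using abs_le_D1[of "k $ i"] abs_le_D2[of "k $ i"] by (force simp: kbox_def)
    hence "vec_nth k \<in> PiE UNIV (\<lambda>_. {- int D..int D})" by blast
    moreover have "k = vec_lambda (vec_nth k)" by simp
    ultimately show "k \<in> vec_lambda ` (PiE UNIV (\<lambda>_. {- int D..int D}))" by blast
  qed
next
  have "\<bar>h i\<bar> \<le> int D" if "h \<in> PiE UNIV (\<lambda>_. {- int D..int D})" for h and i :: 3
    using PiE_mem[OF that, of i] by (simp add: abs_le_iff)
  thus "vec_lambda ` (PiE UNIV (\<lambda>_. {- int D..int D})) \<subseteq> kbox D" by (auto simp: kbox_def)
qed

lemma finite_kbox: "finite (kbox D)"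
  unfolding kbox_image by (intro finite_imageI finite_PiE) auto

lemma card_kbox: "card (kbox D) \<le> (2*D+1)^3"
proof -
  have "card (kbox D) \<le> card (PiE (UNIV::3 set) (\<lambda>_. {- int D..int D}))"
    unfolding kbox_image by (intro card_image_le finite_PiE) auto
  also have "... = (2*D+1)^3"
  proof -
    have "nat (1 + 2 * int D) = 2 * D + 1" by simp
    hence "card {- int D..int D} = 2*D+1" by simp
    thus ?thesis by (simp only: card_PiE finite prod_constant) simp
  qed
  finally show ?thesis .
qed

lemma kbox_mono: "D \<le> E \<Longrightarrow> kbox D \<subseteq> kbox E"
  by (auto simp: kbox_def intro: order_trans)

lemma ev_superset:
  assumes "finite S" "ks f \<subseteq> S"
  shows "ev f x = (\<Sum>k\<in>S. lk f k * cis (dotk k x))"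
  unfolding ev_def using assms by (intro sum.mono_neutral_left) (auto simp: ks_lk)

lemma an_superset:
  assumes "finite S" "ks f \<subseteq> S"
  shows "an f = (\<Sum>k\<in>S. cmod (lk f k))"
  unfolding an_def using assms by (intro sum.mono_neutral_left) (auto simp: ks_lk)

lemma ev_add [simp]: "ev (f + g) x = ev f x + ev g x"
proof -
  let ?S = "ks f \<union> ks g"
  have "ks (f+g) \<subseteq> ?S" by (rule keys_add)
  thus ?thesis
    by (simp add: ev_superset[of ?S] lookup_add sum.distrib ring_distribs)
qed

lemma ev_zero [simp]: "ev 0 x = 0"
  by (simp add: ev_def)

lemma ev_uminus [simp]: "ev (- f) x = - ev f x"
  using ev_add[of f "-f" x] by (simp add: eq_neg_iff_add_eq_0 add.commute)

lemma ev_diff [simp]: "ev (f - g) x = ev f x - ev g x"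
  using ev_add[of f "-g" x] by simp

lemma ev_sum [simp]: "ev (sum f A) x = (\<Sum>a\<in>A. ev (f a) x)"
  by (induction A rule: infinite_finite_induct) auto

lemma ev_single [simp]: "ev (sg k c) x = c * cis (dotk k x)"
  by (cases "c = 0") (auto simp: ev_def)

lemma tpoly_expand: "f = (\<Sum>k\<in>ks f. sg k (lk f k))"
  by (rule poly_mapping_eqI) (auto simp: lookup_sum lookup_single when_def ks_lk)

lemma dotk_add: "dotk (k + l) x = dotk k x + dotk l x"
  by (simp add: dotk_def sum.distrib ring_distribs)

lemma dotk_zero [simp]: "dotk 0 x = 0" by (simp add: dotk_def)

lemma dotk_uminus [simp]: "dotk (- k) x = - dotk k x"
  by (simp add: dotk_def sum_negf)

lemma tpoly_mult_expand: "f * g = (\<Sum>k\<in>ks f. \<Sum>l\<in>ks g. sg (k+l) (lk f k * lk g l))"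
proof -
  have "f * g = (\<Sum>k\<in>ks f. sg k (lk f k)) * (\<Sum>l\<in>ks g. sg l (lk g l))"
    using tpoly_expand[of f] tpoly_expand[of g] by simp
  thus ?thesis by (simp add: sum_product mult_single)
qed

text \<open>The product of finitely supported maps over the additive group Z^3 is convolution, so it
  becomes the pointwise product of functions. Together with \<open>ev_eqI\<close> this allows
  polynomial identities to be checked on values.\<close>

lemma ev_mult [simp]: "ev (f * g) x = ev f x * ev g x"
proof -
  have "ev (f * g) x = (\<Sum>k\<in>ks f. \<Sum>l\<in>ks g. (lk f k * lk g l) * cis (dotk (k+l) x))"
    by (subst tpoly_mult_expand) simp
  also have "... = (\<Sum>k\<in>ks f. \<Sum>l\<in>ks g. (lk f k * cis (dotk k x)) * (lk g l * cis (dotk l x)))"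
    by (simp add: dotk_add cis_mult[symmetric] mult_ac)
  finally show ?thesis by (simp add: ev_def sum_product)
qed

lemma ev_cst [simp]: "ev (cst c) x = c" by (simp add: cst_def)

lemma ev_one [simp]: "ev 1 x = 1"
  using ev_single[of 0 1 x] by simp

lemma ev_power [simp]: "ev (f ^ n) x = ev f x ^ n"
  by (induction n) auto

lemma an_nonneg [simp]: "0 \<le> an f" by (simp add: an_def sum_nonneg)

lemma an_zero [simp]: "an 0 = 0" by (simp add: an_def)

lemma an_triangle: "an (f + g) \<le> an f + an g"
proof -
  let ?S = "ks f \<union> ks g"
  have "an (f + g) = (\<Sum>k\<in>?S. cmod (lk f k + lk g k))"
    using keys_add[of f g] by (simp add: an_superset[of ?S] lookup_add)
  also have "... \<le> (\<Sum>k\<in>?S. cmod (lk f k) + cmod (lk g k))"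
    by (intro sum_mono norm_triangle_ineq)
  finally show ?thesis by (simp add: sum.distrib an_superset[of ?S])
qed

lemma an_uminus [simp]: "an (- f) = an f"
  by (simp add: an_def keys_def)

lemma an_diff: "an (f - g) \<le> an f + an g"
  using an_triangle[of f "-g"] by simp

lemma an_diff_commute: "an (f - g) = an (g - f)"
  using an_uminus[of "f - g"] by simp

lemma an_single [simp]: "an (sg k c) = cmod c"
  by (cases "c = 0") (auto simp: an_def)

lemma an_cst [simp]: "an (cst c) = cmod c" by (simp add: cst_def)

lemma an_sum: "an (sum f A) \<le> (\<Sum>a\<in>A. an (f a))"
  by (induction A rule: infinite_finite_induct) (auto intro: order_trans[OF an_triangle])

lemma an_mult: "an (f * g) \<le> an f * an g"
proof -
  have "an (f * g) \<le> (\<Sum>k\<in>ks f. \<Sum>l\<in>ks g. an (sg (k+l) (lk f k * lk g l)))"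
    by (subst tpoly_mult_expand) (intro order_trans[OF an_sum] sum_mono order_refl)
  thus ?thesis by (simp only: an_single norm_mult) (simp add: an_def sum_product)
qed

lemma cmod_ev_le_an: "cmod (ev f x) \<le> an f"
  unfolding ev_def an_def by (rule order_trans[OF norm_sum]) (simp add: norm_mult)

lemma cmod_lk_le_an: "cmod (lk f k) \<le> an f"
proof (cases "k \<in> ks f")
  case True
  thus ?thesis unfolding an_def by (intro member_le_sum) auto
qed (simp add: ks_lk)

lemma an_mulp:
  assumes "\<And>k. k \<in> ks f \<Longrightarrow> cmod (mu k) \<le> c"
  shows "an (mulp mu f) \<le> c * an f"
proof -
  have "an (mulp mu f) = (\<Sum>k\<in>ks f. cmod (mu k) * cmod (lk f k))"
    using ks_mulp by (simp add: an_superset[of "ks f"] norm_mult)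
  also have "... \<le> (\<Sum>k\<in>ks f. c * cmod (lk f k))"
    by (intro sum_mono mult_right_mono assms) auto
  finally show ?thesis by (simp add: an_def sum_distrib_left)
qed

lemma mulp_add: "mulp mu (f + g) = mulp mu f + mulp mu g"
  by (rule poly_mapping_eqI) (simp add: lookup_add ring_distribs)
lemma mulp_diff: "mulp mu (f - g) = mulp mu f - mulp mu g"
  by (rule poly_mapping_eqI) (simp add: lookup_minus ring_distribs)
lemma mulp_sum: "mulp mu (sum f A) = (\<Sum>a\<in>A. mulp mu (f a))"
  by (rule poly_mapping_eqI) (simp add: lookup_sum sum_distrib_left)
lemma lk_cst_mult [simp]: "lk (cst c * f) k = c * lk f k"
proof -
  have "lk (cst c * f) k = lk (\<Sum>l\<in>ks f. sg l (c * lk f l)) k"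
    by (cases "c = 0") (simp_all add: cst_def tpoly_mult_expand[of "sg 0 c"])
  also have "... = c * lk f k"
    by (auto simp: lookup_sum lookup_single when_def ks_lk)
  finally show ?thesis .
qed
lemma lk_cst: "lk (cst c) k = (if k = 0 then c else 0)"
  by (simp add: cst_def lookup_single when_def)

lemma lk_mult:
  assumes "finite S" "ks f \<subseteq> S"
  shows "lk (f * g) n = (\<Sum>k\<in>S. lk f k * lk g (n - k))"
proof -
  have "lk (f * g) n = (\<Sum>k\<in>ks f. \<Sum>l\<in>ks g. (lk f k * lk g l when k + l = n))"
    by (subst tpoly_mult_expand) (simp add: lookup_sum lookup_single)
  also have "... = (\<Sum>k\<in>ks f. lk f k * lk g (n - k))"
  proof (rule sum.cong[OF refl])
    fix k
    have "(\<Sum>l\<in>ks g. (lk f k * lk g l when k + l = n)) = (\<Sum>l\<in>ks g. if l = n - k then lk f k * lk g l else 0)"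
      by (intro sum.cong) (auto simp: when_def algebra_simps)
    also have "... = lk f k * lk g (n - k)" by (auto simp: ks_lk)
    finally show "(\<Sum>l\<in>ks g. (lk f k * lk g l when k + l = n)) = lk f k * lk g (n - k)" .
  qed
  also have "... = (\<Sum>k\<in>S. lk f k * lk g (n - k))"
    using assms by (intro sum.mono_neutral_left) (auto simp: ks_lk)
  finally show ?thesis .
qed

lemma lk_single_mult: "lk (sg k c * f) n = c * lk f (n - k)"
  by (cases "c = 0") (simp_all add: lk_mult[of "{k}"])

subsection \<open>Degree\<close>

lemma dg_mono: "dg D f \<Longrightarrow> D \<le> E \<Longrightarrow> dg E f"
  using kbox_mono by (auto simp: dg_def)
lemma dg_zero [simp]: "dg D 0" by (simp add: dg_def)
lemma dg_cst [simp]: "dg D (cst c)" by (cases "c = 0") (auto simp: dg_def cst_def kbox_def)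
lemma dg_one [simp]: "dg D 1" by (auto simp: dg_def kbox_def)
lemma dg_add: "dg D f \<Longrightarrow> dg D g \<Longrightarrow> dg D (f + g)"
  using keys_add[of f g] by (auto simp: dg_def)
lemma dg_uminus: "dg D f \<Longrightarrow> dg D (- f)" by (simp add: dg_def)
lemma dg_diff: "dg D f \<Longrightarrow> dg D g \<Longrightarrow> dg D (f - g)"
  using dg_add[of D f "-g"] by (simp add: dg_uminus)
lemma dg_sum: "(\<And>a. a \<in> A \<Longrightarrow> dg D (f a)) \<Longrightarrow> dg D (sum f A)"
  by (induction A rule: infinite_finite_induct) (auto intro: dg_add)
lemma dg_single: "k \<in> kbox D \<Longrightarrow> dg D (sg k c)"
  by (cases "c = 0") (auto simp: dg_def)
lemma dg_mulp: "dg D f \<Longrightarrow> dg D (mulp mu f)"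
  using ks_mulp by (auto simp: dg_def)

lemma dg_mult:
  assumes "dg D f" "dg E g" shows "dg (D + E) (f * g)"
proof -
  have "k + l \<in> kbox (D + E)" if "k \<in> kbox D" "l \<in> kbox E" for k l
  proof -
    have "\<bar>(k + l) $ i\<bar> \<le> int (D + E)" for i
      using that by (auto simp: kbox_def intro: order_trans[OF abs_triangle_ineq add_mono])
    thus ?thesis by (simp add: kbox_def)
  qed
  hence "dg (D+E) (sg (k+l) c)" if "k \<in> ks f" "l \<in> ks g" for k l c
    using that assms by (intro dg_single) (auto simp: dg_def)
  thus ?thesis
    by (subst tpoly_mult_expand) (intro dg_sum; blast)
qed

lemma dg_power: "dg D f \<Longrightarrow> dg (n * D) (f ^ n)"
  by (induction n) (auto intro: dg_mult)

lemma dg_cst_mult: "dg D f \<Longrightarrow> dg D (cst c * f)"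
  using dg_mult[of 0 "cst c" D f] by simp

lemma dg_cn: "dg D f \<Longrightarrow> dg D (cn f)"
  unfolding dg_def
proof
  fix k assume "ks f \<subseteq> kbox D" "k \<in> ks (cn f)"
  hence "- k \<in> kbox D" by (auto simp: in_keys_iff)
  thus "k \<in> kbox D" by (simp add: kbox_def)
qed

subsection \<open>Coefficients from values\<close>

text \<open>A geometric sum over (2D+1)-th roots of unity; |m| <= D excludes nonzero multiples of
  2D+1.\<close>

lemma roots_sum:
  fixes m :: int
  assumes "m \<noteq> 0" "\<bar>m\<bar> \<le> int D"
  shows "(\<Sum>j<2*D+1. cis (of_int m * (2 * pi * real j / real (2*D+1)))) = 0"
proof -
  let ?N = "2*D+1"
  define z where "z = cis (of_int m * (2 * pi / real ?N))"
  have "z ^ ?N = cis (real ?N * (of_int m * (2 * pi / real ?N)))"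
    unfolding z_def by (simp only: Complex.DeMoivre)
  also have "real ?N * (of_int m * (2 * pi / real ?N)) = 2 * pi * of_int m"
    by (simp add: field_simps)
  finally have zN: "z ^ ?N = 1" by simp
  have "z \<noteq> 1"
  proof
    assume "z = 1"
    hence "cis (of_int m * (2 * pi / real ?N)) = cis 0" by (simp add: z_def)
    hence "cos (of_int m * (2 * pi / real ?N)) = 1" by (metis cis.sel(1) cos_zero)
    then obtain n :: int where "of_int m * (2 * pi / real ?N) = of_int n * (2 * pi)"
      using cos_one_2pi_int by (auto simp: mult.assoc)
    hence "of_int m * (2 * pi) = (of_int n * real ?N) * (2 * pi)" by (simp add: divide_eq_eq)
    hence "of_int m = (of_int n :: real) * real ?N" by (simp only: mult_cancel_right) simp
    hence "m = n * int ?N" by (metis of_int_eq_iff of_int_mult of_int_of_nat_eq)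
    hence "n \<noteq> 0" and "\<bar>m\<bar> = \<bar>n\<bar> * int ?N" using assms by (auto simp: abs_mult)
    hence "\<bar>m\<bar> \<ge> int ?N" using mult_right_mono[of 1 "\<bar>n\<bar>" "int ?N"] by simp
    thus False using assms by simp
  qed
  moreover have "cis (of_int m * (2 * pi * real j / real ?N)) = z ^ j" for j
    unfolding z_def Complex.DeMoivre by (simp add: field_simps)
  ultimately have "(\<Sum>j<?N. cis (of_int m * (2 * pi * real j / real ?N))) = (z ^ ?N - 1) / (z - 1)"
    by (simp only: geometric_sum[OF \<open>z \<noteq> 1\<close>])
  thus ?thesis using zN by simp
qed

text \<open>Averaging over (2D+1)^3 equidistant points reproduces the mean of a polynomial of degree
  D exactly. This quadrature takes the place of integration over the torus.\<close>

lemma cmod_lk_zero_le: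
  assumes "dg D f" "sn c f"
  shows "cmod (lk f 0) \<le> c"
proof -
  define N where "N = 2*D+1"
  define p where "p j = 2 * pi * real j / real N" for j
  define pt where "pt = (\<lambda>a b c. vector [p a, p b, p c] :: real^3)"
  have N: "N > 0" by (simp add: N_def)
  have mode: "(\<Sum>a<N. \<Sum>b<N. \<Sum>c<N. cis (dotk k (pt a b c))) = (if k = 0 then of_nat (N^3) else 0)"
    if k: "k \<in> kbox D" for k
  proof -
    have "cis (dotk k (pt a b c)) = cis (of_int (k$1) * p a) * (cis (of_int (k$2) * p b) * cis (of_int (k$3) * p c))" for a b c
      by (simp add: dotk_def pt_def sum_3 cis_mult add.assoc)
    hence "(\<Sum>a<N. \<Sum>b<N. \<Sum>c<N. cis (dotk k (pt a b c))) =
      (\<Sum>a<N. cis (of_int (k$1) * p a)) * ((\<Sum>b<N. cis (of_int (k$2) * p b)) * (\<Sum>c<N. cis (of_int (k$3) * p c)))"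
      by (simp add: sum_distrib_left[symmetric] sum_distrib_right[symmetric])
    moreover have "(\<Sum>j<N. cis (of_int m * p j)) = 0" if "m \<noteq> 0" "\<bar>m\<bar> \<le> int D" for m
      using roots_sum[OF that] by (simp add: N_def p_def)
    ultimately show ?thesis
    proof (cases "k = 0")
      case True
      thus ?thesis by (simp add: power3_eq_cube)
    next
      case False
      then obtain i where "k $ i \<noteq> 0" by (auto simp: vec_eq_iff)
      hence "k$1 \<noteq> 0 \<or> k$2 \<noteq> 0 \<or> k$3 \<noteq> 0" by (metis exhaust_3)
      moreover have "\<bar>k$1\<bar> \<le> int D" "\<bar>k$2\<bar> \<le> int D" "\<bar>k$3\<bar> \<le> int D" using k by (auto simp: kbox_def)
      ultimately show ?thesis
        using False \<open>\<And>m. \<lbrakk>m \<noteq> 0; \<bar>m\<bar> \<le> int D\<rbrakk> \<Longrightarrow> (\<Sum>j<N. cis (of_int m * p j)) = 0\<close>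
          \<open>(\<Sum>a<N. \<Sum>b<N. \<Sum>c<N. cis (dotk k (pt a b c))) = _\<close> by (auto simp: mult_eq_0_iff)
    qed
  qed
  have "(\<Sum>a<N. \<Sum>b<N. \<Sum>c<N. ev f (pt a b c)) = (\<Sum>k\<in>kbox D. lk f k * (\<Sum>a<N. \<Sum>b<N. \<Sum>c<N. cis (dotk k (pt a b c))))"
    using assms(1) finite_kbox
    by (simp add: ev_superset[of "kbox D"] dg_def sum_distrib_left sum.swap[of _ "kbox D"])
  also have "... = (\<Sum>k\<in>kbox D. if k = 0 then lk f k * of_nat (N^3) else 0)"
    by (intro sum.cong) (auto simp: mode)
  also have "... = lk f 0 * of_nat (N^3)" using finite_kbox by (simp add: kbox_def)
  finally have "lk f 0 * of_nat (N^3) = (\<Sum>a<N. \<Sum>b<N. \<Sum>c<N. ev f (pt a b c))" ..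
  hence "cmod (lk f 0) * real (N^3) = cmod (\<Sum>a<N. \<Sum>b<N. \<Sum>c<N. ev f (pt a b c))"
    by (metis norm_mult norm_of_nat)
  also have "... \<le> (\<Sum>a<N. \<Sum>b<N. \<Sum>c<N. cmod (ev f (pt a b c)))"
    by (intro order_trans[OF norm_sum] sum_mono order_refl)
  also have "... \<le> (\<Sum>a<N. \<Sum>b<N. \<Sum>d<N. c)"
    using assms(2) by (intro sum_mono) (simp add: sn_def)
  also have "... = c * real (N^3)" by (simp add: power3_eq_cube)
  finally show ?thesis using N by simp
qed

text \<open>Multiplication by the character of -k moves the coefficient to frequency 0 and leaves
  the moduli of the values unchanged.\<close>

lemma cmod_lk_le:
  assumes "dg D f" "sn c f"
  shows "cmod (lk f k) \<le> c"
proof (cases "k \<in> kbox D")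
  case True
  have "- k \<in> kbox D" using True by (simp add: kbox_def)
  hence "dg (D + D) (sg (-k) 1 * f)" by (intro dg_mult dg_single assms)
  moreover have "sn c (sg (-k) 1 * f)" using assms(2) by (simp add: sn_def norm_mult)
  ultimately have "cmod (lk (sg (-k) 1 * f) 0) \<le> c" by (rule cmod_lk_zero_le)
  thus ?thesis by (simp add: lk_single_mult)
next
  case False
  hence "k \<notin> ks f" using assms(1) by (auto simp: dg_def)
  hence "lk f k = 0" by (rule ks_lk)
  moreover have "0 \<le> c" using assms(2) order_trans[OF norm_ge_zero] by (auto simp: sn_def)
  ultimately show ?thesis by simp
qed

text \<open>Each coefficient is bounded by the sup norm and there are at most (2D+1)^3 of them. This
  volume factor is the loss that the frequency parameters have to pay for.\<close>

lemma an_le_sn: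
  assumes "dg D f" "sn c f"
  shows "an f \<le> real ((2*D+1)^3) * c"
proof -
  have c: "0 \<le> c" using assms(2) order_trans[OF norm_ge_zero] by (auto simp: sn_def)
  have "an f = (\<Sum>k\<in>kbox D. cmod (lk f k))"
    using assms(1) finite_kbox by (intro an_superset) (auto simp: dg_def)
  also have "... \<le> real (card (kbox D)) * c"
    using sum_bounded_above[of "kbox D" "\<lambda>k. cmod (lk f k)" c] cmod_lk_le[OF assms] by simp
  also have "... \<le> real ((2*D+1)^3) * c"
    using card_kbox c by (intro mult_right_mono) (auto simp del: of_nat_power)
  finally show ?thesis .
qed

lemma exists_dg: "\<exists>D. dg D f"
proof -
  have "finite ((\<lambda>k. nat (\<Sum>i\<in>UNIV. \<bar>k $ i\<bar>)) ` ks f)" by simp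
  then obtain D where D: "\<forall>k\<in>ks f. nat (\<Sum>i\<in>UNIV. \<bar>k $ i\<bar>) \<le> D"
    by (meson finite_imageI bdd_aboveI finite_nat_set_iff_bounded_le image_eqI)
  have "\<bar>k $ i\<bar> \<le> int D" if "k \<in> ks f" for k i
  proof -
    have "\<bar>k $ i\<bar> \<le> (\<Sum>i\<in>UNIV. \<bar>k $ i\<bar>)" by (intro member_le_sum) auto
    also have "... \<le> int D" using D that by auto
    finally show ?thesis .
  qed
  thus ?thesis by (auto simp: dg_def kbox_def)
qed

text \<open>The coefficient bound applied to f - g with sup norm 0.\<close>

lemma ev_eqI:
  assumes "\<And>x. ev f x = ev g x" shows "f = g"
proof (rule poly_mapping_eqI)
  fix k
  obtain D where "dg D (f - g)" using exists_dg by blast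
  moreover have "sn 0 (f - g)" using assms by (simp add: sn_def)
  ultimately have "cmod (lk (f - g) k) \<le> 0" by (rule cmod_lk_le)
  thus "lk f k = lk g k" by (simp add: lookup_minus)
qed

lemma ks_cn: "ks (cn f) = uminus ` ks f"
proof -
  have "k \<in> uminus ` ks f" if "- k \<in> ks f" for k
    using imageI[OF that, of uminus] by simp
  thus ?thesis by (auto simp: in_keys_iff)
qed

lemma ev_cn [simp]: "ev (cn f) x = cnj (ev f x)"
proof -
  have "ev (cn f) x = (\<Sum>k\<in>uminus ` ks f. lk (cn f) k * cis (dotk k x))" by (simp add: ev_def ks_cn)
  also have "... = (\<Sum>k\<in>ks f. lk (cn f) (-k) * cis (dotk (-k) x))"
    by (subst sum.reindex) (auto simp: inj_on_def)
  finally show ?thesis by (simp add: ev_def cis_cnj)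
qed

lemma cn_cn [simp]: "cn (cn f) = f" by (rule ev_eqI) simp

lemma rl_iff_cn: "rl f \<longleftrightarrow> cn f = f"
proof
  assume "rl f"
  hence "cnj (ev f x) = ev f x" for x by (simp add: rl_def complex_eq_iff)
  thus "cn f = f" by (intro ev_eqI) simp
next
  assume "cn f = f"
  hence "cnj (ev f x) = ev f x" for x by (metis ev_cn)
  thus "rl f" unfolding rl_def by (metis Reals_cnj_iff complex_is_Real_iff)
qed

lemma rl_herm: "rl f \<Longrightarrow> lk f (- k) = cnj (lk f k)"
  unfolding rl_iff_cn by (metis complex_cnj_cnj lk_cn)

lemma rl_zero [simp]: "rl 0" by (simp add: rl_def)
lemma rl_add: "rl f \<Longrightarrow> rl g \<Longrightarrow> rl (f + g)" by (simp add: rl_def)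
lemma rl_diff: "rl f \<Longrightarrow> rl g \<Longrightarrow> rl (f - g)" by (simp add: rl_def)
lemma rl_mult: "rl f \<Longrightarrow> rl g \<Longrightarrow> rl (f * g)" by (simp add: rl_def)
lemma rl_sum: "(\<And>a. a \<in> A \<Longrightarrow> rl (f a)) \<Longrightarrow> rl (sum f A)"
  by (simp add: rl_def)
lemma rl_cst: "Im c = 0 \<Longrightarrow> rl (cst c)" by (simp add: rl_def)

lemma rl_mulp:
  assumes "rl f" "\<And>k. mu (- k) = cnj (mu k)"
  shows "rl (mulp mu f)"
  unfolding rl_iff_cn
proof (rule poly_mapping_eqI)
  fix k
  have "lk f (- k) = cnj (lk f k)" using assms(1) by (rule rl_herm)
  thus "lk (cn (mulp mu f)) k = lk (mulp mu f) k" by (simp add: assms(2))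
qed

lemma sn_an: "an f \<le> c \<Longrightarrow> sn c f" by (meson cmod_ev_le_an order_trans sn_def)
lemma sn_mono: "sn c f \<Longrightarrow> c \<le> d \<Longrightarrow> sn d f" by (auto simp: sn_def intro: order_trans)
lemma sn_add: "sn c f \<Longrightarrow> sn d g \<Longrightarrow> sn (c + d) (f + g)"
  by (auto simp: sn_def intro: order_trans[OF norm_triangle_ineq add_mono])
lemma sn_mult: "sn c f \<Longrightarrow> sn d g \<Longrightarrow> sn (c * d) (f * g)"
  by (auto simp: sn_def norm_mult intro!: mult_mono intro: order_trans[OF norm_ge_zero])

text \<open>Parseval: the coefficient of \<open>f * cn f\<close> at frequency 0 is the sum of
  squares, and it is bounded by the sup norm of |f|^2. In contrast to \<open>an_le_sn\<close> no
  volume factor is lost, so the energy of a step is governed by its sup norm.\<close>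

lemma l2_le_sn:
  assumes "dg D f" "sn c f"
  shows "(\<Sum>k\<in>ks f. (cmod (lk f k))^2) \<le> c^2"
proof -
  have "lk (f * cn f) 0 = (\<Sum>k\<in>ks f. lk f k * cnj (lk f k))"
    by (subst lk_mult[of "ks f"]) auto
  also have "... = of_real (\<Sum>k\<in>ks f. (cmod (lk f k))^2)"
    by (simp add: complex_norm_square del: of_real_power)
  finally have eq: "lk (f * cn f) 0 = of_real (\<Sum>k\<in>ks f. (cmod (lk f k))^2)" .
  have "sn (c * c) (f * cn f)" using assms(2) by (intro sn_mult) (auto simp: sn_def)
  moreover have "dg (D + D) (f * cn f)" using assms by (intro dg_mult dg_cn)
  ultimately have "cmod (lk (f * cn f) 0) \<le> c * c" by (intro cmod_lk_le)
  moreover have "cmod (of_real (\<Sum>k\<in>ks f. (cmod (lk f k))^2)) = (\<Sum>k\<in>ks f. (cmod (lk f k))^2)"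
    by (simp only: norm_of_real) (simp add: sum_nonneg)
  ultimately show ?thesis unfolding eq power2_eq_square[of c] by simp
qed

subsection \<open>Adapted Hoelder processes of trigonometric polynomials\<close>

text \<open>Kept abstract because it is instantiated later with a filtration that is trivial up to
  time 0, not with \<open>augF\<close> itself.\<close>

locale filt =
  fixes F :: "real \<Rightarrow> 'w measure"
  assumes F_mono: "s \<le> t \<Longrightarrow> sets (F s) \<subseteq> sets (F t)"
    and F_space: "space (F s) = space (F t)"
begin

definition ad :: "'w proc \<Rightarrow> bool" where
  "ad f \<longleftrightarrow> (\<forall>t k. (\<lambda>w. lk (f t w) k) \<in> borel_measurable (F t))"

text \<open>One deterministic constant controls size and Hoelder modulus, uniformly in time and
  \<open>w\<close>. Time runs over all reals, so that a last reset time before 0 makes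
  sense.\<close>

definition gp :: "real \<Rightarrow> nat \<Rightarrow> 'w proc \<Rightarrow> bool" where
  "gp C D f \<longleftrightarrow> (\<forall>t w. dg D (f t w)) \<and> (\<forall>t w. an (f t w) \<le> C)
     \<and> (\<forall>s t w. an (f t w - f s w) \<le> C * \<bar>t - s\<bar> powr (1/8)) \<and> ad f"

lemma F_measurable_mono: "s \<le> t \<Longrightarrow> f \<in> borel_measurable (F s) \<Longrightarrow> f \<in> borel_measurable (F t)"
  using F_mono[of s t] F_space[of s t] by (auto simp: measurable_def)

lemma ad_const: "ad (\<lambda>t w. p)" by (simp add: ad_def)

lemma ad_time: "ad (\<lambda>t w. p t)" by (simp add: ad_def)

lemma ad_add: "ad f \<Longrightarrow> ad g \<Longrightarrow> ad (\<lambda>t w. f t w + g t w)"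
  by (auto simp: ad_def lookup_add intro: borel_measurable_add)

lemma ad_sum: "(\<And>i. i \<in> A \<Longrightarrow> ad (f i)) \<Longrightarrow> ad (\<lambda>t w. \<Sum>i\<in>A. f i t w)"
  by (auto simp: ad_def lookup_sum intro!: borel_measurable_sum)

lemma ad_mulp: "ad f \<Longrightarrow> ad (\<lambda>t w. mulp mu (f t w))"
  unfolding ad_def lk_mulp by (auto intro: borel_measurable_times)

lemma ad_cst_mult: "ad f \<Longrightarrow> ad (\<lambda>t w. cst (c t) * f t w)"
  unfolding ad_def lk_cst_mult by (auto intro: borel_measurable_times)

text \<open>The common degree bound makes the convolution a sum over a fixed finite set, and
  measurability follows termwise.\<close>

lemma ad_mult:
  assumes "\<And>t w. dg D (f t w)" "ad f" "ad g"
  shows "ad (\<lambda>t w. f t w * g t w)"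
proof -
  have "lk (f t w * g t w) n = (\<Sum>k\<in>kbox D. lk (f t w) k * lk (g t w) (n - k))" for t w n
    using assms(1)[of t w] by (intro lk_mult finite_kbox) (simp add: dg_def)
  thus ?thesis using assms(2,3) by (auto simp: ad_def intro!: borel_measurable_sum borel_measurable_times)
qed

lemma ad_power:
  assumes "\<And>t w. dg D (f t w)" "ad f"
  shows "ad (\<lambda>t w. f t w ^ n)"
  by (induction n) (auto intro: ad_const ad_mult assms)

lemma gpD:
  assumes "gp C D f"
  shows gp_dg: "dg D (f t w)" and gp_an: "an (f t w) \<le> C"
    and gp_hold: "an (f t w - f s w) \<le> C * \<bar>t - s\<bar> powr (1/8)" and gp_ad: "ad f"
    and gp_nonneg: "0 \<le> C"
  using assms order_trans[OF an_nonneg, of "f t w" C] unfolding gp_def by auto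

lemma gp_mono:
  assumes "gp C D f" "C \<le> C'" "D \<le> D'" shows "gp C' D' f"
  unfolding gp_def
proof (intro conjI allI)
  fix t s w
  note f = gpD[OF assms(1)]
  show "dg D' (f t w)" using f(1) assms(3) by (rule dg_mono)
  show "an (f t w) \<le> C'" using f(2) assms(2) by (rule order_trans)
  have "C * \<bar>t - s\<bar> powr (1/8) \<le> C' * \<bar>t - s\<bar> powr (1/8)"
    using assms(2) by (intro mult_right_mono) auto
  with f(3) show "an (f t w - f s w) \<le> C' * \<bar>t - s\<bar> powr (1/8)" by (rule order_trans)
  show "ad f" by (rule f(4))
qed

lemma gp_const: "dg D p \<Longrightarrow> an p \<le> C \<Longrightarrow> gp C D (\<lambda>t w. p)"
  using order_trans[OF an_nonneg, of p C] by (simp add: gp_def ad_const)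

lemma gp_add:
  assumes "gp C D f" "gp C' D g" shows "gp (C + C') D (\<lambda>t w. f t w + g t w)"
  unfolding gp_def
proof (intro conjI allI)
  fix t s w
  show "dg D (f t w + g t w)" using assms by (intro dg_add) (auto dest: gp_dg)
  show "an (f t w + g t w) \<le> C + C'"
    using assms by (intro order_trans[OF an_triangle] add_mono) (auto dest: gp_an)
  have "an (f t w + g t w - (f s w + g s w)) \<le> an (f t w - f s w) + an (g t w - g s w)"
    using an_triangle[of "f t w - f s w" "g t w - g s w"] by (simp add: algebra_simps)
  also have "... \<le> (C + C') * \<bar>t - s\<bar> powr (1/8)"
    unfolding distrib_right using assms by (intro add_mono) (auto dest: gp_hold)
  finally show "an (f t w + g t w - (f s w + g s w)) \<le> (C + C') * \<bar>t - s\<bar> powr (1/8)" .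
  show "ad (\<lambda>t w. f t w + g t w)" using assms by (intro ad_add) (auto dest: gp_ad)
qed

lemma gp_mulp:
  assumes "gp C D f" "\<And>k. k \<in> kbox D \<Longrightarrow> cmod (mu k) \<le> c" "0 \<le> c"
  shows "gp (c * C) D (\<lambda>t w. mulp mu (f t w))"
  unfolding gp_def
proof (intro conjI allI)
  fix t s w
  have b: "an (mulp mu p) \<le> c * an p" if "dg D p" for p
    using that assms(2) by (intro an_mulp) (auto simp: dg_def)
  show "dg D (mulp mu (f t w))" using assms by (intro dg_mulp) (auto dest: gp_dg)
  show "an (mulp mu (f t w)) \<le> c * C"
    using assms gpD[OF assms(1)] by (intro order_trans[OF b] mult_left_mono)
  have "an (mulp mu (f t w) - mulp mu (f s w)) = an (mulp mu (f t w - f s w))" by (simp add: mulp_diff)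
  also have "... \<le> c * (C * \<bar>t - s\<bar> powr (1/8))"
    using assms gpD[OF assms(1)] by (intro order_trans[OF b] mult_left_mono dg_diff) auto
  finally show "an (mulp mu (f t w) - mulp mu (f s w)) \<le> c * C * \<bar>t - s\<bar> powr (1/8)" by simp
  show "ad (\<lambda>t w. mulp mu (f t w))" using assms by (intro ad_mulp) (auto dest: gp_ad)
qed

lemma gp_mult:
  assumes "gp C D f" "gp C' D' g" shows "gp (2 * C * C') (D + D') (\<lambda>t w. f t w * g t w)"
  unfolding gp_def
proof (intro conjI allI)
  fix t s w
  note f = gpD[OF assms(1)] and g = gpD[OF assms(2)]
  show "dg (D + D') (f t w * g t w)" using f g by (intro dg_mult)
  have "an (f t w * g t w) \<le> C * C'"
    using f g by (intro order_trans[OF an_mult] mult_mono) auto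
  also have "... \<le> 2 * C * C'" using f(5) g(5) by simp
  finally show "an (f t w * g t w) \<le> 2 * C * C'" .
  have "an (f t w * g t w - f s w * g s w) = an ((f t w - f s w) * g t w + f s w * (g t w - g s w))"
    by (simp add: algebra_simps)
  also have "... \<le> an (f t w - f s w) * an (g t w) + an (f s w) * an (g t w - g s w)"
    by (intro order_trans[OF an_triangle] add_mono an_mult)
  also have "... \<le> (C * \<bar>t - s\<bar> powr (1/8)) * C' + C * (C' * \<bar>t - s\<bar> powr (1/8))"
    using f g by (intro add_mono mult_mono) auto
  finally show "an (f t w * g t w - f s w * g s w) \<le> 2 * C * C' * \<bar>t - s\<bar> powr (1/8)"
    by (simp add: algebra_simps)
  show "ad (\<lambda>t w. f t w * g t w)" using f g by (intro ad_mult) auto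
qed

lemma gp_cst_mult:
  assumes "gp C D f" shows "gp (cmod c * C) D (\<lambda>t w. cst c * f t w)"
proof -
  have "cst c * p = mulp (\<lambda>_. c) p" for p by (rule poly_mapping_eqI) simp
  thus ?thesis using gp_mulp[OF assms, of "\<lambda>_. c" "cmod c"] by simp
qed

lemma gp_uminus: "gp C D f \<Longrightarrow> gp C D (\<lambda>t w. - f t w)"
proof -
  have "- p = cst (-1) * p" for p by (rule poly_mapping_eqI) simp
  thus "gp C D f \<Longrightarrow> gp C D (\<lambda>t w. - f t w)" using gp_cst_mult[of C D f "-1"] by simp
qed

lemma gp_diff: "gp C D f \<Longrightarrow> gp C' D g \<Longrightarrow> gp (C + C') D (\<lambda>t w. f t w - g t w)"
  using gp_add[of C D f C' "\<lambda>t w. - g t w"] gp_uminus[of C' D g] by simp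

lemma gp_sum:
  assumes "finite A" "\<And>i. i \<in> A \<Longrightarrow> gp (C i) D (f i)"
  shows "gp (\<Sum>i\<in>A. C i) D (\<lambda>t w. \<Sum>i\<in>A. f i t w)"
  using assms by (induction A rule: finite_induct) (auto intro: gp_add gp_const)

text \<open>For d <= 1 the Lipschitz bound is the stronger one, since d <= d^(1/8); for d >= 1 the
  trivial bound 2C takes over.\<close>

lemma lip_hold:
  fixes d :: real
  assumes "0 \<le> d" "x \<le> L * d" "x \<le> 2 * C" "0 \<le> L" "0 \<le> C"
  shows "x \<le> (L + 2 * C) * d powr (1/8)"
proof (cases "d \<le> 1")
  case True
  have "d \<le> d powr (1/8)"
    using assms(1) True powr_mono'[of "1/8" 1 d] by (cases "d = 0") auto
  hence "L * d \<le> L * d powr (1/8)" using assms by (intro mult_left_mono)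
  also have "... \<le> (L + 2 * C) * d powr (1/8)" using assms by (intro mult_right_mono) auto
  finally show ?thesis using assms by linarith
next
  case False
  hence "1 \<le> d powr (1/8)" by (simp add: ge_one_powr_ge_zero)
  hence "2 * C * 1 \<le> 2 * C * d powr (1/8)" using assms by (intro mult_left_mono) auto
  also have "... \<le> (L + 2 * C) * d powr (1/8)" using assms by (intro mult_right_mono) auto
  finally show ?thesis using assms by linarith
qed

lemma gp_lip:
  assumes "\<And>t w. dg D (f t w)" "\<And>t w. an (f t w) \<le> C"
    "\<And>s t w. s < t \<Longrightarrow> an (f t w - f s w) \<le> L * (t - s)" "ad f" "0 \<le> L"
  shows "gp (L + 2 * C) D f"
  unfolding gp_def
proof (intro conjI allI)
  fix t s w
  have C: "0 \<le> C" using assms(2) order_trans[OF an_nonneg] by blast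
  show "dg D (f t w)" "ad f" using assms by auto
  show "an (f t w) \<le> L + 2 * C" using assms(2)[of t w] assms(5) C by linarith
  have "an (f t w - f s w) \<le> L * \<bar>t - s\<bar>"
    using assms(3)[of s t w] assms(3)[of t s w] an_diff_commute[of "f t w" "f s w"]
    by (cases s t rule: linorder_cases) auto
  moreover have "an (f t w - f s w) \<le> 2 * C"
    using an_diff[of "f t w" "f s w"] assms(2)[of t w] assms(2)[of s w] by linarith
  ultimately show "an (f t w - f s w) \<le> (L + 2 * C) * \<bar>t - s\<bar> powr (1/8)"
    using assms(5) C by (intro lip_hold) auto
qed

end

subsection \<open>Time windows\<close>

text \<open>
  The two cut-offs \<open>cutf om 0\<close> and \<open>cutf om (1/2)\<close> are \<open>sin g\<close> and \<open>cos g\<close> for a phase \<open>g\<close> whose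
  derivative vanishes at all zeros of either; so each vanishes to second order at its own
  reset times \<open>rst om s t\<close>, where the wave it multiplies is allowed to jump.
\<close>

definition cphase :: "real \<Rightarrow> real \<Rightarrow> real" where
  "cphase om t = om * t - sin (4 * om * t) / 4"

definition cutf :: "real \<Rightarrow> real \<Rightarrow> real \<Rightarrow> real" where
  "cutf om s t = sin (cphase om t + pi * s)"

definition cutf' :: "real \<Rightarrow> real \<Rightarrow> real \<Rightarrow> real" where
  "cutf' om s t = cos (cphase om t + pi * s) * (om * (1 - cos (4 * om * t)))"

definition rst :: "real \<Rightarrow> real \<Rightarrow> real \<Rightarrow> real" where
  "rst om s t = (of_int \<lfloor>om * t / pi + s\<rfloor> - s) * pi / om"

lemma cutf_deriv: "(cutf om s has_real_derivative cutf' om s t) (at t)"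
  unfolding cutf_def[abs_def] cutf'_def cphase_def
  by (rule derivative_eq_intros refl | simp add: algebra_simps)+

lemma cutf'_deriv: "\<exists>d. (cutf' om s has_real_derivative d) (at t) \<and> \<bar>d\<bar> \<le> 8 * om^2"
proof -
  let ?a = "cphase om t + pi * s" and ?c = "1 - cos (4 * om * t)"
  let ?d = "- sin ?a * (om * ?c) * (om * ?c) + cos ?a * (om * (4 * om * sin (4 * om * t)))"
  have "(cphase om has_real_derivative om * ?c) (at t)"
    unfolding cphase_def[abs_def] by (rule derivative_eq_intros refl | simp add: algebra_simps)+
  hence "((\<lambda>t. cphase om t + pi * s) has_real_derivative om * ?c + 0) (at t)"
    by (intro DERIV_add DERIV_const)
  hence 1: "((\<lambda>t. cos (cphase om t + pi * s)) has_real_derivative - sin ?a * (om * ?c)) (at t)"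
    by (intro DERIV_fun_cos) simp
  have 2: "((\<lambda>t. om * (1 - cos (4 * om * t))) has_real_derivative om * (4 * om * sin (4 * om * t))) (at t)"
    by (auto intro!: derivative_eq_intros)
  have "(cutf' om s has_real_derivative ?d) (at t)"
    unfolding cutf'_def[abs_def] using DERIV_mult[OF 1 2] by (simp add: mult.commute add.commute)
  moreover have "\<bar>?d\<bar> \<le> 8 * om^2"
  proof -
    have c: "\<bar>?c\<bar> \<le> 2" using cos_ge_minus_one[of "4 * om * t"] cos_le_one[of "4 * om * t"] by linarith
    have "\<bar>- sin ?a * (om * ?c) * (om * ?c)\<bar> = om^2 * (\<bar>sin ?a\<bar> * (\<bar>?c\<bar> * \<bar>?c\<bar>))"
      by (simp add: abs_mult power2_eq_square mult_ac)
    also have "... \<le> om^2 * (1 * (2 * 2))"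
      using c by (intro mult_left_mono mult_mono) auto
    finally have 1: "\<bar>- sin ?a * (om * ?c) * (om * ?c)\<bar> \<le> 4 * om^2" by simp
    have "\<bar>cos ?a * (om * (4 * om * sin (4 * om * t)))\<bar> = 4 * om^2 * (\<bar>cos ?a\<bar> * \<bar>sin (4 * om * t)\<bar>)"
      by (simp add: abs_mult power2_eq_square mult_ac)
    also have "... \<le> 4 * om^2 * (1 * 1)"
      by (intro mult_left_mono mult_mono) auto
    finally show ?thesis using 1 by linarith
  qed
  ultimately show ?thesis by blast
qed

lemma cutf_bound: "\<bar>cutf om s t\<bar> \<le> 1" by (simp add: cutf_def)

lemma cutf'_bound: "0 \<le> om \<Longrightarrow> \<bar>cutf' om s t\<bar> \<le> 2 * om"
proof -
  assume "0 \<le> om"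
  have c: "\<bar>1 - cos (4 * om * t)\<bar> \<le> 2" using cos_ge_minus_one[of "4 * om * t"] cos_le_one[of "4 * om * t"] by linarith
  have "\<bar>cutf' om s t\<bar> = om * (\<bar>cos (cphase om t + pi * s)\<bar> * \<bar>1 - cos (4 * om * t)\<bar>)"
    using \<open>0 \<le> om\<close> by (simp add: cutf'_def abs_mult)
  also have "... \<le> om * (1 * 2)" using c \<open>0 \<le> om\<close> by (intro mult_left_mono mult_mono) auto
  finally show ?thesis by simp
qed

lemma real_lip:
  fixes f :: "real \<Rightarrow> real"
  assumes "\<And>x. \<exists>d. (f has_real_derivative d) (at x) \<and> \<bar>d\<bar> \<le> L"
  shows "\<bar>f t - f s\<bar> \<le> L * \<bar>t - s\<bar>"
proof -
  obtain d where d: "\<And>x. (f has_real_derivative d x) (at x)" "\<And>x. \<bar>d x\<bar> \<le> L" using assms by metis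
  have "norm (f t - f s) \<le> L * norm (t - s)"
    by (rule field_differentiable_bound[of UNIV f d L])
      (auto intro: d has_field_derivative_at_within)
  thus ?thesis by simp
qed

lemma cutf_lip: "0 \<le> om \<Longrightarrow> \<bar>cutf om s t - cutf om s t'\<bar> \<le> 2 * om * \<bar>t - t'\<bar>"
  using cutf_deriv cutf'_bound by (intro real_lip) blast

lemma cutf'_lip: "\<bar>cutf' om s t - cutf' om s t'\<bar> \<le> 8 * om^2 * \<bar>t - t'\<bar>"
  using cutf'_deriv by (intro real_lip) blast

text \<open>The shift by pi/2 turns the sine into the cosine of the same phase.\<close>

lemma cutf_squares: "(cutf om 0 t)^2 + (cutf om (1/2) t)^2 = 1"
  by (simp add: cutf_def sin_add)

lemma rst_le: "0 < om \<Longrightarrow> rst om s t \<le> t"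
proof -
  assume om: "0 < om"
  have "of_int \<lfloor>om * t / pi + s\<rfloor> - s \<le> om * t / pi" by linarith
  hence "(of_int \<lfloor>om * t / pi + s\<rfloor> - s) * pi / om \<le> om * t / pi * pi / om"
    using om by (intro divide_right_mono mult_right_mono) auto
  thus ?thesis using om by (simp add: rst_def)
qed

lemma rst_ge: "0 < om \<Longrightarrow> t - rst om s t \<le> pi / om"
proof -
  assume om: "0 < om"
  have "om * t / pi - 1 \<le> of_int \<lfloor>om * t / pi + s\<rfloor> - s" by linarith
  hence "(om * t / pi - 1) * pi / om \<le> (of_int \<lfloor>om * t / pi + s\<rfloor> - s) * pi / om"
    using om by (intro divide_right_mono mult_right_mono) auto
  moreover have "(om * t / pi - 1) * pi / om = t - pi / om" using om by (simp add: field_simps)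
  ultimately show ?thesis by (simp add: rst_def)
qed

text \<open>At a reset time \<open>om * t\<close> is a multiple of pi/2. There the correction sin(4
  om t)/4 of the phase vanishes together with the factor 1 - cos(4 om t) of its derivative.\<close>

lemma cutf_rst:
  assumes "s = 0 \<or> s = 1/2" "0 < om"
  shows "cutf om s (rst om s t) = 0" "cutf' om s (rst om s t) = 0"
proof -
  define n where "n = \<lfloor>om * t / pi + s\<rfloor>"
  have r: "om * rst om s t = (of_int n - s) * pi" using assms by (simp add: rst_def n_def)
  hence r4: "4 * om * rst om s t = (4 * of_int n - 4 * s) * pi" by (simp add: algebra_simps)
  have "4 * of_int n - 4 * s = 2 * of_int (if s = 0 then 2 * n else 2 * n - 1)"
    using assms(1) by auto
  then obtain m :: int where m: "4 * of_int n - 4 * s = 2 * of_int m" by blast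
  hence "4 * om * rst om s t = 2 * pi * of_int m" using r4 by simp
  hence *: "sin (4 * om * rst om s t) = 0" "cos (4 * om * rst om s t) = 1"
    by (simp_all only: cos_int_2pin sin_int_2pin)
  have "cphase om (rst om s t) = om * rst om s t" by (simp only: cphase_def *(1))
  hence "cphase om (rst om s t) + pi * s = pi * of_int n"
    using r by (simp add: algebra_simps)
  thus "cutf om s (rst om s t) = 0" by (simp only: cutf_def sin_npi_int)
  show "cutf' om s (rst om s t) = 0" by (simp add: cutf'_def *)
qed

lemma rst_between:
  assumes "0 < om" "t < t'" "rst om s t \<noteq> rst om s t'"
  shows "t < rst om s t'"
proof -
  have "\<lfloor>om * t / pi + s\<rfloor> \<le> \<lfloor>om * t' / pi + s\<rfloor>"
    using assms by (intro floor_mono add_right_mono divide_right_mono mult_left_mono) auto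
  hence "\<lfloor>om * t / pi + s\<rfloor> < \<lfloor>om * t' / pi + s\<rfloor>" using assms(3) by (auto simp: rst_def)
  hence "om * t / pi + s < of_int \<lfloor>om * t' / pi + s\<rfloor>" by linarith
  hence "om * t / pi < of_int \<lfloor>om * t' / pi + s\<rfloor> - s" by linarith
  hence "om * t / pi * pi / om < (of_int \<lfloor>om * t' / pi + s\<rfloor> - s) * pi / om"
    using assms(1) by (intro divide_strict_right_mono mult_strict_right_mono) auto
  thus ?thesis using assms(1) by (simp add: rst_def)
qed

definition rst_times :: "real \<Rightarrow> real \<Rightarrow> real set" where
  "rst_times om s = {t. om * t / pi + s \<in> \<int>}"

text \<open>Supplies the finite exceptional set for the fundamental theorem of calculus in
  \<open>Bw_int\<close>.\<close>

lemma finite_rst_times: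
  assumes "0 < om" shows "finite (rst_times om s \<inter> {a..b})"
proof -
  have "rst_times om s \<inter> {a..b} \<subseteq> (\<lambda>n. (of_int n - s) * pi / om) ` {\<lfloor>om * a / pi + s\<rfloor>..\<lceil>om * b / pi + s\<rceil>}"
  proof
    fix t assume t: "t \<in> rst_times om s \<inter> {a..b}"
    then obtain n where n: "om * t / pi + s = of_int n" by (auto simp: rst_times_def Ints_def)
    have "om * a / pi + s \<le> of_int n" "of_int n \<le> om * b / pi + s"
      unfolding n[symmetric] using t assms by (auto intro!: divide_right_mono mult_left_mono)
    hence "n \<in> {\<lfloor>om * a / pi + s\<rfloor>..\<lceil>om * b / pi + s\<rceil>}" by (auto simp: floor_le_iff le_ceiling_iff)
    moreover have "t = (of_int n - s) * pi / om" using n assms by (simp add: field_simps)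
    ultimately show "t \<in> (\<lambda>n. (of_int n - s) * pi / om) ` {\<lfloor>om * a / pi + s\<rfloor>..\<lceil>om * b / pi + s\<rceil>}" by blast
  qed
  thus ?thesis by (rule finite_subset) simp
qed

lemma rst_locally_const:
  assumes "t \<notin> rst_times om s"
  shows "\<forall>\<^sub>F t' in nhds t. rst om s t' = rst om s t"
proof -
  have "\<forall>\<^sub>F t' in nhds t. \<lfloor>om * t' / pi + s\<rfloor> = \<lfloor>om * t / pi + s\<rfloor>"
    using assms by (intro eventually_floor_eq) (auto simp: rst_times_def intro!: tendsto_eq_intros filterlim_ident)
  thus ?thesis by eventually_elim (simp add: rst_def)
qed

subsection \<open>Polynomial approximation of the square root and of the exponential\<close>

text \<open>The Taylor coefficients of sqrt(1 - x).\<close>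

definition sqc :: "nat \<Rightarrow> real" where "sqc i = (1/2 gchoose i) * (-1)^i"

text \<open>The recursion multiplies by (1/2 - k)/(k + 1), which has modulus at most 1.\<close>

lemma sqc_bound: "\<bar>sqc i\<bar> \<le> 1"
proof -
  have "\<bar>(1/2::real) gchoose i\<bar> \<le> 1"
  proof (induction i)
    case (Suc k)
    have "(1/2) * ((1/2::real) gchoose k) = of_nat k * (1/2 gchoose k) + of_nat (Suc k) * (1/2 gchoose Suc k)"
      by (rule gbinomial_mult_1)
    hence "of_nat (Suc k) * (1/2 gchoose Suc k) = (1/2 - of_nat k) * (1/2 gchoose k :: real)"
      by (simp add: algebra_simps)
    hence "real (Suc k) * \<bar>1/2 gchoose Suc k\<bar> = \<bar>1/2 - real k\<bar> * \<bar>1/2 gchoose k\<bar>"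
      by (metis abs_mult abs_of_nat)
    also have "... \<le> real (Suc k) * 1" using Suc by (intro mult_mono) auto
    finally show ?case by simp
  qed simp
  thus ?thesis by (simp add: sqc_def abs_mult power_abs)
qed

definition sqp :: "nat \<Rightarrow> real \<Rightarrow> real" where "sqp n x = (\<Sum>i\<le>n. sqc i * x^i)"

text \<open>The coefficients are bounded by 1, so the tail is dominated by a geometric series of
  ratio 1/2.\<close>

lemma sqp_approx:
  assumes "\<bar>x\<bar> \<le> 1/2"
  shows "\<bar>sqp n x - sqrt (1 - x)\<bar> \<le> (1/2)^n"
proof -
  have "(\<lambda>i. ((1/2) gchoose i) * (-x)^i) sums (1 + (-x)) powr (1/2)"
    using assms by (intro gen_binomial_real) simp
  hence s: "(\<lambda>i. sqc i * x^i) sums sqrt (1 - x)"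
    using assms by (simp add: powr_half_sqrt sqc_def power_minus[of x] mult_ac)
  hence sm: "summable (\<lambda>i. sqc i * x^i)" by (rule sums_summable)
  have b: "norm (sqc (i + Suc n) * x^(i + Suc n)) \<le> (1/2)^Suc n * (1/2)^i" for i
  proof -
    have "norm (sqc (i + Suc n) * x^(i + Suc n)) \<le> 1 * (1/2)^(i + Suc n)"
      unfolding norm_mult norm_power using sqc_bound assms by (intro mult_mono power_mono) auto
    thus ?thesis by (simp add: power_add mult.commute)
  qed
  have "sqrt (1 - x) - sqp n x = suminf (\<lambda>i. sqc (i + Suc n) * x^(i + Suc n))"
    using suminf_minus_initial_segment[OF sm, of "Suc n"] sums_unique[OF s]
    by (simp add: sqp_def lessThan_Suc_atMost)
  also have "norm ... \<le> suminf (\<lambda>i. (1/2)^Suc n * (1/2)^i)"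
    by (rule norm_suminf_le[OF b]) (intro summable_mult summable_geometric, simp)
  also have "... = (1/2)^n"
    by (subst suminf_mult) (auto simp: suminf_geometric intro: summable_geometric)
  finally show ?thesis by (simp add: abs_minus_commute)
qed

lemma sqp_square:
  assumes "\<bar>x\<bar> \<le> 1/2"
  shows "\<bar>sqp n x\<bar> \<le> 3" "\<bar>(sqp n x)^2 - (1 - x)\<bar> \<le> 5 * (1/2)^n"
proof -
  let ?s = "sqrt (1 - x)" and ?p = "sqp n x"
  have s: "0 \<le> ?s" "?s \<le> 2" using assms by (auto intro: real_le_lsqrt)
  have d: "\<bar>?p - ?s\<bar> \<le> (1/2)^n" "(1/2::real)^n \<le> 1" using sqp_approx[OF assms] by (auto simp: power_le_one)
  thus "\<bar>?p\<bar> \<le> 3" using s by linarith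
  have "?p^2 - (1 - x) = (?p - ?s) * (?p + ?s)"
    using assms by (simp add: algebra_simps power2_eq_square)
  hence "\<bar>?p^2 - (1 - x)\<bar> = \<bar>?p - ?s\<bar> * \<bar>?p + ?s\<bar>" by (simp add: abs_mult)
  also have "... \<le> (1/2)^n * 5" using d s by (intro mult_mono) linarith+
  finally show "\<bar>?p^2 - (1 - x)\<bar> \<le> 5 * (1/2)^n" by simp
qed

definition xpp :: "nat \<Rightarrow> complex \<Rightarrow> complex" where "xpp n z = (\<Sum>k\<le>n. z^k / fact k)"

text \<open>One term of the exponential series gives n^n/n! <= e^n <= 3^n, and y <= n/6 contributes
  the factor 6^(-n).\<close>

lemma power_fact_small:
  assumes "0 \<le> y" "6 * y \<le> real n"
  shows "y^n / fact n \<le> (1/2)^n"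
proof -
  have "(real n)^n / fact n \<le> exp (real n)"
  proof -
    have "(\<lambda>k. (real n)^k / fact k) sums exp (real n)"
      using exp_converges[of "real n"] by (simp add: scaleR_conv_of_real field_simps)
    hence "(\<Sum>k\<in>{n}. (real n)^k / fact k) \<le> exp (real n)"
      unfolding sums_unique[OF \<open>_ sums _\<close>] by (intro sum_le_suminf) (auto dest: sums_summable)
    thus ?thesis by simp
  qed
  also have "exp (real n) \<le> 3^n"
  proof -
    have "exp (real n) = exp 1 ^ n" using exp_of_nat_mult[of n "1::real"] by simp
    thus ?thesis using exp_le by (simp add: power_mono)
  qed
  finally have 1: "(real n)^n / fact n \<le> 3^n" .
  have "y^n \<le> (real n / 6)^n" using assms by (intro power_mono) auto
  hence "y^n / fact n \<le> (real n / 6)^n / fact n" by (intro divide_right_mono) auto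
  also have "... = ((real n)^n / fact n) * (1/6)^n" by (simp add: power_divide)
  also have "... \<le> 3^n * (1/6)^n" by (intro mult_right_mono 1) auto
  also have "... = (1/2)^n" by (simp add: power_mult_distrib[symmetric])
  finally show ?thesis .
qed

text \<open>The origin of condition \<open>J\<close> in the locale \<open>wave\<close>: a Taylor
  degree of at least six times the largest phase makes the error exponentially small in the
  degree.\<close>

lemma xpp_bound:
  assumes "\<bar>y\<bar> \<le> Y" "6 * Y \<le> real n" "1 \<le> n"
  shows "cmod (xpp n (- \<i> * of_real y) - cis (- y)) \<le> real n * (1/2)^n"
proof -
  have Y: "0 \<le> Y" using assms by linarith
  have "cmod (exp (- \<i> * of_real y) - xpp n (- \<i> * of_real y)) \<le>
    exp \<bar>Re (- \<i> * of_real y)\<bar> * (cmod (- \<i> * of_real y))^(Suc n) / fact n"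
    unfolding xpp_def by (rule Taylor_exp)
  also have "... = \<bar>y\<bar>^Suc n / fact n" by (simp add: norm_mult)
  also have "... \<le> Y^Suc n / fact n" using assms by (intro divide_right_mono power_mono) auto
  also have "... = Y * (Y^n / fact n)" by simp
  also have "... \<le> real n * (1/2)^n" using Y assms by (intro mult_mono power_fact_small) auto
  finally show ?thesis by (simp add: cis_conv_exp norm_minus_commute)
qed

subsection \<open>Fourier multipliers\<close>

definition dsym :: "3 \<Rightarrow> freq \<Rightarrow> complex" where "dsym l k = \<i> * of_int (k $ l)"
text \<open>Symbol of the m-th derivative of the inverse Laplacian. At k = 0 division by zero gives
  0, so means are dropped.\<close>

definition isym :: "3 \<Rightarrow> freq \<Rightarrow> complex" where "isym m k = - \<i> * of_int (k $ m) / of_real (knorm2 k)"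
definition lsym :: "real \<Rightarrow> freq \<Rightarrow> complex" where "lsym \<alpha> k = of_real (knorm2 k powr \<alpha>)"

abbreviation dv :: "3 \<Rightarrow> tpoly \<Rightarrow> tpoly" where "dv l \<equiv> mulp (dsym l)"
abbreviation iv :: "3 \<Rightarrow> tpoly \<Rightarrow> tpoly" where "iv m \<equiv> mulp (isym m)"

lemma knorm2_alt: "knorm2 k = (\<Sum>i\<in>UNIV. (real_of_int (k $ i))^2)"
  by (simp add: knorm2_def)

lemma knorm2_nonneg [simp]: "0 \<le> knorm2 k"
  unfolding knorm2_alt by (intro sum_nonneg) auto

lemma knorm2_ge: "(real_of_int (k $ i))^2 \<le> knorm2 k"
  unfolding knorm2_alt by (intro member_le_sum) auto

lemma knorm2_ge_one: "k \<noteq> 0 \<Longrightarrow> 1 \<le> knorm2 k"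
proof -
  assume "k \<noteq> 0"
  then obtain i where "k $ i \<noteq> 0" by (auto simp: vec_eq_iff)
  hence "1 \<le> (k $ i)^2" by (metis int_one_le_iff_zero_less zero_less_power2)
  hence "1 \<le> (real_of_int (k $ i))^2" by (metis of_int_1_le_iff of_int_power)
  with knorm2_ge show ?thesis by (rule order_trans[rotated])
qed

lemma knorm2_zero_iff [simp]: "knorm2 k = 0 \<longleftrightarrow> k = 0"
  using knorm2_ge_one[of k] by (cases "k = 0") (auto simp: knorm2_alt)

lemma knorm2_0 [simp]: "knorm2 0 = 0" by simp

lemma knorm2_uminus [simp]: "knorm2 (- k) = knorm2 k"
  by (simp add: knorm2_alt)

lemma knorm2_le: "k \<in> kbox D \<Longrightarrow> knorm2 k \<le> 3 * (real D)^2"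
proof -
  assume "k \<in> kbox D"
  hence "\<bar>k $ i\<bar> \<le> int D" for i by (simp add: kbox_def)
  hence "real_of_int \<bar>k $ i\<bar> \<le> real D" for i by (metis of_int_le_iff of_int_of_nat_eq)
  hence "(real_of_int (k $ i))^2 \<le> (real D)^2" for i
    by (intro power2_le_iff_abs_le[THEN iffD2]) auto
  hence "knorm2 k \<le> (\<Sum>i\<in>(UNIV::3 set). (real D)^2)" unfolding knorm2_alt by (intro sum_mono)
  thus ?thesis by simp
qed

lemma dsym_bound: "k \<in> kbox D \<Longrightarrow> cmod (dsym l k) \<le> real D"
proof -
  assume "k \<in> kbox D"
  hence "\<bar>k $ l\<bar> \<le> int D" by (simp add: kbox_def)
  hence "real_of_int \<bar>k $ l\<bar> \<le> real D" by linarith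
  thus ?thesis by (simp add: dsym_def norm_mult)
qed

lemma isym_norm: "cmod (isym m k) = \<bar>real_of_int (k $ m)\<bar> / knorm2 k"
  by (simp add: isym_def norm_mult norm_divide)

lemma isym_bound1: "cmod (isym m k) \<le> 1"
proof (cases "k = 0")
  case False
  have "\<bar>z\<bar> \<le> z^2" for z :: int
    using mult_left_mono[of 1 "\<bar>z\<bar>" "\<bar>z\<bar>"] by (cases "z = 0") (auto simp: power2_eq_square)
  hence "\<bar>real_of_int (k $ m)\<bar> \<le> (real_of_int (k $ m))^2"
    by (metis of_int_abs of_int_le_iff of_int_power)
  also have "... \<le> knorm2 k" by (rule knorm2_ge)
  finally show ?thesis using knorm2_ge_one[OF False] by (simp add: isym_norm divide_le_eq)
qed (simp add: isym_def)

lemma isym_high: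
  assumes "0 < R" "R \<le> \<bar>real_of_int (k $ c)\<bar>"
  shows "cmod (isym m k) \<le> 1 / R"
proof -
  have k: "R^2 \<le> knorm2 k"
  proof -
    have "R^2 \<le> \<bar>real_of_int (k $ c)\<bar>^2" using assms by (intro power_mono) auto
    thus ?thesis using knorm2_ge[of k c] by simp
  qed
  moreover have "0 < R^2" using assms(1) by simp
  ultimately have pos: "0 < knorm2 k" by linarith
  have "\<bar>real_of_int (k $ m)\<bar> \<le> sqrt (knorm2 k)" by (rule real_le_rsqrt) (simp add: knorm2_ge)
  hence "cmod (isym m k) \<le> sqrt (knorm2 k) / knorm2 k"
    unfolding isym_norm using pos by (intro divide_right_mono) auto
  also have "... = sqrt (knorm2 k) / (sqrt (knorm2 k) * sqrt (knorm2 k))" using pos by simp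
  also have "... = 1 / sqrt (knorm2 k)" using pos by (intro nonzero_divide_mult_cancel_left) auto
  also have "... \<le> 1 / R" using assms k pos by (intro divide_left_mono real_le_rsqrt mult_pos_pos) auto
  finally show ?thesis .
qed

text \<open>The composed symbol has order 2\<alpha> - 1, which is negative because \<alpha> < 1/2.
  Here the dissipation of a high-frequency wave becomes a small error.\<close>

lemma ilsym_bound:
  assumes "0 < \<alpha>" "\<alpha> < 1/2" "0 < R" "R \<le> \<bar>real_of_int (k $ c)\<bar>"
  shows "cmod (isym m k * lsym \<alpha> k) \<le> R powr (2 * \<alpha> - 1)"
proof -
  have k: "R^2 \<le> knorm2 k"
  proof -
    have "R^2 \<le> \<bar>real_of_int (k $ c)\<bar>^2" using assms by (intro power_mono) auto
    thus ?thesis using knorm2_ge[of k c] by simp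
  qed
  moreover have "0 < R^2" using assms(3) by simp
  ultimately have pos: "0 < knorm2 k" by linarith
  have "\<bar>real_of_int (k $ m)\<bar> \<le> sqrt (knorm2 k)" by (rule real_le_rsqrt) (simp add: knorm2_ge)
  hence "cmod (isym m k * lsym \<alpha> k) \<le> sqrt (knorm2 k) / knorm2 k * knorm2 k powr \<alpha>"
    unfolding isym_norm norm_mult using pos by (intro mult_mono divide_right_mono) (auto simp: lsym_def)
  also have "... = knorm2 k powr (\<alpha> - 1/2)"
  proof -
    have "sqrt (knorm2 k) = knorm2 k powr (1/2)" using pos by (simp add: powr_half_sqrt)
    hence "sqrt (knorm2 k) / knorm2 k * knorm2 k powr \<alpha> = knorm2 k powr (1/2) / knorm2 k powr 1 * knorm2 k powr \<alpha>"
      using pos by simp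
    also have "... = knorm2 k powr (1/2 - 1 + \<alpha>)" by (simp only: powr_diff powr_add)
    also have "1/2 - 1 + \<alpha> = \<alpha> - 1/2" by simp
    finally show ?thesis .
  qed
  also have "... \<le> (R^2) powr (\<alpha> - 1/2)"
    using assms k by (intro powr_mono2') auto
  also have "... = R powr (2 * \<alpha> - 1)"
  proof -
    have "R^2 = R powr 2" using assms by simp
    hence "(R^2) powr (\<alpha> - 1/2) = R powr (2 * (\<alpha> - 1/2))" by (simp only: powr_powr)
    thus ?thesis by (simp add: algebra_simps)
  qed
  finally show ?thesis .
qed

lemma ilsym_bound1:
  assumes "0 < \<alpha>" "\<alpha> < 1/2"
  shows "cmod (isym m k * lsym \<alpha> k) \<le> 1"
proof (cases "k = 0")
  case False
  then obtain i where "k $ i \<noteq> 0" by (auto simp: vec_eq_iff)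
  hence "1 \<le> \<bar>real_of_int (k $ i)\<bar>" by linarith
  thus ?thesis using ilsym_bound[of \<alpha> 1 k i m] assms by simp
qed (simp add: isym_def)

text \<open>A symbol of order -1 varies by O(|k|/|p|^2) near p. The condition 2D <= |P| keeps p + k
  away from the origin: its squared length is at least P^2/4.\<close>

lemma isym_diff:
  fixes P :: int
  assumes p: "p = (\<chi> i. if i = c then P else 0)" and "k \<in> kbox D" "2 * int D \<le> \<bar>P\<bar>" "P \<noteq> 0"
  shows "cmod (isym m (p + k) - isym m p) \<le> 16 * real D / (real_of_int P)^2"
proof -
  define Q d where "Q = real_of_int P" and "d = real D"
  define n where "n = p + k"
  define kk where "kk i = real_of_int (k $ i)" for i
  have "\<bar>k $ i\<bar> \<le> int D" for i using assms(2) by (simp add: kbox_def)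
  hence "real_of_int \<bar>k $ i\<bar> \<le> real D" for i by (metis of_int_le_iff of_int_of_nat_eq)
  hence kk: "\<bar>kk i\<bar> \<le> d" for i by (simp add: kk_def d_def)
  have Q: "2 * d \<le> \<bar>Q\<bar>" "Q \<noteq> 0" "0 \<le> d"
  proof -
    have "real_of_int (2 * int D) \<le> real_of_int \<bar>P\<bar>" using assms(3) by (simp only: of_int_le_iff)
    thus "2 * d \<le> \<bar>Q\<bar>" by (simp add: Q_def d_def)
    show "Q \<noteq> 0" "0 \<le> d" using assms(4) by (auto simp: Q_def d_def)
  qed
  have nc: "real_of_int (n $ i) = (if i = c then Q else 0) + kk i" for i
    by (simp add: n_def p kk_def Q_def)
  have kp: "knorm2 p = Q^2" by (simp add: knorm2_alt p Q_def if_distrib[of "\<lambda>x. x^2"] if_distrib[of real_of_int] cong: if_cong)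
  have "knorm2 n = (\<Sum>i\<in>UNIV. (if i = c then Q^2 + 2 * Q * kk i else 0) + (kk i)^2)"
    unfolding knorm2_alt nc by (intro sum.cong) (auto simp: power2_eq_square algebra_simps)
  hence kn: "knorm2 n = Q^2 + 2 * Q * kk c + (\<Sum>i\<in>UNIV. (kk i)^2)" by (simp add: sum.distrib)
  define S where "S = (\<Sum>i\<in>UNIV. (kk i)^2)"
  have S: "0 \<le> S" "S \<le> 3 * d^2"
  proof -
    show "0 \<le> S" unfolding S_def by (intro sum_nonneg) auto
    have "S \<le> (\<Sum>i\<in>(UNIV::3 set). d^2)" unfolding S_def
      using kk Q by (intro sum_mono) (simp add: power2_le_iff_abs_le)
    thus "S \<le> 3 * d^2" by simp
  qed
  have "\<bar>Q\<bar> / 2 \<le> \<bar>real_of_int (n $ c)\<bar>"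
  proof -
    have "\<bar>Q\<bar> \<le> \<bar>Q + kk c\<bar> + \<bar>kk c\<bar>" by linarith
    thus ?thesis using nc[of c] kk[of c] Q by simp
  qed
  hence "(\<bar>Q\<bar>/2)^2 \<le> \<bar>real_of_int (n $ c)\<bar>^2" by (intro power_mono) auto
  hence kn4: "Q^2 / 4 \<le> knorm2 n" using knorm2_ge[of n c] by (simp add: power_divide)
  have Q2: "0 < Q^2" using Q by simp
  have npos: "0 < knorm2 n" using kn4 Q2 by linarith
  have num: "\<bar>real_of_int (n $ m) * Q^2 - real_of_int (p $ m) * knorm2 n\<bar> \<le> 4 * d * Q^2"
  proof (cases "m = c")
    case False
    hence "real_of_int (n $ m) * Q^2 - real_of_int (p $ m) * knorm2 n = kk m * Q^2" by (simp add: nc) (simp add: p)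
    also have "\<bar>...\<bar> \<le> d * Q^2" using kk[of m] by (simp add: abs_mult mult_right_mono)
    also have "... \<le> 4 * d * Q^2" using Q by (intro mult_right_mono) auto
    finally show ?thesis .
  next
    case True
    hence "real_of_int (n $ m) * Q^2 - real_of_int (p $ m) * knorm2 n = - (kk c * Q^2) - Q * S"
      by (simp add: nc kn S_def[symmetric]) (simp add: p Q_def algebra_simps power2_eq_square)
    also have "\<bar>...\<bar> \<le> \<bar>kk c * Q^2\<bar> + \<bar>Q * S\<bar>" by linarith
    also have "\<bar>kk c * Q^2\<bar> \<le> d * Q^2" using kk[of c] by (simp add: abs_mult mult_right_mono)
    also have "\<bar>Q * S\<bar> \<le> \<bar>Q\<bar> * (3 * d^2)" using S by (simp add: abs_mult mult_left_mono)
    also have "\<bar>Q\<bar> * (3 * d^2) \<le> 3 * d * Q^2"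
    proof -
      have "3 * (\<bar>Q\<bar> * d) * d \<le> 3 * (\<bar>Q\<bar> * d) * \<bar>Q\<bar>" using Q by (intro mult_left_mono) auto
      thus ?thesis by (simp add: power2_eq_square algebra_simps)
    qed
    finally show ?thesis by (simp add: algebra_simps)
  qed
  have "isym m n - isym m p = - \<i> * of_real ((real_of_int (n $ m) * Q^2 - real_of_int (p $ m) * knorm2 n) / (knorm2 n * Q^2))"
  proof -
    have "(of_real (knorm2 n) :: complex) \<noteq> 0" "(of_real (Q^2) :: complex) \<noteq> 0" using npos Q2 by auto
    note * = diff_frac_eq[OF this]
    have "isym m n - isym m p = - \<i> * (of_int (n$m) / of_real (knorm2 n) - of_int (p$m) / of_real (Q^2))"
      unfolding isym_def kp by (simp add: right_diff_distrib)
    also have "... = - \<i> * ((of_int (n$m) * of_real (Q^2) - of_int (p$m) * of_real (knorm2 n)) / (of_real (knorm2 n) * of_real (Q^2)))"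
      by (simp only: *)
    finally show ?thesis by simp
  qed
  hence "cmod (isym m n - isym m p) = \<bar>real_of_int (n $ m) * Q^2 - real_of_int (p $ m) * knorm2 n\<bar> / (knorm2 n * Q^2)"
    using npos Q2 by (simp only: norm_mult norm_minus_cancel norm_ii norm_of_real abs_divide abs_mult)
  also have "... \<le> 4 * d * Q^2 / (Q^2 / 4 * Q^2)"
    using num kn4 Q2 Q by (intro frac_le mult_right_mono) auto
  also have "... = 16 * d / Q^2" using Q2 by (simp add: field_simps)
  finally show ?thesis by (simp add: n_def d_def Q_def)
qed

lemma dv_mult: "dv l (f * g) = dv l f * g + f * dv l g"
proof (rule poly_mapping_eqI)
  fix n
  have "ks (dv l f) \<subseteq> ks f" by (rule ks_mulp)
  hence "lk (dv l f * g + f * dv l g) n = (\<Sum>k\<in>ks f. dsym l k * lk f k * lk g (n - k)) + (\<Sum>k\<in>ks f. lk f k * (dsym l (n - k) * lk g (n - k)))"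
    by (simp add: lookup_add lk_mult[of "ks f"])
  also have "... = (\<Sum>k\<in>ks f. dsym l n * (lk f k * lk g (n - k)))"
    by (simp add: sum.distrib[symmetric] dsym_def algebra_simps)
  also have "... = dsym l n * lk (f * g) n" by (simp add: lk_mult[of "ks f"] sum_distrib_left)
  finally show "lk (dv l (f * g)) n = lk (dv l f * g + f * dv l g) n" by simp
qed

lemma dv_single: "dv l (sg p c) = cst (dsym l p) * sg p c"
  by (rule poly_mapping_eqI) (auto simp: lookup_single when_def)

lemma dv_cst_mult: "mulp mu (cst c * f) = cst c * mulp mu f"
  by (rule poly_mapping_eqI) simp

lemma an_dv: "dg D f \<Longrightarrow> an (dv l f) \<le> real D * an f"
  using dsym_bound by (intro an_mulp) (auto simp: dg_def)

lemma rl_dv: "rl f \<Longrightarrow> rl (dv l f)" by (rule rl_mulp) (auto simp: dsym_def)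
lemma rl_iv: "rl f \<Longrightarrow> rl (iv l f)" by (rule rl_mulp) (auto simp: isym_def)
lemma rl_lsym: "rl f \<Longrightarrow> rl (mulp (lsym \<alpha>) f)" by (rule rl_mulp) (auto simp: lsym_def)

text \<open>High frequency is measured by a single coordinate; this fits wave vectors that are
  multiples of a unit vector.\<close>

definition hf :: "real \<Rightarrow> tpoly \<Rightarrow> bool" where
  "hf R f \<longleftrightarrow> (\<forall>k\<in>ks f. \<exists>c. R \<le> \<bar>real_of_int (k $ c)\<bar>)"

lemma hf_add: "hf R f \<Longrightarrow> hf R g \<Longrightarrow> hf R (f + g)"
  using keys_add[of f g] by (auto simp: hf_def)
lemma hf_zero [simp]: "hf R 0" by (simp add: hf_def)
lemma hf_sum: "(\<And>i. i \<in> A \<Longrightarrow> hf R (f i)) \<Longrightarrow> hf R (sum f A)"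
  by (induction A rule: infinite_finite_induct) (auto intro: hf_add)
lemma hf_mulp: "hf R f \<Longrightarrow> hf R (mulp mu f)" using ks_mulp by (fastforce simp: hf_def)

lemma hf_shift:
  assumes "p = (\<chi> i. if i = c then P else 0)" "dg D f" "R + real D \<le> \<bar>real_of_int P\<bar>"
  shows "hf R (sg p 1 * f)"
  unfolding hf_def
proof
  fix k assume "k \<in> ks (sg p 1 * f)"
  hence "lk f (k - p) \<noteq> 0" by (simp add: in_keys_iff lk_single_mult)
  hence "k - p \<in> kbox D" using assms(2) by (auto simp: dg_def in_keys_iff)
  hence "\<bar>(k - p) $ c\<bar> \<le> int D" unfolding kbox_def by blast
  hence "\<bar>k $ c - P\<bar> \<le> int D" by (simp add: assms(1))
  hence "real_of_int \<bar>k $ c - P\<bar> \<le> real D" by linarith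
  hence "R \<le> \<bar>real_of_int (k $ c)\<bar>" using assms(3) by simp
  thus "\<exists>c. R \<le> \<bar>real_of_int (k $ c)\<bar>" ..
qed

lemma an_iv: "an (iv m f) \<le> an f"
  using an_mulp[of f "isym m" 1] isym_bound1 by simp

lemma an_iv_high: "0 < R \<Longrightarrow> hf R f \<Longrightarrow> an (iv m f) \<le> an f / R"
  using an_mulp[of f "isym m" "1/R"] isym_high by (fastforce simp: hf_def)

lemma an_ivl_high:
  assumes "0 < \<alpha>" "\<alpha> < 1/2" "0 < R" "hf R f"
  shows "an (iv m (mulp (lsym \<alpha>) f)) \<le> R powr (2 * \<alpha> - 1) * an f"
proof -
  have "iv m (mulp (lsym \<alpha>) f) = mulp (\<lambda>k. isym m k * lsym \<alpha> k) f" by (rule poly_mapping_eqI) simp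
  thus ?thesis using assms ilsym_bound by (simp add: hf_def) (intro an_mulp, blast)
qed

lemma an_ivl:
  assumes "0 < \<alpha>" "\<alpha> < 1/2"
  shows "an (iv m (mulp (lsym \<alpha>) f)) \<le> an f"
proof -
  have "iv m (mulp (lsym \<alpha>) f) = mulp (\<lambda>k. isym m k * lsym \<alpha> k) f" by (rule poly_mapping_eqI) simp
  thus ?thesis using an_mulp[of f "\<lambda>k. isym m k * lsym \<alpha> k" 1] ilsym_bound1[OF assms] by simp
qed

text \<open>A bound on the multiplier alone does not give the gain 1/|P| in the sup norm. On a
  function modulated by one frequency \<open>p\<close>, however, the operator is the scalar
  \<open>isym m p\<close> up to a commutator, and only the commutator is paid in the norm
  \<open>an\<close>.\<close>

lemma sn_iv_shift:
  assumes p: "p = (\<chi> i. if i = c then P else 0)" and "dg D f" "2 * int D \<le> \<bar>P\<bar>" "P \<noteq> 0" "sn s f"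
  shows "sn (s / \<bar>real_of_int P\<bar> + 16 * real D / (real_of_int P)^2 * an f) (iv m (sg p 1 * f))"
proof -
  let ?g = "mulp (\<lambda>k. isym m k - isym m p) (sg p 1 * f)"
  have pc: "\<bar>real_of_int (p $ c)\<bar> = \<bar>real_of_int P\<bar>" by (simp add: p)
  have "iv m (sg p 1 * f) = cst (isym m p) * (sg p 1 * f) + ?g"
    by (rule poly_mapping_eqI) (simp add: lookup_add left_diff_distrib)
  moreover have "sn (s / \<bar>real_of_int P\<bar>) (cst (isym m p) * (sg p 1 * f))"
    unfolding sn_def
  proof
    fix x
    have "cmod (isym m p) \<le> 1 / \<bar>real_of_int P\<bar>"
      using isym_high[of "\<bar>real_of_int P\<bar>" p c m] assms(4) pc by simp
    hence "cmod (isym m p) * cmod (ev f x) \<le> (1 / \<bar>real_of_int P\<bar>) * s"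
      using assms(5) by (intro mult_mono) (auto simp: sn_def)
    thus "cmod (ev (cst (isym m p) * (sg p 1 * f)) x) \<le> s / \<bar>real_of_int P\<bar>"
      by (simp add: norm_mult)
  qed
  moreover have "an ?g \<le> 16 * real D / (real_of_int P)^2 * an f"
  proof -
    have "an ?g \<le> 16 * real D / (real_of_int P)^2 * an (sg p 1 * f)"
    proof (rule an_mulp)
      fix k assume "k \<in> ks (sg p 1 * f)"
      hence "lk f (k - p) \<noteq> 0" by (simp add: in_keys_iff lk_single_mult)
      hence "k - p \<in> kbox D" using assms(2) by (auto simp: dg_def in_keys_iff)
      hence "cmod (isym m (p + (k - p)) - isym m p) \<le> 16 * real D / (real_of_int P)^2"
        by (rule isym_diff[OF p _ assms(3,4)])
      thus "cmod (isym m k - isym m p) \<le> 16 * real D / (real_of_int P)^2" by simp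
    qed
    also have "... \<le> 16 * real D / (real_of_int P)^2 * an f"
      using an_mult[of "sg p 1" f] by (intro mult_left_mono) auto
    finally show ?thesis .
  qed
  ultimately show ?thesis by (auto intro: sn_add sn_an)
qed

subsection \<open>Stresses\<close>

text \<open>A stress is given by scalar functions \<open>r a b\<close>: the coefficients of the rank-one tensors
  \<open>\<xi> \<otimes> \<xi>\<close> with \<open>\<xi> = e a + e b\<close> (respectively \<open>\<xi> = e a\<close> for \<open>a = b\<close>).\<close>

definition inc :: "3 \<Rightarrow> 3 \<Rightarrow> 3 \<Rightarrow> bool" where "inc a b m \<longleftrightarrow> m = a \<or> m = b"

definition strs :: "tmat \<Rightarrow> tmat" where
  "strs r m l = (\<Sum>a\<in>UNIV. \<Sum>b\<in>UNIV. if inc a b m \<and> inc a b l then r a b else 0)"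

text \<open>Inverse of \<open>strs\<close> on symmetric matrices. Off the diagonal both r a b and r
  b a contribute to the same entry, hence the factor 1/2. The entry (a,a) also receives all
  off-diagonal coefficients with index a, and S a a minus the other entries of its row is 2 S a a
  minus the whole row.\<close>

definition dec :: "tmat \<Rightarrow> tmat" where
  "dec S a b = (if a = b then cst 2 * S a a - (\<Sum>l\<in>UNIV. S a l) else cst (1/2) * S a b)"

text \<open>A symmetric antidivergence up to gradients: away from frequency 0 the divergence of
  \<open>adv f\<close> is f plus the gradient of the inverse Laplacian of div f, and divergence-free
  test fields do not see the gradient.\<close>

definition adv :: "tvec \<Rightarrow> tmat" where
  "adv f m l = iv m (f l) + iv l (f m)"

lemma ev_numeral [simp]: "ev (numeral n) x = numeral n"
  using ev_single[of 0 "numeral n" x] by simp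

lemma strs_dec:
  assumes "\<And>m l. S m l = S l m"
  shows "strs (dec S) m l = S m l"
proof (rule ev_eqI)
  fix x
  have *: "S 2 1 = S 1 2" "S 3 1 = S 1 3" "S 3 2 = S 2 3" using assms by auto
  show "ev (strs (dec S) m l) x = ev (S m l) x"
    using exhaust_3[of m] exhaust_3[of l]
    by (elim disjE) (simp_all add: strs_def dec_def inc_def sum_3 *)
qed

lemma strs_add: "strs (\<lambda>a b. r a b + q a b) m l = strs r m l + strs q m l"
  unfolding strs_def sum.distrib[symmetric] by (intro sum.cong refl) auto

lemma sn_dec:
  assumes "\<And>m l. sn c (S m l)"
  shows "sn (5 * c) (dec S a b)"
proof -
  have c: "0 \<le> c" using assms order_trans[OF norm_ge_zero] unfolding sn_def by blast
  show ?thesis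
  proof (cases "a = b")
    case True
    have "cmod (ev (dec S a b) x) \<le> 5 * c" for x
    proof -
      have "cmod (ev (dec S a b) x) \<le> cmod (2 * ev (S a a) x) + cmod (\<Sum>l\<in>UNIV. ev (S a l) x)"
        using True norm_triangle_ineq4[of "2 * ev (S a a) x" "\<Sum>l\<in>UNIV. ev (S a l) x"] by (simp add: dec_def)
      also have "... \<le> 2 * c + (\<Sum>l\<in>(UNIV::3 set). c)"
        using assms by (intro add_mono order_trans[OF norm_sum] sum_mono) (auto simp: sn_def norm_mult)
      finally show ?thesis by simp
    qed
    thus ?thesis by (simp add: sn_def)
  next
    case False
    have "cmod (ev (S a b) x) / 2 \<le> 5 * c" for x
    proof -
      have "cmod (ev (S a b) x) \<le> c" using assms unfolding sn_def by blast
      thus ?thesis using c by linarith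
    qed
    thus ?thesis using False by (simp add: sn_def dec_def norm_mult norm_divide)
  qed
qed

lemma adv_mode:
  assumes "n \<noteq> 0"
  shows "(\<Sum>l\<in>UNIV. dsym l n * lk (adv f m l) n)
    = lk (f m) n + of_int (n $ m) * ((\<Sum>l\<in>UNIV. of_int (n $ l) * lk (f l) n) / of_real (knorm2 n))"
proof -
  have K: "(of_real (knorm2 n) :: complex) \<noteq> 0" using assms by simp
  have e: "dsym l n * lk (adv f m l) n = of_int (n $ m) * (of_int (n $ l) * lk (f l) n / of_real (knorm2 n))
      + (of_int (n $ l))^2 * lk (f m) n / of_real (knorm2 n)" for l
    by (simp add: adv_def lookup_add dsym_def isym_def algebra_simps power2_eq_square)
  have "(\<Sum>l\<in>UNIV. dsym l n * lk (adv f m l) n) = of_int (n $ m) * ((\<Sum>l\<in>UNIV. of_int (n $ l) * lk (f l) n) / of_real (knorm2 n))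
     + (\<Sum>l\<in>UNIV. (of_int (n $ l))^2) * lk (f m) n / of_real (knorm2 n)"
    unfolding e sum.distrib by (simp add: sum_distrib_left sum_distrib_right sum_divide_distrib)
  moreover have "(\<Sum>l\<in>UNIV. (of_int (n $ l))^2) = (of_real (knorm2 n) :: complex)" by (simp add: knorm2_alt)
  ultimately show ?thesis using K by simp
qed

subsection \<open>Amplitudes and phases\<close>

definition xpt :: "nat \<Rightarrow> tpoly \<Rightarrow> tpoly" where "xpt n f = (\<Sum>k\<le>n. cst (1 / fact k) * f^k)"

text \<open>Approximates sqrt(K - r). Division by K brings r into the interval |x| <= 1/2, where the
  binomial series converges geometrically.\<close>

definition sqt :: "nat \<Rightarrow> real \<Rightarrow> tpoly \<Rightarrow> tpoly" where
  "sqt n K r = cst (of_real (sqrt K)) * (\<Sum>i\<le>n. cst (of_real (sqc i)) * (cst (of_real (1/K)) * r)^i)"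

lemma ev_xpt: "ev (xpt n f) x = xpp n (ev f x)"
  by (simp add: xpt_def xpp_def)

lemma ev_sqt:
  assumes "rl r"
  shows "ev (sqt n K r) x = of_real (sqrt K * sqp n (Re (ev r x) / K))"
proof -
  have "ev r x = of_real (Re (ev r x))" using assms by (simp add: rl_def complex_eq_iff)
  thus ?thesis by (simp add: sqt_def sqp_def)
qed

lemma dg_xpt: "dg D f \<Longrightarrow> dg (n * D) (xpt n f)"
  unfolding xpt_def by (intro dg_sum dg_cst_mult) (auto intro: dg_mono[OF dg_power])

lemma dg_sqt: "dg D f \<Longrightarrow> dg (n * D) (sqt n K f)"
  unfolding sqt_def by (intro dg_sum dg_cst_mult) (auto intro: dg_mono[OF dg_power] dg_cst_mult)

lemma sqt_bounds:
  assumes "rl r" "sn (K/2) r" "0 < K"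
  shows "sn (3 * sqrt K) (sqt n K r)"
    and "sn (5 * K * (1/2)^n) (sqt n K r * sqt n K r - (cst (of_real K) - r))"
proof -
  have y: "\<bar>Re (ev r x) / K\<bar> \<le> 1/2" for x
  proof -
    have "\<bar>Re (ev r x)\<bar> \<le> K / 2" using assms(2) abs_Re_le_cmod order_trans unfolding sn_def by blast
    thus ?thesis using assms(3) by (simp add: field_simps)
  qed
  show "sn (3 * sqrt K) (sqt n K r)"
    unfolding sn_def
  proof
    fix x
    have "cmod (ev (sqt n K r) x) = sqrt K * \<bar>sqp n (Re (ev r x) / K)\<bar>"
      using assms(3) by (simp add: ev_sqt[OF assms(1)] abs_mult del: of_real_mult)
    also have "... \<le> sqrt K * 3" using sqp_square(1)[OF y] assms(3) by (intro mult_left_mono) auto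
    finally show "cmod (ev (sqt n K r) x) \<le> 3 * sqrt K" by simp
  qed
  show "sn (5 * K * (1/2)^n) (sqt n K r * sqt n K r - (cst (of_real K) - r))"
    unfolding sn_def
  proof
    fix x
    define z where "z = Re (ev r x) / K"
    have r: "ev r x = of_real (K * z)" using assms(1,3) by (simp add: z_def rl_def complex_eq_iff)
    have sK: "complex_of_real (sqrt K) * complex_of_real (sqrt K) = of_real K"
      using assms(3) by (simp flip: of_real_mult)
    have "ev (sqt n K r * sqt n K r - (cst (of_real K) - r)) x = of_real (K * ((sqp n z)^2 - (1 - z)))"
      using assms(3) by (simp add: ev_sqt[OF assms(1)] z_def[symmetric] power2_eq_square algebra_simps r sK)
    hence "cmod (ev (sqt n K r * sqt n K r - (cst (of_real K) - r)) x) = K * \<bar>(sqp n z)^2 - (1 - z)\<bar>"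
      using assms(3) by (simp only: norm_of_real abs_mult)
    also have "... \<le> K * (5 * (1/2)^n)"
      using sqp_square(2)[OF y] assms(3) unfolding z_def by (intro mult_left_mono) auto
    finally show "cmod (ev (sqt n K r * sqt n K r - (cst (of_real K) - r)) x) \<le> 5 * K * (1/2)^n" by simp
  qed
qed

text \<open>Differentiation lowers the Taylor degree by one. Hence J+2, J+1 and J occur for a wave,
  its time derivative and the Lipschitz bound of that derivative.\<close>

lemma xpp_deriv: "(xpp (Suc n) has_field_derivative xpp n z) (at z within A)"
proof -
  have "((\<lambda>z. \<Sum>k\<le>Suc n. z^k / fact k) has_field_derivative (\<Sum>k\<le>Suc n. of_nat k * z^(k - 1) / fact k)) (at z within A)"
    by (auto intro!: derivative_eq_intros simp del: sum.atMost_Suc)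
  also have "(\<Sum>k\<le>Suc n. of_nat k * z^(k - 1) / fact k) = xpp n z"
    unfolding xpp_def by (subst sum.atMost_Suc_shift) (simp add: field_simps del: of_nat_Suc)
  finally show ?thesis by (simp add: xpp_def[abs_def])
qed

text \<open>Mean value inequality on a segment of the imaginary axis, with the Taylor polynomial of
  lower degree as derivative.\<close>

lemma xpp_lip:
  assumes "\<bar>y\<bar> \<le> Y" "\<bar>y'\<bar> \<le> Y" "\<And>y. \<bar>y\<bar> \<le> Y \<Longrightarrow> cmod (xpp n (- \<i> * of_real y)) \<le> c"
  shows "cmod (xpp (Suc n) (- \<i> * of_real y) - xpp (Suc n) (- \<i> * of_real y')) \<le> c * \<bar>y - y'\<bar>"
proof -
  let ?S = "(\<lambda>y. y *\<^sub>R (- \<i>)) ` {-Y..Y}"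
  have S: "- \<i> * of_real y \<in> ?S" if "\<bar>y\<bar> \<le> Y" for y
    using that by (auto simp: image_iff scaleR_conv_of_real intro!: bexI[of _ y])
  have "cmod (xpp (Suc n) (- \<i> * of_real y) - xpp (Suc n) (- \<i> * of_real y'))
     \<le> c * cmod (- \<i> * of_real y - (- \<i> * of_real y'))"
  proof (rule field_differentiable_bound[of ?S "xpp (Suc n)" "xpp n"])
    show "convex ?S" by (intro convex_linear_image convex_real_interval linearI) (auto simp: scaleR_add_left)
    show "(xpp (Suc n) has_field_derivative xpp n z) (at z within ?S)" for z by (rule xpp_deriv)
    show "cmod (xpp n z) \<le> c" if "z \<in> ?S" for z
    proof -
      obtain y where "z = y *\<^sub>R (- \<i>)" "\<bar>y\<bar> \<le> Y" using \<open>z \<in> ?S\<close> by auto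
      thus ?thesis using assms(3)[of y] by (simp add: scaleR_conv_of_real mult.commute)
    qed
  qed (use assms S in auto)
  also have "cmod (- \<i> * of_real y - (- \<i> * of_real y')) = \<bar>y - y'\<bar>"
  proof -
    have "- \<i> * of_real y - (- \<i> * of_real y') = - \<i> * of_real (y - y')" by (simp add: algebra_simps)
    thus ?thesis by (simp only: norm_mult norm_minus_cancel norm_ii norm_of_real mult_1)
  qed
  finally show ?thesis .
qed

context filt
begin

subsection \<open>Processes frozen at reset times\<close>

lemma window_gp:
  assumes tau: "\<And>t. \<tau> t \<le> t" "\<And>t. t - \<tau> t \<le> h" "\<And>t t'. t < t' \<Longrightarrow> \<tau> t \<noteq> \<tau> t' \<Longrightarrow> t < \<tau> t'"
    and th: "\<And>t. vt (\<tau> t) = 0" "\<And>t. \<bar>vt t\<bar> \<le> c0" "\<And>t t'. \<bar>vt t - vt t'\<bar> \<le> c1 * \<bar>t - t'\<bar>"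
    and G: "\<And>t w. dg D (G (\<tau> t) t w)" "\<And>t w. an (G (\<tau> t) t w) \<le> g0"
      "\<And>t t' w. \<tau> t = \<tau> t' \<Longrightarrow> an (G (\<tau> t) t w - G (\<tau> t) t' w) \<le> g1 * \<bar>t - t'\<bar>"
      "ad (\<lambda>t w. G (\<tau> t) t w)"
    and nn: "0 \<le> c1" "0 \<le> g1"
  shows "gp (2 * c1 * g0 + c0 * g1 + 2 * (c0 * g0)) D (\<lambda>t w. cst (of_real (vt t)) * G (\<tau> t) t w)"
proof (rule gp_lip)
  have c0: "0 \<le> c0" using th(2) order_trans[OF abs_ge_zero] by blast
  have g0: "0 \<le> g0" using G(2) order_trans[OF an_nonneg] by blast
  have ancst: "an (cst (of_real c) * f) \<le> \<bar>c\<bar> * an f" for c f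
    using an_mult[of "cst (of_real c)" f] by simp
  fix t w
  show "dg D (cst (of_real (vt t)) * G (\<tau> t) t w)" by (intro dg_cst_mult G)
  show "an (cst (of_real (vt t)) * G (\<tau> t) t w) \<le> c0 * g0"
    using th(2) G(2) c0 by (intro order_trans[OF ancst] mult_mono) auto
  show "ad (\<lambda>t w. cst (of_real (vt t)) * G (\<tau> t) t w)" by (intro ad_cst_mult G)
  show "0 \<le> 2 * c1 * g0 + c0 * g1" using nn c0 g0 by auto
next
  fix s t :: real and w assume st: "s < t"
  have c0: "0 \<le> c0" using th(2) order_trans[OF abs_ge_zero] by blast
  have g0: "0 \<le> g0" using G(2) order_trans[OF an_nonneg] by blast
  have ancst: "an (cst (of_real c) * f) \<le> \<bar>c\<bar> * an f" for c f
    using an_mult[of "cst (of_real c)" f] by simp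
  show "an (cst (of_real (vt t)) * G (\<tau> t) t w - cst (of_real (vt s)) * G (\<tau> s) s w)
     \<le> (2 * c1 * g0 + c0 * g1) * (t - s)"
  proof (cases "\<tau> s = \<tau> t")
    case True
    have "cst (of_real (vt t)) * G (\<tau> t) t w - cst (of_real (vt s)) * G (\<tau> s) s w =
       cst (of_real (vt t - vt s)) * G (\<tau> t) t w + cst (of_real (vt s)) * (G (\<tau> t) t w - G (\<tau> t) s w)"
      by (rule ev_eqI) (simp add: True algebra_simps)
    also have "an ... \<le> \<bar>vt t - vt s\<bar> * an (G (\<tau> t) t w) + \<bar>vt s\<bar> * an (G (\<tau> t) t w - G (\<tau> t) s w)"
      by (intro order_trans[OF an_triangle] add_mono ancst)
    also have "... \<le> (c1 * \<bar>t - s\<bar>) * g0 + c0 * (g1 * \<bar>t - s\<bar>)"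
      using th G(2) G(3)[of t s w] True c0 nn by (intro add_mono mult_mono) auto
    also have "... \<le> (2 * c1 * g0 + c0 * g1) * (t - s)"
      using st nn g0 by (simp add: algebra_simps mult_left_mono mult_right_mono)
    finally show ?thesis .
  next
    case False
    have s: "s < \<tau> t" using tau(3)[OF st False] .
    have "\<bar>vt t\<bar> \<le> c1 * (t - s)" "\<bar>vt s\<bar> \<le> c1 * (t - s)"
    proof -
      have "\<bar>vt t\<bar> \<le> c1 * \<bar>t - \<tau> t\<bar>" using th(3)[of t "\<tau> t"] th(1)[of t] by simp
      also have "... \<le> c1 * (t - s)" using nn s tau(1)[of t] by (intro mult_left_mono) auto
      finally show "\<bar>vt t\<bar> \<le> c1 * (t - s)" .
      have "\<bar>vt s\<bar> \<le> c1 * \<bar>s - \<tau> t\<bar>" using th(3)[of s "\<tau> t"] th(1)[of t] by simp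
      also have "... \<le> c1 * (t - s)" using nn s tau(1)[of t] by (intro mult_left_mono) auto
      finally show "\<bar>vt s\<bar> \<le> c1 * (t - s)" .
    qed
    hence "an (cst (of_real (vt t)) * G (\<tau> t) t w) \<le> (c1 * (t - s)) * g0"
      "an (cst (of_real (vt s)) * G (\<tau> s) s w) \<le> (c1 * (t - s)) * g0"
      using G(2) st nn by (auto intro!: order_trans[OF ancst] mult_mono)
    hence "an (cst (of_real (vt t)) * G (\<tau> t) t w - cst (of_real (vt s)) * G (\<tau> s) s w) \<le> 2 * c1 * g0 * (t - s)"
      using an_diff[of "cst (of_real (vt t)) * G (\<tau> t) t w" "cst (of_real (vt s)) * G (\<tau> s) s w"]
      by (simp add: algebra_simps)
    also have "... \<le> (2 * c1 * g0 + c0 * g1) * (t - s)"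
      using st c0 nn by (intro mult_right_mono) auto
    finally show ?thesis .
  qed
qed

end

lemma xpp_le2:
  assumes "\<bar>y\<bar> \<le> Y" "6 * Y \<le> real n" "1 \<le> n"
  shows "cmod (xpp n (- \<i> * of_real y)) \<le> 2"
    and "\<bar>(cmod (xpp n (- \<i> * of_real y)))^2 - 1\<bar> \<le> 3 * (real n * (1/2)^n)"
proof -
  let ?d = "real n * (1/2)^n"
  have d1: "?d \<le> 1"
  proof -
    have "n \<le> 2^n" by (simp add: less_exp less_imp_le)
    hence "real n \<le> 2^n" by (metis of_nat_le_iff of_nat_numeral of_nat_power)
    thus ?thesis by (simp add: power_divide)
  qed
  have d: "cmod (xpp n (- \<i> * of_real y) - cis (- y)) \<le> ?d" by (rule xpp_bound[OF assms])
  have n: "\<bar>cmod (xpp n (- \<i> * of_real y)) - 1\<bar> \<le> ?d"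
    using norm_triangle_ineq3[of "xpp n (- \<i> * of_real y)" "cis (- y)"] d by simp
  thus le2: "cmod (xpp n (- \<i> * of_real y)) \<le> 2" using d1 by linarith
  have "(cmod (xpp n (- \<i> * of_real y)))^2 - 1 = (cmod (xpp n (- \<i> * of_real y)) - 1) * (cmod (xpp n (- \<i> * of_real y)) + 1)"
    by (simp add: power2_eq_square algebra_simps)
  hence "\<bar>(cmod (xpp n (- \<i> * of_real y)))^2 - 1\<bar> = \<bar>cmod (xpp n (- \<i> * of_real y)) - 1\<bar> * \<bar>cmod (xpp n (- \<i> * of_real y)) + 1\<bar>"
    by (simp add: abs_mult)
  also have "... \<le> ?d * 3" using n le2 by (intro mult_mono) auto
  finally show "\<bar>(cmod (xpp n (- \<i> * of_real y)))^2 - 1\<bar> \<le> 3 * ?d" by simp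
qed

lemma cnj_xpp: "cnj (xpp n z) = xpp n (cnj z)"
  by (simp add: xpp_def)

lemma lk_xpt: "lk (a * xpt n (cst z * s)) k = (\<Sum>i\<le>n. z^i / fact i * lk (a * s^i) k)"
proof -
  have "a * xpt n (cst z * s) = (\<Sum>i\<le>n. cst (z^i / fact i) * (a * s^i))"
    by (rule ev_eqI) (simp add: xpt_def sum_distrib_left power_mult_distrib algebra_simps)
  thus ?thesis by (simp add: lookup_sum)
qed

text \<open>Polynomial version of d/dz exp(z s) = s exp(z s), for one coefficient at a time because
  the processes are differentiated in time coefficientwise.\<close>

lemma lk_xpt_deriv:
  "((\<lambda>z. lk (a * xpt (Suc n) (cst z * s)) k) has_field_derivative lk ((a * s) * xpt n (cst z * s)) k) (at z)"
proof -
  have "((\<lambda>z. \<Sum>i\<le>Suc n. z^i / fact i * lk (a * s^i) k) has_field_derivative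
     (\<Sum>i\<le>Suc n. of_nat i * z^(i - 1) / fact i * lk (a * s^i) k)) (at z)"
    by (auto intro!: derivative_eq_intros simp del: sum.atMost_Suc)
  also have "(\<Sum>i\<le>Suc n. of_nat i * z^(i - 1) / fact i * lk (a * s^i) k) = (\<Sum>i\<le>n. z^i / fact i * lk ((a * s) * s^i) k)"
    by (subst sum.atMost_Suc_shift) (simp add: field_simps del: of_nat_Suc)
  finally show ?thesis by (simp only: lk_xpt)
qed

lemma (in filt) gp_continuous:
  assumes "gp C D f" shows "continuous_on A (\<lambda>t. lk (f t w) k)"
  unfolding continuous_on_def
proof
  fix s
  have b: "norm (lk (f t w) k - lk (f s w) k) \<le> C * \<bar>t - s\<bar> powr (1/8)" for t
    using cmod_lk_le_an[of "f t w - f s w" k] gp_hold[OF assms, of t w s] by (simp add: lookup_minus)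
  have "((\<lambda>t. C * \<bar>t - s\<bar> powr (1/8)) \<longlongrightarrow> C * \<bar>s - s\<bar> powr (1/8)) (at s within A)"
    by (intro tendsto_mult tendsto_const tendsto_powr' tendsto_rabs tendsto_diff tendsto_ident_at) auto
  hence "((\<lambda>t. C * \<bar>t - s\<bar> powr (1/8)) \<longlongrightarrow> 0) (at s within A)" by simp
  hence "((\<lambda>t. lk (f t w) k - lk (f s w) k) \<longlongrightarrow> 0) (at s within A)"
    by (rule tendsto_0_le[where K=1]) (use b gp_nonneg[OF assms] in \<open>auto intro!: always_eventually simp: abs_mult\<close>)
  thus "((\<lambda>t. lk (f t w) k) \<longlongrightarrow> lk (f s w) k) (at s within A)" by (simp add: LIM_zero_iff)
qed

section \<open>Amplitudes with frozen phase\<close>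

definition pj :: "3 \<Rightarrow> nat \<Rightarrow> int \<Rightarrow> freq" where "pj c lam j = (\<chi> i. if i = c then j * int lam else 0)"

text \<open>Frequencies \<open>lam\<close> and 2 \<open>lam\<close> for the two families, with both
  signs so that the sum is real.\<close>

definition Jset :: "int set" where "Jset = {1, -1, 2, -2}"

definition sh :: "int \<Rightarrow> real" where "sh j = (if \<bar>j\<bar> = 1 then 0 else 1/2)"

lemma finite_Jset [simp]: "finite Jset" by (simp add: Jset_def)
lemma Jset_uminus: "j \<in> Jset \<Longrightarrow> - j \<in> Jset" by (auto simp: Jset_def)
lemma sh_uminus [simp]: "sh (- j) = sh j" by (simp add: sh_def)
lemma sh_cases: "sh j = 0 \<or> sh j = 1/2" by (simp add: sh_def)
lemma Jset_abs: "j \<in> Jset \<Longrightarrow> \<bar>j\<bar> \<le> 2 \<and> 1 \<le> \<bar>j\<bar>" by (auto simp: Jset_def)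

text \<open>
  \<open>uc\<close> is the component of the velocity along the wave vector and \<open>rr\<close> the stress coefficient to be
  removed. Amplitude and phase of the mode \<open>j\<close> are frozen at its last reset time \<open>tj j t\<close>; \<open>xpt\<close> is
  a Taylor polynomial of the exponential, so that the wave remains a trigonometric polynomial.
\<close>

locale wave = filt F for F :: "real \<Rightarrow> 'w measure" +
  fixes uc rr :: "'w proc" and Lam K om :: real and D lam n J :: nat
  assumes uc: "gp Lam D uc" "\<And>t w. rl (uc t w)"
    and rr: "gp Lam D rr" "\<And>t w. rl (rr t w)" "\<And>t w. sn (K/2) (rr t w)"
    and K: "0 < K" and om: "0 < om" and lam: "0 < lam"
    and J: "6 * (2 * real lam * (pi / om) * Lam) \<le> real J" "1 \<le> J"
begin

abbreviation tj :: "int \<Rightarrow> real \<Rightarrow> real" where "tj j t \<equiv> rst om (sh j) t"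

definition ph :: "int \<Rightarrow> real \<Rightarrow> 'w proc" where
  "ph j s0 t w = cst (- \<i> * of_real (of_int j * real lam * (t - s0))) * uc s0 w"
definition G0 :: "int \<Rightarrow> real \<Rightarrow> 'w proc" where
  "G0 j s0 t w = sqt n K (rr s0 w) * xpt (Suc (Suc J)) (ph j s0 t w)"
definition G1 :: "int \<Rightarrow> real \<Rightarrow> 'w proc" where
  "G1 j s0 t w = (sqt n K (rr s0 w) * uc s0 w) * xpt (Suc J) (ph j s0 t w)"
text \<open>The time derivative of \<open>G0\<close> between two resets; \<open>G1\<close> carries
  the velocity that the chain rule takes out of the phase.\<close>

definition G2 :: "int \<Rightarrow> real \<Rightarrow> 'w proc" where
  "G2 j s0 t w = cst (- \<i> * of_real (of_int j * real lam)) * G1 j s0 t w"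
text \<open>The factor 1/sqrt 2 compensates that the modes j and -j both contribute to the mean of
  the squared wave.\<close>

definition Bw :: "int \<Rightarrow> 'w proc" where
  "Bw j t w = cst (of_real (cutf om (sh j) t / sqrt 2)) * G0 j (tj j t) t w"
definition Mw :: "int \<Rightarrow> 'w proc" where
  "Mw j t w = cst (of_real (cutf' om (sh j) t / sqrt 2)) * G0 j (tj j t) t w"
definition Bd :: "int \<Rightarrow> 'w proc" where
  "Bd j t w = Mw j t w + cst (of_real (cutf om (sh j) t / sqrt 2)) * G2 j (tj j t) t w"
text \<open>The second summand is the advection of the carrier exp(i j lam x_c) by
  \<open>uc\<close>. The derivative of the cut-off is taken out because it is estimated in another
  norm.\<close>

definition Nw :: "int \<Rightarrow> 'w proc" where
  "Nw j t w = Bd j t w + cst (of_int j * of_real (real lam) * \<i>) * uc t w * Bw j t w - Mw j t w"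

definition dd :: nat where "dd = n * D + Suc (Suc J) * D + D"
definition Vol :: real where "Vol = real ((2 * dd + 1)^3)"

lemma Lam0: "0 \<le> Lam" using uc(1) by (rule gp_nonneg)

lemma dg_ph: "dg D (ph j s0 t w)"
  unfolding ph_def by (intro dg_cst_mult gp_dg[OF uc(1)])

lemma dg_amp: "dg (n * D) (sqt n K (rr s0 w))" by (intro dg_sqt gp_dg[OF rr(1)])

lemma dg_G0: "dg dd (G0 j s0 t w)"
  unfolding G0_def dd_def
  by (rule dg_mono[OF dg_mult[OF dg_amp dg_xpt[OF dg_ph]]]) simp

lemma dg_G1: "dg dd (G1 j s0 t w)"
  unfolding G1_def dd_def
  by (rule dg_mono[OF dg_mult[OF dg_mult[OF dg_amp gp_dg[OF uc(1)]] dg_xpt[OF dg_ph]]]) (simp add: algebra_simps)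

lemma dg_G2: "dg dd (G2 j s0 t w)"
  unfolding G2_def by (intro dg_cst_mult dg_G1)

lemma ev_uc: "ev (uc s0 w) x = of_real (Re (ev (uc s0 w) x))" "\<bar>Re (ev (uc s0 w) x)\<bar> \<le> Lam"
proof -
  show "ev (uc s0 w) x = of_real (Re (ev (uc s0 w) x))" using uc(2) by (simp add: rl_def complex_eq_iff)
  show "\<bar>Re (ev (uc s0 w) x)\<bar> \<le> Lam"
    using abs_Re_le_cmod[of "ev (uc s0 w) x"] cmod_ev_le_an[of "uc s0 w" x] gp_an[OF uc(1), of s0 w] by linarith
qed

definition yy :: "int \<Rightarrow> real \<Rightarrow> real \<Rightarrow> 'w \<Rightarrow> real^3 \<Rightarrow> real" where
  "yy j s0 t w x = of_int j * real lam * (t - s0) * Re (ev (uc s0 w) x)"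

lemma ev_ph: "ev (ph j s0 t w) x = - \<i> * of_real (yy j s0 t w x)"
  by (subst ph_def) (simp add: yy_def, subst ev_uc(1), simp)

definition YY :: real where "YY = 2 * real lam * (pi / om) * Lam"

lemma yy_bound:
  assumes "j \<in> Jset" "0 \<le> t - s0" "t - s0 \<le> pi / om"
  shows "\<bar>yy j s0 t w x\<bar> \<le> YY"
proof -
  have "\<bar>yy j s0 t w x\<bar> = of_int \<bar>j\<bar> * real lam * (t - s0) * \<bar>Re (ev (uc s0 w) x)\<bar>"
    using assms by (simp add: yy_def abs_mult)
  also have "... \<le> 2 * real lam * (pi / om) * Lam"
  proof -
    have "of_int \<bar>j\<bar> \<le> (2::real)" using Jset_abs[OF assms(1)] by linarith
    thus ?thesis using assms ev_uc(2) om Lam0 by (intro mult_mono) auto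
  qed
  finally show ?thesis by (simp add: YY_def)
qed

lemma YJ: "6 * YY \<le> real J" "6 * YY \<le> real (Suc J)" "6 * YY \<le> real (Suc (Suc J))"
  using J by (auto simp: YY_def)

lemma sn_amp: "sn (3 * sqrt K) (sqt n K (rr s0 w))"
  using sqt_bounds(1)[OF rr(2) rr(3) K] .

lemma sn_G0:
  assumes "j \<in> Jset" "0 \<le> t - s0" "t - s0 \<le> pi / om"
  shows "sn (6 * sqrt K) (G0 j s0 t w)"
proof -
  have "sn 2 (xpt (Suc (Suc J)) (ph j s0 t w))"
    unfolding sn_def ev_xpt ev_ph using xpp_le2(1)[OF yy_bound[OF assms] YJ(3)] by simp
  from sn_mult[OF sn_amp this] show ?thesis by (simp add: G0_def)
qed

lemma sn_uc: "sn Lam (uc s0 w)" by (rule sn_an) (rule gp_an[OF uc(1)])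

lemma sn_G1:
  assumes "j \<in> Jset" "0 \<le> t - s0" "t - s0 \<le> pi / om"
  shows "sn (6 * sqrt K * Lam) (G1 j s0 t w)"
proof -
  have "sn 2 (xpt (Suc J) (ph j s0 t w))"
    unfolding sn_def ev_xpt ev_ph using xpp_le2(1)[OF yy_bound[OF assms] YJ(2)] by simp
  from sn_mult[OF sn_mult[OF sn_amp sn_uc] this] show ?thesis by (simp add: G1_def mult_ac)
qed

lemma yy_diff:
  assumes "j \<in> Jset"
  shows "\<bar>yy j s0 t w x - yy j s0 t' w x\<bar> \<le> 2 * real lam * Lam * \<bar>t - t'\<bar>"
proof -
  have "yy j s0 t w x - yy j s0 t' w x = of_int j * real lam * Re (ev (uc s0 w) x) * (t - t')"
    by (simp add: yy_def algebra_simps)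
  hence "\<bar>yy j s0 t w x - yy j s0 t' w x\<bar> = of_int \<bar>j\<bar> * real lam * \<bar>Re (ev (uc s0 w) x)\<bar> * \<bar>t - t'\<bar>"
    by (simp add: abs_mult)
  also have "... \<le> 2 * real lam * Lam * \<bar>t - t'\<bar>"
  proof -
    have "of_int \<bar>j\<bar> \<le> (2::real)" using Jset_abs[OF assms(1)] by linarith
    thus ?thesis using ev_uc(2) Lam0 by (intro mult_mono) auto
  qed
  finally show ?thesis .
qed

lemma sn_xpt_diff:
  assumes "j \<in> Jset" "0 \<le> t - s0" "t - s0 \<le> pi / om" "0 \<le> t' - s0" "t' - s0 \<le> pi / om" "J \<le> m"
  shows "sn (4 * real lam * Lam * \<bar>t - t'\<bar>) (xpt (Suc m) (ph j s0 t w) - xpt (Suc m) (ph j s0 t' w))"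
  unfolding sn_def
proof
  fix x
  have m: "6 * YY \<le> real m" "1 \<le> m" using YJ(1) J(2) assms(6) by auto
  have "cmod (xpp (Suc m) (- \<i> * of_real (yy j s0 t w x)) - xpp (Suc m) (- \<i> * of_real (yy j s0 t' w x)))
    \<le> 2 * \<bar>yy j s0 t w x - yy j s0 t' w x\<bar>"
    using assms by (intro xpp_lip[of _ YY] yy_bound xpp_le2(1)[OF _ m])
  also have "... \<le> 2 * (2 * real lam * Lam * \<bar>t - t'\<bar>)" by (intro mult_left_mono yy_diff assms) simp
  also have "... = 4 * real lam * Lam * \<bar>t - t'\<bar>" by (simp add: mult.assoc)
  finally show "cmod (ev (xpt (Suc m) (ph j s0 t w) - xpt (Suc m) (ph j s0 t' w)) x) \<le> 4 * real lam * Lam * \<bar>t - t'\<bar>"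
    by (simp add: ev_xpt ev_ph)
qed

lemma sn_G0_diff:
  assumes "j \<in> Jset" "0 \<le> t - s0" "t - s0 \<le> pi / om" "0 \<le> t' - s0" "t' - s0 \<le> pi / om"
  shows "sn (12 * sqrt K * real lam * Lam * \<bar>t - t'\<bar>) (G0 j s0 t w - G0 j s0 t' w)"
proof -
  have "G0 j s0 t w - G0 j s0 t' w = sqt n K (rr s0 w) * (xpt (Suc (Suc J)) (ph j s0 t w) - xpt (Suc (Suc J)) (ph j s0 t' w))"
    by (rule ev_eqI) (simp add: G0_def algebra_simps)
  thus ?thesis using sn_mult[OF sn_amp[of s0 w] sn_xpt_diff[OF assms, of "Suc J" w]] by (simp add: mult_ac)
qed

lemma sn_G1_diff:
  assumes "j \<in> Jset" "0 \<le> t - s0" "t - s0 \<le> pi / om" "0 \<le> t' - s0" "t' - s0 \<le> pi / om"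
  shows "sn (12 * sqrt K * Lam * real lam * Lam * \<bar>t - t'\<bar>) (G1 j s0 t w - G1 j s0 t' w)"
proof -
  have "G1 j s0 t w - G1 j s0 t' w = (sqt n K (rr s0 w) * uc s0 w) * (xpt (Suc J) (ph j s0 t w) - xpt (Suc J) (ph j s0 t' w))"
    by (rule ev_eqI) (simp add: G1_def algebra_simps)
  thus ?thesis using sn_mult[OF sn_mult[OF sn_amp[of s0 w] sn_uc[of s0 w]] sn_xpt_diff[OF assms, of "J" w]] by (simp add: mult_ac)
qed

lemma Vol_ge: "1 \<le> Vol" by (simp add: Vol_def)

lemma an_Vol: "dg dd f \<Longrightarrow> sn s f \<Longrightarrow> an f \<le> Vol * s"
  unfolding Vol_def by (rule an_le_sn)

lemma tj_range: "0 \<le> t - tj j t" "t - tj j t \<le> pi / om"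
  using rst_le[OF om, of "sh j" t] rst_ge[OF om, of t "sh j"] by auto

lemma ad_frozen:
  assumes "\<And>k. (\<lambda>w. lk (a w) k) \<in> borel_measurable (F t)" "\<And>k. (\<lambda>w. lk (s w) k) \<in> borel_measurable (F t)"
    "\<And>w. dg Da (a w)" "\<And>w. dg Ds (s w)"
  shows "(\<lambda>w. lk (a w * xpt m (cst z * s w)) k) \<in> borel_measurable (F t)"
proof -
  have p: "(\<lambda>w. lk (a w * s w ^ i) k) \<in> borel_measurable (F t)" for i k
  proof (induction i arbitrary: k)
    case (Suc i)
    have "lk (a w * s w ^ Suc i) k = (\<Sum>l\<in>kbox Ds. lk (s w) l * lk (a w * s w ^ i) (k - l))" for w
      using lk_mult[of "kbox Ds" "s w" "a w * s w ^ i" k] assms(4)[of w] finite_kbox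
      by (simp add: dg_def mult_ac)
    thus ?case using Suc assms(2) by (auto intro!: borel_measurable_sum borel_measurable_times)
  qed (use assms in simp)
  have "(\<lambda>w. z^i / fact i * lk (a w * s w ^ i) k) \<in> borel_measurable (F t)" for i
    using borel_measurable_times[OF borel_measurable_const p, of "z^i / fact i"] by simp
  thus ?thesis unfolding lk_xpt by (intro borel_measurable_sum)
qed

lemma amp_meas: "(\<lambda>w. lk (sqt n K (rr s0 w)) k) \<in> borel_measurable (F s0)"
proof -
  have 1: "ad (\<lambda>t w. cst (of_real (1/K)) * rr t w)" by (intro ad_cst_mult gp_ad[OF rr(1)])
  have 2: "ad (\<lambda>t w. (cst (of_real (1/K)) * rr t w)^i)" for i
    by (intro ad_power[OF _ 1]) (rule dg_cst_mult[OF gp_dg[OF rr(1)]])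
  have "ad (\<lambda>t w. sqt n K (rr t w))" unfolding sqt_def
    by (intro ad_cst_mult[where c="\<lambda>_. of_real (sqrt K)"] ad_sum ad_cst_mult[where c="\<lambda>_. of_real (sqc _)"] 2)
  thus ?thesis by (simp add: ad_def)
qed

lemma ad_G0: "ad (\<lambda>t w. G0 j (tj j t) t w)"
  unfolding ad_def G0_def ph_def
proof (intro allI)
  fix t k
  have le: "tj j t \<le> t" using tj_range by simp
  show "(\<lambda>w. lk (sqt n K (rr (tj j t) w) * xpt (Suc (Suc J)) (cst (- \<i> * of_real (of_int j * real lam * (t - tj j t))) * uc (tj j t) w)) k) \<in> borel_measurable (F t)"
    by (rule ad_frozen[OF F_measurable_mono[OF le amp_meas] F_measurable_mono[OF le] dg_amp gp_dg[OF uc(1)]])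
      (use gp_ad[OF uc(1)] in \<open>simp add: ad_def\<close>)
qed

lemma ad_G1: "ad (\<lambda>t w. G1 j (tj j t) t w)"
  unfolding ad_def G1_def ph_def
proof (intro allI)
  fix t k
  have le: "tj j t \<le> t" using tj_range by simp
  have "lk (sqt n K (rr s0 w) * uc s0 w) k = (\<Sum>l\<in>kbox (n * D). lk (sqt n K (rr s0 w)) l * lk (uc s0 w) (k - l))" for s0 w k
    using dg_amp by (intro lk_mult finite_kbox) (auto simp: dg_def)
  moreover have ucm: "(\<lambda>w. lk (uc s0 w) k) \<in> borel_measurable (F s0)" for s0 k
    using gp_ad[OF uc(1)] by (simp add: ad_def)
  ultimately have m: "(\<lambda>w. lk (sqt n K (rr s0 w) * uc s0 w) k) \<in> borel_measurable (F s0)" for s0 k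
    using amp_meas by (auto intro!: borel_measurable_sum borel_measurable_times)
  show "(\<lambda>w. lk (sqt n K (rr (tj j t) w) * uc (tj j t) w * xpt (Suc J) (cst (- \<i> * of_real (of_int j * real lam * (t - tj j t))) * uc (tj j t) w)) k) \<in> borel_measurable (F t)"
    by (rule ad_frozen[OF F_measurable_mono[OF le m] F_measurable_mono[OF le ucm] dg_mult[OF dg_amp gp_dg[OF uc(1)]] gp_dg[OF uc(1)]])
qed

text \<open>The factor 1 + \<open>Lam\<close> lets one constant serve \<open>G0\<close> and
  \<open>G1\<close>.\<close>

definition g0 :: real where "g0 = Vol * (6 * sqrt K * (1 + Lam))"
definition g1 :: real where "g1 = Vol * (12 * sqrt K * (1 + Lam)^2 * real lam)"

lemma g0_nonneg: "0 \<le> g0" using Vol_ge Lam0 K by (simp add: g0_def)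
lemma g1_nonneg: "0 \<le> g1" using Vol_ge Lam0 K by (simp add: g1_def)

lemma G0_props:
  assumes "j \<in> Jset"
  shows "an (G0 j (tj j t) t w) \<le> g0"
    and "tj j t = tj j t' \<Longrightarrow> an (G0 j (tj j t) t w - G0 j (tj j t) t' w) \<le> g1 * \<bar>t - t'\<bar>"
proof -
  have "an (G0 j (tj j t) t w) \<le> Vol * (6 * sqrt K)"
    by (intro an_Vol dg_G0 sn_G0 assms tj_range)
  also have "... \<le> g0" unfolding g0_def using Vol_ge Lam0 K by (intro mult_left_mono) auto
  finally show "an (G0 j (tj j t) t w) \<le> g0" .
  assume e: "tj j t = tj j t'"
  have "an (G0 j (tj j t) t w - G0 j (tj j t) t' w) \<le> Vol * (12 * sqrt K * real lam * Lam * \<bar>t - t'\<bar>)"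
    using tj_range[of t' j] unfolding e[symmetric]
    by (intro an_Vol dg_diff dg_G0 sn_G0_diff assms tj_range)
  also have "... = Vol * (12 * sqrt K * Lam * real lam) * \<bar>t - t'\<bar>" by simp
  also have "... \<le> g1 * \<bar>t - t'\<bar>" unfolding g1_def using Vol_ge Lam0 K
    by (intro mult_right_mono mult_left_mono) (auto simp: power2_eq_square algebra_simps)
  finally show "an (G0 j (tj j t) t w - G0 j (tj j t) t' w) \<le> g1 * \<bar>t - t'\<bar>" .
qed

lemma G2_props:
  assumes "j \<in> Jset"
  shows "an (G2 j (tj j t) t w) \<le> 2 * real lam * g0"
    and "tj j t = tj j t' \<Longrightarrow> an (G2 j (tj j t) t w - G2 j (tj j t) t' w) \<le> 2 * real lam * g1 * \<bar>t - t'\<bar>"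
    and "ad (\<lambda>t w. G2 j (tj j t) t w)"
proof -
  have c: "cmod (- \<i> * of_real (of_int j * real lam)) \<le> 2 * real lam"
  proof -
    have "of_int \<bar>j\<bar> \<le> (2::real)" using Jset_abs[OF assms(1)] by linarith
    thus ?thesis by (simp add: norm_mult abs_mult mult_right_mono)
  qed
  have anc: "an (cst (- \<i> * of_real (of_int j * real lam)) * f) \<le> 2 * real lam * an f" for f
    using an_mult[of "cst (- \<i> * of_real (of_int j * real lam))" f] mult_right_mono[OF c an_nonneg[of f]] by simp
  have "an (G1 j (tj j t) t w) \<le> Vol * (6 * sqrt K * Lam)"
    by (intro an_Vol dg_G1 sn_G1 assms tj_range)
  also have "... \<le> g0" unfolding g0_def using Vol_ge Lam0 K by (intro mult_left_mono) auto
  finally show "an (G2 j (tj j t) t w) \<le> 2 * real lam * g0"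
    unfolding G2_def by (intro order_trans[OF anc] mult_left_mono) auto
  show "ad (\<lambda>t w. G2 j (tj j t) t w)" unfolding G2_def by (intro ad_cst_mult ad_G1)
  assume e: "tj j t = tj j t'"
  have "an (G1 j (tj j t) t w - G1 j (tj j t) t' w) \<le> Vol * (12 * sqrt K * Lam * real lam * Lam * \<bar>t - t'\<bar>)"
    using tj_range[of t' j] unfolding e[symmetric]
    by (intro an_Vol dg_diff dg_G1 sn_G1_diff assms tj_range)
  also have "... = Vol * (12 * sqrt K * Lam^2 * real lam) * \<bar>t - t'\<bar>" by (simp add: power2_eq_square)
  also have "... \<le> g1 * \<bar>t - t'\<bar>" unfolding g1_def using Vol_ge Lam0 K
    by (intro mult_right_mono mult_left_mono power_mono) auto
  finally have "2 * real lam * an (G1 j (tj j t) t w - G1 j (tj j t) t' w) \<le> 2 * real lam * (g1 * \<bar>t - t'\<bar>)"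
    by (intro mult_left_mono) auto
  moreover have "G2 j (tj j t) t w - G2 j (tj j t) t' w = cst (- \<i> * of_real (of_int j * real lam)) * (G1 j (tj j t) t w - G1 j (tj j t) t' w)"
    by (simp add: G2_def right_diff_distrib)
  ultimately show "an (G2 j (tj j t) t w - G2 j (tj j t) t' w) \<le> 2 * real lam * g1 * \<bar>t - t'\<bar>"
    using anc[of "G1 j (tj j t) t w - G1 j (tj j t) t' w"] by simp
qed

lemma tau_props:
  "tj j t \<le> t" "t - tj j t \<le> pi / om" "t < t' \<Longrightarrow> tj j t \<noteq> tj j t' \<Longrightarrow> t < tj j t'"
  using tj_range rst_between[OF om] by auto

lemma theta_props:
  "cutf om (sh j) (tj j t) / sqrt 2 = 0" "\<bar>cutf om (sh j) t / sqrt 2\<bar> \<le> 1"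
  "\<bar>cutf om (sh j) t / sqrt 2 - cutf om (sh j) t' / sqrt 2\<bar> \<le> 2 * om * \<bar>t - t'\<bar>"
  "cutf' om (sh j) (tj j t) / sqrt 2 = 0" "\<bar>cutf' om (sh j) t / sqrt 2\<bar> \<le> 2 * om"
  "\<bar>cutf' om (sh j) t / sqrt 2 - cutf' om (sh j) t' / sqrt 2\<bar> \<le> 8 * om^2 * \<bar>t - t'\<bar>"
proof -
  have s2: "\<bar>x / sqrt 2\<bar> \<le> b" if "\<bar>x\<bar> \<le> b" for x b :: real
  proof -
    have "\<bar>x\<bar> / sqrt 2 \<le> \<bar>x\<bar> / 1" by (intro divide_left_mono) auto
    thus ?thesis using that by simp
  qed
  show "cutf om (sh j) (tj j t) / sqrt 2 = 0" "cutf' om (sh j) (tj j t) / sqrt 2 = 0"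
    using cutf_rst[OF sh_cases om] by auto
  show "\<bar>cutf om (sh j) t / sqrt 2\<bar> \<le> 1" by (intro s2 cutf_bound)
  show "\<bar>cutf' om (sh j) t / sqrt 2\<bar> \<le> 2 * om" using om by (intro s2 cutf'_bound) auto
  show "\<bar>cutf om (sh j) t / sqrt 2 - cutf om (sh j) t' / sqrt 2\<bar> \<le> 2 * om * \<bar>t - t'\<bar>"
    unfolding diff_divide_distrib[symmetric] using om by (intro s2 cutf_lip) auto
  show "\<bar>cutf' om (sh j) t / sqrt 2 - cutf' om (sh j) t' / sqrt 2\<bar> \<le> 8 * om^2 * \<bar>t - t'\<bar>"
    unfolding diff_divide_distrib[symmetric] by (intro s2 cutf'_lip)
qed

definition gB :: real where "gB = 4 * om * g0 + g1 + 2 * g0"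
definition gBd :: real where
  "gBd = 16 * om^2 * g0 + 2 * om * g1 + 4 * om * g0 + 2 * real lam * gB"

lemma gp_Bw: "j \<in> Jset \<Longrightarrow> gp gB dd (Bw j)"
  using window_gp[of "tj j" "pi / om" "\<lambda>t. cutf om (sh j) t / sqrt 2" 1 "2 * om" dd "G0 j" g0 g1]
    tau_props theta_props dg_G0 G0_props ad_G0 om g1_nonneg
  by (simp add: Bw_def[abs_def] gB_def)

lemma gp_Bd: assumes j: "j \<in> Jset" shows "gp gBd dd (Bd j)"
proof -
  have 1: "gp (16 * om^2 * g0 + 2 * om * g1 + 4 * om * g0) dd (Mw j)"
    using window_gp[of "tj j" "pi / om" "\<lambda>t. cutf' om (sh j) t / sqrt 2" "2 * om" "8 * om^2" dd "G0 j" g0 g1]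
      tau_props theta_props dg_G0 G0_props[OF j] ad_G0 om g1_nonneg
    by (simp add: Mw_def[abs_def] mult.assoc)
  have 2: "gp (2 * real lam * gB) dd (\<lambda>t w. cst (of_real (cutf om (sh j) t / sqrt 2)) * G2 j (tj j t) t w)"
    using window_gp[of "tj j" "pi / om" "\<lambda>t. cutf om (sh j) t / sqrt 2" 1 "2 * om" dd "G2 j" "2 * real lam * g0" "2 * real lam * g1"]
      tau_props theta_props dg_G2 G2_props[OF j] om g1_nonneg
    by (simp add: gB_def algebra_simps)
  show ?thesis unfolding Bd_def[abs_def] gBd_def using gp_add[OF 1 2] .
qed

lemma Bw_deriv:
  assumes t: "t \<notin> rst_times om (sh j)"
  shows "((\<lambda>t. lk (Bw j t w) k) has_vector_derivative lk (Bd j t w) k) (at t)"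
proof -
  let ?c = "- \<i> * of_real (of_int j * real lam)"
  define s0 where "s0 = tj j t"
  define g where "g t = lk (G0 j s0 t w) k" for t
  have dg: "(g has_vector_derivative lk (G2 j s0 t w) k) (at t)"
  proof -
    let ?z = "\<lambda>t. - \<i> * of_real (of_int j * real lam * (t - s0))"
    have 1: "(?z has_vector_derivative ?c) (at t)"
      by (auto intro!: derivative_eq_intros simp: has_vector_derivative_def scaleR_conv_of_real algebra_simps)
    have "((\<lambda>z. lk (sqt n K (rr s0 w) * xpt (Suc (Suc J)) (cst z * uc s0 w)) k) \<circ> ?z has_vector_derivative
        ?c * lk ((sqt n K (rr s0 w) * uc s0 w) * xpt (Suc J) (cst (?z t) * uc s0 w)) k) (at t)"
      by (rule field_vector_diff_chain_at[OF 1 lk_xpt_deriv])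
    thus ?thesis by (simp add: g_def[abs_def] G0_def G2_def G1_def ph_def o_def)
  qed
  have c: "((\<lambda>t. complex_of_real (cutf om (sh j) t / sqrt 2)) has_vector_derivative of_real (cutf' om (sh j) t / sqrt 2)) (at t)"
    by (intro has_vector_derivative_of_real DERIV_cdivide cutf_deriv)
  have "((\<lambda>t. of_real (cutf om (sh j) t / sqrt 2) * g t) has_vector_derivative
     (of_real (cutf om (sh j) t / sqrt 2) * lk (G2 j s0 t w) k + of_real (cutf' om (sh j) t / sqrt 2) * g t)) (at t)"
    by (rule has_vector_derivative_mult[OF c dg])
  also have "of_real (cutf om (sh j) t / sqrt 2) * lk (G2 j s0 t w) k + of_real (cutf' om (sh j) t / sqrt 2) * g t = lk (Bd j t w) k"
    by (simp add: Bd_def Mw_def lookup_add g_def s0_def)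
  finally have 1: "((\<lambda>t. of_real (cutf om (sh j) t / sqrt 2) * g t) has_vector_derivative lk (Bd j t w) k) (at t)" .
  have "\<forall>\<^sub>F t' in nhds t. tj j t' = s0" using rst_locally_const[OF t] by (simp add: s0_def)
  hence ev: "\<forall>\<^sub>F t' in nhds t. of_real (cutf om (sh j) t' / sqrt 2) * g t' = lk (Bw j t' w) k"
    by eventually_elim (simp add: Bw_def g_def)
  hence "\<forall>\<^sub>F t' in nhds t. t' \<in> UNIV \<longrightarrow> of_real (cutf om (sh j) t' / sqrt 2) * g t' = lk (Bw j t' w) k"
    by eventually_elim simp
  from has_vector_derivative_cong_ev[OF this eventually_nhds_x_imp_x[OF ev]] 1 show ?thesis by simp
qed

lemma Bw_int:
  assumes "j \<in> Jset" "0 \<le> t"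
  shows "((\<lambda>s. lk (Bd j s w) k) has_integral lk (Bw j t w) k - lk (Bw j 0 w) k) {0..t}"
proof (rule fundamental_theorem_of_calculus_interior_strong[OF finite_rst_times[OF om]])
  show "0 \<le> t" by fact
  show "((\<lambda>s. lk (Bw j s w) k) has_vector_derivative lk (Bd j x w) k) (at x)"
    if "x \<in> {0<..<t} - rst_times om (sh j) \<inter> {0..t}" for x
    using that by (intro Bw_deriv) auto
  show "continuous_on {0..t} (\<lambda>s. lk (Bw j s w) k)" by (rule gp_continuous[OF gp_Bw[OF assms(1)]])
qed

lemma yy_uminus: "yy (- j) s0 t w x = - yy j s0 t w x"
  by (simp add: yy_def)

lemma cnj_amp: "cnj (ev (sqt n K (rr s0 w)) x) = ev (sqt n K (rr s0 w)) x"
  by (simp add: ev_sqt[OF rr(2)])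

lemma ev_G0_uminus: "ev (G0 (- j) s0 t w) x = cnj (ev (G0 j s0 t w) x)"
  by (simp add: G0_def ev_xpt ev_ph cnj_xpp yy_uminus cnj_amp)

lemma ev_G1_uminus: "ev (G1 (- j) s0 t w) x = cnj (ev (G1 j s0 t w) x)"
  using uc(2) by (simp add: G1_def ev_xpt ev_ph cnj_xpp yy_uminus cnj_amp rl_def complex_eq_iff)

lemma ev_Bw_uminus: "ev (Bw (- j) t w) x = cnj (ev (Bw j t w) x)"
  by (simp add: Bw_def ev_G0_uminus)

lemma ev_Bd_uminus: "ev (Bd (- j) t w) x = cnj (ev (Bd j t w) x)"
  by (simp add: Bd_def Mw_def G2_def ev_G0_uminus ev_G1_uminus)

definition dl :: real where "dl = real (Suc (Suc J)) * (1/2)^(Suc J)"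

lemma dl_nonneg: "0 \<le> dl" by (simp add: dl_def)

text \<open>The errors of the Taylor exponential, of the binomial square root, and of freezing the
  stress for a time of at most pi/om. The factor 27 K is (3 sqrt K)^2 times the 3 of
  \<open>xpp_le2\<close>.\<close>

definition lowerr :: real where
  "lowerr = 27 * K * dl + 5 * K * (1/2)^n + Lam * (pi / om) powr (1/8)"

text \<open>The phases of j and -j are opposite, so the exponentials cancel up to the Taylor error;
  what remains is the squared amplitude, K minus the stress at the reset time.\<close>

lemma G0_square:
  assumes "j \<in> Jset"
  shows "sn lowerr (G0 j (tj j t) t w * G0 (- j) (tj j t) t w - (cst (of_real K) - rr t w))"
  unfolding sn_def
proof
  fix x
  define s0 where "s0 = tj j t"
  define a where "a = ev (sqt n K (rr s0 w)) x"
  define E where "E = xpp (Suc (Suc J)) (- \<i> * of_real (yy j s0 t w x))"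
  have r: "0 \<le> t - s0" "t - s0 \<le> pi / om" using tj_range by (auto simp: s0_def)
  have E: "\<bar>(cmod E)^2 - 1\<bar> \<le> 3 * dl"
  proof -
    have "\<bar>(cmod E)^2 - 1\<bar> \<le> 3 * (real (Suc (Suc J)) * (1/2)^(Suc (Suc J)))"
      unfolding E_def by (rule xpp_le2(2)[OF yy_bound[OF assms r] YJ(3)]) simp
    also have "... \<le> 3 * dl" unfolding dl_def by (intro mult_left_mono power_decreasing) auto
    finally show ?thesis .
  qed
  have a: "cmod a \<le> 3 * sqrt K" using sn_amp by (auto simp: a_def sn_def)
  have "ev (G0 j s0 t w * G0 (- j) s0 t w) x = (a * E) * cnj (a * E)"
    by (simp add: ev_G0_uminus) (simp add: G0_def ev_xpt ev_ph a_def E_def)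
  also have "... = a * a * of_real ((cmod E)^2)"
    unfolding complex_norm_square using cnj_amp[of s0 w x] by (simp add: a_def)
  finally have "ev (G0 j s0 t w * G0 (- j) s0 t w - (cst (of_real K) - rr t w)) x =
     a * a * of_real ((cmod E)^2 - 1) + ev (sqt n K (rr s0 w) * sqt n K (rr s0 w) - (cst (of_real K) - rr s0 w)) x
       + ev (rr t w - rr s0 w) x"
    by (simp add: a_def algebra_simps)
  also have "cmod ... \<le> 27 * K * dl + 5 * K * (1/2)^n + Lam * (pi / om) powr (1/8)"
  proof (intro order_trans[OF norm_triangle_ineq] add_mono)
    have "cmod (a * a * of_real ((cmod E)^2 - 1)) = cmod a * cmod a * \<bar>(cmod E)^2 - 1\<bar>"
      by (simp only: norm_mult norm_of_real)
    also have "... \<le> (3 * sqrt K) * (3 * sqrt K) * (3 * dl)"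
      using a E K by (intro mult_mono) auto
    finally show "cmod (a * a * of_real ((cmod E)^2 - 1)) \<le> 27 * K * dl" using K by simp
    show "cmod (ev (sqt n K (rr s0 w) * sqt n K (rr s0 w) - (cst (of_real K) - rr s0 w)) x) \<le> 5 * K * (1/2)^n"
      using sqt_bounds(2)[OF rr(2) rr(3) K] by (auto simp: sn_def)
    have "cmod (ev (rr t w - rr s0 w) x) \<le> Lam * \<bar>t - s0\<bar> powr (1/8)"
      by (rule order_trans[OF cmod_ev_le_an gp_hold[OF rr(1)]])
    also have "... \<le> Lam * (pi / om) powr (1/8)"
      using r Lam0 by (intro mult_left_mono powr_mono2) auto
    finally show "cmod (ev (rr t w - rr s0 w) x) \<le> Lam * (pi / om) powr (1/8)" .
  qed
  finally show "cmod (ev (G0 j (tj j t) t w * G0 (- j) (tj j t) t w - (cst (of_real K) - rr t w)) x) \<le> lowerr"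
    by (simp add: s0_def lowerr_def)
qed

definition low :: "'w proc" where
  "low t w = (\<Sum>j\<in>Jset. Bw j t w * Bw (- j) t w)"

text \<open>The squared cut-offs are a partition of unity, so the errors of the two families are
  averaged.\<close>

lemma low_approx: "sn lowerr (low t w - (cst (of_real K) - rr t w))"
  unfolding sn_def
proof
  fix x
  define R where "R = ev (cst (of_real K) - rr t w) x"
  define g where "g j = ev (G0 j (tj j t) t w * G0 (- j) (tj j t) t w) x" for j
  define c where "c j = (cutf om (sh j) t)^2" for j
  have B: "ev (Bw j t w * Bw (- j) t w) x = of_real (c j / 2) * g j" for j
  proof -
    have "complex_of_real (sqrt 2) * complex_of_real (sqrt 2) = 2" by (simp flip: of_real_mult)
    thus ?thesis by (simp add: Bw_def g_def c_def power2_eq_square field_simps)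
  qed
  have c1: "c 1 + c 2 = 1" "0 \<le> c 1" "0 \<le> c 2"
    using cutf_squares[of om t] by (auto simp: c_def sh_def)
  have gm: "g (-1) = g 1" "g (-2) = g 2" by (simp_all add: g_def mult.commute)
  have cm: "c (-1) = c 1" "c (-2) = c 2" by (simp_all add: c_def sh_def)
  have "ev (low t w) x = (\<Sum>j\<in>Jset. of_real (c j / 2) * g j)"
    by (simp only: low_def ev_sum B)
  hence "2 * ev (low t w) x = 2 * (of_real (c 1) * g 1 + of_real (c 2) * g 2)"
    by (simp add: Jset_def gm cm field_simps)
  hence "ev (low t w) x = of_real (c 1) * g 1 + of_real (c 2) * g 2"
    using mult_left_cancel[of "2::complex"] by (metis zero_neq_numeral)
  moreover have "R = of_real (c 1) * R + of_real (c 2) * R"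
    using c1(1) by (metis mult_1 of_real_1 of_real_add ring_class.ring_distribs(2))
  ultimately have "ev (low t w) x - R = of_real (c 1) * (g 1 - R) + of_real (c 2) * (g 2 - R)"
    by (simp add: algebra_simps)
  also have "cmod ... \<le> c 1 * cmod (g 1 - R) + c 2 * cmod (g 2 - R)"
    by (rule order_trans[OF norm_triangle_ineq]) (use c1 in \<open>simp add: norm_mult\<close>)
  also have "... \<le> c 1 * lowerr + c 2 * lowerr"
    using G0_square[of 1 t w] G0_square[of 2 t w] c1
    by (intro add_mono mult_left_mono) (auto simp: Jset_def sn_def g_def R_def)
  also have "... = lowerr" using c1(1) by (metis mult_1 ring_class.ring_distribs(2))
  finally show "cmod (ev (low t w - (cst (of_real K) - rr t w)) x) \<le> lowerr" by (simp add: R_def)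
qed

text \<open>This bound is free of the factor \<open>Vol\<close> hidden in \<open>g0\<close>; it
  serves the main part of the switching error.\<close>

lemma sn_Mw: "j \<in> Jset \<Longrightarrow> sn (12 * om * sqrt K) (Mw j t w)"
proof -
  assume j: "j \<in> Jset"
  have "sn (2 * om * (6 * sqrt K)) (Mw j t w)"
    unfolding Mw_def
  proof (rule sn_mult)
    show "sn (2 * om) (cst (complex_of_real (cutf' om (sh j) t / sqrt 2)))"
      using theta_props(5)[of j t] by (simp add: sn_def del: of_real_divide)
  qed (intro sn_G0 j tj_range)
  thus ?thesis by (simp add: mult.assoc)
qed

lemma an_Mw: "j \<in> Jset \<Longrightarrow> an (Mw j t w) \<le> 2 * om * g0"
proof -
  assume j: "j \<in> Jset"
  have "an (Mw j t w) \<le> \<bar>cutf' om (sh j) t / sqrt 2\<bar> * an (G0 j (tj j t) t w)"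
    unfolding Mw_def by (rule order_trans[OF an_mult]) (simp del: of_real_divide)
  also have "... \<le> 2 * om * g0"
    using theta_props(5) G0_props(1)[OF j] om by (intro mult_mono) auto
  finally show ?thesis .
qed

lemma dg_Mw: "dg dd (Mw j t w)" unfolding Mw_def by (intro dg_cst_mult dg_G0)

lemma dg_Bw: "dg dd (Bw j t w)" unfolding Bw_def by (intro dg_cst_mult dg_G0)

lemma sn_Bw: "j \<in> Jset \<Longrightarrow> sn (6 * sqrt K) (Bw j t w)"
proof -
  assume j: "j \<in> Jset"
  have "sn (1 * (6 * sqrt K)) (Bw j t w)"
    unfolding Bw_def
  proof (rule sn_mult)
    show "sn 1 (cst (complex_of_real (cutf om (sh j) t / sqrt 2)))"
      using theta_props(2)[of j t] by (simp add: sn_def del: of_real_divide)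
  qed (intro sn_G0 j tj_range)
  thus ?thesis by simp
qed

lemma an_Bw: "j \<in> Jset \<Longrightarrow> an (Bw j t w) \<le> g0"
proof -
  assume j: "j \<in> Jset"
  have "an (Bw j t w) \<le> \<bar>cutf om (sh j) t / sqrt 2\<bar> * an (G0 j (tj j t) t w)"
    unfolding Bw_def by (rule order_trans[OF an_mult]) (simp del: of_real_divide)
  also have "... \<le> 1 * g0"
    using theta_props(2) G0_props(1)[OF j] by (intro mult_mono) auto
  finally show ?thesis by simp
qed

text \<open>The transport operator applied to a wave: the fast phase follows the velocity frozen at
  the last reset time, so only the increment of the velocity since then is left.\<close>

lemma an_Nw:
  assumes j: "j \<in> Jset"
  shows "an (Nw j t w) \<le> 2 * real lam * (Lam * (pi / om) powr (1/8) * g0 + g0 * dl)"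
proof -
  define s0 where "s0 = tj j t"
  define c where "c = of_int j * complex_of_real (real lam) * \<i>"
  define th where "th = complex_of_real (cutf om (sh j) t / sqrt 2)"
  have r: "0 \<le> t - s0" "t - s0 \<le> pi / om" using tj_range by (auto simp: s0_def)
  \<comment> \<open>Time differentiation lowered the Taylor degree, so it cancels the transport only
    up to the difference of two consecutive Taylor polynomials.\<close>
  define H where "H = (sqt n K (rr s0 w) * uc s0 w) * (xpt (Suc (Suc J)) (ph j s0 t w) - xpt (Suc J) (ph j s0 t w))"
  have "Nw j t w = cst c * ((uc t w - uc s0 w) * Bw j t w) + cst c * (cst th * H)"
    by (rule ev_eqI) (simp add: Nw_def Bd_def G2_def G1_def G0_def Bw_def H_def c_def th_def s0_def algebra_simps)
  moreover have anc: "an (cst c * f) \<le> cmod c * an f" for c f using an_mult[of "cst c" f] by simp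
  ultimately have "an (Nw j t w) \<le> cmod c * an ((uc t w - uc s0 w) * Bw j t w) + cmod c * an (cst th * H)"
    using order_trans[OF an_triangle add_mono[OF anc anc]] by simp
  hence "an (Nw j t w) \<le> cmod c * an ((uc t w - uc s0 w) * Bw j t w) + cmod c * (cmod th * an H)"
    using mult_left_mono[OF anc[of th H], of "cmod c"] by simp
  moreover have c: "cmod c \<le> 2 * real lam"
  proof -
    have "of_int \<bar>j\<bar> \<le> (2::real)" using Jset_abs[OF j] by linarith
    thus ?thesis by (simp add: c_def norm_mult mult_right_mono)
  qed
  moreover have "cmod th \<le> 1" using theta_props(2)[of j t] by (simp add: th_def del: of_real_divide)
  moreover have "an H \<le> g0 * dl"
  proof -
    have "sn (2 * dl) (xpt (Suc (Suc J)) (ph j s0 t w) - xpt (Suc J) (ph j s0 t w))"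
      unfolding sn_def
    proof
      fix x
      let ?y = "yy j s0 t w x"
      have "cmod (xpp (Suc (Suc J)) (- \<i> * of_real ?y) - cis (- ?y)) \<le> real (Suc (Suc J)) * (1/2)^(Suc (Suc J))"
        by (rule xpp_bound[OF yy_bound[OF j r] YJ(3)]) simp
      also have "... \<le> dl" unfolding dl_def by (intro mult_left_mono power_decreasing) auto
      finally have 1: "cmod (xpp (Suc (Suc J)) (- \<i> * of_real ?y) - cis (- ?y)) \<le> dl" .
      have "cmod (xpp (Suc J) (- \<i> * of_real ?y) - cis (- ?y)) \<le> real (Suc J) * (1/2)^(Suc J)"
        by (rule xpp_bound[OF yy_bound[OF j r] YJ(2)]) simp
      also have "... \<le> dl" unfolding dl_def by (intro mult_right_mono) auto
      finally have 2: "cmod (xpp (Suc J) (- \<i> * of_real ?y) - cis (- ?y)) \<le> dl" .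
      have "cmod (xpp (Suc (Suc J)) (- \<i> * of_real ?y) - xpp (Suc J) (- \<i> * of_real ?y)) \<le> dl + dl"
        using norm_diff_triangle_ineq[of "xpp (Suc (Suc J)) (- \<i> * of_real ?y)" "cis (- ?y)" "cis (- ?y)" "xpp (Suc J) (- \<i> * of_real ?y)"]
          1 2 norm_minus_commute[of "cis (- ?y)" "xpp (Suc J) (- \<i> * of_real ?y)"] by simp
      thus "cmod (ev (xpt (Suc (Suc J)) (ph j s0 t w) - xpt (Suc J) (ph j s0 t w)) x) \<le> 2 * dl"
        by (simp add: ev_xpt ev_ph)
    qed
    from sn_mult[OF sn_mult[OF sn_amp sn_uc] this] have "sn (3 * sqrt K * Lam * (2 * dl)) H"
      by (simp add: H_def)
    moreover have "dg dd H"
    proof -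
      have 1: "dg (Suc (Suc J) * D) (xpt (Suc (Suc J)) (ph j s0 t w) - xpt (Suc J) (ph j s0 t w))"
        by (intro dg_diff dg_mono[OF dg_xpt[OF dg_ph]]) auto
      show ?thesis unfolding H_def dd_def
        by (rule dg_mono[OF dg_mult[OF dg_mult[OF dg_amp gp_dg[OF uc(1)]] 1]]) (simp add: algebra_simps)
    qed
    ultimately have "an H \<le> Vol * (3 * sqrt K * Lam * (2 * dl))" by (intro an_Vol)
    also have "... = Vol * (6 * sqrt K * Lam) * dl" by simp
    also have "... \<le> g0 * dl" unfolding g0_def using Vol_ge Lam0 K dl_nonneg
      by (intro mult_right_mono mult_left_mono) auto
    finally show ?thesis .
  qed
  moreover have "an ((uc t w - uc s0 w) * Bw j t w) \<le> Lam * (pi / om) powr (1/8) * g0"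
  proof -
    have "an (uc t w - uc s0 w) \<le> Lam * \<bar>t - s0\<bar> powr (1/8)" by (rule gp_hold[OF uc(1)])
    also have "... \<le> Lam * (pi / om) powr (1/8)" using r Lam0 by (intro mult_left_mono powr_mono2) auto
    finally show ?thesis using an_Bw[OF j] Lam0 by (intro order_trans[OF an_mult] mult_mono) auto
  qed
  ultimately have "an (Nw j t w) \<le> 2 * real lam * (Lam * (pi / om) powr (1/8) * g0) + 2 * real lam * (1 * (g0 * dl))"
    by (elim order_trans) (intro add_mono mult_mono; simp add: g0_nonneg Lam0 dl_nonneg)
  thus ?thesis by (simp add: algebra_simps)
qed

end

subsection \<open>The algebra of one perturbation\<close>

text \<open>The right-hand side without pressure; gradients are removed by testing.\<close>

definition rhs :: "real \<Rightarrow> tvec \<Rightarrow> tmat \<Rightarrow> tvec" where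
  "rhs \<alpha> u r m = (\<Sum>l\<in>UNIV. dv l (strs r m l - u m * u l)) - mulp (lsym \<alpha>) (u m)"

lemma dv_cst [simp]: "dv l (cst c) = 0"
  by (rule poly_mapping_eqI) (simp add: lk_cst dsym_def)

lemma mulp_zero [simp]: "mulp mu 0 = 0"
  by (rule poly_mapping_eqI) simp

text \<open>What has to be inverted by \<open>adv\<close>: the time derivative of the wave, the
  terms linear in it, the high-frequency part of its square, and its dissipation.\<close>

definition newF :: "real \<Rightarrow> tvec \<Rightarrow> tvec \<Rightarrow> tvec \<Rightarrow> tvec \<Rightarrow> tmat \<Rightarrow> tvec" where
  "newF \<alpha> u wd wt wc hi l = wd l + (\<Sum>k\<in>UNIV. dv k (u l * wt k + wt l * u k)) + (\<Sum>k\<in>UNIV. dv k (hi l k))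
     + mulp (lsym \<alpha>) (wt l + wc l)"

text \<open>Products with a small factor, namely the divergence corrector \<open>wc\<close> or the
  noise increment \<open>\<zeta>\<close>; they enter the stress as they stand.\<close>

definition newS :: "tvec \<Rightarrow> tvec \<Rightarrow> tvec \<Rightarrow> tvec \<Rightarrow> tmat" where
  "newS u wt wc \<zeta> m l = u m * wc l + wc m * u l + wt m * wc l + wc m * wt l + wc m * wc l
     + (u m + wt m + wc m) * \<zeta> l + \<zeta> m * (u l + wt l + wc l) + \<zeta> m * \<zeta> l"

definition newr :: "tmat \<Rightarrow> 3 \<Rightarrow> 3 \<Rightarrow> tpoly \<Rightarrow> tmat \<Rightarrow> tvec \<Rightarrow> tmat" where
  "newr r a0 b0 q S f a b = r a b + (if a = a0 \<and> b = b0 then q else 0) + dec S a b + dec (adv f) a b"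

lemma strs_newr:
  assumes "\<And>m l. S m l = S l m"
  shows "strs (newr r a0 b0 q S f) m l = strs r m l + (if inc a0 b0 m \<and> inc a0 b0 l then q else 0) + S m l + adv f m l"
proof -
  have e: "(if inc a b m \<and> inc a b l then if a = a0 \<and> b = b0 then q else 0 else 0) =
     (if a = a0 then if b = b0 then if inc a0 b0 m \<and> inc a0 b0 l then q else 0 else 0 else 0)" for a b
    by auto
  have "strs (\<lambda>a b. if a = a0 \<and> b = b0 then q else 0) m l =
     (\<Sum>a\<in>UNIV. if a = a0 then (\<Sum>b\<in>UNIV. if b = b0 then (if inc a0 b0 m \<and> inc a0 b0 l then q else 0) else 0) else 0)"
    unfolding strs_def e by (intro sum.cong refl) auto
  hence 1: "strs (\<lambda>a b. if a = a0 \<and> b = b0 then q else 0) m l = (if inc a0 b0 m \<and> inc a0 b0 l then q else 0)"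
    by simp
  have 2: "strs (dec (adv f)) m l = adv f m l" by (rule strs_dec) (simp add: adv_def add.commute)
  have "strs (newr r a0 b0 q S f) m l = strs r m l + strs (\<lambda>a b. if a = a0 \<and> b = b0 then q else 0) m l
      + strs (dec S) m l + strs (dec (adv f)) m l"
    unfolding newr_def by (simp only: strs_add)
  thus ?thesis using strs_dec[OF assms] by (simp only: 1 2)
qed

text \<open>The low part q of the squared wave cancels against the q inside \<open>newr\<close>, the
  constant K has no divergence, and the force f returns through \<open>adv\<close> up to a gradient.
  At n = 0, where \<open>adv\<close> gives nothing, the coefficient of f vanishes.\<close>

lemma stress_identity:
  fixes u wt wc \<zeta> wd :: "tvec" and hi r :: "tmat" and e :: "3 \<Rightarrow> complex"
  assumes wt: "\<And>m l. wt m * wt l = (if inc a0 b0 m \<and> inc a0 b0 l then q else 0) + hi m l"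
    and wd: "\<And>m. lk (wd m) 0 = 0"
    and e: "(\<Sum>m\<in>UNIV. e m * of_int (n $ m)) = 0" and \<alpha>: "0 < \<alpha>"
  defines "f \<equiv> (\<lambda>l. newF \<alpha> u wd wt wc hi l + mulp (lsym \<alpha>) (\<zeta> l))"
  shows "(\<Sum>m\<in>UNIV. e m * lk (rhs \<alpha> (\<lambda>m. u m + wt m + wc m + \<zeta> m) (newr r a0 b0 (q - cst K) (newS u wt wc \<zeta>) f) m) n)
    = (\<Sum>m\<in>UNIV. e m * (lk (rhs \<alpha> u r m) n + lk (wd m) n))"
proof -
  let ?u = "\<lambda>m. u m + wt m + wc m + \<zeta> m" and ?r = "newr r a0 b0 (q - cst K) (newS u wt wc \<zeta>) f"
  have S: "newS u wt wc \<zeta> m l = newS u wt wc \<zeta> l m" for m l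
    by (simp add: newS_def algebra_simps)
  have A: "strs ?r m l - ?u m * ?u l = (strs r m l - u m * u l) + adv f m l - (u m * wt l + wt m * u l) - hi m l
      - cst (if inc a0 b0 m \<and> inc a0 b0 l then K else 0)" for m l
  proof -
    have "?u m * ?u l = u m * u l + (u m * wt l + wt m * u l) + wt m * wt l + newS u wt wc \<zeta> m l"
      by (simp add: newS_def algebra_simps)
    thus ?thesis unfolding strs_newr[OF S] wt by (auto simp: cst_def)
  qed
  have B: "rhs \<alpha> ?u ?r m = rhs \<alpha> u r m + (\<Sum>l\<in>UNIV. dv l (adv f m l)) - (f m - wd m)" for m
    unfolding rhs_def A
    by (simp add: mulp_add mulp_diff sum.distrib sum_subtractf f_def newF_def)
  show ?thesis
  proof (cases "n = 0")
    case True
    have "lk (f m) 0 = 0" for m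
      using \<alpha> wd[of m] by (simp add: f_def newF_def lookup_add lookup_sum dsym_def lsym_def)
    hence "lk (rhs \<alpha> ?u ?r m) n = lk (rhs \<alpha> u r m) n + lk (wd m) n" for m
      using wd[of m] by (simp add: B True lookup_add lookup_minus lookup_sum dsym_def)
    thus ?thesis by simp
  next
    case False
    define c where "c = (\<Sum>l\<in>UNIV. of_int (n $ l) * lk (f l) n) / of_real (knorm2 n)"
    have "lk (rhs \<alpha> ?u ?r m) n = lk (rhs \<alpha> u r m) n + lk (wd m) n + of_int (n $ m) * c" for m
      using adv_mode[OF False, of f m] by (simp add: B lookup_add lookup_minus lookup_sum c_def)
    hence "e m * lk (rhs \<alpha> ?u ?r m) n = e m * (lk (rhs \<alpha> u r m) n + lk (wd m) n) + e m * of_int (n $ m) * c" for m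
      by (simp only: distrib_left mult.assoc)
    hence "(\<Sum>m\<in>UNIV. e m * lk (rhs \<alpha> ?u ?r m) n) =
       (\<Sum>m\<in>UNIV. e m * (lk (rhs \<alpha> u r m) n + lk (wd m) n)) + (\<Sum>m\<in>UNIV. e m * of_int (n $ m)) * c"
      by (simp only: sum.distrib sum_distrib_right)
    thus ?thesis using e by simp
  qed
qed

text \<open>Only the derivative along \<open>c\<close> sees the carrier and produces a factor of
  size \<open>lam\<close>.\<close>

lemma dv_shift:
  "dv l (b * sg (pj c lam j) 1) = dv l b * sg (pj c lam j) 1 + (if l = c then cst (of_int j * of_real (real lam) * \<i>) * b * sg (pj c lam j) 1 else 0)"
proof -
  have "cst (dsym l (pj c lam j)) = (if l = c then cst (of_int j * of_real (real lam) * \<i>) else 0)"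
    by (auto simp: dsym_def pj_def cst_def mult_ac)
  thus ?thesis by (simp add: dv_mult dv_single mult_ac)
qed

lemma pj_add: "pj c lam j + pj c lam i = pj c lam (j + i)"
  by (simp add: pj_def vec_eq_iff distrib_right)

lemma hf_mod:
  assumes "dg E f" "2 * E \<le> lam" "j \<noteq> 0"
  shows "hf (real lam / 2) (f * sg (pj c lam j) 1)"
proof -
  have "real lam \<le> \<bar>real_of_int (j * int lam)\<bar>"
  proof -
    have "1 \<le> \<bar>j\<bar>" using assms(3) by simp
    hence "1 * real lam \<le> real_of_int \<bar>j\<bar> * real lam" by (intro mult_right_mono) auto
    thus ?thesis by (simp add: abs_mult)
  qed
  hence "hf (real lam / 2) (sg (pj c lam j) 1 * f)"
    using assms(2) by (intro hf_shift[OF pj_def[of c lam j] assms(1)]) linarith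
  thus ?thesis by (simp add: mult.commute)
qed

lemma an_mod: "an (f * sg p 1) \<le> an f"
  using an_mult[of f "sg p 1"] by simp

lemma hf_zero_mode: "0 < R \<Longrightarrow> hf R f \<Longrightarrow> lk f 0 = 0"
proof (rule ccontr)
  assume "0 < R" "hf R f" "lk f 0 \<noteq> 0"
  hence "0 \<in> ks f" by (simp add: in_keys_iff)
  thus False using \<open>hf R f\<close> \<open>0 < R\<close> by (auto simp: hf_def)
qed

section \<open>The wave, its divergence corrector and the errors they leave\<close>

locale step = wave +
  fixes u :: "3 \<Rightarrow> 'a proc" and a0 b0 c :: 3 and \<alpha> :: real
  assumes u: "\<And>m. gp Lam D (u m)" "\<And>m t w. rl (u m t w)" "uc = u c"
    and divu: "\<And>t w. (\<Sum>k\<in>UNIV. dv k (u k t w)) = 0"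
    and c: "\<not> inc a0 b0 c" and \<alpha>: "0 < \<alpha>" "\<alpha> < 1/2"
    and lamb: "2 * (2 * dd + D) \<le> lam"
begin

abbreviation X :: "int \<Rightarrow> tpoly" where "X j \<equiv> sg (pj c lam j) 1"

definition psi :: "'a proc" where "psi t w = (\<Sum>j\<in>Jset. Bw j t w * X j)"
definition psid :: "'a proc" where "psid t w = (\<Sum>j\<in>Jset. Bd j t w * X j)"
definition wt :: "real \<Rightarrow> 'a \<Rightarrow> tvec" where "wt t w m = (if inc a0 b0 m then psi t w else 0)"
definition wd :: "real \<Rightarrow> 'a \<Rightarrow> tvec" where "wd t w m = (if inc a0 b0 m then psid t w else 0)"
definition divw :: "'a proc" where "divw t w = (\<Sum>l\<in>UNIV. dv l (wt t w l))"
text \<open>The Leray correction: minus the gradient of the inverse Laplacian of the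
  divergence.\<close>

definition wc :: "real \<Rightarrow> 'a \<Rightarrow> tvec" where "wc t w m = - iv m (divw t w)"

definition P2 :: "(int \<times> int) set" where "P2 = {p \<in> Jset \<times> Jset. fst p + snd p \<noteq> 0}"
definition hi0 :: "'a proc" where
  "hi0 t w = (\<Sum>p\<in>P2. (Bw (fst p) t w * Bw (snd p) t w) * X (fst p + snd p))"
definition hi :: "real \<Rightarrow> 'a \<Rightarrow> tmat" where
  "hi t w m l = (if inc a0 b0 m \<and> inc a0 b0 l then hi0 t w else 0)"

text \<open>Together with \<open>R2\<close> the slowly varying factors of the error: no derivative
  in them falls on a carrier, except for the advection already collected in
  \<open>Nw\<close>.\<close>

definition R1 :: "real \<Rightarrow> 'a \<Rightarrow> 3 \<Rightarrow> int \<Rightarrow> tpoly" where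
  "R1 t w l j = (if inc a0 b0 l then Nw j t w + (\<Sum>k\<in>UNIV. u k t w * dv k (Bw j t w)) else 0)
     + (\<Sum>k\<in>UNIV. if inc a0 b0 k then dv k (u l t w) * Bw j t w + u l t w * dv k (Bw j t w) else 0)"
definition R2 :: "real \<Rightarrow> 'a \<Rightarrow> 3 \<Rightarrow> int \<times> int \<Rightarrow> tpoly" where
  "R2 t w l p = (if inc a0 b0 l then (\<Sum>k\<in>UNIV. if inc a0 b0 k then dv k (Bw (fst p) t w * Bw (snd p) t w) else 0) else 0)"

lemma card_P2: "card P2 \<le> 16"
proof -
  have "card P2 \<le> card (Jset \<times> Jset)" unfolding P2_def by (intro card_mono) auto
  thus ?thesis by (simp add: Jset_def card_cartesian_product)
qed

lemma card_Jset: "card Jset = 4" by (simp add: Jset_def)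

lemma incc: "inc a0 b0 k \<Longrightarrow> k \<noteq> c" using c by auto

text \<open>The frequencies of carriers add. Pairs (j, -j) lose the carrier and form
  \<open>low\<close>; all other pairs keep a nonzero multiple of \<open>lam\<close>.\<close>

lemma wt_mult: "wt t w m * wt t w l = (if inc a0 b0 m \<and> inc a0 b0 l then low t w else 0) + hi t w m l"
proof -
  have "psi t w * psi t w = (\<Sum>p\<in>Jset \<times> Jset. (Bw (fst p) t w * Bw (snd p) t w) * X (fst p + snd p))"
    unfolding psi_def sum_product sum.cartesian_product
  proof (intro sum.cong refl)
    fix p :: "int \<times> int"
    have "X (fst p) * X (snd p) = X (fst p + snd p)" by (simp add: mult_single pj_add)
    moreover have "Bw (fst p) t w * X (fst p) * (Bw (snd p) t w * X (snd p)) = Bw (fst p) t w * Bw (snd p) t w * (X (fst p) * X (snd p))"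
      by (simp only: mult_ac)
    ultimately show "(case p of (i, j) \<Rightarrow> Bw i t w * X i * (Bw j t w * X j)) = (Bw (fst p) t w * Bw (snd p) t w) * X (fst p + snd p)"
      by (simp only: case_prod_beta)
  qed
  also have "... = (\<Sum>p\<in>P2. (Bw (fst p) t w * Bw (snd p) t w) * X (fst p + snd p))
      + (\<Sum>p\<in>Jset \<times> Jset - P2. (Bw (fst p) t w * Bw (snd p) t w) * X (fst p + snd p))"
    by (rule sum.subset_diff[of P2, THEN trans[OF _ add.commute]]) (auto simp: P2_def)
  also have "(\<Sum>p\<in>Jset \<times> Jset - P2. (Bw (fst p) t w * Bw (snd p) t w) * X (fst p + snd p)) = low t w"
  proof -
    have "Jset \<times> Jset - P2 = (\<lambda>j. (j, - j)) ` Jset" by (auto simp: P2_def image_iff dest: Jset_uminus)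
    moreover have "X 0 = 1"
    proof -
      have "pj c lam 0 = 0" by (simp add: pj_def vec_eq_iff)
      thus ?thesis by simp
    qed
    ultimately show ?thesis unfolding low_def by (simp add: sum.reindex inj_on_def)
  qed
  finally have "psi t w * psi t w = hi0 t w + low t w" by (simp add: hi0_def)
  thus ?thesis by (auto simp: wt_def hi_def)
qed

lemma dv_psi: "dv l (psi t w) = (\<Sum>j\<in>Jset. dv l (Bw j t w) * X j) +
    (if l = c then (\<Sum>j\<in>Jset. cst (of_int j * of_real (real lam) * \<i>) * Bw j t w * X j) else 0)"
  by (simp add: psi_def mulp_sum dv_shift sum.distrib)

text \<open>The polarisation has no component along \<open>c\<close>, so no derivative of a carrier
  survives and the divergence is only as large as slow derivatives.\<close>

lemma divw_eq: "divw t w = (\<Sum>j\<in>Jset. (\<Sum>l\<in>UNIV. if inc a0 b0 l then dv l (Bw j t w) else 0) * X j)"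
proof -
  have "dv l (wt t w l) = (\<Sum>j\<in>Jset. (if inc a0 b0 l then dv l (Bw j t w) else 0) * X j)" for l
    using incc[of l] by (auto simp: wt_def dv_psi)
  thus ?thesis unfolding divw_def by (simp add: sum_distrib_right) (rule sum.swap)
qed

text \<open>Derivatives contracted with the wave never hit a carrier; derivatives contracted with
  the velocity do so only along \<open>c\<close>, where they join the time derivative in
  \<open>Nw\<close>. Apart from the dissipation, what remains is carriers times slow factors, on
  which \<open>adv\<close> gains 1/lam.\<close>

lemma newF_eq:
  "newF \<alpha> (\<lambda>m. u m t w) (wd t w) (wt t w) (wc t w) (hi t w) l =
     (\<Sum>j\<in>Jset. ((if inc a0 b0 l then Mw j t w else 0) + R1 t w l j) * X j) + (\<Sum>p\<in>P2. R2 t w l p * X (fst p + snd p))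
     + mulp (lsym \<alpha>) (wt t w l + wc t w l)"
proof -
  let ?u = "\<lambda>k. u k t w" and ?I = "inc a0 b0"
  have 1: "(\<Sum>k\<in>UNIV. dv k (wt t w l * ?u k)) = (\<Sum>k\<in>UNIV. ?u k * dv k (wt t w l))"
  proof -
    have "dv k (wt t w l * ?u k) = ?u k * dv k (wt t w l) + wt t w l * dv k (?u k)" for k
      by (simp add: dv_mult mult.commute)
    hence "(\<Sum>k\<in>UNIV. dv k (wt t w l * ?u k)) = (\<Sum>k\<in>UNIV. ?u k * dv k (wt t w l)) + wt t w l * (\<Sum>k\<in>UNIV. dv k (?u k))"
      by (simp add: sum.distrib sum_distrib_left)
    thus ?thesis using divu by simp
  qed
  have 2: "(\<Sum>k\<in>UNIV. ?u k * dv k (psi t w)) = (\<Sum>j\<in>Jset. (\<Sum>k\<in>UNIV. ?u k * dv k (Bw j t w)) * X j)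
     + (\<Sum>j\<in>Jset. cst (of_int j * of_real (real lam) * \<i>) * uc t w * Bw j t w * X j)"
  proof -
    have "?u k * dv k (psi t w) = (\<Sum>j\<in>Jset. ?u k * dv k (Bw j t w) * X j) +
       (if k = c then (\<Sum>j\<in>Jset. cst (of_int j * of_real (real lam) * \<i>) * uc t w * Bw j t w * X j) else 0)" for k
    proof (cases "k = c")
      case True
      hence "?u k = uc t w" using u(3) by simp
      moreover have "uc t w * dv k (psi t w) = (\<Sum>j\<in>Jset. uc t w * dv k (Bw j t w) * X j)
         + (\<Sum>j\<in>Jset. uc t w * (cst (of_int j * of_real (real lam) * \<i>) * Bw j t w * X j))"
        unfolding dv_psi using True by (simp only: refl if_True distrib_left sum_distrib_left mult.assoc)
      moreover have "uc t w * (cst a * Bw j t w * X j) = cst a * uc t w * Bw j t w * X j" for a j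
        by (simp only: mult_ac)
      ultimately show ?thesis using True by (simp only: refl if_True)
    next
      case False
      thus ?thesis unfolding dv_psi by (simp only: if_False add_0_right sum_distrib_left mult.assoc)
    qed
    hence "(\<Sum>k\<in>UNIV. ?u k * dv k (psi t w)) = (\<Sum>k\<in>UNIV. \<Sum>j\<in>Jset. ?u k * dv k (Bw j t w) * X j)
      + (\<Sum>j\<in>Jset. cst (of_int j * of_real (real lam) * \<i>) * uc t w * Bw j t w * X j)"
      by (simp add: sum.distrib)
    thus ?thesis by (simp add: sum_distrib_right) (rule sum.swap)
  qed
  have 3: "(\<Sum>k\<in>UNIV. dv k (?u l * wt t w k)) = (\<Sum>j\<in>Jset. (\<Sum>k\<in>UNIV. if ?I k then dv k (?u l) * Bw j t w + ?u l * dv k (Bw j t w) else 0) * X j)"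
  proof -
    have "dv k (?u l * wt t w k) = (\<Sum>j\<in>Jset. (if ?I k then dv k (?u l) * Bw j t w + ?u l * dv k (Bw j t w) else 0) * X j)" for k
    proof (cases "?I k")
      case True
      hence "dv k (?u l * wt t w k) = dv k (?u l) * psi t w + ?u l * dv k (psi t w)"
        by (simp add: wt_def dv_mult)
      also have "... = (\<Sum>j\<in>Jset. dv k (?u l) * Bw j t w * X j) + (\<Sum>j\<in>Jset. ?u l * dv k (Bw j t w) * X j)"
      proof -
        have "dv k (psi t w) = (\<Sum>j\<in>Jset. dv k (Bw j t w) * X j)"
          using incc[OF True] dv_psi[of k t w] by simp
        thus ?thesis by (simp only:) (simp add: psi_def sum_distrib_left mult_ac)
      qed
      finally show ?thesis using True by (simp add: sum.distrib[symmetric] distrib_right)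
    qed (simp add: wt_def)
    thus ?thesis by (simp add: sum_distrib_right) (rule sum.swap)
  qed
  have 4: "(\<Sum>k\<in>UNIV. dv k (hi t w l k)) = (\<Sum>p\<in>P2. R2 t w l p * X (fst p + snd p))"
  proof -
    have "dv k (hi t w l k) = (\<Sum>p\<in>P2. (if ?I l then (if ?I k then dv k (Bw (fst p) t w * Bw (snd p) t w) else 0) else 0) * X (fst p + snd p))" for k
      using incc[of k] by (cases "?I l"; cases "?I k"; simp add: hi_def hi0_def mulp_sum dv_shift)
    hence "(\<Sum>k\<in>UNIV. dv k (hi t w l k)) = (\<Sum>p\<in>P2. \<Sum>k\<in>UNIV. (if ?I l then (if ?I k then dv k (Bw (fst p) t w * Bw (snd p) t w) else 0) else 0) * X (fst p + snd p))"
      by (simp only:) (rule sum.swap)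
    thus ?thesis by (simp add: R2_def sum_distrib_right[symmetric]) (intro sum.cong refl; auto)
  qed
  have 5: "wd t w l + (\<Sum>k\<in>UNIV. ?u k * dv k (wt t w l)) =
     (\<Sum>j\<in>Jset. (if ?I l then Mw j t w + Nw j t w + (\<Sum>k\<in>UNIV. ?u k * dv k (Bw j t w)) else 0) * X j)"
  proof (cases "?I l")
    case True
    have "wd t w l + (\<Sum>k\<in>UNIV. ?u k * dv k (wt t w l)) = (\<Sum>j\<in>Jset. Bd j t w * X j) + ((\<Sum>j\<in>Jset. (\<Sum>k\<in>UNIV. ?u k * dv k (Bw j t w)) * X j)
     + (\<Sum>j\<in>Jset. cst (of_int j * of_real (real lam) * \<i>) * uc t w * Bw j t w * X j))"
      using True by (simp only: wd_def wt_def if_True psid_def 2)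
    also have "... = (\<Sum>j\<in>Jset. (Bd j t w + (\<Sum>k\<in>UNIV. ?u k * dv k (Bw j t w)) + cst (of_int j * of_real (real lam) * \<i>) * uc t w * Bw j t w) * X j)"
      by (simp only: sum.distrib[symmetric] distrib_right add.assoc)
    also have "... = (\<Sum>j\<in>Jset. (Mw j t w + Nw j t w + (\<Sum>k\<in>UNIV. ?u k * dv k (Bw j t w))) * X j)"
      by (intro sum.cong refl arg_cong2[where f="(*)"]) (simp add: Nw_def)
    finally show ?thesis using True by simp
  qed (simp add: wd_def wt_def)
  have T: "(if ?I l then Mw j t w + Nw j t w + (\<Sum>k\<in>UNIV. ?u k * dv k (Bw j t w)) else 0) * X j
       + (\<Sum>k\<in>UNIV. if ?I k then dv k (?u l) * Bw j t w + ?u l * dv k (Bw j t w) else 0) * X j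
     = ((if ?I l then Mw j t w else 0) + R1 t w l j) * X j" for j
    unfolding distrib_right[symmetric] R1_def by (cases "?I l") (simp_all add: add.assoc)
  have "newF \<alpha> ?u (wd t w) (wt t w) (wc t w) (hi t w) l =
     (wd t w l + (\<Sum>k\<in>UNIV. dv k (wt t w l * ?u k))) + (\<Sum>k\<in>UNIV. dv k (?u l * wt t w k)) + (\<Sum>k\<in>UNIV. dv k (hi t w l k))
     + mulp (lsym \<alpha>) (wt t w l + wc t w l)"
    by (simp add: newF_def mulp_add sum.distrib)
  also have "... = (\<Sum>j\<in>Jset. (if ?I l then Mw j t w + Nw j t w + (\<Sum>k\<in>UNIV. ?u k * dv k (Bw j t w)) else 0) * X j
       + (\<Sum>k\<in>UNIV. if ?I k then dv k (?u l) * Bw j t w + ?u l * dv k (Bw j t w) else 0) * X j)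
     + (\<Sum>p\<in>P2. R2 t w l p * X (fst p + snd p)) + mulp (lsym \<alpha>) (wt t w l + wc t w l)"
    by (simp only: 1 3 4 5 sum.distrib)
  finally show ?thesis by (simp only: T)
qed

lemma Jset_nz: "j \<in> Jset \<Longrightarrow> j \<noteq> 0" by (auto simp: Jset_def)

lemma lam_dd: "2 * (dd + D) \<le> lam" "2 * (2 * dd) \<le> lam" "2 * dd \<le> lam" "2 * D \<le> lam" "real dd \<le> real lam / 2"
  using lamb by auto

lemma ddD: "D \<le> dd" by (simp add: dd_def)

lemma dg_Nw: "dg (dd + D) (Nw j t w)"
proof -
  have "dg dd (Bd j t w)" unfolding Bd_def by (intro dg_add dg_Mw dg_cst_mult dg_G2)
  moreover have "dg (D + dd) (cst (of_int j * of_real (real lam) * \<i>) * uc t w * Bw j t w)"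
    by (intro dg_mult dg_Bw dg_cst_mult gp_dg[OF uc(1)])
  ultimately show ?thesis unfolding Nw_def
    by (intro dg_add dg_diff) (auto intro: dg_mono dg_Mw simp: add.commute)
qed

lemma dg_R1: "dg (dd + D) (R1 t w l j)"
proof -
  have 1: "dg (dd + D) (u k t w * dv l (Bw j t w))" for k l
    using dg_mult[OF gp_dg[OF u(1)] dg_mulp[OF dg_Bw]] by (simp add: add.commute)
  have 2: "dg (dd + D) (dv k (u l t w) * Bw j t w)" for k l
    using dg_mult[OF dg_mulp[OF gp_dg[OF u(1)]] dg_Bw] by (simp add: add.commute)
  show ?thesis unfolding R1_def
    by (intro dg_add dg_sum) (auto intro!: dg_add dg_sum 1 2 dg_Nw)
qed

lemma dg_R2: "dg (2 * dd) (R2 t w l p)"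
proof -
  have "dg (2 * dd) (Bw (fst p) t w * Bw (snd p) t w)"
    using dg_mult[OF dg_Bw dg_Bw] by (simp add: mult_2)
  thus ?thesis unfolding R2_def by (auto intro!: dg_sum dg_mulp)
qed

lemma hf_psi: "hf (real lam / 2) (psi t w)"
  unfolding psi_def using lam_dd by (intro hf_sum hf_mod[OF dg_Bw]) (auto dest: Jset_nz)

lemma hf_psid: "hf (real lam / 2) (psid t w)"
proof -
  have "dg dd (Bd j t w)" for j unfolding Bd_def by (intro dg_add dg_Mw dg_cst_mult dg_G2)
  thus ?thesis
    unfolding psid_def using lam_dd by (intro hf_sum hf_mod) (auto dest: Jset_nz)
qed

lemma hf_divw: "hf (real lam / 2) (divw t w)"
  unfolding divw_def by (intro hf_sum hf_mulp) (simp add: wt_def hf_psi)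

lemma hf_wt: "hf (real lam / 2) (wt t w m)" by (simp add: wt_def hf_psi)

lemma hf_uminus: "hf R f \<Longrightarrow> hf R (- f)" by (simp add: hf_def)

lemma hf_wc: "hf (real lam / 2) (wc t w m)"
  unfolding wc_def by (intro hf_uminus hf_mulp hf_divw)

lemma an_psi: "an (psi t w) \<le> 4 * g0"
proof -
  have "an (psi t w) \<le> (\<Sum>j\<in>Jset. g0)"
    unfolding psi_def by (intro order_trans[OF an_sum] sum_mono order_trans[OF an_mod] an_Bw)
  thus ?thesis by (simp add: card_Jset)
qed

lemma sn_psi: "sn (24 * sqrt K) (psi t w)"
  unfolding sn_def
proof
  fix x
  have "cmod (ev (psi t w) x) \<le> (\<Sum>j\<in>Jset. 6 * sqrt K)"
    unfolding psi_def ev_sum using sn_Bw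
    by (intro order_trans[OF norm_sum] sum_mono) (simp add: norm_mult sn_def)
  thus "cmod (ev (psi t w) x) \<le> 24 * sqrt K" by (simp add: card_Jset)
qed

lemma an_dv_Bw: "j \<in> Jset \<Longrightarrow> an (dv l (Bw j t w)) \<le> real dd * g0"
  by (intro order_trans[OF an_dv[OF dg_Bw]] mult_left_mono an_Bw) auto

lemma an_if: "0 \<le> b \<Longrightarrow> (P \<Longrightarrow> an f \<le> b) \<Longrightarrow> an (if P then f else 0) \<le> b" by simp

lemma an_sum3: "(\<And>k::3. an (f k) \<le> b) \<Longrightarrow> an (\<Sum>k\<in>UNIV. f k) \<le> 3 * b"
  using sum_mono[of UNIV "\<lambda>k. an (f k)" "\<lambda>_. b"] order_trans[OF an_sum, of f UNIV] by simp

lemma an_divw: "an (divw t w) \<le> 12 * real dd * g0"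
proof -
  have "an (divw t w) \<le> (\<Sum>j\<in>Jset. 3 * (real dd * g0))"
    unfolding divw_eq using g0_nonneg
    by (intro order_trans[OF an_sum] sum_mono order_trans[OF an_mod an_sum3] an_if an_dv_Bw) auto
  thus ?thesis by (simp add: card_Jset)
qed

lemma an_wc: "an (wc t w m) \<le> 24 * real dd * g0 / real lam"
proof -
  have "an (wc t w m) \<le> an (divw t w) / (real lam / 2)"
    unfolding wc_def an_uminus using lam by (intro an_iv_high hf_divw) auto
  also have "... \<le> 12 * real dd * g0 / (real lam / 2)"
    using lam by (intro divide_right_mono an_divw) auto
  finally show ?thesis by simp
qed

lemma an_w: "an (wt t w m + wc t w m) \<le> 16 * g0"
proof -
  have "an (wt t w m) \<le> 4 * g0" using an_psi g0_nonneg by (simp add: wt_def)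
  moreover have "24 * real dd * g0 / real lam \<le> 12 * g0"
    using lam_dd(5) lam g0_nonneg mult_right_mono[OF lam_dd(5), of "24 * g0"]
    by (simp add: divide_le_eq algebra_simps)
  ultimately show ?thesis using an_triangle[of "wt t w m" "wc t w m"] an_wc[of t w m] by linarith
qed

definition nu :: real where "nu = 2 * real lam * (Lam * (pi / om) powr (1/8) * g0 + g0 * dl)"

lemma nu_nonneg: "0 \<le> nu" unfolding nu_def using Lam0 g0_nonneg dl_nonneg by auto

lemma an_u: "an (u k t w) \<le> Lam" by (rule gp_an[OF u(1)])

lemma an_dv_u: "an (dv l (u k t w)) \<le> real dd * Lam"
proof -
  have "an (dv l (u k t w)) \<le> real D * an (u k t w)" by (rule an_dv[OF gp_dg[OF u(1)]])
  also have "... \<le> real dd * Lam" using ddD by (intro mult_mono an_u) auto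
  finally show ?thesis .
qed

lemma an_R1: "j \<in> Jset \<Longrightarrow> an (R1 t w l j) \<le> nu + 9 * real dd * Lam * g0"
proof -
  assume j: "j \<in> Jset"
  have a: "an (u k t w * dv l (Bw j t w)) \<le> real dd * Lam * g0" for k l
    using order_trans[OF an_mult mult_mono[OF an_u an_dv_Bw[OF j]]] Lam0 by (simp add: mult_ac)
  have b: "an (dv k (u l t w) * Bw j t w) \<le> real dd * Lam * g0" for k l
    using order_trans[OF an_mult mult_mono[OF an_dv_u an_Bw[OF j]]] Lam0 by simp
  have nn: "0 \<le> real dd * Lam * g0" using Lam0 g0_nonneg by auto
  have N: "an (Nw j t w) \<le> nu" unfolding nu_def by (rule an_Nw[OF j])
  have X1: "an (\<Sum>k\<in>UNIV. u k t w * dv k (Bw j t w)) \<le> 3 * (real dd * Lam * g0)"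
    by (intro an_sum3 a)
  have X2: "an (if inc a0 b0 l then Nw j t w + (\<Sum>k\<in>UNIV. u k t w * dv k (Bw j t w)) else 0) \<le> nu + 3 * (real dd * Lam * g0)"
    using nn nu_nonneg order_trans[OF an_triangle add_mono[OF N X1]] by (intro an_if) auto
  have X3: "an (if inc a0 b0 k then dv k (u l t w) * Bw j t w + u l t w * dv k (Bw j t w) else 0)
      \<le> real dd * Lam * g0 + real dd * Lam * g0" for k
    by (intro an_if add_nonneg_nonneg nn order_trans[OF an_triangle add_mono[OF b a]])
  have X4: "an (\<Sum>k\<in>UNIV. if inc a0 b0 k then dv k (u l t w) * Bw j t w + u l t w * dv k (Bw j t w) else 0)
      \<le> 3 * (real dd * Lam * g0 + real dd * Lam * g0)"
    by (rule an_sum3[OF X3])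
  have "an (R1 t w l j) \<le> nu + 3 * (real dd * Lam * g0) + 3 * (real dd * Lam * g0 + real dd * Lam * g0)"
    unfolding R1_def by (rule order_trans[OF an_triangle add_mono[OF X2 X4]])
  thus ?thesis by (simp add: mult_ac)
qed

lemma an_R2: "p \<in> P2 \<Longrightarrow> an (R2 t w l p) \<le> 6 * real dd * g0^2"
proof -
  assume p: "p \<in> P2"
  hence j: "fst p \<in> Jset" "snd p \<in> Jset" by (auto simp: P2_def)
  have a: "an (dv k (Bw (fst p) t w * Bw (snd p) t w)) \<le> 2 * (real dd * g0^2)" for k
  proof -
    have "an (dv k (Bw (fst p) t w * Bw (snd p) t w)) \<le> real (dd + dd) * an (Bw (fst p) t w * Bw (snd p) t w)"
      by (intro an_dv dg_mult dg_Bw)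
    also have "... \<le> real (dd + dd) * (g0 * g0)"
      by (intro mult_left_mono order_trans[OF an_mult mult_mono] an_Bw j) (auto simp: g0_nonneg)
    finally show ?thesis by (simp add: power2_eq_square algebra_simps)
  qed
  have "an (R2 t w l p) \<le> 3 * (2 * (real dd * g0^2))"
    unfolding R2_def using a by (intro an_if an_sum3) auto
  thus ?thesis by simp
qed

abbreviation nF :: "real \<Rightarrow> 'a \<Rightarrow> tvec" where
  "nF t w \<equiv> newF \<alpha> (\<lambda>m. u m t w) (wd t w) (wt t w) (wc t w) (hi t w)"

text \<open>In this order: the switching error in the sup norm, its commutator, transport and
  self-interaction after the gain 2/lam, and the dissipation.\<close>

definition errF :: real where
  "errF = 48 * om * sqrt K / real lam + 128 * real dd * om * g0 / (real lam)^2
    + 2 * (4 * nu + 36 * real dd * Lam * g0 + 96 * real dd * g0^2) / real lam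
    + (real lam / 2) powr (2 * \<alpha> - 1) * (16 * g0)"

lemma sn_sum_bound:
  assumes "\<And>i. i \<in> A \<Longrightarrow> sn b (f i)" shows "sn (real (card A) * b) (sum f A)"
  unfolding sn_def
proof
  fix x
  have "cmod (ev (sum f A) x) \<le> (\<Sum>i\<in>A. cmod (ev (f i) x))" by (simp add: norm_sum)
  also have "... \<le> of_nat (card A) * b" using assms by (intro sum_bounded_above) (auto simp: sn_def)
  finally show "cmod (ev (sum f A) x) \<le> real (card A) * b" by simp
qed

text \<open>\<open>sn_iv_shift\<close> uses \<open>sn_Mw\<close> for the main term, while the volume
  factor in \<open>an_Mw\<close> is accompanied by the second power of 1/lam.\<close>

lemma sn_iv_Mw:
  assumes j: "j \<in> Jset"
  shows "sn (12 * om * sqrt K / real lam + 32 * real dd * om * g0 / (real lam)^2) (iv m (Mw j t w * X j))"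
proof -
  have P: "real lam \<le> \<bar>real_of_int (j * int lam)\<bar>"
  proof -
    have "1 * real lam \<le> real_of_int \<bar>j\<bar> * real lam" using Jset_abs[OF j] by (intro mult_right_mono) auto
    thus ?thesis by (simp add: abs_mult)
  qed
  have P2: "(real lam)^2 \<le> (real_of_int (j * int lam))^2"
    using power_mono[OF P, of 2] by simp
  have lz: "real lam > 0" using lam by simp
  have "sn (12 * om * sqrt K / \<bar>real_of_int (j * int lam)\<bar> + 16 * real dd / (real_of_int (j * int lam))^2 * an (Mw j t w))
     (iv m (sg (pj c lam j) 1 * Mw j t w))"
  proof (rule sn_iv_shift[OF pj_def dg_Mw])
    show "2 * int dd \<le> \<bar>j * int lam\<bar>" using P lam_dd(3) by linarith
    show "j * int lam \<noteq> 0" using Jset_nz[OF j] lam by simp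
  qed (rule sn_Mw[OF j])
  moreover have "12 * om * sqrt K / \<bar>real_of_int (j * int lam)\<bar> \<le> 12 * om * sqrt K / real lam"
    using P lz om K by (intro divide_left_mono mult_pos_pos) auto
  moreover have "16 * real dd / (real_of_int (j * int lam))^2 * an (Mw j t w) \<le> 16 * real dd / (real lam)^2 * (2 * om * g0)"
  proof -
    have "0 < (real lam)^2" using lz by simp
    hence "0 < (real_of_int (j * int lam))^2" using P2 by linarith
    thus ?thesis using P2 lz an_Mw[OF j]
      by (intro mult_mono divide_left_mono mult_pos_pos) auto
  qed
  ultimately have "sn (12 * om * sqrt K / real lam + 16 * real dd / (real lam)^2 * (2 * om * g0)) (iv m (sg (pj c lam j) 1 * Mw j t w))"
    by (elim sn_mono) linarith
  thus ?thesis by (simp add: mult.commute mult.assoc mult.left_commute)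
qed

lemma sn_iv_nF: "sn errF (iv m (nF t w l))"
proof -
  let ?I = "inc a0 b0 l"
  let ?M = "\<Sum>j\<in>Jset. iv m ((if ?I then Mw j t w else 0) * X j)"
  let ?R = "(\<Sum>j\<in>Jset. R1 t w l j * X j) + (\<Sum>p\<in>P2. R2 t w l p * X (fst p + snd p))"
  let ?b = "12 * om * sqrt K / real lam + 32 * real dd * om * g0 / (real lam)^2"
  have e: "iv m (nF t w l) = ?M + iv m ?R + iv m (mulp (lsym \<alpha>) (wt t w l + wc t w l))"
    by (simp add: newF_eq mulp_add mulp_sum distrib_right sum.distrib add.assoc)
  have "sn (real (card Jset) * ?b) ?M"
  proof (rule sn_sum_bound)
    fix j assume j: "j \<in> Jset"
    have "0 \<le> ?b" using om K g0_nonneg by auto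
    thus "sn ?b (iv m ((if ?I then Mw j t w else 0) * X j))"
      using sn_iv_Mw[OF j, of m t w] by (cases ?I) (auto simp: sn_def)
  qed
  hence 1: "sn (4 * ?b) ?M" by (simp add: card_Jset)
  have lz: "0 < real lam / 2" using lam by simp
  have "hf (real lam / 2) ?R"
    using lam_dd by (intro hf_add hf_sum hf_mod[OF dg_R1] hf_mod[OF dg_R2]) (auto dest: Jset_nz simp: P2_def)
  from an_iv_high[OF lz this] have "an (iv m ?R) \<le> an ?R / (real lam / 2)" .
  also have "an ?R \<le> (\<Sum>j\<in>Jset. nu + 9 * real dd * Lam * g0) + (\<Sum>p\<in>P2. 6 * real dd * g0^2)"
    by (intro order_trans[OF an_triangle] add_mono order_trans[OF an_sum] sum_mono order_trans[OF an_mod] an_R1 an_R2)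
  also have "... \<le> 4 * (nu + 9 * real dd * Lam * g0) + 16 * (6 * real dd * g0^2)"
  proof (rule add_mono)
    show "(\<Sum>j\<in>Jset. nu + 9 * real dd * Lam * g0) \<le> 4 * (nu + 9 * real dd * Lam * g0)"
      by (simp add: card_Jset)
    have "(\<Sum>p\<in>P2. 6 * real dd * g0^2) = real (card P2) * (6 * real dd * g0^2)" by simp
    also have "... \<le> 16 * (6 * real dd * g0^2)" using card_P2 by (intro mult_right_mono) auto
    finally show "(\<Sum>p\<in>P2. 6 * real dd * g0^2) \<le> 16 * (6 * real dd * g0^2)" .
  qed
  finally have "an (iv m ?R) \<le> (4 * (nu + 9 * real dd * Lam * g0) + 16 * (6 * real dd * g0^2)) / (real lam / 2)"
    using lz by (simp add: divide_right_mono)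
  hence 2: "sn ((4 * (nu + 9 * real dd * Lam * g0) + 16 * (6 * real dd * g0^2)) / (real lam / 2)) (iv m ?R)"
    by (rule sn_an)
  have "an (iv m (mulp (lsym \<alpha>) (wt t w l + wc t w l))) \<le> (real lam / 2) powr (2 * \<alpha> - 1) * an (wt t w l + wc t w l)"
    by (intro an_ivl_high \<alpha> lz hf_add hf_wt hf_wc)
  also have "... \<le> (real lam / 2) powr (2 * \<alpha> - 1) * (16 * g0)"
    by (intro mult_left_mono an_w) auto
  finally have 3: "sn ((real lam / 2) powr (2 * \<alpha> - 1) * (16 * g0)) (iv m (mulp (lsym \<alpha>) (wt t w l + wc t w l)))"
    by (rule sn_an)
  show ?thesis unfolding e
    by (rule sn_mono[OF sn_add[OF sn_add[OF 1 2] 3]]) (simp add: errF_def algebra_simps)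
qed

lemma rl_psi: "rl (psi t w)"
proof -
  have c: "cnj (ev (Bw j t w * X j) x) = ev (Bw (- j) t w * X (- j)) x" for j x
  proof -
    have "pj c lam (- j) = - pj c lam j" by (simp add: pj_def vec_eq_iff)
    thus ?thesis by (simp add: ev_Bw_uminus cis_cnj)
  qed
  have "cn (psi t w) = psi t w"
  proof (rule ev_eqI)
    fix x
    have "ev (cn (psi t w)) x = (\<Sum>j\<in>Jset. ev (Bw (- j) t w * X (- j)) x)"
      by (simp only: ev_cn psi_def ev_sum cnj_sum c)
    also have "... = (\<Sum>j\<in>Jset. ev (Bw j t w * X j) x)"
      by (rule sum.reindex_bij_witness[of _ uminus uminus]) (auto dest: Jset_uminus)
    finally show "ev (cn (psi t w)) x = ev (psi t w) x" by (simp only: psi_def ev_sum)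
  qed
  thus ?thesis by (simp add: rl_iff_cn)
qed

lemma rl_psid: "rl (psid t w)"
proof -
  have c: "cnj (ev (Bd j t w * X j) x) = ev (Bd (- j) t w * X (- j)) x" for j x
  proof -
    have "pj c lam (- j) = - pj c lam j" by (simp add: pj_def vec_eq_iff)
    thus ?thesis by (simp add: ev_Bd_uminus cis_cnj)
  qed
  have "cn (psid t w) = psid t w"
  proof (rule ev_eqI)
    fix x
    have "ev (cn (psid t w)) x = (\<Sum>j\<in>Jset. ev (Bd (- j) t w * X (- j)) x)"
      by (simp only: ev_cn psid_def ev_sum cnj_sum c)
    also have "... = (\<Sum>j\<in>Jset. ev (Bd j t w * X j) x)"
      by (rule sum.reindex_bij_witness[of _ uminus uminus]) (auto dest: Jset_uminus)
    finally show "ev (cn (psid t w)) x = ev (psid t w) x" by (simp only: psid_def ev_sum)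
  qed
  thus ?thesis by (simp add: rl_iff_cn)
qed

lemma rl_low: "rl (low t w)"
  unfolding rl_def low_def ev_sum ev_mult ev_Bw_uminus by (simp add: complex_mult_cnj)

end

subsection \<open>Weighted sums over the frequency lattice\<close>

lemma inv_square_sum_bound: "\<exists>C. \<forall>D. (\<Sum>j\<in>{- int D..int D}. (1 + (real_of_int j)^2) powr (-7/12)) \<le> C"
proof -
  define f where "f j = (1 + (real_of_int j)^2) powr (-7/12)" for j
  have "summable (\<lambda>n. real n powr (-7/6))" by (simp add: summable_real_powr_iff)
  then obtain S where S: "\<And>N. (\<Sum>n<N. real n powr (-7/6)) \<le> S"
    by (meson powr_ge_zero sum_le_suminf finite_lessThan)
  have f: "f (int n) \<le> real n powr (-7/6)" "f (- int n) \<le> real n powr (-7/6)" if "n \<ge> 1" for n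
  proof -
    have "(1 + (real n)^2) powr (-7/12) \<le> ((real n)^2) powr (-7/12)"
      using that by (intro powr_mono2') auto
    also have "((real n)^2) powr (-7/12) = real n powr (-7/6)"
    proof -
      have "(real n)^2 = real n powr 2" using that by simp
      thus ?thesis by (simp only: powr_powr) simp
    qed
    finally show "f (int n) \<le> real n powr (-7/6)" "f (- int n) \<le> real n powr (-7/6)" by (simp_all add: f_def)
  qed
  have "(\<Sum>j\<in>{- int D..int D}. f j) \<le> 1 + 2 * S" for D
  proof -
    have "{- int D..int D} = insert 0 (int ` {1..D} \<union> (\<lambda>n. - int n) ` {1..D})" (is "_ = ?R")
    proof (intro set_eqI iffI)
      fix j assume j: "j \<in> {- int D..int D}"
      show "j \<in> ?R"
      proof (cases j "0::int" rule: linorder_cases)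
        case less
        hence "j = - int (nat (- j))" "nat (- j) \<in> {1..D}" using j by auto
        thus ?thesis by blast
      next
        case greater
        hence "j = int (nat j)" "nat j \<in> {1..D}" using j by auto
        thus ?thesis by blast
      qed simp
    qed auto
    hence "(\<Sum>j\<in>{- int D..int D}. f j) \<le> f 0 + ((\<Sum>n\<in>{1..D}. f (int n)) + (\<Sum>n\<in>{1..D}. f (- int n)))"
      by (simp only:) (subst sum.insert; (subst sum.union_disjoint)?; auto simp: sum.reindex inj_on_def)
    also have "... \<le> 1 + ((\<Sum>n\<in>{1..D}. real n powr (-7/6)) + (\<Sum>n\<in>{1..D}. real n powr (-7/6)))"
      using f by (intro add_mono sum_mono) (auto simp: f_def)
    also have "(\<Sum>n\<in>{1..D}. real n powr (-7/6)) \<le> (\<Sum>n<Suc D. real n powr (-7/6))"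
      by (intro sum_mono2) auto
    finally show ?thesis using S[of "Suc D"] by linarith
  qed
  thus ?thesis unfolding f_def by blast
qed

lemma exists_kbox: "finite A \<Longrightarrow> \<exists>D. A \<subseteq> kbox D"
proof (induction A rule: finite_induct)
  case (insert x A)
  then obtain D where D: "A \<subseteq> kbox D" by blast
  obtain E where "dg E (sg x 1)" using exists_dg by blast
  hence "x \<in> kbox E" by (simp add: dg_def)
  hence "insert x A \<subseteq> kbox (max D E)"
    using D kbox_mono[of D "max D E"] kbox_mono[of E "max D E"] by auto
  thus ?case by blast
qed simp

text \<open>The exponent 7/4 exceeds 3/2. As 7/4 = 3 * 7/12 it can be split over the three
  coordinates, and each factor is a one-dimensional sum that decays like n^(-7/6).\<close>

lemma lattice_sum_bound: "\<exists>C. 0 \<le> C \<and> (\<forall>A. finite A \<longrightarrow> (\<Sum>k\<in>A. jb k powr (-7/4)) \<le> C)"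
proof -
  obtain C0 where C0: "\<And>D. (\<Sum>j\<in>{- int D..int D}. (1 + (real_of_int j)^2) powr (-7/12)) \<le> C0"
    using inv_square_sum_bound by blast
  define f where "f j = (1 + (real_of_int j)^2) powr (-7/12)" for j
  have f0: "0 \<le> f j" for j by (simp add: f_def)
  have C00: "0 \<le> C0" using C0[of 0] f0[of 0] by (simp add: f_def)
  have pt: "jb k powr (-7/4) \<le> (\<Prod>i\<in>UNIV. f (k $ i))" for k
  proof -
    have e: "jb k powr (-7/4) = (\<Prod>i\<in>(UNIV::3 set). jb k powr (-7/12))"
    proof -
      have "(\<Prod>i\<in>(UNIV::3 set). jb k powr (-7/12)) = (jb k powr (-7/12)) powr 3"
        by (subst powr_numeral) (auto simp: add_pos_nonneg)
      thus ?thesis by (simp add: powr_powr)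
    qed
    show ?thesis unfolding e f_def
      by (intro prod_mono conjI powr_mono2') (auto simp: knorm2_ge add_pos_nonneg)
  qed
  have box: "(\<Sum>k\<in>kbox D. jb k powr (-7/4)) \<le> C0^3" for D
  proof -
    have "(\<Sum>k\<in>kbox D. jb k powr (-7/4)) \<le> (\<Sum>k\<in>kbox D. \<Prod>i\<in>UNIV. f (k $ i))"
      by (intro sum_mono pt)
    also have "... = (\<Sum>h\<in>PiE UNIV (\<lambda>_. {- int D..int D}). \<Prod>i\<in>(UNIV::3 set). f (h i))"
      unfolding kbox_image by (subst sum.reindex) (auto simp: inj_on_def vec_lambda_inject)
    also have "... = (\<Prod>i\<in>(UNIV::3 set). \<Sum>j\<in>{- int D..int D}. f j)"
      by (rule prod_sum_PiE[symmetric]) auto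
    also have "... = (\<Sum>j\<in>{- int D..int D}. f j)^3" by simp
    also have "... \<le> C0^3" using C0[of D] by (intro power_mono sum_nonneg f0) (simp add: f_def)
    finally show ?thesis .
  qed
  have "(\<Sum>k\<in>A. jb k powr (-7/4)) \<le> C0^3" if fin: "finite A" for A
  proof -
    obtain D where "A \<subseteq> kbox D" using exists_kbox[OF fin] by blast
    hence "(\<Sum>k\<in>A. jb k powr (-7/4)) \<le> (\<Sum>k\<in>kbox D. jb k powr (-7/4))"
      by (intro sum_mono2 finite_kbox) auto
    thus ?thesis using box[of D] by linarith
  qed
  thus ?thesis using C00 by (intro exI[of _ "C0^3"]) auto
qed

definition Clat :: real where
  "Clat = (SOME C. 0 \<le> C \<and> (\<forall>A. finite A \<longrightarrow> (\<Sum>k\<in>A. jb k powr (-7/4)) \<le> C))"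

lemma Clat: "0 \<le> Clat" "finite A \<Longrightarrow> (\<Sum>k\<in>A. jb k powr (-7/4)) \<le> Clat"
  using someI_ex[OF lattice_sum_bound] unfolding Clat_def[symmetric] by auto

text \<open>Cauchy-Schwarz against the H^2 weight: (1+|k|^2)^(-2) is the summable power -7/4 times a
  power -1/4, which gives smallness on high frequencies.\<close>

lemma l1_bound:
  fixes c :: "freq \<Rightarrow> complex^3"
  assumes A: "finite A" "wS A c \<le> M^2" "0 \<le> M"
    and th: "\<And>k. k \<in> A \<Longrightarrow> jb k powr (-1/4) \<le> th^2" "0 \<le> th"
  shows "(\<Sum>k\<in>A. cmod (c k $ m)) \<le> M * sqrt Clat * th"
proof -
  define W where "W k = 1 + knorm2 k" for k
  have W: "0 < W k" for k by (simp add: W_def add_pos_nonneg)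
  have "(\<Sum>k\<in>A. cmod (c k $ m)) \<le> (\<Sum>k\<in>A. \<bar>W k * norm (c k)\<bar> * \<bar>1 / W k\<bar>)"
  proof (rule sum_mono)
    fix k
    have "cmod (c k $ m) \<le> norm (c k)" by (rule Finite_Cartesian_Product.norm_nth_le)
    thus "cmod (c k $ m) \<le> \<bar>W k * norm (c k)\<bar> * \<bar>1 / W k\<bar>" using W[of k] by (simp add: abs_mult)
  qed
  also have "... \<le> L2_set (\<lambda>k. W k * norm (c k)) A * L2_set (\<lambda>k. 1 / W k) A"
    by (rule L2_set_mult_ineq)
  also have "... \<le> M * (sqrt Clat * th)"
  proof (intro mult_mono)
    show "L2_set (\<lambda>k. W k * norm (c k)) A \<le> M"
      unfolding L2_set_def using A by (intro real_le_lsqrt) (auto simp: W_def power_mult_distrib intro!: sum_nonneg)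
    have "(1 / W k)^2 \<le> th^2 * W k powr (-7/4)" if "k \<in> A" for k
    proof -
      have "(1 / W k)^2 = W k powr (-2)"
        using W[of k] by (simp add: powr_minus powr_numeral power_divide field_simps)
      also have "... = W k powr (-1/4) * W k powr (-7/4)" by (simp flip: powr_add)
      also have "... \<le> th^2 * W k powr (-7/4)" using th(1)[OF that] by (intro mult_right_mono) (auto simp: W_def)
      finally show ?thesis .
    qed
    hence "(\<Sum>k\<in>A. (1 / W k)^2) \<le> (\<Sum>k\<in>A. th^2 * W k powr (-7/4))" by (intro sum_mono)
    also have "... \<le> th^2 * Clat"
      unfolding sum_distrib_left[symmetric] using Clat(2)[OF A(1)] by (intro mult_left_mono) (auto simp: W_def)
    finally have "L2_set (\<lambda>k. 1 / W k) A \<le> sqrt (th^2 * Clat)" unfolding L2_set_def by (rule real_sqrt_le_mono)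
    also have "... = sqrt Clat * th" using th(2) by (simp add: real_sqrt_mult)
    finally show "L2_set (\<lambda>k. 1 / W k) A \<le> sqrt Clat * th" .
  qed (use A Clat th in auto)
  finally show ?thesis by simp
qed

lemma wt_le_one: "jb k powr - (1/4) \<le> 1"
proof -
  have "jb k powr (-1/4) \<le> 1 powr (-1/4)" by (intro powr_mono2') auto
  thus ?thesis by simp
qed

subsection \<open>The driving path and approximate solutions\<close>

text \<open>All that the construction sees of the noise: a divergence-free path, zero up to time 0,
  with deterministic H^2 bounds for every \<open>w\<close>. Finite sets A stand in for the sum over
  all modes.\<close>

locale noise = filt F for F :: "real \<Rightarrow> 'a measure" +
  fixes b :: "real \<Rightarrow> 'a \<Rightarrow> field" and Lb \<alpha> :: real
  assumes b_neg: "t \<le> 0 \<Longrightarrow> b t w = 0"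
    and b_meas: "(\<lambda>w. b t w k $ m) \<in> borel_measurable (F t)"
    and b_herm: "b t w (- k) $ m = cnj (b t w k $ m)"
    and b_div: "(\<Sum>m\<in>UNIV. of_int (k $ m) * b t w k $ m) = 0"
    and b_bd: "finite A \<Longrightarrow> wS A (b t w) \<le> Lb^2"
    and b_hold: "finite A \<Longrightarrow> wS A (\<lambda>k. b t w k - b s w k) \<le> (Lb * \<bar>t - s\<bar> powr (1/8))^2"
    and Lb: "0 \<le> Lb" and \<alpha>: "0 < \<alpha>" "\<alpha> < 1/2"
begin

definition bt :: "nat \<Rightarrow> 3 \<Rightarrow> 'a proc" where
  "bt N m t w = (\<Sum>k\<in>kbox N. sg k (b t w k $ m))"

definition Cb :: real where "Cb = Lb * sqrt Clat"

lemma Cb_nonneg: "0 \<le> Cb" using Lb Clat by (simp add: Cb_def)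

lemma lk_bt: "lk (bt N m t w) k = (if k \<in> kbox N then b t w k $ m else 0)"
  using finite_kbox by (simp add: bt_def lookup_sum lookup_single when_def)

lemma dg_bt: "dg N (bt N m t w)"
  unfolding bt_def by (intro dg_sum dg_single)

lemma an_le_coeffs:
  assumes "finite A" "\<And>k. k \<notin> A \<Longrightarrow> lk f k = 0"
  shows "an f = (\<Sum>k\<in>A. cmod (lk f k))"
  using assms by (intro an_superset) (auto simp: in_keys_iff)

lemma an_bt: "an (bt N m t w) \<le> Cb"
proof -
  have "an (bt N m t w) = (\<Sum>k\<in>kbox N. cmod (b t w k $ m))"
    using finite_kbox by (subst an_le_coeffs[of "kbox N"]) (auto simp: lk_bt)
  also have "... \<le> Lb * sqrt Clat * 1"
    using finite_kbox b_bd Lb by (intro l1_bound) (auto intro: wt_le_one)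
  finally show ?thesis by (simp add: Cb_def)
qed

lemma hold_bt: "an (bt N m t w - bt N m s w) \<le> Cb * \<bar>t - s\<bar> powr (1/8)"
proof -
  have "an (bt N m t w - bt N m s w) = (\<Sum>k\<in>kbox N. cmod ((b t w k - b s w k) $ m))"
    using finite_kbox by (subst an_le_coeffs[of "kbox N"]) (auto simp: lk_bt lookup_minus)
  also have "... \<le> (Lb * \<bar>t - s\<bar> powr (1/8)) * sqrt Clat * 1"
    using finite_kbox b_hold Lb by (intro l1_bound) (auto intro: wt_le_one)
  finally show ?thesis by (simp add: Cb_def mult_ac)
qed

lemma ad_bt: "ad (bt N m)"
  unfolding ad_def lk_bt using b_meas by auto

lemma gp_bt: "gp Cb N (bt N m)"
  unfolding gp_def using dg_bt an_bt hold_bt ad_bt by auto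

text \<open>Outside the box |k| >= N, so the spare power -1/4 in \<open>l1_bound\<close> yields th =
  N^(-1/4). For N = L^12 this is L^(-3).\<close>

lemma an_bt_tail:
  assumes "N \<le> N'" "1 \<le> N"
  shows "an (bt N' m t w - bt N m t w) \<le> Cb * real N powr (-1/4)"
proof -
  let ?A = "kbox N' - kbox N"
  have "an (bt N' m t w - bt N m t w) = (\<Sum>k\<in>?A. cmod (b t w k $ m))"
    using finite_kbox kbox_mono[OF assms(1)]
    by (subst an_le_coeffs[of ?A]) (auto simp: lk_bt lookup_minus)
  also have "... \<le> Lb * sqrt Clat * (real N powr (-1/4))"
  proof (rule l1_bound)
    fix k assume k: "k \<in> ?A"
    then obtain i where "\<not> \<bar>k $ i\<bar> \<le> int N" by (auto simp: kbox_def)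
    hence "real N \<le> \<bar>real_of_int (k $ i)\<bar>" by linarith
    hence "(real N)^2 \<le> \<bar>real_of_int (k $ i)\<bar>^2" by (intro power_mono) auto
    hence "(real N)^2 \<le> 1 + knorm2 k" using knorm2_ge[of k i] by simp
    hence "jb k powr (-1/4) \<le> ((real N)^2) powr (-1/4)"
      using assms(2) by (intro powr_mono2') auto
    also have "... = (real N powr (-1/4))^2"
    proof -
      have "(real N)^2 = real N powr 2" using assms(2) by simp
      hence "((real N)^2) powr (-1/4) = real N powr (-1/4 + -1/4)" by (simp only: powr_powr) simp
      thus ?thesis unfolding powr_add by (simp add: power2_eq_square)
    qed
    finally show "jb k powr (-1/4) \<le> (real N powr (-1/4))^2" .
  qed (use finite_kbox b_bd Lb in auto)
  finally show ?thesis by (simp add: Cb_def)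
qed

lemma rl_bt: "rl (bt N m t w)"
  unfolding rl_iff_cn
  by (rule poly_mapping_eqI) (simp add: lk_bt b_herm kbox_def)

lemma div_bt: "(\<Sum>l\<in>UNIV. dv l (bt N l t w)) = 0"
proof (rule poly_mapping_eqI)
  fix k
  have "lk (\<Sum>l\<in>UNIV. dv l (bt N l t w)) k = (if k \<in> kbox N then \<i> * (\<Sum>l\<in>UNIV. of_int (k $ l) * b t w k $ l) else 0)"
    by (simp add: lookup_sum lk_bt dsym_def sum_distrib_left mult.assoc)
  thus "lk (\<Sum>l\<in>UNIV. dv l (bt N l t w)) k = lk 0 k" by (simp add: b_div)
qed

text \<open>Testing with \<open>e\<close> orthogonal to \<open>n\<close> means that the equation holds modulo gradients.\<close>

definition st :: "nat \<Rightarrow> (3 \<Rightarrow> 'a proc) \<Rightarrow> (3 \<Rightarrow> 3 \<Rightarrow> 'a proc) \<Rightarrow> bool" where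
  "st L u r \<longleftrightarrow> (\<forall>m. gp (real L) (L^13) (u m)) \<and> (\<forall>m t w. rl (u m t w))
     \<and> (\<forall>a b. gp (real L) (L^13) (r a b)) \<and> (\<forall>a b t w. rl (r a b t w))
     \<and> (\<forall>t w. (\<Sum>l\<in>UNIV. dv l (u l t w)) = 0)
     \<and> (\<forall>w n e t. (\<Sum>m\<in>UNIV. e m * of_int (n $ m)) = 0 \<longrightarrow> 0 \<le> t \<longrightarrow>
        ((\<lambda>s. \<Sum>m\<in>UNIV. e m * lk (rhs \<alpha> (\<lambda>m. u m s w) (\<lambda>a b. r a b s w) m) n) has_integral
          (\<Sum>m\<in>UNIV. e m * (lk (u m t w) n - lk (u m 0 w) n - lk (bt (L^12) m t w) n))) {0..t})"

end

subsection \<open>Size of the new stress\<close>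

context filt
begin

lemma gp_iv: "gp C D f \<Longrightarrow> gp C D (\<lambda>t w. iv m (f t w))"
  using gp_mulp[of C D f "isym m" 1] isym_bound1 by simp

lemma gp_dv: "gp C D f \<Longrightarrow> gp (real D * C) D (\<lambda>t w. dv l (f t w))"
  using gp_mulp[of C D f "dsym l" "real D"] dsym_bound by simp

lemma gp_lsym:
  assumes "gp C D f" "0 < \<alpha>" "\<alpha> < 1/2"
  shows "gp (2 * real D * C) D (\<lambda>t w. mulp (lsym \<alpha>) (f t w))"
proof (rule gp_mulp[OF assms(1)])
  fix k assume k: "k \<in> kbox D"
  show "cmod (lsym \<alpha> k) \<le> 2 * real D"
  proof (cases "k = 0")
    case False
    have 1: "1 \<le> knorm2 k" by (rule knorm2_ge_one[OF False])
    have "cmod (lsym \<alpha> k) = knorm2 k powr \<alpha>" by (simp add: lsym_def)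
    also have "... \<le> knorm2 k powr (1/2)" using 1 assms by (intro powr_mono) auto
    also have "... = sqrt (knorm2 k)" using 1 by (simp add: powr_half_sqrt)
    also have "... \<le> 2 * real D"
      by (intro real_le_lsqrt) (auto simp: power_mult_distrib intro: order_trans[OF knorm2_le[OF k]])
    finally show ?thesis .
  qed (simp add: lsym_def)
qed simp

lemma gp_ivl:
  assumes "gp C D f" "0 < \<alpha>" "\<alpha> < 1/2"
  shows "gp C D (\<lambda>t w. iv m (mulp (lsym \<alpha>) (f t w)))"
proof -
  have e: "iv m (mulp (lsym \<alpha>) p) = mulp (\<lambda>k. isym m k * lsym \<alpha> k) p" for p by (rule poly_mapping_eqI) simp
  show ?thesis unfolding e using gp_mulp[OF assms(1), of "\<lambda>k. isym m k * lsym \<alpha> k" 1] ilsym_bound1[OF assms(2,3)] by simp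
qed

lemma gp_zero: "0 \<le> C \<Longrightarrow> gp C D (\<lambda>t w. 0)" by (rule gp_const) auto

lemma gp_if: "0 \<le> C \<Longrightarrow> (P \<Longrightarrow> gp C D f) \<Longrightarrow> gp C D (\<lambda>t w. if P then f t w else 0)"
  by (cases P) (auto intro: gp_zero)

lemma gp_sum3: "(\<And>k::3. gp C D (f k)) \<Longrightarrow> gp (3 * C) D (\<lambda>t w. \<Sum>k\<in>UNIV. f k t w)"
  using gp_sum[of "UNIV :: 3 set" "\<lambda>_. C" D f] by simp

lemma gp_dec:
  assumes "\<And>m l. gp C D (\<lambda>t w. S t w m l)"
  shows "gp (5 * C) D (\<lambda>t w. dec (S t w) a b)"
proof (cases "a = b")
  case True
  have "gp (2 * C + 3 * C) D (\<lambda>t w. cst 2 * S t w a a - (\<Sum>l\<in>UNIV. S t w a l))"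
    using gp_cst_mult[OF assms, of 2 a a] by (intro gp_diff gp_sum3 assms) simp
  thus ?thesis using True by (simp add: dec_def)
next
  case False
  have "gp (cmod (1/2) * C) D (\<lambda>t w. cst (1/2) * S t w a b)" by (rule gp_cst_mult[OF assms])
  hence "gp (5 * C) D (\<lambda>t w. cst (1/2) * S t w a b)"
    by (rule gp_mono) (use gp_nonneg[OF assms] in \<open>auto simp: norm_divide\<close>)
  thus ?thesis using False by (simp add: dec_def)
qed

end

text \<open>From here on sizes are compared with powers of \<open>lam\<close> alone. The largest
  exponent that occurs is 13, and \<open>lam^13\<close> becomes the parameter of the next
  stage.\<close>

locale stepn = step F uc rr Lam K om D lam n J u a0 b0 c \<alpha> + noise F b Lb \<alpha>
  for F :: "real \<Rightarrow> 'a measure" and uc rr Lam K om D lam n J u a0 b0 c \<alpha> b Lb +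
  fixes r :: "3 \<Rightarrow> 3 \<Rightarrow> 'a proc" and L N' E :: nat
  assumes st: "st L u r" and Lam: "Lam = real L" and rr_r: "rr = r a0 b0"
    and gB: "gB \<le> (real lam)^2" "gBd \<le> (real lam)^4"
    and big: "Lam \<le> real lam" "Cb \<le> real lam" "K \<le> real lam" "1000 \<le> lam"
    and E: "L^12 \<le> N'" "N' \<le> E" "6 * lam \<le> E" "L^13 \<le> lam" "D = L^13"
begin

abbreviation "x \<equiv> real lam"

text \<open>One spare power of \<open>lam\<close> absorbs the numerical constants of the following
  bounds.\<close>

lemma pw1: "1000 * x^j \<le> x^(Suc j)" using big(4) by (simp add: mult_right_mono)
lemma pwm: "i \<le> j \<Longrightarrow> x^i \<le> x^j" using big(4) by (intro power_increasing) auto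
lemma x0: "0 \<le> x^j" by simp
lemma px1: "1 \<le> j \<Longrightarrow> x \<le> x^j" using pwm[of 1 j] by simp

definition \<zeta> :: "3 \<Rightarrow> 'a proc" where "\<zeta> m t w = bt N' m t w - bt (L^12) m t w"
definition u' :: "3 \<Rightarrow> 'a proc" where "u' m t w = u m t w + wt t w m + wc t w m + \<zeta> m t w"
definition F' :: "real \<Rightarrow> 'a \<Rightarrow> tvec" where "F' t w l = nF t w l + mulp (lsym \<alpha>) (\<zeta> l t w)"
definition S' :: "real \<Rightarrow> 'a \<Rightarrow> tmat" where
  "S' t w = newS (\<lambda>m. u m t w) (wt t w) (wc t w) (\<lambda>m. \<zeta> m t w)"
definition r' :: "3 \<Rightarrow> 3 \<Rightarrow> 'a proc" where
  "r' p q t w = newr (\<lambda>p q. r p q t w) a0 b0 (low t w - cst (of_real K)) (S' t w) (F' t w) p q"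

lemma gp_X: "j \<in> Jset \<Longrightarrow> gp 1 (2 * lam) (\<lambda>t w. X j)"
proof (rule gp_const)
  assume j: "j \<in> Jset"
  show "dg (2 * lam) (X j)"
  proof (rule dg_single)
    have "\<bar>j\<bar> * int lam \<le> 2 * int lam" using Jset_abs[OF j] by (intro mult_right_mono) auto
    thus "pj c lam j \<in> kbox (2 * lam)" by (auto simp: kbox_def pj_def abs_mult)
  qed
qed simp

lemma gp_psi: "gp (x^3) (3 * lam) psi"
proof -
  have "gp (\<Sum>j\<in>Jset. 2 * gB * 1) (dd + 2 * lam) psi"
    unfolding psi_def[abs_def] by (intro gp_sum gp_mult gp_Bw gp_X) auto
  thus ?thesis
  proof (rule gp_mono)
    have "(\<Sum>j\<in>Jset. 2 * gB * 1) = 8 * gB" by (simp add: card_Jset)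
    moreover have "1000 * x^2 \<le> x^3" using pw1[of 2] by simp
    ultimately show "(\<Sum>j\<in>Jset. 2 * gB * 1) \<le> x^3" using gB(1) x0[of 2] by linarith
  qed (use lam_dd in simp)
qed

lemma gp_psid: "gp (x^5) (3 * lam) psid"
proof -
  have "gp (\<Sum>j\<in>Jset. 2 * gBd * 1) (dd + 2 * lam) psid"
    unfolding psid_def[abs_def] by (intro gp_sum gp_mult gp_Bd gp_X) auto
  thus ?thesis
  proof (rule gp_mono)
    have "(\<Sum>j\<in>Jset. 2 * gBd * 1) = 8 * gBd" by (simp add: card_Jset)
    moreover have "1000 * x^4 \<le> x^5" using pw1[of 4] by simp
    ultimately show "(\<Sum>j\<in>Jset. 2 * gBd * 1) \<le> x^5" using gB(2) x0[of 4] by linarith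
  qed (use lam_dd in simp)
qed

lemma gp_wt: "gp (x^3) (3 * lam) (\<lambda>t w. wt t w m)" unfolding wt_def by (intro gp_if gp_psi) simp
lemma gp_wd: "gp (x^5) (3 * lam) (\<lambda>t w. wd t w m)" unfolding wd_def by (intro gp_if gp_psid) simp

lemma gp_divw: "gp (x^5) (3 * lam) divw"
proof -
  have "gp (3 * (real (3 * lam) * x^3)) (3 * lam) divw"
    unfolding divw_def[abs_def] by (intro gp_sum3 gp_dv gp_wt)
  thus ?thesis
  proof (rule gp_mono)
    have "3 * (real (3 * lam) * x^3) = 9 * x^4" by (simp add: power4_eq_xxxx power3_eq_cube)
    moreover have "1000 * x^4 \<le> x^5" using pw1[of 4] by simp
    ultimately show "3 * (real (3 * lam) * x^3) \<le> x^5" using x0[of 4] by linarith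
  qed simp
qed

lemma gp_wc: "gp (x^5) (3 * lam) (\<lambda>t w. wc t w m)"
  unfolding wc_def by (intro gp_uminus gp_iv gp_divw)

lemma gp_low: "gp (x^5) (6 * lam) low"
proof -
  have "gp (\<Sum>j\<in>Jset. 2 * gB * gB) (dd + dd) low"
    unfolding low_def[abs_def] by (intro gp_sum gp_mult gp_Bw Jset_uminus) auto
  thus ?thesis
  proof (rule gp_mono)
    have "gB * gB \<le> x^2 * x^2" using gB(1) gp_nonneg[OF gp_Bw[of 1]] by (intro mult_mono) (auto simp: Jset_def)
    also have "x^2 * x^2 = x^4" by (simp flip: power_add)
    finally have "gB * gB \<le> x^4" .
    moreover have "(\<Sum>j\<in>Jset. 2 * gB * gB) = 8 * (gB * gB)" by (simp add: card_Jset)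
    moreover have "1000 * x^4 \<le> x^5" using pw1[of 4] by simp
    ultimately show "(\<Sum>j\<in>Jset. 2 * gB * gB) \<le> x^5" using x0[of 4] by linarith
  qed (use lam_dd in simp)
qed

text \<open>Obtained as the full product minus \<open>low\<close>, which avoids a sum over
  \<open>P2\<close>.\<close>

lemma gp_hi: "gp (x^7) (6 * lam) (\<lambda>t w. hi t w m l)"
proof -
  have e: "hi t w m l = wt t w m * wt t w l - (if inc a0 b0 m \<and> inc a0 b0 l then low t w else 0)" for t w
    using wt_mult[of t w m l] by simp
  have "gp (2 * x^3 * x^3 + x^5) (6 * lam) (\<lambda>t w. hi t w m l)"
    unfolding e using gp_mult[OF gp_wt gp_wt, of m l] by (intro gp_diff gp_if gp_low) (auto simp: mult_2[symmetric] simp flip: distrib_right)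
  thus ?thesis
  proof (rule gp_mono)
    have "2 * x^3 * x^3 = 2 * x^6" by (simp flip: power_add)
    moreover have "1000 * x^6 \<le> x^7" using pw1[of 6] by simp
    moreover have "x^5 \<le> x^6" by (rule pwm) simp
    ultimately show "2 * x^3 * x^3 + x^5 \<le> x^7" using x0[of 6] by linarith
  qed simp
qed

lemma gp_u: "gp x lam (u m)"
  by (rule gp_mono[OF u(1)]) (use big E in auto)

lemma gp_nF: "gp (x^9) (6 * lam) (\<lambda>t w. nF t w l)"
proof -
  have p: "gp (4 * x^4) (4 * lam) (\<lambda>t w. u l t w * wt t w k + wt t w l * u k t w)" for k
  proof -
    have "gp (2 * x * x^3 + 2 * x^3 * x) (4 * lam) (\<lambda>t w. u l t w * wt t w k + wt t w l * u k t w)"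
      using gp_mult[OF gp_u gp_wt, of l k] gp_mult[OF gp_wt gp_u, of l k]
      by (intro gp_add) (simp_all add: add.commute)
    moreover have "2 * x * x^3 + 2 * x^3 * x = 4 * x^4" by (simp add: power4_eq_xxxx power3_eq_cube)
    ultimately show ?thesis by simp
  qed
  have 1: "gp (3 * (real (4 * lam) * (4 * x^4))) (4 * lam) (\<lambda>t w. \<Sum>k\<in>UNIV. dv k (u l t w * wt t w k + wt t w l * u k t w))"
    by (intro gp_sum3 gp_dv p)
  have 2: "gp (3 * (real (6 * lam) * x^7)) (6 * lam) (\<lambda>t w. \<Sum>k\<in>UNIV. dv k (hi t w l k))"
    by (intro gp_sum3 gp_dv gp_hi)
  have 3: "gp (2 * real (3 * lam) * (x^3 + x^5)) (3 * lam) (\<lambda>t w. mulp (lsym \<alpha>) (wt t w l + wc t w l))"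
    by (intro gp_lsym gp_add gp_wt gp_wc \<alpha>)
  have "gp (x^5 + 3 * (real (4 * lam) * (4 * x^4)) + 3 * (real (6 * lam) * x^7) + 2 * real (3 * lam) * (x^3 + x^5)) (6 * lam) (\<lambda>t w. nF t w l)"
    unfolding newF_def
    by (intro gp_add gp_mono[OF gp_wd] gp_mono[OF 1] gp_mono[OF 2] gp_mono[OF 3]) auto
  thus ?thesis
  proof (rule gp_mono)
    have "x^5 + 3 * (real (4 * lam) * (4 * x^4)) + 3 * (real (6 * lam) * x^7) + 2 * real (3 * lam) * (x^3 + x^5)
      = 49 * x^5 + 18 * x^8 + 6 * x^4 + 6 * x^6"
      by (simp add: algebra_simps eval_nat_numeral)
    moreover have "1000 * x^8 \<le> x^9" using pw1[of 8] by simp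
    moreover have "x^5 \<le> x^8" "x^4 \<le> x^8" "x^6 \<le> x^8" by (auto intro: pwm)
    ultimately show "x^5 + 3 * (real (4 * lam) * (4 * x^4)) + 3 * (real (6 * lam) * x^7) + 2 * real (3 * lam) * (x^3 + x^5) \<le> x^9"
      using x0[of 8] by linarith
  qed simp
qed

lemma gp_zeta: "gp (2 * x) N' (\<zeta> m)"
proof -
  have "gp (Cb + Cb) N' (\<zeta> m)" unfolding \<zeta>_def[abs_def]
    by (intro gp_diff gp_bt gp_mono[OF gp_bt]) (use E in auto)
  thus ?thesis by (rule gp_mono) (use big in auto)
qed

lemma gp_advF: "gp (x^10) E (\<lambda>t w. adv (F' t w) m l)"
proof -
  have p: "gp (x^9 + 2 * x) E (\<lambda>t w. iv m (F' t w l))" for m l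
  proof -
    have "gp (x^9 + 2 * x) E (\<lambda>t w. iv m (nF t w l) + iv m (mulp (lsym \<alpha>) (\<zeta> l t w)))"
      by (intro gp_add gp_mono[OF gp_iv[OF gp_nF]] gp_mono[OF gp_ivl[OF gp_zeta \<alpha>]]) (use E in auto)
    thus ?thesis by (simp add: F'_def mulp_add)
  qed
  have "gp ((x^9 + 2 * x) + (x^9 + 2 * x)) E (\<lambda>t w. adv (F' t w) m l)"
    unfolding adv_def by (intro gp_add p)
  thus ?thesis
  proof (rule gp_mono)
    have "1000 * x^9 \<le> x^10" using pw1[of 9] by simp
    thus "(x^9 + 2 * x) + (x^9 + 2 * x) \<le> x^10" using px1[of 9] x0[of 9] by linarith
  qed simp
qed

lemma gp_S: "gp (x^11) (2 * E) (\<lambda>t w. S' t w m l)"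
proof -
  have a: "gp (x^5) E (u m)" "gp (x^5) E (\<lambda>t w. wt t w m)" "gp (x^5) E (\<lambda>t w. wc t w m)" "gp (x^5) E (\<zeta> m)" for m
  proof -
    show "gp (x^5) E (u m)" by (rule gp_mono[OF gp_u]) (use pwm[of 1 5] E in auto)
    show "gp (x^5) E (\<lambda>t w. wt t w m)" by (rule gp_mono[OF gp_wt]) (use pwm[of 3 5] E in auto)
    show "gp (x^5) E (\<lambda>t w. wc t w m)" by (rule gp_mono[OF gp_wc]) (use E in auto)
    show "gp (x^5) E (\<zeta> m)"
    proof (rule gp_mono[OF gp_zeta])
      have "1000 * x \<le> x^2" using pw1[of 1] by (simp add: power2_eq_square)
      thus "2 * x \<le> x^5" using pwm[of 2 5] x0[of 1] by simp
    qed (use E in auto)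
  qed
  have s: "gp (x^5 + x^5 + x^5) E (\<lambda>t w. u m t w + wt t w m + wc t w m)" for m
    by (intro gp_add a)
  have pm: "gp (6 * x^10) (2 * E) (\<lambda>t w. f t w * g t w)"
    if "gp (x^5 + x^5 + x^5) E f" "gp (x^5) E g" for f g
  proof -
    have "gp (2 * (x^5 + x^5 + x^5) * x^5) (E + E) (\<lambda>t w. f t w * g t w)" using that by (rule gp_mult)
    moreover have "2 * (x^5 + x^5 + x^5) * x^5 = 6 * x^10"
    proof -
      have "x^10 = x^5 * x^5" by (simp flip: power_add)
      thus ?thesis by (simp only:) (simp add: algebra_simps)
    qed
    moreover have "E + E = 2 * E" by simp
    ultimately show ?thesis by (simp only:)
  qed
  have pm': "gp (6 * x^10) (2 * E) (\<lambda>t w. f t w * g t w)" if "gp (x^5) E f" "gp (x^5) E g" for f g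
    by (rule pm[OF gp_mono[OF that(1)] that(2)]) (auto simp: x0)
  have pm'': "gp (6 * x^10) (2 * E) (\<lambda>t w. g t w * f t w)"
    if "gp (x^5 + x^5 + x^5) E f" "gp (x^5) E g" for f g
    using pm[OF that] by (simp add: mult.commute)
  have "gp (6 * x^10 + 6 * x^10 + 6 * x^10 + 6 * x^10 + 6 * x^10 + 6 * x^10 + 6 * x^10 + 6 * x^10) (2 * E) (\<lambda>t w. S' t w m l)"
    unfolding S'_def newS_def
    by (rule gp_add[OF gp_add[OF gp_add[OF gp_add[OF gp_add[OF gp_add[OF gp_add[OF pm'[OF a(1) a(3)] pm'[OF a(3) a(1)]]
          pm'[OF a(2) a(3)]] pm'[OF a(3) a(2)]] pm'[OF a(3) a(3)]] pm[OF s a(4)]] pm''[OF s a(4)]] pm'[OF a(4) a(4)]])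
  thus ?thesis
  proof (rule gp_mono)
    have "1000 * x^10 \<le> x^11" using pw1[of 10] by simp
    thus "6 * x^10 + 6 * x^10 + 6 * x^10 + 6 * x^10 + 6 * x^10 + 6 * x^10 + 6 * x^10 + 6 * x^10 \<le> x^11"
      using x0[of 10] by linarith
  qed simp
qed

lemma gp_r: "gp x (2 * E) (r p q)"
  using st unfolding st_def by (elim conjE) (erule allE, erule allE, erule gp_mono; use Lam big E in simp)

lemma gp_r': "gp (x^13) (2 * E) (r' p q)"
proof -
  have 1: "gp (x^5 + x) (2 * E) (\<lambda>t w. low t w - cst (of_real K))"
    by (intro gp_diff gp_mono[OF gp_low] gp_const) (use E big K in auto)
  have "gp (x + (x^5 + x) + 5 * x^11 + 5 * x^10) (2 * E) (r' p q)"
    unfolding r'_def newr_def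
    by (intro gp_add gp_r gp_if 1 gp_dec gp_S gp_mono[OF gp_dec[OF gp_advF]]) (auto simp: add_nonneg_nonneg)
  thus ?thesis
  proof (rule gp_mono)
    have "1000 * x^11 \<le> x^12" using pw1[of 11] by simp
    moreover have "x^12 \<le> x^13" "x^5 \<le> x^11" "x^10 \<le> x^11" by (auto intro: pwm)
    moreover have "x \<le> x^11" by (rule px1) simp
    ultimately show "x + (x^5 + x) + 5 * x^11 + 5 * x^10 \<le> x^13" using x0[of 11] by linarith
  qed simp
qed

lemma gp_u': "gp (x^13) E (u' m)"
proof -
  have "gp (x + x^3 + x^5 + 2 * x) E (u' m)"
    unfolding u'_def[abs_def]
    by (intro gp_add gp_mono[OF gp_u] gp_mono[OF gp_wt] gp_mono[OF gp_wc] gp_mono[OF gp_zeta]) (use E in auto)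
  thus ?thesis
  proof (rule gp_mono)
    have "1000 * x^5 \<le> x^6" using pw1[of 5] by simp
    moreover have "x^6 \<le> x^13" "x^3 \<le> x^5" by (auto intro: pwm)
    moreover have "x \<le> x^5" by (rule px1) simp
    ultimately show "x + x^3 + x^5 + 2 * x \<le> x^13" using x0[of 5] by linarith
  qed simp
qed

subsection \<open>The perturbed equation\<close>

lemma wt_int:
  assumes "0 \<le> t"
  shows "((\<lambda>s. lk (wd s w m) k) has_integral lk (wt t w m) k - lk (wt 0 w m) k) {0..t}"
proof (cases "inc a0 b0 m")
  case True
  have e: "lk (f * X j) k = lk f (k - pj c lam j)" for f j
    using lk_single_mult[of "pj c lam j" 1 f k] by (simp add: mult.commute)
  have "((\<lambda>s. \<Sum>j\<in>Jset. lk (Bd j s w) (k - pj c lam j)) has_integral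
      (\<Sum>j\<in>Jset. lk (Bw j t w) (k - pj c lam j) - lk (Bw j 0 w) (k - pj c lam j))) {0..t}"
    by (intro has_integral_sum Bw_int assms) auto
  thus ?thesis using True by (simp add: wd_def wt_def psi_def psid_def lookup_sum e sum_subtractf)
qed (simp add: wd_def wt_def)

lemma wc_grad: "lk (wc t w m) k = of_int (k $ m) * (\<i> / of_real (knorm2 k) * lk (divw t w) k)"
  by (simp add: wc_def isym_def)

text \<open>The corrector cancels the divergence of the wave mode by mode; at k = 0 both vanish,
  since the wave has high frequencies only.\<close>

lemma div_u': "(\<Sum>l\<in>UNIV. dv l (u' l t w)) = 0"
proof (rule poly_mapping_eqI)
  fix k
  have 1: "(\<Sum>l\<in>UNIV. dsym l k * lk (u l t w) k) = 0"
  proof -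
    have "lk (\<Sum>l\<in>UNIV. dv l (u l t w)) k = 0" using divu[of t w] by simp
    thus ?thesis by (simp add: lookup_sum)
  qed
  have 2: "(\<Sum>l\<in>UNIV. dsym l k * lk (\<zeta> l t w) k) = 0"
  proof -
    have "lk (\<Sum>l\<in>UNIV. dv l (bt N l t w)) k = 0" for N using div_bt[of N t w] by simp
    thus ?thesis by (simp add: lookup_sum \<zeta>_def lookup_minus right_diff_distrib sum_subtractf)
  qed
  have 3: "(\<Sum>l\<in>UNIV. dsym l k * lk (wt t w l) k) = lk (divw t w) k"
    by (simp add: divw_def lookup_sum)
  have 4: "(\<Sum>l\<in>UNIV. dsym l k * lk (wc t w l) k) = - lk (divw t w) k"
  proof (cases "k = 0")
    case True
    have "lk (divw t w) 0 = 0" by (rule hf_zero_mode[OF _ hf_divw]) (use lam in simp)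
    thus ?thesis using True by (simp add: dsym_def)
  next
    case False
    have "(\<Sum>l\<in>UNIV. dsym l k * lk (wc t w l) k) = (\<Sum>l\<in>UNIV. - ((of_int (k $ l))^2 * (lk (divw t w) k / of_real (knorm2 k))))"
      unfolding wc_grad dsym_def by (intro sum.cong refl) (simp add: power2_eq_square field_simps)
    also have "... = - ((\<Sum>l\<in>UNIV. (of_int (k $ l))^2) * (lk (divw t w) k / of_real (knorm2 k)))"
      unfolding sum_negf sum_distrib_right ..
    also have "(\<Sum>l\<in>UNIV. (of_int (k $ l))^2) = (of_real (knorm2 k) :: complex)" by (simp add: knorm2_alt)
    finally show ?thesis using False by simp
  qed
  have "lk (\<Sum>l\<in>UNIV. dv l (u' l t w)) k = (\<Sum>l\<in>UNIV. dsym l k * lk (u l t w) k) + (\<Sum>l\<in>UNIV. dsym l k * lk (wt t w l) k)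
    + (\<Sum>l\<in>UNIV. dsym l k * lk (wc t w l) k) + (\<Sum>l\<in>UNIV. dsym l k * lk (\<zeta> l t w) k)"
    by (simp add: lookup_sum u'_def lookup_add distrib_left sum.distrib)
  thus "lk (\<Sum>l\<in>UNIV. dv l (u' l t w)) k = lk 0 k" by (simp add: 1 2 3 4)
qed

text \<open>The corrector is a gradient and disappears under a test orthogonal to k, although it
  changes in time. The increment \<open>\<zeta>\<close>, zero at time 0, replaces the old truncation
  of the path by the new one.\<close>

lemma eq_u':
  assumes e: "(\<Sum>m\<in>UNIV. e m * of_int (k $ m)) = 0" and t: "0 \<le> t"
  shows "((\<lambda>s. \<Sum>m\<in>UNIV. e m * lk (rhs \<alpha> (\<lambda>m. u' m s w) (\<lambda>a b. r' a b s w) m) k) has_integral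
      (\<Sum>m\<in>UNIV. e m * (lk (u' m t w) k - lk (u' m 0 w) k - lk (bt N' m t w) k))) {0..t}"
proof -
  have z: "lk (wd s w m) 0 = 0" for s m
  proof -
    have "hf (x / 2) (wd s w m)" by (simp add: wd_def hf_psid)
    thus ?thesis by (rule hf_zero_mode[rotated]) (use lam in simp)
  qed
  have R: "(\<Sum>m\<in>UNIV. e m * lk (rhs \<alpha> (\<lambda>m. u' m s w) (\<lambda>a b. r' a b s w) m) k)
    = (\<Sum>m\<in>UNIV. e m * (lk (rhs \<alpha> (\<lambda>m. u m s w) (\<lambda>a b. r a b s w) m) k + lk (wd s w m) k))" for s
    using stress_identity[of "wt s w" a0 b0 "low s w" "hi s w" "wd s w" e k \<alpha> "\<lambda>m. u m s w" "wc s w" "\<lambda>m. \<zeta> m s w" "\<lambda>a b. r a b s w" "of_real K",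
        OF wt_mult z e \<alpha>(1)]
    by (simp add: u'_def[abs_def] r'_def[abs_def] F'_def[abs_def] S'_def)
  have 1: "((\<lambda>s. \<Sum>m\<in>UNIV. e m * lk (rhs \<alpha> (\<lambda>m. u m s w) (\<lambda>a b. r a b s w) m) k) has_integral
          (\<Sum>m\<in>UNIV. e m * (lk (u m t w) k - lk (u m 0 w) k - lk (bt (L^12) m t w) k))) {0..t}"
    using st e t unfolding st_def by blast
  have 2: "((\<lambda>s. \<Sum>m\<in>UNIV. e m * lk (wd s w m) k) has_integral (\<Sum>m\<in>UNIV. e m * (lk (wt t w m) k - lk (wt 0 w m) k))) {0..t}"
    by (intro has_integral_sum has_integral_mult_right wt_int t) auto
  have g: "(\<Sum>m\<in>UNIV. e m * lk (wc s w m) k) = 0" for s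
  proof -
    have "(\<Sum>m\<in>UNIV. e m * lk (wc s w m) k) = (\<Sum>m\<in>UNIV. e m * of_int (k $ m)) * (\<i> / of_real (knorm2 k) * lk (divw s w) k)"
      by (simp only: wc_grad sum_distrib_right mult.assoc)
    thus ?thesis using e by simp
  qed
  have z0: "lk (\<zeta> m 0 w) k = 0" for m by (simp add: \<zeta>_def lookup_minus lk_bt b_neg)
  have "(\<Sum>m\<in>UNIV. e m * (lk (u' m t w) k - lk (u' m 0 w) k - lk (bt N' m t w) k))
    = (\<Sum>m\<in>UNIV. e m * (lk (u m t w) k - lk (u m 0 w) k - lk (bt (L^12) m t w) k))
     + (\<Sum>m\<in>UNIV. e m * (lk (wt t w m) k - lk (wt 0 w m) k))
     + (\<Sum>m\<in>UNIV. e m * lk (wc t w m) k) - (\<Sum>m\<in>UNIV. e m * lk (wc 0 w m) k)"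
    unfolding sum.distrib[symmetric] sum_subtractf[symmetric]
    by (intro sum.cong refl) (simp add: u'_def lookup_add z0, simp add: \<zeta>_def lookup_minus algebra_simps)
  thus ?thesis unfolding R using has_integral_add[OF 1 2] g by (simp add: distrib_left sum.distrib)
qed

lemma rl_u_all: "rl (\<zeta> m t w)" "rl (wt t w m)" "rl (wc t w m)" "rl (wd t w m)" "rl (hi t w m l)"
proof -
  show z: "rl (\<zeta> m t w)" unfolding \<zeta>_def by (intro rl_diff rl_bt)
  show w: "rl (wt t w m)" for m by (simp add: wt_def rl_psi)
  have "rl (divw t w)" unfolding divw_def by (intro rl_sum rl_dv w)
  thus "rl (wc t w m)" unfolding wc_def using rl_diff[of 0 "iv m (divw t w)"] by (simp add: rl_iv)
  show "rl (wd t w m)" by (simp add: wd_def rl_psid)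
  have e: "hi t w m l = wt t w m * wt t w l - (if inc a0 b0 m \<and> inc a0 b0 l then low t w else 0)" for t w
    using wt_mult[of t w m l] by simp
  show "rl (hi t w m l)" unfolding e by (intro rl_diff rl_mult w) (auto simp: rl_low)
qed

lemma rl_u': "rl (u' m t w)"
  unfolding u'_def by (intro rl_add u rl_u_all)

lemma rl_dec: "(\<And>m l. rl (S m l)) \<Longrightarrow> rl (dec S p q)"
  unfolding dec_def by (auto intro!: rl_diff rl_mult rl_cst rl_sum)

lemma rl_r': "rl (r' p q t w)"
proof -
  have r: "rl (r p q t w)" using st by (simp add: st_def)
  have S: "rl (S' t w m l)" for m l
    unfolding S'_def newS_def by (intro rl_add rl_mult u rl_u_all)
  have F: "rl (F' t w l)" for l
    unfolding F'_def newF_def by (intro rl_add rl_mult rl_sum rl_dv rl_lsym u rl_u_all)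
  have A: "rl (adv (F' t w) m l)" for m l unfolding adv_def by (intro rl_add rl_iv F)
  have qq: "rl (if p = a0 \<and> q = b0 then low t w - cst (of_real K) else 0)"
    by (auto intro!: rl_diff rl_low rl_cst)
  show ?thesis unfolding r'_def newr_def by (intro rl_add r qq rl_dec S A)
qed

definition ew :: real where "ew = 24 * real dd * g0 / x"
definition ez :: real where "ez = Cb * real (L^12) powr (-1/4)"
definition eS :: real where
  "eS = 2 * (Lam * ew) + 2 * (4 * g0 * ew) + ew * ew + 2 * ((Lam + 24 * sqrt K + ew) * ez) + ez * ez"

lemma an_zeta: "1 \<le> L \<Longrightarrow> an (\<zeta> m t w) \<le> ez"
  unfolding \<zeta>_def ez_def using E(1) by (intro an_bt_tail) auto

lemma sn_S:
  assumes "1 \<le> L" shows "sn eS (S' t w m l)"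
proof -
  have uu: "sn Lam (u m t w)" for m by (rule sn_an[OF an_u])
  have ww: "sn ew (wc t w m)" for m unfolding ew_def by (rule sn_an[OF an_wc])
  have zz: "sn ez (\<zeta> m t w)" for m by (rule sn_an[OF an_zeta[OF assms]])
  have pp: "sn (4 * g0) (wt t w m)" for m
    using an_psi[of t w] g0_nonneg by (intro sn_an) (simp add: wt_def)
  have pk: "sn (24 * sqrt K) (wt t w m)" for m
    using sn_psi[of t w] K by (auto simp: wt_def sn_def)
  have s: "sn (Lam + 24 * sqrt K + ew) (u m t w + wt t w m + wc t w m)" for m
    by (intro sn_add uu pk ww)
  have "sn (Lam * ew + ew * Lam + 4 * g0 * ew + ew * (4 * g0) + ew * ew + (Lam + 24 * sqrt K + ew) * ez
      + ez * (Lam + 24 * sqrt K + ew) + ez * ez) (S' t w m l)"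
    unfolding S'_def newS_def by (intro sn_add sn_mult uu ww zz pp s)
  thus ?thesis by (rule sn_mono) (simp add: eS_def algebra_simps)
qed

definition er :: real where "er = lowerr + 5 * eS + 10 * (errF + ez)"

text \<open>At the treated position r + (low - K) equals low - (K - r), which
  \<open>low_approx\<close> makes small.\<close>

lemma sn_r':
  assumes L: "1 \<le> L"
  shows "sn er (r' p q t w - (if p = a0 \<and> q = b0 then 0 else r p q t w))"
proof -
  have iv: "sn (errF + ez) (iv m (F' t w l))" for m l
  proof -
    have "an (iv m (mulp (lsym \<alpha>) (\<zeta> l t w))) \<le> ez"
      by (rule order_trans[OF an_ivl[OF \<alpha>] an_zeta[OF L]])
    hence "sn (errF + ez) (iv m (nF t w l) + iv m (mulp (lsym \<alpha>) (\<zeta> l t w)))"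
      by (intro sn_add sn_iv_nF sn_an)
    thus ?thesis by (simp add: F'_def mulp_add)
  qed
  have A: "sn (5 * (2 * (errF + ez))) (dec (adv (F' t w)) p q)"
    unfolding adv_def by (rule sn_dec) (use sn_add[OF iv iv] in \<open>simp add: adv_def\<close>)
  have S: "sn (5 * eS) (dec (S' t w) p q)" by (rule sn_dec[OF sn_S[OF L]])
  have l: "sn lowerr (if p = a0 \<and> q = b0 then low t w - (cst (of_real K) - rr t w) else 0)"
  proof -
    have "0 \<le> lowerr" using low_approx[of t w] order_trans[OF norm_ge_zero] unfolding sn_def by blast
    thus ?thesis using low_approx[of t w] by (auto simp: sn_def)
  qed
  have "sn (lowerr + 5 * eS + 5 * (2 * (errF + ez)))
     ((if p = a0 \<and> q = b0 then low t w - (cst (of_real K) - rr t w) else 0) + dec (S' t w) p q + dec (adv (F' t w)) p q)"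
    by (intro sn_add l S A)
  moreover have "r' p q t w - (if p = a0 \<and> q = b0 then 0 else r p q t w) =
     (if p = a0 \<and> q = b0 then low t w - (cst (of_real K) - rr t w) else 0) + dec (S' t w) p q + dec (adv (F' t w)) p q"

  proof -
    have "r a0 b0 t w = rr t w" using rr_r by simp
    thus ?thesis by (auto simp: r'_def newr_def)
  qed
  ultimately show ?thesis by (simp add: er_def)
qed

lemma sn_u':
  assumes L: "1 \<le> L"
  shows "sn (24 * sqrt K + ew + ez) (u' m t w - u m t w)"
proof -
  have pk: "sn (24 * sqrt K) (wt t w m)"
    using sn_psi[of t w] K by (auto simp: wt_def sn_def)
  have ww: "sn ew (wc t w m)" unfolding ew_def by (rule sn_an[OF an_wc])
  have zz: "sn ez (\<zeta> m t w)" by (rule sn_an[OF an_zeta[OF L]])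
  have "u' m t w - u m t w = wt t w m + wc t w m + \<zeta> m t w" by (simp add: u'_def)
  thus ?thesis by (simp only:) (intro sn_add pk ww zz)
qed

text \<open>Wave and corrector live above lam/2, the noise increment outside the box of size L^12.
  Therefore every Fourier coefficient becomes stationary along the iteration.\<close>

lemma low_modes:
  assumes "k \<in> kbox (L^12)" "2 * L^12 < lam"
  shows "lk (u' m t w) k = lk (u m t w) k"
proof -
  have z: "lk (\<zeta> m t w) k = 0"
    using assms(1) kbox_mono[OF E(1)] by (auto simp: \<zeta>_def lookup_minus lk_bt)
  have h: "lk f k = 0" if hf: "hf (x / 2) f" for f
  proof (rule ccontr)
    assume "lk f k \<noteq> 0"
    hence "k \<in> ks f" by (simp add: in_keys_iff)
    then obtain c where c: "x / 2 \<le> \<bar>real_of_int (k $ c)\<bar>" using hf by (auto simp: hf_def)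
    have "\<bar>k $ c\<bar> \<le> int (L^12)" using assms(1) unfolding kbox_def by blast
    hence "\<bar>real_of_int (k $ c)\<bar> \<le> real (L^12)" by linarith
    moreover have "2 * real (L^12) < x" using assms(2) by linarith
    ultimately show False using c by linarith
  qed
  show ?thesis using h[OF hf_wt[of t w m]] h[OF hf_wc[of t w m]] z by (simp add: u'_def lookup_add)
qed

end

section \<open>Choice of all parameters as powers of L\<close>

lemma inv_pow_le:
  fixes X :: real assumes "0 \<le> c" "c \<le> X^k" "1 \<le> X" "j + k \<le> i"
  shows "c / X^i \<le> 1 / X^j"
proof -
  have "c / X^i \<le> X^k / X^i" using assms by (intro divide_right_mono) auto
  also have "... \<le> X^k / X^(j + k)" using assms by (intro divide_left_mono power_increasing mult_pos_pos zero_less_power) auto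
  also have "... = 1 / X^j" using assms by (simp add: power_add)
  finally show ?thesis .
qed

lemma (in wave) wave_sizes:
  fixes L P :: nat
  defines "X \<equiv> real L"
  assumes p: "Lam = real L" "D = L^13" "n = L" "J = L^5" "lam = L^P" "om = real L^(P - 3)"
    and P: "1000 \<le> P" and L: "1000 \<le> L" and KX: "K \<le> X"
  shows "real dd \<le> X^19" "g0 \<le> X^61" "gB \<le> X^63 * real lam" "gBd \<le> X^64 * (real lam)^2"
    "om \<le> real lam" "om / real lam = 1 / X^3" "sqrt K \<le> X" "X^20 \<le> real lam"
proof -
  have X: "1000 \<le> X" using L by (simp add: X_def)
  hence X1: "1 \<le> X" by simp
  have s: "c * X^k \<le> X^(Suc k)" if "c \<le> 1000" for c k
    using that X by (simp add: mult_right_mono)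
  have "real dd = X * X^13 + (X^5 + 2) * X^13 + X^13"
    unfolding dd_def by (simp add: p X_def distrib_right)
  also have "... = X^14 + X^18 + 3 * X^13" by (simp add: algebra_simps eval_nat_numeral)
  also have "... \<le> 5 * X^18"
    using power_increasing[of 14 18 X] power_increasing[of 13 18 X] X1 by simp
  also have "... \<le> X^19" using s[of 5 18] by simp
  finally show dd: "real dd \<le> X^19" .
  show K2: "sqrt K \<le> X"
  proof -
    have "X \<le> X^2" using X1 by (simp add: power2_eq_square)
    thus ?thesis using KX X1 by (intro real_le_lsqrt) auto
  qed
  have "real (2 * dd + 1) \<le> 3 * X^19" using dd one_le_power[OF X1, of 19] by simp
  hence "Vol \<le> (3 * X^19)^3" unfolding Vol_def of_nat_power by (intro power_mono) auto
  also have "... = 27 * X^57" by (simp add: power_mult_distrib flip: power_mult)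
  also have "... \<le> X^58" using s[of 27 57] by simp
  finally have V: "Vol \<le> X^58" .
  have lamX: "real lam = X^P" by (simp add: p X_def)
  have omX: "om = X^(P - 3)" by (simp add: p X_def)
  have "X^P = X^(P - 3) * X^3" using P by (simp flip: power_add)
  thus oml: "om / real lam = 1 / X^3" unfolding lamX omX using X1 by simp
  show oml': "om \<le> real lam" unfolding lamX omX using X1 by (intro power_increasing) auto
  show "X^20 \<le> real lam" unfolding lamX using X1 P by (intro power_increasing) auto
  have LX: "1 + Lam \<le> 2 * X" "0 \<le> Lam" using X1 p by (auto simp: X_def)
  have V0: "0 \<le> Vol" using Vol_ge by simp
  have g0': "g0 \<le> X^58 * (6 * X * (2 * X))"
    unfolding g0_def using V V0 K K2 LX X1 by (intro mult_mono) auto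
  also have "... = 12 * X^60" by (simp add: eval_nat_numeral)
  also have "... \<le> X^61" using s[of 12 60] by simp
  finally show g0: "g0 \<le> X^61" .
  have "g1 \<le> X^58 * (12 * X * (2 * X)^2 * real lam)"
    unfolding g1_def using V V0 K K2 LX X1 by (intro mult_mono power_mono) auto
  also have "... = 48 * X^61 * real lam" by (simp add: eval_nat_numeral)
  also have "... \<le> X^62 * real lam" using s[of 48 61] by (intro mult_right_mono) auto
  finally have g1: "g1 \<le> X^62 * real lam" .
  have lam1: "1 \<le> real lam" using lam by simp
  have og: "om * g0 \<le> real lam * X^61" using oml' g0 om g0_nonneg by (intro mult_mono) auto
  have gl: "g0 \<le> real lam * X^61"
  proof -
    have "1 * X^61 \<le> real lam * X^61" using X1 by (intro mult_right_mono lam1) auto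
    thus ?thesis using g0 by linarith
  qed
  have "gB \<le> 4 * (real lam * X^61) + X^62 * real lam + 2 * (real lam * X^61)"
    unfolding gB_def using og gl g1 by (intro add_mono) (simp_all add: mult.assoc)
  also have "... = (6 * X^61 + X^62) * real lam" by (simp add: algebra_simps)
  also have "... \<le> X^63 * real lam"
  proof (rule mult_right_mono)
    have "6 * X^61 \<le> X^62" using s[of 6 61] by simp
    moreover have "2 * X^62 \<le> X^63" using s[of 2 62] by simp
    ultimately show "6 * X^61 + X^62 \<le> X^63" by linarith
  qed simp
  finally show gB: "gB \<le> X^63 * real lam" .
  have oog: "om^2 * g0 \<le> (real lam)^2 * X^61" using oml' g0 om g0_nonneg by (intro mult_mono power_mono) auto
  have og1: "om * g1 \<le> real lam * (X^62 * real lam)" using oml' g1 om g1_nonneg by (intro mult_mono) auto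
  have ogl: "om * g0 \<le> (real lam)^2 * X^61"
  proof -
    have "real lam * X^61 \<le> (real lam * real lam) * X^61"
      using lam1 X1 mult_right_mono[OF lam1, of "real lam"] by (intro mult_right_mono) auto
    thus ?thesis using og by (simp add: power2_eq_square)
  qed
  have lgB: "real lam * gB \<le> real lam * (X^63 * real lam)" using gB by (intro mult_left_mono) auto
  have "gBd \<le> 16 * ((real lam)^2 * X^61) + 2 * (real lam * (X^62 * real lam)) + 4 * ((real lam)^2 * X^61) + 2 * (real lam * (X^63 * real lam))"
    unfolding gBd_def using oog og1 ogl lgB by (intro add_mono) (simp_all add: mult.assoc)
  also have "... = (20 * X^61 + 2 * X^62 + 2 * X^63) * (real lam)^2" by (simp add: algebra_simps power2_eq_square)
  also have "... \<le> X^64 * (real lam)^2"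
  proof (rule mult_right_mono)
    have "20 * X^61 \<le> X^62" using s[of 20 61] by simp
    moreover have "3 * X^62 \<le> X^63" using s[of 3 62] by simp
    moreover have "3 * X^63 \<le> X^64" using s[of 3 63] by simp
    ultimately show "20 * X^61 + 2 * X^62 + 2 * X^63 \<le> X^64" by linarith
  qed simp
  finally show "gBd \<le> X^64 * (real lam)^2" .
qed

text \<open>The exponent P is free and beats all volume factors; \<open>p0\<close> brings the
  dissipation factor below L^(-80), more than the loss g0 <= L^61. Only om/lam and the noise tail
  \<open>ez\<close> have no such room: both are of order L^(-3), and even after multiplication by L
  they are small against 1/L.\<close>

lemma (in stepn) step_sizes:
  fixes P p0 :: nat
  defines "Z \<equiv> real L"
  assumes p: "n = L" "J = L^5" "lam = L^P" "om = real L^(P - 3)"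
    and P: "2000 + p0 \<le> P" "80 \<le> real p0 * (1 - 2 * \<alpha>)" and L: "1000 \<le> L" and KX: "K \<le> Z"
    and dl: "dl \<le> 1 / Z^100" and hf: "(1/2)^L \<le> 1 / Z^10" and Cb: "10^5 * (1 + Cb)^2 \<le> Z"
  shows "er \<le> 1 / Z" "ew + ez \<le> 1 / Z"
proof -
  have P': "1000 \<le> P" using P by simp
  note w = wave_sizes[OF Lam E(5) p P' L KX[unfolded Z_def], folded Z_def]
  have Z: "1000 \<le> Z" using L by (simp add: Z_def)
  hence X1: "1 \<le> Z" and X0: "0 < Z" by auto
  have lamX: "real lam = Z^P" by (simp add: p Z_def)
  have omX: "om = Z^(P - 3)" by (simp add: p Z_def)
  have lam0: "0 < real lam" using lam by simp
  have div: "c / real lam \<le> 1 / Z^j" if "0 \<le> c" "c \<le> Z^k" "j + k \<le> 2000" for c j k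
    unfolding lamX using that P X1 by (intro inv_pow_le[of c Z k]) auto
  have s: "c * Z^k \<le> Z^(Suc k)" if "c \<le> 1000" for c k
    using that Z by (simp add: mult_right_mono)
  have dg: "real dd * g0 \<le> Z^80"
  proof -
    have "real dd * g0 \<le> Z^19 * Z^61" using w(1,2) g0_nonneg X0 by (intro mult_mono) auto
    thus ?thesis by (simp flip: power_add)
  qed
  have dgg: "real dd * g0^2 \<le> Z^141"
  proof -
    have "real dd * g0^2 \<le> Z^19 * (Z^61)^2" using w(1,2) g0_nonneg X0 by (intro mult_mono power_mono) auto
    thus ?thesis by (simp flip: power_add power_mult)
  qed
  have ew: "ew \<le> 1 / Z^100" "0 \<le> ew"
  proof -
    have "24 * real dd * g0 \<le> Z^81" using dg s[of 24 80] by simp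
    thus "ew \<le> 1 / Z^100" unfolding ew_def using g0_nonneg by (intro div[of _ 81]) auto
    show "0 \<le> ew" unfolding ew_def using g0_nonneg by simp
  qed
  have "real (L^12) powr (-1/4) = 1 / Z^3"
  proof -
    have "real (L^12) = Z powr 12" using X0 by (simp add: Z_def)
    hence "real (L^12) powr (-1/4) = Z powr - 3" by (simp only: powr_powr) simp
    also have "... = 1 / Z powr 3" by (simp add: powr_minus_divide)
    finally show ?thesis using X0 by simp
  qed
  hence ez: "ez = Cb / Z^3" "0 \<le> ez" using Cb_nonneg X0 by (auto simp: ez_def)
  have Cb1: "10^5 * Cb \<le> Z" "10^5 \<le> Z" "Cb * Cb \<le> Z"
  proof -
    have "Cb \<le> (1 + Cb)^2" "1 \<le> (1 + Cb)^2" "Cb * Cb \<le> (1 + Cb)^2"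
      using Cb_nonneg by (auto simp: power2_eq_square algebra_simps)
    thus "10^5 * Cb \<le> Z" "10^5 \<le> Z" "Cb * Cb \<le> Z" using Cb by auto
  qed
  have hb: "(pi / om) powr (1/8) \<le> 1 / Z^120"
  proof -
    \<comment> \<open>960 = 8 * 120: the Hoelder exponent 1/8 leaves L^(-120).\<close>
    have "pi / om \<le> 1 / Z^960"
      unfolding omX using P pi_less_4 Z by (intro inv_pow_le[of pi Z 1]) auto
    hence "(pi / om) powr (1/8) \<le> (1 / Z^960) powr (1/8)" using om by (intro powr_mono2) auto
    also have "1 / Z^960 = (1 / Z^120) powr 8"
      using X0 by (simp add: power_divide flip: power_mult)
    also have "((1 / Z^120) powr 8) powr (1/8) = (1 / Z^120) powr (8 * (1/8))" by (simp only: powr_powr)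
    also have "... = 1 / Z^120" using X0 by simp
    finally show ?thesis .
  qed
  have low: "lowerr \<le> 1 / Z^8"
  proof -
    have K0: "0 \<le> K" using K by simp
    have "27 * K * dl \<le> 27 * Z * (1 / Z^100)" using KX dl dl_nonneg K0 by (intro mult_mono) auto
    also have "... = (27 * Z) / Z^100" by simp
    also have "... \<le> 1 / Z^9" using Z by (intro inv_pow_le[of _ Z 2]) (auto simp: power2_eq_square)
    finally have 1: "27 * K * dl \<le> 1 / Z^9" .
    have "5 * K * (1/2)^n \<le> 5 * Z * (1 / Z^10)" using KX hf K0 p by (intro mult_mono) auto
    also have "... = 5 / Z^9" using X0 by (simp add: eval_nat_numeral)
    finally have 2: "5 * K * (1/2)^n \<le> 5 / Z^9" .
    have "Lam * (pi / om) powr (1/8) \<le> Z * (1 / Z^120)" using hb Lam Z_def by (intro mult_mono) auto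
    also have "... = Z / Z^120" by simp
    also have "... \<le> 1 / Z^9" using Z by (intro inv_pow_le[of _ Z 1]) auto
    finally have "lowerr \<le> 1 / Z^9 + 5 / Z^9 + 1 / Z^9" unfolding lowerr_def using 1 2 by linarith
    also have "... = 7 / Z^9" by (simp add: add_divide_distrib[symmetric])
    also have "... \<le> 1 / Z^8" using Z by (intro inv_pow_le[of _ Z 1]) auto
    finally show ?thesis .
  qed
  have nu: "8 * nu / real lam \<le> 1 / Z^3"
  proof -
    have "Lam * (pi / om) powr (1/8) * g0 + g0 * dl \<le> Z * (1 / Z^120) * Z^61 + Z^61 * (1 / Z^100)"
      using hb dl dl_nonneg w(2) g0_nonneg Lam Z_def by (intro add_mono mult_mono) auto
    also have "... = Z^62 / Z^120 + Z^61 / Z^100" by (simp add: eval_nat_numeral)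
    also have "... \<le> 1 / Z^5 + 1 / Z^5"
      using X1 by (intro add_mono inv_pow_le[of _ Z 62] inv_pow_le[of _ Z 61]) auto
    finally have "Lam * (pi / om) powr (1/8) * g0 + g0 * dl \<le> 2 / Z^5" by (simp add: add_divide_distrib[symmetric])
    hence "nu \<le> 2 * real lam * (2 / Z^5)" unfolding nu_def by (intro mult_left_mono) auto
    hence "8 * nu / real lam \<le> 8 * (2 * real lam * (2 / Z^5)) / real lam" using lam0 by (intro divide_right_mono) auto
    also have "... = 32 / Z^5" using lam0 by simp
    also have "... \<le> 1 / Z^3" using Z by (intro inv_pow_le[of _ Z 1]) auto
    finally show ?thesis .
  qed
  have eF: "errF \<le> 52 / Z^2"
  proof -
    have "48 * om * sqrt K / real lam = 48 * sqrt K * (om / real lam)" by simp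
    also have "... \<le> 48 * Z * (1 / Z^3)" unfolding w(6) using w(7) X0 by (intro mult_right_mono) auto
    also have "... = 48 / Z^2" using X0 by (simp add: eval_nat_numeral)
    finally have 1: "48 * om * sqrt K / real lam \<le> 48 / Z^2" .
    have "128 * real dd * om * g0 / (real lam)^2 = (128 * (real dd * g0)) * (om / real lam) / real lam"
      by (simp add: power2_eq_square)
    also have "... \<le> (128 * Z^80) * 1 / real lam"
    proof (intro divide_right_mono mult_mono mult_left_mono dg)
      show "om / real lam \<le> 1" using w(5) lam0 by simp
    qed (use om lam0 g0_nonneg X0 in auto)
    also have "... \<le> 1 / Z^2" using s[of 128 80] X0 by (intro div[of _ 81]) auto
    finally have 2: "128 * real dd * om * g0 / (real lam)^2 \<le> 1 / Z^2" .
    have "2 * (36 * real dd * Lam * g0 + 96 * real dd * g0^2) = 72 * (Z * (real dd * g0)) + 192 * (real dd * g0^2)"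
      by (simp add: Lam Z_def algebra_simps)
    also have "... \<le> 72 * (Z * Z^80) + 192 * Z^141" using dg dgg X0 by (intro add_mono mult_left_mono) auto
    also have "... \<le> Z^142"
    proof -
      have "Z * Z^80 \<le> Z^141"
      proof -
        have "Z * Z^80 = Z^81" by (simp flip: power_Suc)
        thus ?thesis using power_increasing[of 81 141 Z] X1 by simp
      qed
      moreover have "1000 * Z^141 \<le> Z^142" using s[of 1000 141] by simp
      moreover have "0 \<le> Z^141" using X0 by simp
      ultimately show ?thesis by linarith
    qed
    finally have "2 * (36 * real dd * Lam * g0 + 96 * real dd * g0^2) / real lam \<le> 1 / Z^3"
      using Lam0 g0_nonneg by (intro div[of _ 142]) auto
    moreover have "2 * (4 * nu + 36 * real dd * Lam * g0 + 96 * real dd * g0^2) / real lam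
       = 8 * nu / real lam + 2 * (36 * real dd * Lam * g0 + 96 * real dd * g0^2) / real lam"
      by (simp add: add_divide_distrib algebra_simps)
    moreover have "2 / Z^3 \<le> 1 / Z^2" using Z by (intro inv_pow_le[of _ Z 1]) auto
    moreover have "1 / Z^3 + 1 / Z^3 = 2 / Z^3" by (simp add: add_divide_distrib[symmetric])
    ultimately have 3: "2 * (4 * nu + 36 * real dd * Lam * g0 + 96 * real dd * g0^2) / real lam \<le> 1 / Z^2"
      using nu by linarith
    have 4: "(real lam / 2) powr (2 * \<alpha> - 1) * (16 * g0) \<le> 1 / Z^2"
    proof -
      have "Z^p0 * 2 \<le> Z^p0 * Z" using Z by (intro mult_left_mono) auto
      also have "... = Z^(Suc p0)" by simp
      also have "... \<le> Z^P" using P X1 by (intro power_increasing) auto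
      finally have "Z^p0 \<le> real lam / 2" by (simp add: lamX)
      hence "(real lam / 2) powr (2 * \<alpha> - 1) \<le> (Z^p0) powr (2 * \<alpha> - 1)"
        using \<alpha> X0 by (intro powr_mono2') auto
      also have "... = Z powr (real p0 * (2 * \<alpha> - 1))" using X0 by (simp add: powr_powr flip: powr_realpow)
      also have "... \<le> Z powr (- 80)" using P(2) X1 by (intro powr_mono) (auto simp: algebra_simps)
      also have "... = 1 / Z^80" using X0 by (simp add: powr_minus_divide)
      finally have "(real lam / 2) powr (2 * \<alpha> - 1) * (16 * g0) \<le> (1 / Z^80) * (16 * Z^61)"
        using w(2) g0_nonneg by (intro mult_mono) auto
      also have "... = (16 * Z^61) / Z^80" by simp
      also have "... \<le> 1 / Z^2" using s[of 16 61] X1 by (intro inv_pow_le[of _ Z 62]) auto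
      finally show ?thesis .
    qed
    have "errF \<le> 48 / Z^2 + 1 / Z^2 + 1 / Z^2 + 1 / Z^2" unfolding errF_def using 1 2 3 4 by linarith
    also have "... = 51 / Z^2" by (simp add: add_divide_distrib[symmetric])
    also have "... \<le> 52 / Z^2" by (intro divide_right_mono) auto
    finally show ?thesis .
  qed
  have eS: "eS \<le> 60 * (1 + Cb) / Z^2"
  proof -
    have a: "2 * (Lam * ew) \<le> 1 / Z^5"
    proof -
      have "2 * (Lam * ew) \<le> 2 * (Z * (1 / Z^100))" using ew Lam Z_def X0 by (intro mult_left_mono mult_mono) auto
      also have "... = (2 * Z) / Z^100" by simp
      also have "... \<le> 1 / Z^5" using Z by (intro inv_pow_le[of _ Z 2]) (auto simp: power2_eq_square)
      finally show ?thesis .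
    qed
    have b: "2 * (4 * g0 * ew) \<le> 1 / Z^5"
    proof -
      have "2 * (4 * g0 * ew) \<le> 2 * (4 * Z^61 * (1 / Z^100))" using ew w(2) g0_nonneg X0 by (intro mult_left_mono mult_mono) auto
      also have "... = (8 * Z^61) / Z^100" by simp
      also have "... \<le> 1 / Z^5" using s[of 8 61] X1 by (intro inv_pow_le[of _ Z 62]) auto
      finally show ?thesis .
    qed
    have ew1: "ew \<le> 1"
    proof -
      have "1 / Z^100 \<le> 1" using inv_pow_le[of 1 Z 0 0 100] X1 by simp
      thus ?thesis using ew by linarith
    qed
    have cc: "ew * ew \<le> 1 / Z^5"
    proof -
      have "ew * ew \<le> (1 / Z^100) * 1" using ew ew1 by (intro mult_mono) auto
      also have "... \<le> 1 / Z^5" using inv_pow_le[of 1 Z 0 5 100] X1 by simp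
      finally show ?thesis .
    qed
    have d: "2 * ((Lam + 24 * sqrt K + ew) * ez) \<le> 52 * Cb / Z^2"
    proof -
      have "Lam + 24 * sqrt K + ew \<le> 26 * Z" using w(7) ew1 X1 Lam Z_def by simp
      hence "2 * ((Lam + 24 * sqrt K + ew) * ez) \<le> 2 * ((26 * Z) * ez)" using ez by (intro mult_left_mono mult_right_mono) auto
      also have "... = 52 * Cb / Z^2" using X0 by (simp add: ez eval_nat_numeral)
      finally show ?thesis .
    qed
    have f: "ez * ez \<le> 1 / Z^5"
    proof -
      have "ez * ez = (Cb * Cb) / Z^6" by (simp add: ez flip: power_add)
      also have "... \<le> Z / Z^6" using Cb1 X0 by (intro divide_right_mono) auto
      also have "... \<le> 1 / Z^5" using X1 by (intro inv_pow_le[of _ Z 1]) auto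
      finally show ?thesis .
    qed
    have "eS \<le> 4 / Z^5 + 52 * Cb / Z^2" unfolding eS_def using a b cc d f by (simp add: add_divide_distrib[symmetric])
    also have "... \<le> 1 / Z^2 + 52 * Cb / Z^2" using Z by (intro add_mono inv_pow_le[of _ Z 1]) auto
    also have "... = (1 + 52 * Cb) / Z^2" by (simp add: add_divide_distrib)
    also have "... \<le> 60 * (1 + Cb) / Z^2" using Cb_nonneg by (intro divide_right_mono) auto
    finally show ?thesis .
  qed
  have c2: "(c + d * Cb) / Z^2 \<le> 1 / (10 * Z)" if "c \<le> 5000" "d \<le> 5000" "0 \<le> d" for c d
  proof -
    have "10 * (c + d * Cb) \<le> Z"
    proof -
      have "d * Cb \<le> 5000 * Cb" using that Cb_nonneg by (intro mult_right_mono) auto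
      thus ?thesis using Cb1 that by simp
    qed
    hence "(c + d * Cb) / Z^2 \<le> (Z / 10) / Z^2" using X0 by (intro divide_right_mono) auto
    also have "... = 1 / (10 * Z)" using X0 by (simp add: power2_eq_square)
    finally show ?thesis .
  qed
  have ez1: "ez \<le> 1 / (10 * Z)"
  proof -
    have "ez \<le> Cb / Z^2" unfolding ez using Cb_nonneg X1 by (intro divide_left_mono power_increasing mult_pos_pos) auto
    also have "... \<le> 1 / (10 * Z)" using c2[of 0 1] by simp
    finally show ?thesis .
  qed
  have ez10: "10 * ez \<le> 1 / (10 * Z)"
  proof -
    have "10 * ez = 10 * Cb / Z^3" by (simp add: ez)
    also have "... \<le> 10 * Cb / Z^2" using Cb_nonneg X1 by (intro divide_left_mono power_increasing mult_pos_pos) auto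
    also have "... \<le> 1 / (10 * Z)" using c2[of 0 10] by simp
    finally show ?thesis .
  qed
  have ten: "1 / Z^j \<le> 1 / (10 * Z)" if "2 \<le> j" for j
  proof -
    have "10 * Z \<le> Z^2" using Z by (simp add: power2_eq_square)
    also have "... \<le> Z^j" using that X1 by (intro power_increasing) auto
    finally show ?thesis using X0 by (intro divide_left_mono mult_pos_pos) auto
  qed
  show "ew + ez \<le> 1 / Z"
  proof -
    have "ew + ez \<le> 1 / (10 * Z) + 1 / (10 * Z)" using ten[of 100] ew ez1 by simp
    also have "... \<le> 1 / Z" using X0 by (simp add: field_simps)
    finally show ?thesis .
  qed
  have "5 * eS \<le> 5 * (60 * (1 + Cb) / Z^2)" using eS by (intro mult_left_mono) auto
  also have "... = (300 + 300 * Cb) / Z^2" by (simp add: algebra_simps)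
  finally have 5: "5 * eS \<le> 1 / (10 * Z)" using c2[of 300 300] by linarith
  have "10 * errF \<le> 520 / Z^2" using eF by simp
  hence 6: "10 * errF \<le> 1 / (10 * Z)" using c2[of 520 0] by simp
  have "er \<le> 1 / (10 * Z) + 1 / (10 * Z) + 1 / (10 * Z) + 1 / (10 * Z)"
    unfolding er_def using low ten[of 8] 5 6 ez10 by simp
  also have "... \<le> 1 / Z" using X0 by (simp add: field_simps)
  finally show "er \<le> 1 / Z" .
qed

context noise
begin

text \<open>The term of degree k + 1 in the series of exp(n ln 2) exceeds n^k once n is
  large.\<close>

lemma power_le_two_power: "\<exists>M. \<forall>n\<ge>M. real n^k \<le> 2^n"
proof -
  let ?c = "(ln 2)^(Suc k) / fact (Suc k) :: real"
  have c: "0 < ?c" by simp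
  have "real n^k \<le> 2^n" if n: "nat \<lceil>1 / ?c\<rceil> \<le> n" for n
  proof -
    have "1 / ?c \<le> real n" using n by linarith
    hence "1 \<le> real n * ?c" using c by (simp only: pos_divide_le_eq)
    hence "real n^k * 1 \<le> real n^k * (real n * ?c)" by (intro mult_left_mono) auto
    also have "... = (real n * ln 2)^(Suc k) / fact (Suc k)" by (simp add: power_mult_distrib)
    also have "... \<le> exp (real n * ln 2)"
    proof -
      let ?x = "real n * ln 2"
      have "(\<lambda>j. ?x^j / fact j) sums exp ?x"
        using exp_converges[of ?x] by (simp add: scaleR_conv_of_real field_simps)
      hence "(\<Sum>j\<in>{Suc k}. ?x^j / fact j) \<le> exp ?x"
        unfolding sums_unique[OF \<open>_ sums _\<close>] by (intro sum_le_suminf) (auto dest: sums_summable)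
      thus ?thesis by simp
    qed
    also have "... = 2^n" by (simp add: exp_of_nat_mult)
    finally show ?thesis by simp
  qed
  thus ?thesis by blast
qed

lemma large_L: "\<exists>L0. \<forall>L\<ge>L0. real (Suc (Suc (L^5))) * (1/2)^(Suc (L^5)) \<le> 1 / (real L)^100 \<and> (1/2)^L \<le> 1 / (real L)^10"
proof -
  obtain M where M: "\<And>n. M \<le> n \<Longrightarrow> real n^22 \<le> 2^n" using power_le_two_power by blast
  obtain M' where M': "\<And>n. M' \<le> n \<Longrightarrow> real n^10 \<le> 2^n" using power_le_two_power by blast
  show ?thesis
  proof (intro exI[of _ "max 3 (max M M')"] allI impI)
    fix L assume L: "max 3 (max M M') \<le> L"
    hence L1: "3 \<le> L" "M \<le> L" "M' \<le> L" by auto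
    define m where "m = L^5"
    have "L^1 \<le> L^5" using L1 by (intro power_increasing) auto
    hence m: "M \<le> m" "3 \<le> m" using L1 by (auto simp: m_def)
    have "real (Suc (Suc m)) * real m^20 \<le> (real m * real m) * real m^20"
    proof (rule mult_right_mono)
      have "real (Suc (Suc m)) \<le> 3 * real m" using m by simp
      also have "... \<le> real m * real m" using m by (intro mult_right_mono) auto
      finally show "real (Suc (Suc m)) \<le> real m * real m" .
    qed simp
    also have "... = real m^22" by (simp add: eval_nat_numeral)
    also have "... \<le> 2^m" by (rule M[OF m(1)])
    also have "... \<le> 2^(Suc m)" by simp
    finally have "real (Suc (Suc m)) * real m^20 \<le> 2^(Suc m)" .
    moreover have "real m^20 = real L^100" by (simp add: m_def flip: power_mult)
    ultimately have "real (Suc (Suc m)) * real L^100 \<le> 2^(Suc m)" by simp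
    hence "real (Suc (Suc m)) * (1/2)^(Suc m) \<le> 1 / (real L)^100"
      using L1 by (simp add: field_simps del: of_nat_Suc power_Suc)
    moreover have "(1/2)^L \<le> 1 / (real L)^10" using M'[OF L1(3)] L1 by (simp add: field_simps)
    ultimately show "real (Suc (Suc (L^5))) * (1/2)^(Suc (L^5)) \<le> 1 / (real L)^100 \<and> (1/2)^L \<le> 1 / (real L)^10"
      by (simp add: m_def)
  qed
qed

definition step_concl :: "nat \<Rightarrow> nat \<Rightarrow> (3 \<Rightarrow> 'a proc) \<Rightarrow> (3 \<Rightarrow> 3 \<Rightarrow> 'a proc) \<Rightarrow> 3 \<Rightarrow> 3 \<Rightarrow> real
   \<Rightarrow> (3 \<Rightarrow> 'a proc) \<Rightarrow> (3 \<Rightarrow> 3 \<Rightarrow> 'a proc) \<Rightarrow> bool" where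
  "step_concl Be L u r a0 b0 K u' r' \<longleftrightarrow> st (L^Be) u' r'
     \<and> (\<forall>p q t w. sn (1 / real L) (r' p q t w - (if p = a0 \<and> q = b0 then 0 else r p q t w)))
     \<and> (\<forall>m t w. sn (30 * sqrt K) (u' m t w - u m t w))
     \<and> (\<forall>m t w. \<forall>k\<in>kbox (L^12). lk (u' m t w) k = lk (u m t w) k)"

text \<open>\<open>Be\<close> and \<open>L0\<close> are fixed before the approximate solution, so
  one growth exponent serves all steps. The lower bound on K makes sqrt K dominate the contribution
  1/L of corrector and noise increment.\<close>

lemma step_exists:
  "\<exists>Be L0. 2 \<le> Be \<and> 2 \<le> L0 \<and> (\<forall>L\<ge>L0. \<forall>u r a0 b0 K. st L u r \<longrightarrow> 1 / real L \<le> K \<longrightarrow> K \<le> real L \<longrightarrow>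
     (\<forall>t w. sn (K/2) (r a0 b0 t w)) \<longrightarrow> (\<exists>u' r'. step_concl Be L u r a0 b0 K u' r'))"
proof -
  obtain L1 where L1: "\<And>L. L1 \<le> L \<Longrightarrow> real (Suc (Suc (L^5))) * (1/2)^(Suc (L^5)) \<le> 1 / (real L)^100"
    "\<And>L. L1 \<le> L \<Longrightarrow> (1/2)^L \<le> 1 / (real L)^10"
    using large_L by blast
  define p0 where "p0 = nat \<lceil>80 / (1 - 2 * \<alpha>)\<rceil>"
  have p0: "80 \<le> real p0 * (1 - 2 * \<alpha>)"
  proof -
    have "80 / (1 - 2 * \<alpha>) \<le> real p0" unfolding p0_def by linarith
    thus ?thesis using \<alpha> by (simp add: field_simps)
  qed
  define P where "P = 2000 + p0"
  define L0 where "L0 = max (max L1 1000) (nat \<lceil>10^5 * (1 + Cb)^2\<rceil>)"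
  have main: "\<exists>u' r'. step_concl (13 * P) L u r a0 b0 K u' r'"
    if L: "L0 \<le> L" and s: "st L u r" and hK: "1 / real L \<le> K" "K \<le> real L" "\<And>t w. sn (K/2) (r a0 b0 t w)"
    for L u r a0 b0 K
  proof -
    define Z where "Z = real L"
    have L': "L1 \<le> L" "1000 \<le> L" "10^5 * (1 + Cb)^2 \<le> Z"
    proof -
      show "L1 \<le> L" "1000 \<le> L" using L by (auto simp: L0_def)
      have "nat \<lceil>10^5 * (1 + Cb)^2\<rceil> \<le> L" using L by (simp add: L0_def)
      thus "10^5 * (1 + Cb)^2 \<le> Z" unfolding Z_def by linarith
    qed
    have Z: "1000 \<le> Z" using L' by (simp add: Z_def)
    define lam om where "lam = L^P" and "om = real L^(P - 3)"
    \<comment> \<open>At most two of the three coordinates occur in the polarisation, so an axis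
      orthogonal to it exists.\<close>
    have "{a0, b0} \<noteq> (UNIV :: 3 set)"
    proof
      assume e: "{a0, b0} = UNIV"
      have "card {a0, b0} \<le> 2" by (simp add: card_insert_if)
      thus False unfolding e by simp
    qed
    then obtain c :: 3 where "c \<notin> {a0, b0}" by blast
    hence c: "\<not> inc a0 b0 c" by (simp add: inc_def)
    have "0 < 1 / real L" using L' by simp
    hence K0: "0 < K" using hK(1) by linarith
    have om0: "0 < om" using L' by (simp add: om_def)
    have lam0: "0 < lam" using L' by (simp add: lam_def)
    have lo: "real lam / om = Z^3"
    proof -
      have "Z^P = Z^(P - 3) * Z^3" by (simp add: P_def flip: power_add)
      thus ?thesis using Z by (simp add: lam_def om_def Z_def)
    qed
    have J: "6 * (2 * real lam * (pi / om) * real L) \<le> real (L^5)"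
    proof -
      have "6 * (2 * real lam * (pi / om) * real L) = 12 * pi * (real lam / om) * Z" by (simp add: Z_def)
      also have "... = 12 * pi * Z^4" unfolding lo by (simp add: eval_nat_numeral)
      also have "... \<le> Z * Z^4"
      proof (rule mult_right_mono)
        show "12 * pi \<le> Z" using pi_less_4 Z by linarith
      qed simp
      also have "... = real (L^5)" by (simp add: Z_def eval_nat_numeral)
      finally show ?thesis .
    qed
    have gpu: "gp (real L) (L^13) (u m)" "rl (u m t w)" "gp (real L) (L^13) (r p q)" "rl (r p q t w)"
        "(\<Sum>l\<in>UNIV. dv l (u l t w)) = 0" for m t w p q
      using s by (auto simp: st_def)
    interpret wave F "u c" "r a0 b0" "real L" K om "L^13" lam L "L^5"
      using gpu hK K0 om0 lam0 J L' by unfold_locales auto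
    have KX: "K \<le> Z" using hK(2) by (simp add: Z_def)
    note w = wave_sizes[OF refl refl refl refl lam_def om_def _ L'(2) KX[unfolded Z_def]]
    have P1: "1000 \<le> P" by (simp add: P_def)
    have dd: "real dd \<le> Z^19" using w(1)[OF P1] by (simp add: Z_def)
    have lamX: "real lam = Z^P" by (simp add: lam_def Z_def)
    have lamb: "2 * (2 * dd + L^13) \<le> lam"
    proof -
      have "real (2 * (2 * dd + L^13)) = 4 * real dd + 2 * Z^13" by (simp add: Z_def)
      also have "... \<le> 4 * Z^19 + 2 * Z^19" using dd power_increasing[of 13 19 Z] Z by (intro add_mono) auto
      also have "... \<le> Z * Z^19" using Z by (simp add: mult_right_mono flip: distrib_right)
      also have "... \<le> real lam" using w(8)[OF P1] by (simp add: Z_def eval_nat_numeral)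
      finally show ?thesis by linarith
    qed
    interpret step F "u c" "r a0 b0" "real L" K om "L^13" lam L "L^5" u a0 b0 c \<alpha>
      using gpu c \<alpha> lamb by unfold_locales auto
    \<comment> \<open>The power 13 comes from \<open>gp_u'\<close> and \<open>gp_r'\<close>; one
      stage raises L to the power 13 P.\<close>
    define L2 where "L2 = lam^13"
    have XP: "Z^64 \<le> real lam" unfolding lamX using Z by (intro power_increasing) (auto simp: P_def)
    have gB2: "gB \<le> (real lam)^2"
    proof -
      have "Z^63 \<le> Z^64" using Z by (intro power_increasing) auto
      hence "Z^63 * real lam \<le> real lam * real lam" using XP by (intro mult_right_mono) auto
      thus ?thesis using w(3)[OF P1] by (simp add: Z_def power2_eq_square)
    qed
    have gBd2: "gBd \<le> (real lam)^4"
    proof -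
      have "1 \<le> real lam" using lam0 by simp
      hence "real lam \<le> (real lam)^2" by (simp add: power2_eq_square)
      with XP have "Z^64 \<le> (real lam)^2" by (rule order_trans)
      hence "Z^64 * (real lam)^2 \<le> (real lam)^2 * (real lam)^2" by (rule mult_right_mono) simp
      also have "... = (real lam)^4" by (simp flip: power_add)
      finally show ?thesis using w(4)[OF P1] by (simp add: Z_def)
    qed
    have Xl: "Z \<le> real lam" using XP power_increasing[of 1 64 Z] Z by simp
    have lam1: "1 \<le> lam" using lam0 by simp
    have l2: "lam \<le> L2" unfolding L2_def using power_increasing[of 1 13 lam] lam1 by simp
    have Ll: "L \<le> lam" using Xl by (simp add: Z_def)
    interpret stepn F "u c" "r a0 b0" "real L" K om "L^13" lam L "L^5" u a0 b0 c \<alpha> b Lb r L "L2^12" "L2^12"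
    proof unfold_locales
      show "st L u r" by (rule s)
      show "Cb \<le> real lam"
      proof -
        have "Cb \<le> (1 + Cb)^2" using Cb_nonneg by (auto simp: power2_eq_square algebra_simps)
        thus ?thesis using L'(3) Xl Cb_nonneg by simp
      qed
      show "K \<le> real lam" using KX Xl by simp
      show "real L \<le> real lam" using Xl by (simp add: Z_def)
      show "1000 \<le> lam" using Z Xl by linarith
      show "L^12 \<le> L2^12" using Ll l2 by (intro power_mono) auto
      have "6 * lam \<le> lam * lam" using Z Xl by (intro mult_right_mono) auto
      also have "... = lam^2" by (simp add: power2_eq_square)
      also have "... \<le> L2^2" using l2 by (intro power_mono) auto
      also have "... \<le> L2^12" using l2 lam1 by (intro power_increasing) auto
      finally show "6 * lam \<le> L2^12" .
      show "L^13 \<le> lam" unfolding lam_def using L' by (intro power_increasing) (auto simp: P_def)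
    qed (use gB2 gBd2 in auto)
    have dlb: "dl \<le> 1 / Z^100" unfolding dl_def Z_def by (rule L1(1)[OF L'(1)])
    note sz = step_sizes[OF refl refl lam_def om_def _ p0 L'(2) KX[unfolded Z_def] dlb[unfolded Z_def]
        L1(2)[OF L'(1)] L'(3)[unfolded Z_def]]
    have er: "er \<le> 1 / Z" and ewz: "ew + ez \<le> 1 / Z" using sz by (auto simp: P_def Z_def)
    have LL: "1 \<le> L" using L' by simp
    have L2e: "L2 = L^(13 * P)" by (simp add: L2_def lam_def mult.commute flip: power_mult)
    have L22: "2 \<le> L2" using l2 Z Xl by linarith
    have st': "st L2 u' r'"
      unfolding st_def
    proof (intro conjI allI impI)
      show "gp (real L2) (L2^13) (u' m)" for m
      proof (rule gp_mono[OF gp_u'])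
        show "real lam^13 \<le> real L2" by (simp add: L2_def)
        show "L2^12 \<le> L2^13" using L22 by (intro power_increasing) auto
      qed
      have "2 * L2^12 \<le> L2 * L2^12" by (intro mult_right_mono L22) simp
      also have "L2 * L2^12 = L2^13" by (simp flip: power_Suc)
      finally have "2 * L2^12 \<le> L2^13" .
      thus "gp (real L2) (L2^13) (r' p q)" for p q
        by (rule gp_mono[OF gp_r', rotated]) (simp add: L2_def)
    qed (auto intro: rl_u' rl_r' div_u' eq_u')
    have "step_concl (13 * P) L u r a0 b0 K u' r'"
      unfolding step_concl_def
    proof (intro conjI allI ballI)
      show "st (L^(13 * P)) u' r'" using st' by (simp add: L2e)
      show "sn (1 / real L) (r' p q t w - (if p = a0 \<and> q = b0 then 0 else r p q t w))" for p q t w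
        using er by (intro sn_mono[OF sn_r'[OF LL]]) (simp add: Z_def)
      have sK: "1 / Z \<le> sqrt K"
      proof (rule real_le_rsqrt)
        have "(1 / Z)^2 \<le> 1 / Z" using Z by (simp add: power2_eq_square field_simps)
        thus "(1 / Z)^2 \<le> K" using hK(1) by (simp add: Z_def)
      qed
      show "sn (30 * sqrt K) (u' m t w - u m t w)" for m t w
        by (rule sn_mono[OF sn_u'[OF LL]]) (use ewz sK real_sqrt_ge_zero[OF less_imp_le[OF K0]] in linarith)
      have "2 * L^12 < lam"
      proof -
        have "2 * L^12 < L * L^12" using L' by (intro mult_strict_right_mono) auto
        also have "L * L^12 = L^13" by (simp flip: power_Suc)
        also have "... \<le> lam" unfolding lam_def using L' by (intro power_increasing) (auto simp: P_def)
        finally show ?thesis .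
      qed
      thus "lk (u' m t w) k = lk (u m t w) k" if "k \<in> kbox (L^12)" for m t w k
        using low_modes[OF that] by simp
    qed
    thus ?thesis by blast
  qed
  show ?thesis
    by (rule exI[of _ "13 * P"], rule exI[of _ L0]) (use main in \<open>auto simp: P_def L0_def\<close>)
qed

end

subsection \<open>The initial approximate solution\<close>

context noise
begin

text \<open>Equals 2 cos x_2, hence the factor 1/2 in \<open>v0\<close>.\<close>

definition Y0 :: tpoly where "Y0 = sg (pj 2 1 1) 1 + sg (pj 2 1 (-1)) 1"

definition v0 :: "real \<Rightarrow> real \<Rightarrow> 3 \<Rightarrow> real \<Rightarrow> tpoly" where
  "v0 A T m t = (if m = 1 then cst (of_real (A * sin (t / T) / 2)) * Y0 else 0)"

definition v1 :: "real \<Rightarrow> real \<Rightarrow> 3 \<Rightarrow> real \<Rightarrow> tpoly" where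
  "v1 A T m t = (if m = 1 then cst (of_real (A / T * cos (t / T) / 2)) * Y0 else 0)"

lemma dg_Y0: "dg 1 Y0"
  unfolding Y0_def by (intro dg_add dg_single) (auto simp: kbox_def pj_def)

lemma an_Y0: "an Y0 \<le> 2"
  unfolding Y0_def by (rule order_trans[OF an_triangle]) simp

lemma rl_Y0: "rl Y0"
proof -
  have "pj 2 1 (-1) = - pj 2 1 1" by (simp add: pj_def vec_eq_iff)
  thus ?thesis by (simp add: rl_def Y0_def)
qed

lemma lk_Y0_zero: "lk Y0 0 = 0"
proof -
  have "pj 2 1 1 \<noteq> 0" "pj 2 1 (-1) \<noteq> 0" by (auto simp: pj_def vec_eq_iff)
  thus ?thesis by (simp add: Y0_def lookup_add lookup_single when_def)
qed

lemma dv_Y0: "l \<noteq> 2 \<Longrightarrow> dv l Y0 = 0"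
proof -
  assume l: "l \<noteq> 2"
  hence "cst (dsym l (pj 2 1 j)) = 0" for j
    by (simp add: cst_def dsym_def pj_def)
  thus ?thesis by (simp add: Y0_def mulp_add dv_single)
qed

lemma an_v:
  assumes "0 < T" "0 \<le> A"
  shows "an (v0 A T m t) \<le> A" "an (v1 A T m t) \<le> A / T"
    "an (v0 A T m t - v0 A T m s) \<le> A / T * \<bar>t - s\<bar>" "an (v1 A T m t - v1 A T m s) \<le> A / T / T * \<bar>t - s\<bar>"
proof -
  have c: "an (cst (of_real (c * x / 2)) * Y0) \<le> c * a" if "\<bar>x\<bar> \<le> a" "0 \<le> c" for c x a :: real
  proof -
    have "an (cst (of_real (c * x / 2)) * Y0) \<le> \<bar>c * x / 2\<bar> * an Y0"
      using an_mult[of "cst (of_real (c * x / 2))" Y0] by (simp only: an_cst norm_of_real)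
    also have "... \<le> \<bar>c * x / 2\<bar> * 2" by (intro mult_left_mono an_Y0) auto
    also have "... = c * \<bar>x\<bar>" using that by (simp add: abs_mult)
    also have "... \<le> c * a" using that by (intro mult_left_mono)
    finally show ?thesis .
  qed
  have lip: "\<bar>sin (t / T) - sin (s / T)\<bar> \<le> 1 / T * \<bar>t - s\<bar>" "\<bar>cos (t / T) - cos (s / T)\<bar> \<le> 1 / T * \<bar>t - s\<bar>"
  proof -
    have "((\<lambda>t. sin (t / T)) has_real_derivative cos (x / T) * (1 / T)) (at x)"
      "((\<lambda>t. cos (t / T)) has_real_derivative - sin (x / T) * (1 / T)) (at x)" for x
      using assms(1) by (auto intro!: derivative_eq_intros)
    moreover have "\<bar>cos (x / T) * (1 / T)\<bar> \<le> 1 / T" "\<bar>- sin (x / T) * (1 / T)\<bar> \<le> 1 / T" for x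
      using assms(1) by (auto simp: abs_mult divide_right_mono)
    ultimately show "\<bar>sin (t / T) - sin (s / T)\<bar> \<le> 1 / T * \<bar>t - s\<bar>" "\<bar>cos (t / T) - cos (s / T)\<bar> \<le> 1 / T * \<bar>t - s\<bar>"
      by (intro real_lip; blast)+
  qed
  show "an (v0 A T m t) \<le> A" using c[of "sin (t / T)" 1 A] assms by (simp add: v0_def)
  show "an (v1 A T m t) \<le> A / T" using c[of "cos (t / T)" 1 "A / T"] assms by (simp add: v1_def)
  show "an (v0 A T m t - v0 A T m s) \<le> A / T * \<bar>t - s\<bar>"
  proof -
    have "v0 A T m t - v0 A T m s = (if m = 1 then cst (of_real (A * (sin (t / T) - sin (s / T)) / 2)) * Y0 else 0)"
      by (rule ev_eqI) (simp add: v0_def algebra_simps diff_divide_distrib)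
    thus ?thesis using c[OF lip(1), of A] assms by simp
  qed
  show "an (v1 A T m t - v1 A T m s) \<le> A / T / T * \<bar>t - s\<bar>"
  proof -
    have "v1 A T m t - v1 A T m s = (if m = 1 then cst (of_real (A / T * (cos (t / T) - cos (s / T)) / 2)) * Y0 else 0)"
      by (rule ev_eqI) (simp add: v1_def algebra_simps diff_divide_distrib)
    thus ?thesis using c[OF lip(2), of "A / T"] assms by simp
  qed
qed

lemma gp_v:
  assumes "0 < T" "0 \<le> A"
  shows "gp (A / T + 2 * A) 1 (\<lambda>t w. v0 A T m t)" "gp (A / T / T + 2 * (A / T)) 1 (\<lambda>t w. v1 A T m t)"
proof -
  have d: "dg 1 (v0 A T m t)" "dg 1 (v1 A T m t)" for t
    using dg_cst_mult[OF dg_Y0] by (simp_all add: v0_def v1_def)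
  have ab: "\<bar>t - s\<bar> = t - s" if "s < t" for s t :: real using that by simp
  have l0: "an (v0 A T m t - v0 A T m s) \<le> A / T * (t - s)" if "s < t" for s t
    using an_v(3)[OF assms, of m t s] by (simp only: ab[OF that])
  have l1: "an (v1 A T m t - v1 A T m s) \<le> A / T / T * (t - s)" if "s < t" for s t
    using an_v(4)[OF assms, of m t s] by (simp only: ab[OF that])
  have nn: "0 \<le> A / T" "0 \<le> A / T / T" using assms by auto
  show "gp (A / T + 2 * A) 1 (\<lambda>t w. v0 A T m t)"
    by (rule gp_lip[OF d(1) an_v(1)[OF assms] l0 ad_time nn(1)])
  show "gp (A / T / T + 2 * (A / T)) 1 (\<lambda>t w. v1 A T m t)"
    by (rule gp_lip[OF d(2) an_v(2)[OF assms] l1 ad_time nn(2)])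
qed

lemma v0_int:
  assumes "0 < T" and that: "0 \<le> t"
  shows "((\<lambda>s. lk (v1 A T m s) k) has_integral lk (v0 A T m t) k - lk (v0 A T m 0) k) {0..t}"
proof (cases "m = 1")
  case True
  have "((\<lambda>t. complex_of_real (A * sin (t / T) / 2)) has_vector_derivative of_real (A / T * cos (x / T) / 2)) (at x within {0..t})" for x
  proof -
    have "((\<lambda>t. sin (t / T)) has_real_derivative cos (x / T) * (1 / T)) (at x)"
      using assms(1) by (auto intro!: derivative_eq_intros)
    hence "((\<lambda>t. A * sin (t / T) / 2) has_real_derivative A * (cos (x / T) * (1 / T)) / 2) (at x)"
      by (intro DERIV_cdivide DERIV_cmult)
    hence "((\<lambda>t. A * sin (t / T) / 2) has_real_derivative A / T * cos (x / T) / 2) (at x)" by simp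
    thus ?thesis by (rule has_vector_derivative_of_real[OF has_field_derivative_at_within])
  qed
  hence "((\<lambda>t. complex_of_real (A * sin (t / T) / 2) * lk Y0 k) has_vector_derivative of_real (A / T * cos (x / T) / 2) * lk Y0 k) (at x within {0..t})" for x
    by (rule has_vector_derivative_mult_left)
  from fundamental_theorem_of_calculus[OF that this]
  have "((\<lambda>x. of_real (A / T * cos (x / T) / 2) * lk Y0 k) has_integral
    of_real (A * sin (t / T) / 2) * lk Y0 k - of_real (A * sin (0 / T) / 2) * lk Y0 k) {0..t}" .
  moreover have "lk (v1 A T m s) k = of_real (A / T * cos (s / T) / 2) * lk Y0 k"
    "lk (v0 A T m s) k = of_real (A * sin (s / T) / 2) * lk Y0 k" for s
    by (simp_all only: v0_def v1_def True refl if_True lk_cst_mult)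
  ultimately show ?thesis by (simp only:)
qed (simp add: v0_def v1_def)

definition ui :: "nat \<Rightarrow> real \<Rightarrow> real \<Rightarrow> 3 \<Rightarrow> 'a proc" where
  "ui L A T m t w = bt (L^12) m t w + v0 A T m t"
definition Si :: "nat \<Rightarrow> real \<Rightarrow> real \<Rightarrow> real \<Rightarrow> 'a \<Rightarrow> tmat" where
  "Si L A T t w m l = bt (L^12) m t w * bt (L^12) l t w + bt (L^12) m t w * v0 A T l t + v0 A T m t * bt (L^12) l t w"
definition fi :: "nat \<Rightarrow> real \<Rightarrow> real \<Rightarrow> real \<Rightarrow> 'a \<Rightarrow> tvec" where
  "fi L A T t w l = v1 A T l t + mulp (lsym \<alpha>) (ui L A T l t w)"
definition ri :: "nat \<Rightarrow> real \<Rightarrow> real \<Rightarrow> 3 \<Rightarrow> 3 \<Rightarrow> 'a proc" where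
  "ri L A T p q t w = dec (Si L A T t w) p q + dec (adv (fi L A T t w)) p q"

text \<open>The shear flow depends on x_2 only and points in direction 1, so its self-interaction
  has no divergence. The stress \<open>ri\<close> can therefore do without a term quadratic in A,
  and the tested right-hand side is the time derivative \<open>v1\<close> of the shear flow.\<close>

lemma rhs_init:
  assumes e: "(\<Sum>m\<in>UNIV. e m * of_int (n $ m)) = 0"
  shows "(\<Sum>m\<in>UNIV. e m * lk (rhs \<alpha> (\<lambda>m. ui L A T m t w) (\<lambda>p q. ri L A T p q t w) m) n)
     = (\<Sum>m\<in>UNIV. e m * lk (v1 A T m t) n)"
proof -
  let ?f = "fi L A T t w" and ?u = "\<lambda>m. ui L A T m t w"
  have s: "strs (\<lambda>p q. ri L A T p q t w) m l = Si L A T t w m l + adv ?f m l" for m l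
  proof -
    have 1: "strs (dec (Si L A T t w)) m l = Si L A T t w m l"
      by (rule strs_dec) (simp add: Si_def algebra_simps)
    have 2: "strs (dec (adv ?f)) m l = adv ?f m l"
      by (rule strs_dec) (simp add: adv_def add.commute)
    show ?thesis unfolding ri_def using strs_add[of "dec (Si L A T t w)" "dec (adv ?f)" m l] 1 2 by simp
  qed
  have vv: "dv l (v0 A T m t * v0 A T l t) = 0" for m l
    using dv_Y0[of l] by (auto simp: v0_def dv_mult dv_cst_mult)
  have B: "rhs \<alpha> ?u (\<lambda>p q. ri L A T p q t w) m = (\<Sum>l\<in>UNIV. dv l (adv ?f m l)) - (?f m - v1 A T m t)" for m
  proof -
    have "strs (\<lambda>p q. ri L A T p q t w) m l - ?u m * ?u l = adv ?f m l - v0 A T m t * v0 A T l t" for l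
      unfolding s by (simp add: Si_def ui_def algebra_simps)
    thus ?thesis by (simp add: rhs_def mulp_diff vv fi_def)
  qed
  show ?thesis
  proof (cases "n = 0")
    case True
    have "lk (?f m) 0 = 0" "lk (v1 A T m t) 0 = 0" for m
      using \<alpha> lk_Y0_zero by (auto simp: fi_def v1_def lookup_add lsym_def)
    thus ?thesis by (simp add: B True lookup_minus lookup_sum dsym_def)
  next
    case False
    define c where "c = (\<Sum>l\<in>UNIV. of_int (n $ l) * lk (?f l) n) / of_real (knorm2 n)"
    have "e m * lk (rhs \<alpha> ?u (\<lambda>p q. ri L A T p q t w) m) n = e m * lk (v1 A T m t) n + e m * of_int (n $ m) * c" for m
      using adv_mode[OF False, of ?f m] by (simp add: B lookup_minus lookup_sum c_def distrib_left mult.assoc)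
    hence "(\<Sum>m\<in>UNIV. e m * lk (rhs \<alpha> ?u (\<lambda>p q. ri L A T p q t w) m) n) =
       (\<Sum>m\<in>UNIV. e m * lk (v1 A T m t) n) + (\<Sum>m\<in>UNIV. e m * of_int (n $ m)) * c"
      by (simp only: sum.distrib sum_distrib_right)
    thus ?thesis using e by simp
  qed
qed

text \<open>The bound C A is linear in A and uniform in L, which may still be enlarged after A is
  chosen.\<close>

lemma init_exists:
  assumes T: "0 < T"
  shows "\<exists>C. 1 \<le> C \<and> (\<forall>A\<ge>1. \<exists>L1. \<forall>L\<ge>L1. st L (ui L A T) (ri L A T) \<and> (\<forall>p q t w. sn (C * A) (ri L A T p q t w)))"
proof -
  define C where "C = 5 * (Cb * Cb + Cb + Cb) + 5 * (2 * (1 / T + Cb + 1)) + 1"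
  have C1: "1 \<le> C" using T Cb_nonneg by (simp add: C_def)
  have "\<exists>L1. \<forall>L\<ge>L1. st L (ui L A T) (ri L A T) \<and> (\<forall>p q t w. sn (C * A) (ri L A T p q t w))" if A: "1 \<le> A" for A
  proof -
    have A0: "0 \<le> A" using A by simp
    define cu where "cu = Cb + (A / T + 2 * A)"
    define cv where "cv = A / T / T + 2 * (A / T)"
    have cu0: "0 \<le> cu" "Cb \<le> cu" "A / T + 2 * A \<le> cu" using Cb_nonneg A T by (auto simp: cu_def)
    have cv0: "0 \<le> cv" using A T by (simp add: cv_def)
    define cr where "cr = 5 * (2 * cu * cu + 2 * cu * cu + 2 * cu * cu) + 5 * ((cv + cu) + (cv + cu))"
    have "st L (ui L A T) (ri L A T) \<and> (\<forall>p q t w. sn (C * A) (ri L A T p q t w))"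
      if L: "max 4 (nat \<lceil>max cu cr\<rceil>) \<le> L" for L
    proof
      have L4: "4 \<le> L" and "nat \<lceil>max cu cr\<rceil> \<le> L" using L by auto
      hence "max cu cr \<le> real L" by linarith
      hence Lc: "cu \<le> real L" "cr \<le> real L" by auto
      have d1: "1 \<le> L^12" using L4 by simp
      have d2: "2 * L^12 \<le> L^13"
      proof -
        have "2 * L^12 \<le> L * L^12" using L4 by (intro mult_right_mono) auto
        thus ?thesis by (simp flip: power_Suc)
      qed
      have gu: "gp cu (L^12) (ui L A T m)" for m
        unfolding ui_def[abs_def] cu_def
        by (intro gp_add gp_bt gp_mono[OF gp_v(1)[OF T A0]]) (use d1 in auto)
      have gb: "gp cu (L^12) (bt (L^12) m)" for m by (rule gp_mono[OF gp_bt]) (use cu0 in auto)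
      have gv: "gp cu (L^12) (\<lambda>t w. v0 A T m t)" for m by (rule gp_mono[OF gp_v(1)[OF T A0]]) (use cu0 d1 in auto)
      have gv1: "gp cv (L^12) (\<lambda>t w. v1 A T m t)" for m
        unfolding cv_def by (rule gp_mono[OF gp_v(2)[OF T A0]]) (use d1 in auto)
      have gS: "gp (2 * cu * cu + 2 * cu * cu + 2 * cu * cu) (L^12 + L^12) (\<lambda>t w. Si L A T t w m l)" for m l
        unfolding Si_def by (intro gp_add gp_mult gb gv)
      have giv: "gp (cv + cu) (L^12) (\<lambda>t w. iv m (fi L A T t w l))" for m l
      proof -
        have "gp (cv + cu) (L^12) (\<lambda>t w. iv m (v1 A T l t) + iv m (mulp (lsym \<alpha>) (ui L A T l t w)))"
          by (intro gp_add gp_iv gv1 gp_ivl gu \<alpha>)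
        thus ?thesis by (simp add: fi_def mulp_add)
      qed
      have gA: "gp ((cv + cu) + (cv + cu)) (L^12 + L^12) (\<lambda>t w. adv (fi L A T t w) m l)" for m l
        unfolding adv_def by (intro gp_add gp_mono[OF giv]) auto
      have gr: "gp cr (L^12 + L^12) (ri L A T p q)" for p q
        unfolding ri_def[abs_def] cr_def by (intro gp_add gp_dec gS gA)
      have rv: "rl (v0 A T m t)" "rl (v1 A T m t)" for m t
        unfolding v0_def v1_def by (auto intro!: rl_mult rl_cst rl_Y0)
      have ru: "rl (ui L A T m t w)" for m t w unfolding ui_def by (intro rl_add rl_bt rv)
      have dz: "(\<Sum>l\<in>UNIV. dv l (ui L A T l t w)) = 0" for t w
      proof -
        have "dv l (v0 A T l t) = 0" for l
          using dv_Y0[of l] by (auto simp: v0_def dv_cst_mult)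
        thus ?thesis using div_bt[of "L^12" t w] by (simp add: ui_def mulp_add sum.distrib)
      qed
      show "st L (ui L A T) (ri L A T)"
        unfolding st_def
      proof (intro conjI allI impI)
        show "gp (real L) (L^13) (ui L A T m)" for m
          by (rule gp_mono[OF gu]) (use Lc d2 in auto)
        show "gp (real L) (L^13) (ri L A T p q)" for p q
          by (rule gp_mono[OF gr]) (use Lc d2 in auto)
        show "rl (ri L A T p q t w)" for p q t w
        proof -
          have "rl (Si L A T t w m l)" for m l unfolding Si_def by (intro rl_add rl_mult rl_bt rv)
          moreover have "rl (adv (fi L A T t w) m l)" for m l
            unfolding adv_def fi_def by (intro rl_add rl_iv rl_lsym ru rv)
          ultimately show ?thesis unfolding ri_def dec_def by (auto intro!: rl_add rl_diff rl_mult rl_cst rl_sum)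
        qed
        fix w :: 'a and n :: freq and e :: "3 \<Rightarrow> complex" and t :: real assume e: "(\<Sum>m\<in>UNIV. e m * of_int (n $ m)) = (0::complex)" and t: "0 \<le> t"
        have z: "lk (bt (L^12) m 0 w) n = 0" for m by (simp add: lk_bt b_neg)
        have "((\<lambda>s. \<Sum>m\<in>UNIV. e m * lk (v1 A T m s) n) has_integral (\<Sum>m\<in>UNIV. e m * (lk (v0 A T m t) n - lk (v0 A T m 0) n))) {0..t}"
          by (intro has_integral_sum has_integral_mult_right v0_int T t) auto
        thus "((\<lambda>s. \<Sum>m\<in>UNIV. e m * lk (rhs \<alpha> (\<lambda>m. ui L A T m s w) (\<lambda>p q. ri L A T p q s w) m) n) has_integral
          (\<Sum>m\<in>UNIV. e m * (lk (ui L A T m t w) n - lk (ui L A T m 0 w) n - lk (bt (L^12) m t w) n))) {0..t}"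
          unfolding rhs_init[OF e] by (simp add: ui_def lookup_add z)
      qed (auto intro: ru dz)
      show "\<forall>p q t w. sn (C * A) (ri L A T p q t w)"
      proof (intro allI)
        fix p q t w
        have sb: "sn Cb (bt (L^12) m t w)" for m by (rule sn_an[OF an_bt])
        have sv: "sn A (v0 A T m t)" for m by (rule sn_an[OF an_v(1)[OF T A0]])
        have 1: "sn (5 * (Cb * Cb + Cb * A + A * Cb)) (dec (Si L A T t w) p q)"
          unfolding Si_def by (intro sn_dec sn_add sn_mult sb sv)
        have i: "sn (A / T + (Cb + A)) (iv m (fi L A T t w l))" for m l
        proof -
          have a: "an (iv m (v1 A T l t)) \<le> A / T" by (rule order_trans[OF an_iv an_v(2)[OF T A0]])
          have "an (ui L A T l t w) \<le> Cb + A" unfolding ui_def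
            by (rule order_trans[OF an_triangle add_mono[OF an_bt an_v(1)[OF T A0]]])
          hence "an (iv m (mulp (lsym \<alpha>) (ui L A T l t w))) \<le> Cb + A"
            by (rule order_trans[OF an_ivl[OF \<alpha>]])
          hence "sn (A / T + (Cb + A)) (iv m (v1 A T l t) + iv m (mulp (lsym \<alpha>) (ui L A T l t w)))"
            by (intro sn_add sn_an a)
          thus ?thesis by (simp add: fi_def mulp_add)
        qed
        have "sn (5 * ((A / T + (Cb + A)) + (A / T + (Cb + A)))) (dec (adv (fi L A T t w)) p q)"
          unfolding adv_def by (intro sn_dec sn_add i)
        with 1 have "sn (5 * (Cb * Cb + Cb * A + A * Cb) + 5 * ((A / T + (Cb + A)) + (A / T + (Cb + A)))) (ri L A T p q t w)"
          unfolding ri_def by (rule sn_add)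
        thus "sn (C * A) (ri L A T p q t w)"
        proof (rule sn_mono)
          have "Cb * Cb * 1 \<le> Cb * Cb * A" "Cb * 1 \<le> Cb * A" using A Cb_nonneg by (intro mult_left_mono; auto)+
          thus "5 * (Cb * Cb + Cb * A + A * Cb) + 5 * ((A / T + (Cb + A)) + (A / T + (Cb + A))) \<le> C * A"
            using A by (simp add: C_def algebra_simps)
        qed
      qed
    qed
    thus ?thesis by blast
  qed
  thus ?thesis using C1 by blast
qed

end

subsection \<open>The iteration\<close>

text \<open>\<open>rho dir l c q d\<close> bounds the stress coefficient \<open>d\<close> after \<open>q\<close> steps, where step \<open>q\<close> treats \<open>dir q\<close>.\<close>

fun rho :: "(nat \<Rightarrow> 'd) \<Rightarrow> (nat \<Rightarrow> real) \<Rightarrow> real \<Rightarrow> nat \<Rightarrow> 'd \<Rightarrow> real" where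
  "rho dir l c 0 d = c"
| "rho dir l c (Suc q) d = (if dir q = d then 0 else rho dir l c q d) + 1 / l q"

text \<open>Since l at least doubles, 1/l q <= 2/l q - 2/l (q+1), and the errors telescope. After
  the treatment at step j only the errors from step j on remain.\<close>

lemma rho_bounds:
  assumes l: "\<And>q. 2 * l q \<le> l (Suc q)" "\<And>q. 0 < l q" and c: "0 \<le> c"
  shows "rho dir l c q d \<le> c + 2 / l 0 - 2 / l q"
    and "j < q \<Longrightarrow> dir j = d \<Longrightarrow> rho dir l c q d \<le> 2 / l j - 2 / l q"
proof -
  have s: "1 / l q \<le> 2 / l q - 2 / l (Suc q)" for q
  proof -
    have "2 / l (Suc q) \<le> 2 / (2 * l q)" using l by (intro divide_left_mono mult_pos_pos) auto
    thus ?thesis by simp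
  qed
  have mono: "2 / l q \<le> 2 / l j" if "j \<le> q" for j q
    using that
  proof (induction q rule: dec_induct)
    case (step n)
    have "l n \<le> l (Suc n)" using l(1)[of n] l(2)[of n] by linarith
    hence "2 / l (Suc n) \<le> 2 / l n" using l by (intro divide_left_mono mult_pos_pos) auto
    thus ?case using step by linarith
  qed simp
  show "rho dir l c q d \<le> c + 2 / l 0 - 2 / l q"
  proof (induction q)
    case (Suc q)
    have "(if dir q = d then 0 else rho dir l c q d) \<le> c + 2 / l 0 - 2 / l q"
      using Suc c mono[of 0 q] by simp
    thus ?case using s[of q] by simp
  qed simp
  show "j < q \<Longrightarrow> dir j = d \<Longrightarrow> rho dir l c q d \<le> 2 / l j - 2 / l q"
  proof (induction q)
    case (Suc q)
    show ?case
    proof (cases "j = q")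
      case True
      thus ?thesis using Suc s[of q] by simp
    next
      case False
      hence "(if dir q = d then 0 else rho dir l c q d) \<le> 2 / l j - 2 / l q"
        using Suc mono[of j q] by simp
      thus ?thesis using s[of q] by simp
    qed
  qed simp
qed

definition Lq :: "nat \<Rightarrow> nat \<Rightarrow> nat \<Rightarrow> nat" where "Lq Be L q = L^(Be^q)"

lemma Lq_Suc: "Lq Be L (Suc q) = (Lq Be L q)^Be"
  by (simp add: Lq_def mult.commute flip: power_mult)

lemma Lq_ge: "1 \<le> Be \<Longrightarrow> 1 \<le> L \<Longrightarrow> L \<le> Lq Be L q"
  unfolding Lq_def using power_increasing[of 1 "Be^q" L] by simp

text \<open>During the first nine steps some coefficient may be untreated, and only a bound by the
  initial stress is available. Later each coefficient was treated within the last nine steps, so its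
  bound is 2/l (q-9), and K is twice that.\<close>

definition Kq :: "nat \<Rightarrow> nat \<Rightarrow> real \<Rightarrow> nat \<Rightarrow> real" where
  "Kq Be L c q = (if q < 9 then c else 4 / real (Lq Be L (q - 9)))"

context noise
begin

definition good_seq :: "nat \<Rightarrow> nat \<Rightarrow> real \<Rightarrow> (nat \<Rightarrow> 3 \<Rightarrow> 'a proc) \<Rightarrow> (nat \<Rightarrow> 3 \<Rightarrow> 3 \<Rightarrow> 'a proc) \<Rightarrow> bool" where
  "good_seq Be L c U R \<longleftrightarrow> (\<forall>q. st (Lq Be L q) (U q) (R q)
     \<and> (\<forall>m t w. sn (30 * sqrt (Kq Be L c q)) (U (Suc q) m t w - U q m t w))
     \<and> (\<forall>m t w. \<forall>k\<in>kbox ((Lq Be L q)^12). lk (U (Suc q) m t w) k = lk (U q m t w) k)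
     \<and> (9 \<le> q \<longrightarrow> (\<forall>a d t w. sn (2 / real (Lq Be L (q - 9))) (R q a d t w))))"

lemma sequence_exists:
  assumes T: "0 < T"
  shows "\<exists>Be C. 2 \<le> Be \<and> 1 \<le> C \<and> (\<forall>A\<ge>1. \<exists>L U R. 2 \<le> L \<and> C * A \<le> real L \<and> U 0 = ui L A T \<and> good_seq Be L (C * A) U R)"
proof -
  obtain C1 where C1: "1 \<le> C1" "\<And>A. 1 \<le> A \<Longrightarrow> \<exists>L1. \<forall>L\<ge>L1. st L (ui L A T) (ri L A T) \<and> (\<forall>p q t w. sn (C1 * A) (ri L A T p q t w))"
    using init_exists[OF T] by blast
  obtain Be L0 where "2 \<le> Be \<and> 2 \<le> L0 \<and> (\<forall>L\<ge>L0. \<forall>u r a0 b0 K. st L u r \<longrightarrow> 1 / real L \<le> K \<longrightarrow> K \<le> real L \<longrightarrow>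
     (\<forall>t w. sn (K/2) (r a0 b0 t w)) \<longrightarrow> (\<exists>u' r'. step_concl Be L u r a0 b0 K u' r'))"
    using step_exists by (elim exE)
  note Be0 = this
  have Be: "2 \<le> Be" "2 \<le> L0" using Be0 by simp_all
  have step: "L0 \<le> L \<Longrightarrow> st L u r \<Longrightarrow> 1 / real L \<le> K \<Longrightarrow> K \<le> real L \<Longrightarrow>
     (\<And>t w. sn (K/2) (r a0 b0 t w)) \<Longrightarrow> \<exists>u' r'. step_concl Be L u r a0 b0 K u' r'" for L u r a0 b0 K
    using Be0[THEN conjunct2, THEN conjunct2, rule_format] by simp
  \<comment> \<open>K must be twice the stress bound C1 A + 1, and A >= 1.\<close>
  define C where "C = 2 * C1 + 2"
  have "\<exists>h. bij_betw h {0..<card (UNIV :: (3 \<times> 3) set)} (UNIV :: (3 \<times> 3) set)"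
    by (rule ex_bij_betw_nat_finite) simp
  then obtain h :: "nat \<Rightarrow> 3 \<times> 3" where h: "bij_betw h {0..<9} UNIV" by auto
  define dir where "dir q = h (q mod 9)" for q
  \<comment> \<open>Nine consecutive steps meet every residue class and hence every pair of
    indices.\<close>
  have cover: "\<exists>j. q - 9 \<le> j \<and> j < q \<and> dir j = d" if "9 \<le> q" for q d
  proof -
    obtain i where i: "i < 9" "h i = d" using h unfolding bij_betw_def by (metis UNIV_I atLeastLessThan_iff imageE)
    define s where "s = (i + 9 - (q mod 9)) mod 9"
    have "(q - 9 + s) mod 9 = i"
    proof -
      have "(q - 9 + s) mod 9 = ((q - 9) mod 9 + (i + 9 - (q mod 9))) mod 9" by (simp only: s_def mod_add_right_eq mod_add_left_eq)
      also have "(q - 9) mod 9 = q mod 9" using that by (metis le_mod_geq)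
      also have "(q mod 9 + (i + 9 - (q mod 9))) mod 9 = (i + 9) mod 9"
      proof -
        have "q mod 9 \<le> i + 9" by (rule order_trans[OF less_imp_le[OF mod_less_divisor]]) auto
        thus ?thesis by simp
      qed
      finally show ?thesis using i by simp
    qed
    moreover have "s < 9" by (simp add: s_def)
    ultimately show ?thesis using that i by (intro exI[of _ "q - 9 + s"]) (auto simp: dir_def)
  qed
  have main: "\<exists>L U R. 2 \<le> L \<and> C * A \<le> real L \<and> U 0 = ui L A T \<and> good_seq Be L (C * A) U R" if A: "1 \<le> A" for A
  proof -
    obtain L1 where L1: "\<And>L. L1 \<le> L \<Longrightarrow> st L (ui L A T) (ri L A T) \<and> (\<forall>p q t w. sn (C1 * A) (ri L A T p q t w))"
      using C1(2)[OF A] by blast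
    define L where "L = max (max L0 L1) (nat \<lceil>C * A\<rceil>)"
    have L: "L0 \<le> L" "L1 \<le> L" "2 \<le> L" using Be by (auto simp: L_def)
    have CAL: "C * A \<le> real L"
    proof -
      have "nat \<lceil>C * A\<rceil> \<le> L" by (simp add: L_def)
      thus ?thesis by linarith
    qed
    define l where "l q = real (Lq Be L q)" for q
    have lL: "L \<le> Lq Be L q" for q using Be L by (intro Lq_ge) auto
    have l2: "2 * l q \<le> l (Suc q)" for q
    proof -
      have "2 \<le> Lq Be L q" using lL[of q] L by linarith
      hence "2 * Lq Be L q \<le> (Lq Be L q)^2" by (simp add: power2_eq_square)
      also have "... \<le> (Lq Be L q)^Be" using Be \<open>2 \<le> Lq Be L q\<close> by (intro power_increasing) auto
      finally show ?thesis unfolding l_def Lq_Suc by linarith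
    qed
    have l0: "2 \<le> l q" for q using lL[of q] L unfolding l_def by linarith
    have lp: "0 < l q" for q using l0[of q] by linarith
    define c where "c = C1 * A"
    have c0: "0 \<le> c" using C1 A by (simp add: c_def)
    have CA1: "1 \<le> C * A" using C1 A mult_mono[of 1 C 1 A] by (simp add: C_def)
    note rb = rho_bounds[where l=l and c=c and dir=dir, OF l2 lp c0]
    have all: "rho dir l c q d \<le> c + 1" for q d
    proof -
      have "2 / l 0 \<le> 1" "0 \<le> 2 / l q" using l0[of 0] lp[of q] by auto
      thus ?thesis using rb(1)[of q d] by linarith
    qed
    have late: "rho dir l c q d \<le> 2 / l (q - 9)" if "9 \<le> q" for q d
    proof -
      obtain j where j: "q - 9 \<le> j" "j < q" "dir j = d" using cover[OF \<open>9 \<le> q\<close>] by blast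
      have lm: "l (q - 9) \<le> l j" using j(1)
      proof (induction j rule: dec_induct)
        case (step n)
        thus ?case using l2[of n] lp[of n] by linarith
      qed simp
      have "rho dir l c q d \<le> 2 / l j - 2 / l q" by (rule rb(2)[OF j(2,3)])
      also have "... \<le> 2 / l j" using lp[of q] by simp
      also have "... \<le> 2 / l (q - 9)" using lm lp by (intro divide_left_mono mult_pos_pos) auto
      finally show ?thesis .
    qed
    define K where "K q = Kq Be L (C * A) q" for q
    have K: "rho dir l c q d \<le> K q / 2" "1 / l q \<le> K q" "K q \<le> l q" for q d
    proof -
      have lq1: "1 / l q \<le> 1" using l0[of q] by simp
      have "rho dir l c q d \<le> K q / 2 \<and> 1 / l q \<le> K q \<and> K q \<le> l q"
      proof (cases "q < 9")
        case True
        have "c + 1 \<le> C * A / 2" using A by (simp add: c_def C_def algebra_simps)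
        moreover have "C * A \<le> l q" using CAL lL[of q] unfolding l_def by linarith
        moreover have "1 / l q \<le> C * A" using lq1 CA1 by linarith
        moreover have "K q = C * A" using True by (simp add: K_def Kq_def)
        ultimately show ?thesis using all[of q d] by (intro conjI) linarith+
      next
        case False
        have "1 / l q \<le> 4 / l (q - 9)"
        proof -
          have "l (q - 9) \<le> l (q - 9 + n)" for n
          proof (induction n)
            case (Suc n)
            thus ?case using l2[of "q - 9 + n"] lp[of "q - 9 + n"] by simp
          qed simp
          from this[of 9] have "l (q - 9) \<le> l q" using False by simp
          hence "1 / l q \<le> 1 / l (q - 9)" using lp by (intro divide_left_mono mult_pos_pos) auto
          also have "... \<le> 4 / l (q - 9)" using lp[of "q - 9"] by (intro divide_right_mono) auto
          finally show ?thesis .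
        qed
        moreover have "4 / l (q - 9) \<le> l q"
        proof -
          have "4 / l (q - 9) \<le> 2" using l0[of "q - 9"] lp[of "q - 9"] by (simp add: divide_le_eq)
          thus ?thesis using l0[of q] by linarith
        qed
        ultimately show ?thesis using False late[of q d] by (simp add: K_def Kq_def l_def)
      qed
      thus "rho dir l c q d \<le> K q / 2" "1 / l q \<le> K q" "K q \<le> l q" by auto
    qed
    let ?P = "\<lambda>q x. st (Lq Be L q) (fst x) (snd x) \<and> (\<forall>a d t w. sn (rho dir l c q (a, d)) (snd x a d t w)) \<and> (q = 0 \<longrightarrow> fst x = ui L A T)"
    let ?Q = "\<lambda>q x y. (\<forall>m t w. sn (30 * sqrt (K q)) (fst y m t w - fst x m t w))
       \<and> (\<forall>m t w. \<forall>k\<in>kbox ((Lq Be L q)^12). lk (fst y m t w) k = lk (fst x m t w) k)"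
    \<comment> \<open>Dependent choice, as \<open>step_exists\<close> only asserts existence; the
      bound \<open>rho\<close> is carried along as an invariant.\<close>
    have "\<exists>f. \<forall>q. ?P q (f q) \<and> ?Q q (f q) (f (Suc q))"
    proof (rule dependent_nat_choice)
      have "Lq Be L 0 = L" by (simp add: Lq_def)
      hence "?P 0 (ui L A T, ri L A T)" using L1[OF L(2)] by (simp add: c_def)
      thus "\<exists>x. ?P 0 x" by blast
    next
      fix x q assume P: "?P q x"
      obtain a0 b0 where d: "dir q = (a0, b0)" by (cases "dir q")
      have "L0 \<le> Lq Be L q" using lL[of q] L by linarith
      moreover have "sn (K q / 2) (snd x a0 b0 t w)" for t w
        using P K(1)[of q "(a0, b0)"] sn_mono by blast
      ultimately obtain u' r' where s: "step_concl Be (Lq Be L q) (fst x) (snd x) a0 b0 (K q) u' r'"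
        using step[of "Lq Be L q" "fst x" "snd x" "K q" a0 b0] P K(2,3)[of q] unfolding l_def by blast
      have "?P (Suc q) (u', r')"
      proof (intro conjI allI impI)
        show "st (Lq Be L (Suc q)) (fst (u', r')) (snd (u', r'))" using s by (simp add: step_concl_def Lq_Suc)
        fix a e t w
        have 1: "sn (1 / l q) (r' a e t w - (if a = a0 \<and> e = b0 then 0 else snd x a e t w))"
          using s by (simp add: step_concl_def l_def)
        have 2: "sn (if dir q = (a, e) then 0 else rho dir l c q (a, e)) (if a = a0 \<and> e = b0 then 0 else snd x a e t w)"
          using P d by (auto simp: sn_def)
        have "sn ((if dir q = (a, e) then 0 else rho dir l c q (a, e)) + 1 / l q)
           ((if a = a0 \<and> e = b0 then 0 else snd x a e t w) + (r' a e t w - (if a = a0 \<and> e = b0 then 0 else snd x a e t w)))"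
          by (rule sn_add[OF 2 1])
        thus "sn (rho dir l c (Suc q) (a, e)) (snd (u', r') a e t w)" by simp
      qed simp
      moreover have "?Q q x (u', r')" using s by (simp add: step_concl_def)
      ultimately show "\<exists>y. ?P (Suc q) y \<and> ?Q q x y" by blast
    qed
    then obtain f where f0: "\<forall>q. ?P q (f q) \<and> ?Q q (f q) (f (Suc q))" by (elim exE)
    have f: "?P q (f q)" "?Q q (f q) (f (Suc q))" for q
      using spec[OF f0, of q] by (rule conjunct1, rule conjunct2)
    have "good_seq Be L (C * A) (\<lambda>q. fst (f q)) (\<lambda>q. snd (f q))"
      unfolding good_seq_def
    proof (intro allI conjI impI)
      fix q
      show "st (Lq Be L q) (fst (f q)) (snd (f q))" using f(1)[of q] by blast
      show "sn (30 * sqrt (Kq Be L (C * A) q)) (fst (f (Suc q)) m t w - fst (f q) m t w)" for m t w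
        using f(2)[of q] unfolding K_def by blast
      show "\<forall>k\<in>kbox ((Lq Be L q)^12). lk (fst (f (Suc q)) m t w) k = lk (fst (f q) m t w) k" for m t w
        using f(2)[of q] by blast
      fix a d t w assume q: "9 \<le> q"
      show "sn (2 / real (Lq Be L (q - 9))) (snd (f q) a d t w)"
        using f(1)[of q] late[OF q, of "(a, d)"] sn_mono unfolding l_def by blast
    qed
    moreover have "fst (f 0) = ui L A T" using f(1)[of 0] by blast
    ultimately show ?thesis using L(3) CAL by (intro exI[of _ L] exI[of _ "\<lambda>q. fst (f q)"] exI[of _ "\<lambda>q. snd (f q)"]) auto
  qed
  show ?thesis
    by (rule exI[of _ Be], rule exI[of _ C]) (use main Be C1 in \<open>auto simp: C_def\<close>)
qed

end

subsection \<open>Sobolev norms over finite sets of frequencies\<close>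

text \<open>Restriction to a finite frequency set keeps all sums finite; bounds uniform in S pass to
  \<open>Hs_norm2\<close>.\<close>

definition Hn :: "real \<Rightarrow> freq set \<Rightarrow> field \<Rightarrow> real" where
  "Hn g S f = L2_set (\<lambda>k. jb k powr (g/2) * norm (f k)) S"

lemma Hn_triangle: "Hn g S (f + h) \<le> Hn g S f + Hn g S h"
proof -
  have "Hn g S (f + h) \<le> L2_set (\<lambda>k. jb k powr (g/2) * norm (f k) + jb k powr (g/2) * norm (h k)) S"
    unfolding Hn_def
    by (intro L2_set_mono) (auto intro!: mult_left_mono norm_triangle_ineq simp flip: distrib_left)
  also have "... \<le> Hn g S f + Hn g S h" unfolding Hn_def by (rule L2_set_triangle_ineq)
  finally show ?thesis .
qed

lemma Hn_nonneg [simp]: "0 \<le> Hn g S f" by (simp add: Hn_def L2_set_nonneg)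

lemma Hn_uminus: "Hn g S (- f) = Hn g S f" by (simp add: Hn_def)

lemma Hn_minus_commute: "Hn g S (f - h) = Hn g S (h - f)"
  using Hn_uminus[of g S "f - h"] by simp

lemma Hn_square: "(Hn g S f)^2 = (\<Sum>k\<in>S. jb k powr g * (norm (f k))^2)"
proof -
  have "(jb k powr (g/2) * norm (f k))^2 = jb k powr g * (norm (f k))^2" for k
  proof -
    have "(jb k powr (g/2))^2 = jb k powr (g/2 + g/2)"
      unfolding powr_add by (simp add: power2_eq_square)
    thus ?thesis by (simp add: power_mult_distrib)
  qed
  thus ?thesis by (simp add: Hn_def L2_set_def sum_nonneg)
qed

lemma Hs_norm2_le:
  assumes "\<And>S. finite S \<Longrightarrow> Hn g S f \<le> c"
  shows "Hs_norm2 g f \<le> ennreal (c^2)"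
proof -
  have "Hs_norm2 g f = (SUP S\<in>{S. finite S \<and> S \<subseteq> UNIV}. \<Sum>k\<in>S. ennreal (jb k powr g * (norm (f k))^2))"
    unfolding Hs_norm2_def by (rule nonneg_infsum_complete) simp
  also have "... \<le> ennreal (c^2)"
  proof (rule SUP_least)
    fix S :: "freq set" assume "S \<in> {S. finite S \<and> S \<subseteq> UNIV}"
    hence S: "finite S" by simp
    have "(\<Sum>k\<in>S. ennreal (jb k powr g * (norm (f k))^2)) = ennreal ((Hn g S f)^2)"
      unfolding Hn_square by (rule sum_ennreal) simp
    also have "... \<le> ennreal (c^2)"
      using assms[OF S] by (intro ennreal_leI power_mono) auto
    finally show "(\<Sum>k\<in>S. ennreal (jb k powr g * (norm (f k))^2)) \<le> ennreal (c^2)" .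
  qed
  finally show ?thesis .
qed

lemma Hn_le_Hs:
  assumes "Hs_norm2 g f < \<infinity>" "finite S"
  shows "(Hn g S f)^2 \<le> enn2real (Hs_norm2 g f)"
proof -
  have "ennreal ((Hn g S f)^2) = (\<Sum>k\<in>S. ennreal (jb k powr g * (norm (f k))^2))"
    unfolding Hn_square by (rule sum_ennreal[symmetric]) simp
  also have "... \<le> Hs_norm2 g f"
    unfolding Hs_norm2_def by (subst nonneg_infsum_complete) (auto intro!: SUP_upper simp: assms)
  finally have "ennreal ((Hn g S f)^2) \<le> ennreal (enn2real (Hs_norm2 g f))" using assms by simp
  thus ?thesis by simp
qed

definition vf :: "tvec \<Rightarrow> field" where "vf u k = (\<chi> m. lk (u m) k)"

lemma norm2_vec3: "(norm (v :: complex^3))^2 = (\<Sum>m\<in>UNIV. (cmod (v $ m))^2)"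
  by (simp add: norm_vec_def L2_set_def sum_nonneg)

lemma vf_diff: "vf u - vf v = vf (\<lambda>m. u m - v m)"
  by (rule ext) (simp add: vf_def vec_eq_iff lookup_minus)

text \<open>Bernstein's inequality combined with \<open>l2_le_sn\<close>; the factor 2 rounds up the
  sqrt 3 from the three components.\<close>

lemma Hn_vf:
  assumes S: "finite S" and d: "\<And>m. dg D (u m)" and s: "\<And>m. sn c (u m)" and g: "0 \<le> g"
  shows "Hn g S (vf u) \<le> (1 + 3 * (real D)^2) powr (g/2) * (2 * c)"
proof -
  have c: "0 \<le> c" using s order_trans[OF norm_ge_zero] unfolding sn_def by blast
  let ?W = "(1 + 3 * (real D)^2) powr g"
  have "(Hn g S (vf u))^2 \<le> (\<Sum>k\<in>S. ?W * (\<Sum>m\<in>UNIV. (cmod (lk (u m) k))^2))"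
    unfolding Hn_square
  proof (rule sum_mono)
    fix k
    show "jb k powr g * (norm (vf u k))^2 \<le> ?W * (\<Sum>m\<in>UNIV. (cmod (lk (u m) k))^2)"
    proof (cases "k \<in> kbox D")
      case True
      thus ?thesis using knorm2_le[OF True] g unfolding norm2_vec3
        by (intro mult_mono powr_mono2) (auto simp: vf_def intro: sum_nonneg add_nonneg_nonneg)
    next
      case False
      hence "lk (u m) k = 0" for m using d[of m] by (auto simp: dg_def in_keys_iff)
      thus ?thesis by (simp add: norm2_vec3 vf_def)
    qed
  qed
  also have "... = ?W * (\<Sum>m\<in>UNIV. \<Sum>k\<in>S. (cmod (lk (u m) k))^2)"
    by (simp add: sum_distrib_left[symmetric] sum.swap[of _ S])
  also have "... \<le> ?W * (\<Sum>m\<in>(UNIV::3 set). c^2)"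
  proof (intro mult_left_mono sum_mono)
    fix m
    have "(\<Sum>k\<in>S. (cmod (lk (u m) k))^2) \<le> (\<Sum>k\<in>S \<union> ks (u m). (cmod (lk (u m) k))^2)"
      using S by (intro sum_mono2) auto
    also have "... = (\<Sum>k\<in>ks (u m). (cmod (lk (u m) k))^2)"
      using S by (intro sum.mono_neutral_right) (auto simp: ks_lk)
    also have "... \<le> c^2" by (rule l2_le_sn[OF d s])
    finally show "(\<Sum>k\<in>S. (cmod (lk (u m) k))^2) \<le> c^2" .
  qed simp
  also have "... \<le> ?W * (2 * c)^2" by (intro mult_left_mono) (auto simp: power_mult_distrib)
  also have "... = ((1 + 3 * (real D)^2) powr (g/2) * (2 * c))^2"
  proof -
    have "((1 + 3 * (real D)^2) powr (g/2))^2 = (1 + 3 * (real D)^2) powr (g/2 + g/2)"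
      unfolding powr_add by (simp add: power2_eq_square)
    thus ?thesis by (simp add: power_mult_distrib)
  qed
  finally show ?thesis by (rule power2_le_imp_le) (use c in simp)
qed

subsection \<open>Estimates for the weak formulation\<close>

definition lb :: "real \<Rightarrow> field \<Rightarrow> bool" where
  "lb c f \<longleftrightarrow> (\<forall>S. finite S \<longrightarrow> L2_set (\<lambda>k. norm (f k)) S \<le> c)"

lemma Hn_0: "Hn 0 S f = L2_set (\<lambda>k. norm (f k)) S"
proof -
  have "1 + knorm2 k \<noteq> 0" for k using knorm2_nonneg[of k] by linarith
  thus ?thesis by (simp add: Hn_def)
qed

lemma lb_nonneg: "lb c f \<Longrightarrow> 0 \<le> c"
  unfolding lb_def by (drule spec[of _ "{}"]) simp

lemma lb_mono: "lb c f \<Longrightarrow> c \<le> d \<Longrightarrow> lb d f" unfolding lb_def by (meson order_trans)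

lemma lb_add: "lb c f \<Longrightarrow> lb d h \<Longrightarrow> lb (c + d) (f + h)"
  unfolding lb_def Hn_0[symmetric] by (meson Hn_triangle add_mono order_trans)

lemma lb_uminus: "lb c f \<Longrightarrow> lb c (- f)" by (simp add: lb_def)

lemma lb_diff: "lb c f \<Longrightarrow> lb d h \<Longrightarrow> lb (c + d) (f - h)"
  using lb_add[of c f d "- h"] lb_uminus[of d h] by simp

lemma lb_minus_commute: "lb c (f - h) \<Longrightarrow> lb c (h - f)"
  using lb_uminus[of c "f - h"] by simp

lemma lb_pt: "lb c f \<Longrightarrow> norm (f k) \<le> c"
  unfolding lb_def by (drule spec[of _ "{k}"]) simp

lemma cmod_nth_le: "cmod ((v :: complex^3) $ i) \<le> norm v"
  by (rule Finite_Cartesian_Product.norm_nth_le)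

text \<open>The weight (1+|k|^2)^(5/8) dominates one derivative as well as the multiplier
  |k|^(2\<alpha>). The exponent 5/8 = 3/2 - 7/8 is what Cauchy-Schwarz leaves of an H^3 field after
  splitting off the square-summable factor with exponent -7/8.\<close>

definition hw :: "field \<Rightarrow> freq \<Rightarrow> real" where
  "hw e n = jb n powr (5/8) * norm (e n)"

lemma hw_nonneg [simp]: "0 \<le> hw e n" by (simp add: hw_def)

definition tst :: "real \<Rightarrow> field \<Rightarrow> bool" where
  "tst E e \<longleftrightarrow> (\<forall>S. finite S \<longrightarrow> sum (hw e) S \<le> E)"

lemma tst_nonneg: "tst E e \<Longrightarrow> 0 \<le> E"
  unfolding tst_def by (drule spec[of _ "{}"]) simp

lemma tst_Hs:
  assumes "e \<in> Hs 3"
  shows "tst (sqrt (enn2real (Hs_norm2 3 e)) * sqrt Clat) e"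
  unfolding tst_def
proof (intro allI impI)
  fix S :: "freq set" assume S: "finite S"
  have fin: "Hs_norm2 3 e < \<infinity>" using assms by (simp add: Hs_def)
  have W: "(0::real) < 1 + knorm2 k" for k by (simp add: add_pos_nonneg)
  have "sum (hw e) S = (\<Sum>k\<in>S. \<bar>jb k powr (3/2) * norm (e k)\<bar> * \<bar>jb k powr (-7/8)\<bar>)"
  proof (rule sum.cong[OF refl])
    fix k
    have "jb k powr (5/8) = jb k powr (3/2 + -7/8)" by simp
    thus "hw e k = \<bar>jb k powr (3/2) * norm (e k)\<bar> * \<bar>jb k powr (-7/8)\<bar>"
      unfolding hw_def powr_add by (simp add: abs_mult)
  qed
  also have "... \<le> L2_set (\<lambda>k. jb k powr (3/2) * norm (e k)) S * L2_set (\<lambda>k. jb k powr (-7/8)) S"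
    by (rule L2_set_mult_ineq)
  also have "... \<le> sqrt (enn2real (Hs_norm2 3 e)) * sqrt Clat"
  proof (intro mult_mono)
    show "L2_set (\<lambda>k. jb k powr (3/2) * norm (e k)) S \<le> sqrt (enn2real (Hs_norm2 3 e))"
      using Hn_le_Hs[OF fin S] by (intro real_le_rsqrt) (simp add: Hn_def)
    have "(jb k powr (-7/8))^2 = jb k powr (-7/4)" for k
    proof -
      have "jb k powr (-7/4) = jb k powr (-7/8 + -7/8)" by simp
      thus ?thesis unfolding powr_add by (simp add: power2_eq_square)
    qed
    thus "L2_set (\<lambda>k. jb k powr (-7/8)) S \<le> sqrt Clat"
      unfolding L2_set_def using Clat(2)[OF S] by (intro real_sqrt_le_mono) simp
  qed (auto simp: L2_set_nonneg Clat)
  finally show "sum (hw e) S \<le> sqrt (enn2real (Hs_norm2 3 e)) * sqrt Clat" .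
qed

lemma norm_le_hw: "norm (e n) \<le> hw e n"
proof -
  have "1 \<le> jb n powr (5/8)" by (intro ge_one_powr_ge_zero) auto
  thus ?thesis unfolding hw_def using mult_right_mono[of 1 _ "norm (e n)"] by fastforce
qed

lemma freq_norm_le_hw: "\<bar>real_of_int (n $ j)\<bar> * norm (e n) \<le> hw e n"
proof -
  have "\<bar>real_of_int (n $ j)\<bar> \<le> sqrt (1 + knorm2 n)"
    using knorm2_ge[of n j] by (intro real_le_rsqrt) simp
  also have "... = jb n powr (1/2)" by (simp add: powr_half_sqrt add_nonneg_nonneg)
  also have "... \<le> jb n powr (5/8)" by (intro powr_mono) auto
  finally show ?thesis unfolding hw_def by (intro mult_right_mono) auto
qed

lemma frac_norm_le_hw:
  assumes "0 < \<alpha>" "\<alpha> < 1/2"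
  shows "knorm2 n powr \<alpha> * norm (e n) \<le> hw e n"
proof -
  have "knorm2 n powr \<alpha> \<le> jb n powr \<alpha>" using assms by (intro powr_mono2) auto
  also have "... \<le> jb n powr (5/8)" using assms by (intro powr_mono) auto
  finally show ?thesis unfolding hw_def by (intro mult_right_mono) auto
qed

text \<open>Polarised form of the nonlinear pairing, with separate arguments for estimating
  differences.\<close>

definition Qt :: "field \<Rightarrow> field \<Rightarrow> field \<Rightarrow> freq \<times> freq \<Rightarrow> complex" where
  "Qt y z e = (\<lambda>(k, l). (\<Sum>i\<in>UNIV. \<Sum>j\<in>UNIV.
        y k $ i * z l $ j * (- \<i> * of_int ((k + l) $ j)) * cnj (e (k + l) $ i)))"

lemma cmod_Qt: "cmod (Qt y z e (k, l)) \<le> 9 * (norm (y k) * norm (z l) * hw e (k + l))"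
proof -
  have "cmod (y k $ i * z l $ j * (- \<i> * of_int ((k + l) $ j)) * cnj (e (k + l) $ i))
     \<le> norm (y k) * norm (z l) * hw e (k + l)" for i j
  proof -
    have "cmod (y k $ i * z l $ j * (- \<i> * of_int ((k + l) $ j)) * cnj (e (k + l) $ i))
      = cmod (y k $ i) * cmod (z l $ j) * (\<bar>real_of_int ((k + l) $ j)\<bar> * cmod (e (k + l) $ i))"
      by (simp add: norm_mult mult.assoc del: of_int_add vector_add_component)
    also have "... \<le> norm (y k) * norm (z l) * (\<bar>real_of_int ((k + l) $ j)\<bar> * norm (e (k + l)))"
      by (intro mult_mono cmod_nth_le) auto
    also have "... \<le> norm (y k) * norm (z l) * hw e (k + l)"
      by (intro mult_left_mono freq_norm_le_hw) auto
    finally show ?thesis .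
  qed
  hence "cmod (Qt y z e (k, l)) \<le> (\<Sum>i\<in>(UNIV::3 set). \<Sum>j\<in>(UNIV::3 set). norm (y k) * norm (z l) * hw e (k + l))"
    unfolding Qt_def prod.case by (intro order_trans[OF norm_sum] sum_mono)
  thus ?thesis by simp
qed

text \<open>Group the pairs by n = k + l. For fixed n Cauchy-Schwarz bounds the convolution by the
  product of the L^2 norms, and the weights of the test field are summed over n.\<close>

lemma Qt_finite_sum:
  assumes y: "lb Y y" and z: "lb Z z" and e: "tst E e" and A: "finite A"
  shows "(\<Sum>p\<in>A. cmod (Qt y z e p)) \<le> 9 * (Y * Z * E)"
proof -
  let ?g = "\<lambda>p :: freq \<times> freq. fst p + snd p"
  have Y: "0 \<le> Y" "0 \<le> Z" using y z by (auto intro: lb_nonneg)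
  have "(\<Sum>p\<in>A. cmod (Qt y z e p)) \<le> (\<Sum>p\<in>A. 9 * (norm (y (fst p)) * norm (z (snd p)) * hw e (?g p)))"
    by (intro sum_mono) (metis cmod_Qt prod.collapse)
  also have "... = 9 * (\<Sum>p\<in>A. norm (y (fst p)) * norm (z (snd p)) * hw e (?g p))"
    by (simp only: sum_distrib_left)
  also have "(\<Sum>p\<in>A. norm (y (fst p)) * norm (z (snd p)) * hw e (?g p))
     = (\<Sum>n\<in>?g ` A. \<Sum>p\<in>{p \<in> A. ?g p = n}. norm (y (fst p)) * norm (z (snd p)) * hw e (?g p))"
    by (rule sum.image_gen[OF A])
  also have "... \<le> (\<Sum>n\<in>?g ` A. Y * Z * hw e n)"
  proof (rule sum_mono)
    fix n
    let ?B = "{p \<in> A. ?g p = n}"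
    have B: "finite ?B" using A by simp
    have i: "inj_on fst ?B" "inj_on snd ?B" by (auto simp: inj_on_def)
    have "(\<Sum>p\<in>?B. norm (y (fst p)) * norm (z (snd p)) * hw e (?g p))
       = (\<Sum>p\<in>?B. \<bar>norm (y (fst p))\<bar> * \<bar>norm (z (snd p))\<bar>) * hw e n"
      by (simp add: sum_distrib_right)
    also have "... \<le> (L2_set (\<lambda>p. norm (y (fst p))) ?B * L2_set (\<lambda>p. norm (z (snd p))) ?B) * hw e n"
      by (intro mult_right_mono L2_set_mult_ineq) simp
    also have "L2_set (\<lambda>p. norm (y (fst p))) ?B = L2_set (\<lambda>k. norm (y k)) (fst ` ?B)"
      unfolding L2_set_def using sum.reindex[OF i(1), of "\<lambda>k. (norm (y k))^2"] by (simp add: o_def)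
    also have "L2_set (\<lambda>p. norm (z (snd p))) ?B = L2_set (\<lambda>k. norm (z k)) (snd ` ?B)"
      unfolding L2_set_def using sum.reindex[OF i(2), of "\<lambda>k. (norm (z k))^2"] by (simp add: o_def)
    also have "L2_set (\<lambda>k. norm (y k)) (fst ` ?B) * L2_set (\<lambda>k. norm (z k)) (snd ` ?B) * hw e n \<le> Y * Z * hw e n"
      using y z B Y unfolding lb_def by (intro mult_right_mono mult_mono) (auto simp: L2_set_nonneg)
    finally show "(\<Sum>p\<in>?B. norm (y (fst p)) * norm (z (snd p)) * hw e (?g p)) \<le> Y * Z * hw e n" .
  qed
  also have "... = Y * Z * sum (hw e) (?g ` A)" by (simp only: sum_distrib_left)
  also have "... \<le> Y * Z * E" using e A Y unfolding tst_def by (intro mult_left_mono) auto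
  finally show ?thesis by simp
qed

lemma bounded_infsum:
  fixes f :: "'b \<Rightarrow> complex"
  assumes "\<And>A. finite A \<Longrightarrow> (\<Sum>p\<in>A. cmod (f p)) \<le> c"
  shows "f summable_on UNIV" "cmod (infsum f UNIV) \<le> c"
proof -
  have s: "(\<lambda>p. cmod (f p)) summable_on UNIV"
    using assms by (intro nonneg_bdd_above_summable_on) (auto simp: bdd_above_def)
  thus "f summable_on UNIV" by (rule abs_summable_summable)
  have "cmod (infsum f UNIV) \<le> (\<Sum>\<^sub>\<infinity>p. cmod (f p))" by (rule norm_infsum_bound[OF s])
  also have "... \<le> c" by (rule infsum_le_finite_sums[OF s]) (use assms in auto)
  finally show "cmod (infsum f UNIV) \<le> c" .
qed

lemma nonlin_diff:
  assumes y: "lb Y y" and z: "lb Y z" and d: "lb c (y - z)" and e: "tst E e"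
  shows "\<bar>nonlin_pair y e - nonlin_pair z e\<bar> \<le> 18 * (Y * c * E)"
proof -
  note b = bounded_infsum[OF Qt_finite_sum]
  have eq: "Qt y y e p = (Qt (y - z) y e p + Qt z (y - z) e p) + Qt z z e p" for p
    unfolding Qt_def by (cases p) (simp add: sum.distrib[symmetric] algebra_simps)
  have "infsum (Qt y y e) UNIV = infsum (Qt (y - z) y e) UNIV + infsum (Qt z (y - z) e) UNIV + infsum (Qt z z e) UNIV"
    unfolding eq[abs_def]
    by (simp add: infsum_add summable_on_add b(1)[OF d y e] b(1)[OF z d e] b(1)[OF z z e])
  moreover have np: "nonlin_pair v e = Re (infsum (Qt v v e) UNIV)" for v
    by (simp add: nonlin_pair_def Qt_def)
  ultimately have "nonlin_pair y e - nonlin_pair z e = Re (infsum (Qt (y - z) y e) UNIV + infsum (Qt z (y - z) e) UNIV)"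
    by simp
  hence "\<bar>nonlin_pair y e - nonlin_pair z e\<bar> \<le> cmod (infsum (Qt (y - z) y e) UNIV + infsum (Qt z (y - z) e) UNIV)"
    using abs_Re_le_cmod by metis
  also have "... \<le> 9 * (c * Y * E) + 9 * (Y * c * E)"
    by (rule order_trans[OF norm_triangle_ineq add_mono[OF b(2)[OF d y e] b(2)[OF z d e]]])
  finally show ?thesis by (simp add: mult_ac)
qed

definition ip :: "field \<Rightarrow> field \<Rightarrow> freq \<Rightarrow> complex" where
  "ip f g k = (\<Sum>i\<in>UNIV. f k $ i * cnj (g k $ i))"

lemma cmod_ip: "cmod (ip f g k) \<le> 3 * (norm (f k) * norm (g k))"
proof -
  have "cmod (ip f g k) \<le> (\<Sum>i\<in>(UNIV::3 set). norm (f k) * norm (g k))"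
    unfolding ip_def by (intro order_trans[OF norm_sum] sum_mono) (auto simp: norm_mult intro!: mult_mono cmod_nth_le)
  thus ?thesis by simp
qed

lemma ip_diff: "ip (f - h) g k = ip f g k - ip h g k"
  by (simp add: ip_def sum_subtractf[symmetric] algebra_simps)

lemma mult_finite_sum:
  assumes y: "lb Y y" and e: "tst E e" and s: "\<And>k. cmod (mu k) * norm (e k) \<le> hw e k" and A: "finite A"
  shows "(\<Sum>k\<in>A. cmod (mu k * ip y e k)) \<le> 3 * (Y * E)"
proof -
  have "(\<Sum>k\<in>A. cmod (mu k * ip y e k)) \<le> (\<Sum>k\<in>A. 3 * (Y * hw e k))"
  proof (rule sum_mono)
    fix k
    have "cmod (mu k * ip y e k) \<le> cmod (mu k) * (3 * (norm (y k) * norm (e k)))"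
      unfolding norm_mult by (intro mult_left_mono cmod_ip) auto
    also have "... = 3 * (norm (y k) * (cmod (mu k) * norm (e k)))" by simp
    also have "... \<le> 3 * (Y * hw e k)"
      using lb_pt[OF y] s lb_nonneg[OF y] by (intro mult_left_mono mult_mono) auto
    finally show "cmod (mu k * ip y e k) \<le> 3 * (Y * hw e k)" .
  qed
  also have "... = 3 * (Y * sum (hw e) A)" by (simp only: sum_distrib_left)
  also have "... \<le> 3 * (Y * E)" using e A lb_nonneg[OF y] unfolding tst_def by (intro mult_left_mono) auto
  finally show ?thesis .
qed

lemma mult_diff:
  assumes y: "lb Y y" and z: "lb Y z" and d: "lb c (y - z)" and e: "tst E e"
    and s: "\<And>k. cmod (mu k) * norm (e k) \<le> hw e k"
  shows "\<bar>Re (\<Sum>\<^sub>\<infinity>k. mu k * ip y e k) - Re (\<Sum>\<^sub>\<infinity>k. mu k * ip z e k)\<bar> \<le> 3 * (c * E)"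
proof -
  note b = bounded_infsum[OF mult_finite_sum[where mu=mu]]
  have "(\<Sum>\<^sub>\<infinity>k. mu k * ip y e k) = (\<Sum>\<^sub>\<infinity>k. mu k * ip (y - z) e k + mu k * ip z e k)"
    by (simp add: ip_diff algebra_simps)
  also have "... = (\<Sum>\<^sub>\<infinity>k. mu k * ip (y - z) e k) + (\<Sum>\<^sub>\<infinity>k. mu k * ip z e k)"
    by (intro infsum_add b(1)[OF d e s] b(1)[OF z e s])
  finally have "Re (\<Sum>\<^sub>\<infinity>k. mu k * ip y e k) - Re (\<Sum>\<^sub>\<infinity>k. mu k * ip z e k) = Re (\<Sum>\<^sub>\<infinity>k. mu k * ip (y - z) e k)" by simp
  thus ?thesis using b(2)[OF d e s] abs_Re_le_cmod order_trans by metis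
qed

text \<open>Lipschitz continuity on L^2-bounded sets. It serves both the passage to the limit and
  the continuity of the integrand in time.\<close>

lemma F_pair_diff:
  assumes "lb Y y" "lb Y z" "lb c (y - z)" "tst E e" "0 < \<alpha>" "\<alpha> < 1/2"
  shows "\<bar>F_pair \<alpha> y e - F_pair \<alpha> z e\<bar> \<le> (18 * Y + 3) * E * c"
proof -
  have "\<bar>frac_pair \<alpha> y e - frac_pair \<alpha> z e\<bar> \<le> 3 * (c * E)"
    unfolding frac_pair_def ip_def[symmetric]
    by (rule mult_diff[OF assms(1-4)]) (use frac_norm_le_hw[OF assms(5,6)] in simp)
  thus ?thesis using nonlin_diff[OF assms(1-4)] unfolding F_pair_def by (simp add: algebra_simps)
qed

lemma inner_diff:
  assumes "lb Y y" "lb Y z" "lb c (y - z)" "tst E e"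
  shows "\<bar>inner_L2 y e - inner_L2 z e\<bar> \<le> 3 * (c * E)"
  using mult_diff[OF assms, of "\<lambda>_. 1"] norm_le_hw unfolding inner_L2_def ip_def[symmetric] by simp

lemma infsum_support:
  assumes "finite S" "\<And>k. k \<notin> S \<Longrightarrow> f k = 0"
  shows "(\<Sum>\<^sub>\<infinity>k. f k) = (\<Sum>k\<in>S. f k)"
proof -
  have "(\<Sum>\<^sub>\<infinity>k. f k) = infsum f S" by (rule infsum_cong_neutral) (use assms in auto)
  thus ?thesis using assms(1) by simp
qed

lemma inner_vf:
  assumes "\<And>m. dg D (u m)" "kbox D \<subseteq> S" "finite S"
  shows "inner_L2 (vf u) e = Re (\<Sum>n\<in>S. \<Sum>m\<in>UNIV. cnj (e n $ m) * lk (u m) n)"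
proof -
  have z: "lk (u m) k = 0" if "k \<notin> S" for k m
    using assms(1)[of m] assms(2) that by (auto simp: dg_def in_keys_iff)
  have "(\<Sum>\<^sub>\<infinity>k. \<Sum>i\<in>UNIV. vf u k $ i * cnj (e k $ i)) = (\<Sum>k\<in>S. \<Sum>i\<in>UNIV. vf u k $ i * cnj (e k $ i))"
    by (rule infsum_support[OF assms(3)]) (simp add: vf_def z)
  thus ?thesis unfolding inner_L2_def by (simp add: vf_def mult.commute)
qed

lemma pair_mult:
  assumes "finite A" "ks f \<subseteq> A" "ks g \<subseteq> A" "finite S" "\<And>k l. k \<in> A \<Longrightarrow> l \<in> A \<Longrightarrow> k + l \<in> S"
  shows "(\<Sum>n\<in>S. mu n * lk (f * g) n) = (\<Sum>k\<in>A. \<Sum>l\<in>A. mu (k + l) * (lk f k * lk g l))"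
proof -
  have "f * g = (\<Sum>k\<in>A. \<Sum>l\<in>A. sg (k+l) (lk f k * lk g l))"
  proof -
    have "f = (\<Sum>k\<in>A. sg k (lk f k))" "g = (\<Sum>l\<in>A. sg l (lk g l))"
      using assms(1-3) by (auto intro!: poly_mapping_eqI simp: lookup_sum lookup_single when_def in_keys_iff subset_iff)
    hence "f * g = (\<Sum>k\<in>A. sg k (lk f k)) * (\<Sum>l\<in>A. sg l (lk g l))" by metis
    thus ?thesis by (simp add: sum_product mult_single)
  qed
  hence "(\<Sum>n\<in>S. mu n * lk (f * g) n) = (\<Sum>n\<in>S. \<Sum>k\<in>A. \<Sum>l\<in>A. if k + l = n then mu n * (lk f k * lk g l) else 0)"
    by (simp add: lookup_sum lookup_single when_def sum_distrib_left if_distrib cong: if_cong)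
  also have "... = (\<Sum>k\<in>A. \<Sum>l\<in>A. \<Sum>n\<in>S. if k + l = n then mu n * (lk f k * lk g l) else 0)"
    by (subst sum.swap, rule sum.cong[OF refl], rule sum.swap)
  also have "... = (\<Sum>k\<in>A. \<Sum>l\<in>A. mu (k + l) * (lk f k * lk g l))"
    using assms(4,5) by (intro sum.cong refl) simp
  finally show ?thesis .
qed

text \<open>For polynomials the pairing is the tested right-hand side with zero stress. Products
  have degree 2D, hence the larger box.\<close>

lemma F_pair_vf:
  assumes d: "\<And>m. dg D (u m)"
  shows "F_pair \<alpha> (vf u) e = Re (\<Sum>n\<in>kbox (2 * D). \<Sum>m\<in>UNIV. cnj (e n $ m) * lk (rhs \<alpha> u (\<lambda>a b. 0) m) n)"
proof -
  let ?S = "kbox (2 * D)" and ?A = "kbox D"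
  have z: "lk (u m) k = 0" if "k \<notin> ?A" for k m
    using d[of m] that by (auto simp: dg_def in_keys_iff)
  have add: "k + l \<in> ?S" if "k \<in> ?A" "l \<in> ?A" for k l
    using that by (auto simp: kbox_def intro: order_trans[OF abs_triangle_ineq] add_mono[of _ "int D" _ "int D", simplified])
  have sub: "?A \<subseteq> ?S" by (rule kbox_mono) simp
  have "nonlin_pair (vf u) e = Re (\<Sum>p\<in>?A \<times> ?A. Qt (vf u) (vf u) e p)"
  proof -
    have "(\<Sum>\<^sub>\<infinity>p. Qt (vf u) (vf u) e p) = (\<Sum>p\<in>?A \<times> ?A. Qt (vf u) (vf u) e p)"
    proof (rule infsum_support)
      fix p :: "freq \<times> freq" assume "p \<notin> ?A \<times> ?A"
      then consider "fst p \<notin> ?A" | "snd p \<notin> ?A" by (cases p) auto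
      thus "Qt (vf u) (vf u) e p = 0"
        by cases (simp_all add: Qt_def vf_def z case_prod_beta)
    qed (simp add: finite_kbox)
    thus ?thesis by (simp add: nonlin_pair_def Qt_def)
  qed
  also have "(\<Sum>p\<in>?A \<times> ?A. Qt (vf u) (vf u) e p) = (\<Sum>k\<in>?A. \<Sum>l\<in>?A. Qt (vf u) (vf u) e (k, l))"
    by (simp add: sum.cartesian_product case_prod_beta)
  also have "...
     = (\<Sum>k\<in>?A. \<Sum>l\<in>?A. \<Sum>i\<in>UNIV. \<Sum>j\<in>UNIV. (- \<i> * of_int ((k + l) $ j)) * cnj (e (k + l) $ i) * (lk (u i) k * lk (u j) l))"
    by (simp add: Qt_def vf_def mult_ac)
  also have "... = (\<Sum>i\<in>UNIV. \<Sum>j\<in>UNIV. \<Sum>k\<in>?A. \<Sum>l\<in>?A. (- \<i> * of_int ((k + l) $ j)) * cnj (e (k + l) $ i) * (lk (u i) k * lk (u j) l))"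
  proof -
    have sw: "(\<Sum>k\<in>?A. \<Sum>l\<in>?A. \<Sum>i\<in>UNIV. \<Sum>j\<in>UNIV. G k l i j) = (\<Sum>i\<in>(UNIV::3 set). \<Sum>j\<in>(UNIV::3 set). \<Sum>k\<in>?A. \<Sum>l\<in>?A. G k l i j)"
      for G :: "freq \<Rightarrow> freq \<Rightarrow> 3 \<Rightarrow> 3 \<Rightarrow> complex"
    proof -
      have "(\<Sum>k\<in>?A. \<Sum>l\<in>?A. \<Sum>i\<in>UNIV. \<Sum>j\<in>UNIV. G k l i j) = (\<Sum>k\<in>?A. \<Sum>i\<in>UNIV. \<Sum>l\<in>?A. \<Sum>j\<in>UNIV. G k l i j)"
        by (intro sum.cong refl sum.swap)
      also have "... = (\<Sum>i\<in>UNIV. \<Sum>k\<in>?A. \<Sum>l\<in>?A. \<Sum>j\<in>UNIV. G k l i j)" by (rule sum.swap)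
      also have "... = (\<Sum>i\<in>UNIV. \<Sum>k\<in>?A. \<Sum>j\<in>UNIV. \<Sum>l\<in>?A. G k l i j)" by (intro sum.cong refl sum.swap)
      also have "... = (\<Sum>i\<in>UNIV. \<Sum>j\<in>UNIV. \<Sum>k\<in>?A. \<Sum>l\<in>?A. G k l i j)" by (intro sum.cong refl sum.swap)
      finally show ?thesis .
    qed
    show ?thesis by (rule sw)
  qed
  also have "... = (\<Sum>i\<in>UNIV. \<Sum>j\<in>UNIV. \<Sum>n\<in>?S. (- \<i> * of_int (n $ j)) * cnj (e n $ i) * lk (u i * u j) n)"
    using d by (intro sum.cong refl pair_mult[symmetric] finite_kbox add) (auto simp: dg_def)
  also have "... = (\<Sum>i\<in>UNIV. \<Sum>n\<in>?S. \<Sum>j\<in>UNIV. (- \<i> * of_int (n $ j)) * cnj (e n $ i) * lk (u i * u j) n)"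
    by (intro sum.cong refl sum.swap)
  also have "... = (\<Sum>n\<in>?S. \<Sum>i\<in>UNIV. \<Sum>j\<in>UNIV. (- \<i> * of_int (n $ j)) * cnj (e n $ i) * lk (u i * u j) n)"
    by (rule sum.swap)
  finally have N: "nonlin_pair (vf u) e = Re (\<Sum>n\<in>?S. \<Sum>i\<in>UNIV. \<Sum>j\<in>UNIV. (- \<i> * of_int (n $ j)) * cnj (e n $ i) * lk (u i * u j) n)" .
  have "(\<Sum>\<^sub>\<infinity>k. of_real (knorm2 k powr \<alpha>) * (\<Sum>i\<in>UNIV. vf u k $ i * cnj (e k $ i)))
      = (\<Sum>k\<in>?S. of_real (knorm2 k powr \<alpha>) * (\<Sum>i\<in>UNIV. vf u k $ i * cnj (e k $ i)))"
  proof (rule infsum_support[OF finite_kbox])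
    fix k assume "k \<notin> ?S"
    hence "k \<notin> ?A" using sub by blast
    thus "of_real (knorm2 k powr \<alpha>) * (\<Sum>i\<in>UNIV. vf u k $ i * cnj (e k $ i)) = 0" by (simp add: vf_def z)
  qed
  hence Fr: "frac_pair \<alpha> (vf u) e = Re (\<Sum>n\<in>?S. \<Sum>i\<in>UNIV. cnj (e n $ i) * (lsym \<alpha> n * lk (u i) n))"
    by (simp add: frac_pair_def vf_def lsym_def sum_distrib_left mult_ac)
  have "strs (\<lambda>a b. 0) m l = 0" for m l by (simp add: strs_def)
  hence R: "lk (rhs \<alpha> u (\<lambda>a b. 0) m) n = (\<Sum>l\<in>UNIV. (- \<i> * of_int (n $ l)) * lk (u m * u l) n) - lsym \<alpha> n * lk (u m) n" for m n
    by (simp add: rhs_def lookup_minus lookup_sum dsym_def)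
  show ?thesis
    unfolding F_pair_def N Fr R minus_complex.sel(1)[symmetric]
    by (simp add: sum_subtractf[symmetric] sum_distrib_left right_diff_distrib mult_ac)
qed

text \<open>Nine entries (m, l) with nine coefficients (a, b) each give the constant 81; the
  derivative falls on the test field.\<close>

lemma stress_pair:
  assumes e: "tst E e" and S: "finite S" and r: "\<And>a b n. cmod (lk (r a b) n) \<le> c"
  shows "cmod (\<Sum>n\<in>S. \<Sum>m\<in>UNIV. cnj (e n $ m) * (lk (rhs \<alpha> u r m) n - lk (rhs \<alpha> u (\<lambda>a b. 0) m) n)) \<le> 81 * (c * E)"
proof -
  have c: "0 \<le> c" using r norm_ge_zero order_trans by blast
  have st: "cmod (lk (strs r m l) n) \<le> 9 * c" for m l n
  proof -
    have "cmod (lk (strs r m l) n) \<le> (\<Sum>a\<in>(UNIV::3 set). \<Sum>b\<in>(UNIV::3 set). c)"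
      unfolding strs_def lookup_sum using r c by (intro order_trans[OF norm_sum] sum_mono) auto
    thus ?thesis by simp
  qed
  have R: "lk (rhs \<alpha> u r m) n - lk (rhs \<alpha> u (\<lambda>a b. 0) m) n = (\<Sum>l\<in>UNIV. \<i> * of_int (n $ l) * lk (strs r m l) n)" for m n
  proof -
    have "strs (\<lambda>a b. 0) m l = 0" for m l by (simp add: strs_def)
    thus ?thesis by (simp add: rhs_def lookup_minus lookup_sum dsym_def sum_subtractf[symmetric] algebra_simps)
  qed
  have "cmod (\<Sum>n\<in>S. \<Sum>m\<in>UNIV. cnj (e n $ m) * (\<Sum>l\<in>UNIV. \<i> * of_int (n $ l) * lk (strs r m l) n))
     \<le> (\<Sum>n\<in>S. \<Sum>m\<in>(UNIV::3 set). \<Sum>l\<in>(UNIV::3 set). 9 * c * hw e n)"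
    unfolding sum_distrib_left
  proof (intro order_trans[OF norm_sum] sum_mono)
    fix n and m l :: 3
    have "cmod (cnj (e n $ m) * (\<i> * of_int (n $ l) * lk (strs r m l) n)) = (\<bar>real_of_int (n $ l)\<bar> * cmod (e n $ m)) * cmod (lk (strs r m l) n)"
      by (simp add: norm_mult mult_ac)
    also have "... \<le> (\<bar>real_of_int (n $ l)\<bar> * norm (e n)) * (9 * c)"
      by (intro mult_mono st cmod_nth_le) auto
    also have "... \<le> hw e n * (9 * c)" using c by (intro mult_right_mono freq_norm_le_hw) auto
    finally show "cmod (cnj (e n $ m) * (\<i> * of_int (n $ l) * lk (strs r m l) n)) \<le> 9 * c * hw e n" by (simp add: mult_ac)
  qed
  also have "... = (\<Sum>n\<in>S. 81 * (c * hw e n))" by simp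
  also have "... = 81 * (c * sum (hw e) S)" by (simp only: sum_distrib_left)
  also have "... \<le> 81 * (c * E)" using e S c unfolding tst_def by (intro mult_left_mono) auto
  finally show ?thesis unfolding R .
qed

subsection \<open>The limit solution\<close>

context noise
begin

lemma b_lb: "lb Lb (b t w)" "N \<ge> 1 \<Longrightarrow> lb (Lb / real N) (b t w - vf (\<lambda>m. bt N m t w))"
proof -
  have wt: "1 \<le> 1 + knorm2 k" for k by simp
  have "(\<Sum>k\<in>S. (norm (b t w k))^2) \<le> Lb^2" if S: "finite S" for S
  proof -
    have "(\<Sum>k\<in>S. (norm (b t w k))^2) \<le> wS S (b t w)"
    proof (rule sum_mono)
      fix k
      have "1 \<le> jb k^2" using wt[of k] by (rule one_le_power)
      from mult_right_mono[OF this, of "(norm (b t w k))^2"]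
      show "(norm (b t w k))^2 \<le> jb k^2 * (norm (b t w k))^2" by simp
    qed
    thus ?thesis using b_bd[OF S, of t w] by linarith
  qed
  thus "lb Lb (b t w)" unfolding lb_def L2_set_def using Lb by (auto intro: real_le_lsqrt sum_nonneg)
  show "lb (Lb / real N) (b t w - vf (\<lambda>m. bt N m t w))" if N: "N \<ge> 1"
    unfolding lb_def
  proof (intro allI impI)
    fix S :: "freq set" assume S: "finite S"
    have pt: "(norm ((b t w - vf (\<lambda>m. bt N m t w)) k))^2 \<le> jb k^2 * (norm (b t w k))^2 / (real N)^2" for k
    proof (cases "k \<in> kbox N")
      case True
      hence "(b t w - vf (\<lambda>m. bt N m t w)) k = 0" by (simp add: vec_eq_iff vf_def lk_bt)
      thus ?thesis by simp
    next
      case False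
      then obtain i where "\<not> \<bar>k $ i\<bar> \<le> int N" by (auto simp: kbox_def)
      hence "real N \<le> \<bar>real_of_int (k $ i)\<bar>" by linarith
      hence "(real N)^2 \<le> \<bar>real_of_int (k $ i)\<bar>^2" by (intro power_mono) auto
      hence "(real N)^2 \<le> 1 + knorm2 k" using knorm2_ge[of k i] by simp
      also have "... \<le> jb k^2" using wt[of k] by (simp add: power2_eq_square mult_le_cancel_left1)
      finally have 1: "(real N)^2 \<le> jb k^2" .
      have "(b t w - vf (\<lambda>m. bt N m t w)) k = b t w k" using False by (simp add: vec_eq_iff vf_def lk_bt)
      thus ?thesis using mult_right_mono[OF 1, of "(norm (b t w k))^2"] N by (simp add: le_divide_eq mult.commute)
    qed
    have "(\<Sum>k\<in>S. (norm ((b t w - vf (\<lambda>m. bt N m t w)) k))^2) \<le> (\<Sum>k\<in>S. jb k^2 * (norm (b t w k))^2 / (real N)^2)"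
      by (intro sum_mono pt)
    also have "... = wS S (b t w) / (real N)^2" by (simp only: sum_divide_distrib)
    also have "... \<le> Lb^2 / (real N)^2" using b_bd[OF S, of t w] by (intro divide_right_mono) auto
    also have "... = (Lb / real N)^2" by (simp add: power_divide)
    finally show "L2_set (\<lambda>k. norm ((b t w - vf (\<lambda>m. bt N m t w)) k)) S \<le> Lb / real N"
      unfolding L2_set_def using Lb by (intro real_le_lsqrt) (auto intro: sum_nonneg)
  qed
qed

end

text \<open>The rate of l^(-1/4) when l is at least 2^q.\<close>

definition theta :: real where "theta = 2 powr (-1/4)"

lemma theta: "0 < theta" "theta < 1"
  unfolding theta_def using powr_less_mono[of "-1/4" 0 2] by auto

locale limit = noise F b Lb \<alpha> for F :: "real \<Rightarrow> 'a measure" and b Lb \<alpha> +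
  fixes Be L :: nat and c :: real and U R
  assumes good: "good_seq Be L c U R" and Be2: "2 \<le> Be" and L2: "2 \<le> L" and c0: "0 \<le> c"
begin

abbreviation l :: "nat \<Rightarrow> nat" where "l \<equiv> Lq Be L"
definition V :: "nat \<Rightarrow> real \<Rightarrow> 'a \<Rightarrow> field" where "V q t w = vf (\<lambda>m. U q m t w)"
text \<open>The degree after step q is l (q-9) to the power 13 Be^10, so its \<open>gam\<close>-th
  power is l (q-9)^(1/4).\<close>

definition gam :: real where "gam = 1 / (52 * real Be^10)"

lemma gam: "0 < gam" "gam < 1"
proof -
  have "1 \<le> real Be ^ 10" using Be2 by simp
  hence "1 < 52 * real Be ^ 10" by linarith
  thus "0 < gam" "gam < 1" using Be2 unfolding gam_def by (auto simp: divide_less_eq)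
qed

lemma l_ge: "2^(q+1) \<le> l q"
proof -
  have "q + 1 \<le> Be^q"
  proof (induction q)
    case (Suc q)
    have "2 * (q + 1) \<le> Be * Be^q" using Suc Be2 by (intro mult_mono) auto
    thus ?case by simp
  qed simp
  hence "(2::nat)^(q+1) \<le> 2^(Be^q)" by (intro power_increasing) auto
  also have "... \<le> L^(Be^q)" using L2 by (intro power_mono) auto
  finally show ?thesis by (simp add: Lq_def)
qed

lemma l_gt: "q < l q" "1 \<le> l q"
proof -
  have "q < 2^q" by simp
  also have "(2::nat)^q \<le> 2^(q+1)" by simp
  finally show "q < l q" using l_ge[of q] by linarith
  thus "1 \<le> l q" by simp
qed

lemma l_Suc_ge: "l q \<le> l (Suc q)"
  unfolding Lq_Suc using l_gt(2)[of q] Be2 power_increasing[of 1 Be "l q"] by simp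

lemma stq: "st (l q) (U q) (R q)" using good by (simp add: good_seq_def)

lemma gpU: "gp (real (l q)) ((l q)^13) (U q m)" using stq by (simp add: st_def)

lemma dU: "sn (30 * sqrt (Kq Be L c q)) (U (Suc q) m t w - U q m t w)"
  using good by (simp add: good_seq_def)

lemma Ueq: "k \<in> kbox ((l q)^12) \<Longrightarrow> lk (U (Suc q) m t w) k = lk (U q m t w) k"
  using good by (simp add: good_seq_def)

lemma Rsm: "9 \<le> q \<Longrightarrow> sn (2 / real (l (q - 9))) (R q a d t w)"
  using good by (simp add: good_seq_def)

definition Nz :: "real \<Rightarrow> nat \<Rightarrow> real" where
  "Nz g q = (if q < 9 then (1 + 3 * (real ((l (Suc q))^13))^2) powr (g/2) * (60 * sqrt c) else 240 * theta^(q - 9))"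

lemma Nz_nonneg: "0 \<le> Nz g q" using c0 theta by (simp add: Nz_def)

text \<open>For q >= 9 the amplitude is a constant times l (q-9)^(-1/2), while the Bernstein factor
  is at most 2 l (q-9)^(1/4) by the choice of \<open>gam\<close>. The first nine increments are
  merely finite.\<close>

lemma V_step:
  assumes "finite S" "0 \<le> g" "g \<le> gam"
  shows "Hn g S (V (Suc q) t w - V q t w) \<le> Nz g q"
proof -
  let ?D = "(l (Suc q))^13"
  have d: "dg ?D (U (Suc q) m t w - U q m t w)" for m
    using gp_dg[OF gpU[of "Suc q" m]] dg_mono[OF gp_dg[OF gpU[of q m]] power_mono[OF l_Suc_ge]]
    by (intro dg_diff) auto
  have "Hn g S (V (Suc q) t w - V q t w) \<le> (1 + 3 * (real ?D)^2) powr (g/2) * (2 * (30 * sqrt (Kq Be L c q)))"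
    unfolding V_def vf_diff by (rule Hn_vf[OF assms(1) d dU assms(2)])
  also have "... \<le> Nz g q"
  proof (cases "q < 9")
    case True
    thus ?thesis by (simp add: Nz_def Kq_def)
  next
    case False
    define x where "x = real (l (q - 9))"
    have x1: "1 \<le> x" using l_gt(2)[of "q - 9"] unfolding x_def by linarith
    have "l (Suc q) = l (q - 9) ^ (Be^10)"
    proof -
      have "Be ^ Suc q = Be^(q - 9) * Be^10" using False by (simp flip: power_add)
      thus ?thesis by (simp add: Lq_def power_mult)
    qed
    hence D: "real ?D = x ^ (13 * Be^10)" by (simp add: x_def mult.commute flip: power_mult)
    have D1: "1 \<le> real ?D" unfolding D using x1 by simp
    have "(1 + 3 * (real ?D)^2) powr (g/2) \<le> ((2 * real ?D)^2) powr (g/2)"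
      using D1 assms one_le_power[OF D1, of 2] by (intro powr_mono2) (auto simp: power_mult_distrib)
    also have "... = (2 * real ?D) powr g"
    proof -
      have "(2 * real ?D)^2 = (2 * real ?D) powr 2" using D1 by simp
      thus ?thesis by (simp only: powr_powr) simp
    qed
    also have "... \<le> (2 * real ?D) powr gam" using assms D1 by (intro powr_mono) auto
    also have "... = 2 powr gam * real ?D powr gam" by (simp only: powr_mult)
    also have "... \<le> 2 powr 1 * real ?D powr gam" using gam by (intro mult_right_mono powr_mono) auto
    also have "real ?D powr gam = x powr (1/4)"
    proof -
      have "real ?D = x powr (13 * real Be^10)" using x1 unfolding D by (simp flip: powr_realpow)
      moreover have "13 * real Be^10 * gam = 1/4" using Be2 by (simp add: gam_def)
      ultimately show ?thesis by (simp only: powr_powr)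
    qed
    finally have 1: "(1 + 3 * (real ?D)^2) powr (g/2) \<le> 2 * x powr (1/4)" by simp
    have "sqrt (Kq Be L c q) = 2 * x powr (-1/2)"
    proof -
      have "sqrt (4 / x) = 2 * (1 / sqrt x)" by (simp add: real_sqrt_divide)
      also have "1 / sqrt x = x powr (-1/2)" using x1 by (simp add: powr_minus_divide powr_half_sqrt)
      finally show ?thesis using False by (simp only: Kq_def x_def if_False)
    qed
    hence "2 * (30 * sqrt (Kq Be L c q)) = 120 * x powr (-1/2)" by simp
    hence "(1 + 3 * (real ?D)^2) powr (g/2) * (2 * (30 * sqrt (Kq Be L c q))) \<le> 2 * x powr (1/4) * (120 * x powr (-1/2))"
      using mult_right_mono[OF 1, of "120 * x powr (-1/2)"] by (simp only:) simp
    also have "... = 240 * x powr (-1/4)" by (simp flip: powr_add)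
    also have "x powr (-1/4) \<le> (2 ^ (q - 9)) powr (-1/4)"
    proof (rule powr_mono2')
      have "2^(q - 9) \<le> (2::nat)^(q - 9 + 1)" by simp
      hence "2^(q - 9) \<le> l (q - 9)" using l_ge[of "q - 9"] by linarith
      thus "2^(q - 9) \<le> x" unfolding x_def by (metis of_nat_le_iff of_nat_numeral of_nat_power)
    qed auto
    also have "(2 ^ (q - 9)) powr (-1/4) = theta^(q - 9)"
      unfolding theta_def by (simp add: powr_powr mult.commute flip: powr_realpow)
    finally show ?thesis using False by (simp add: Nz_def)
  qed
  finally show ?thesis .
qed

lemma Nz_summable: "summable (Nz g)"
proof -
  have "summable (\<lambda>q. 240 * theta^q)" using theta by (intro summable_mult summable_geometric) simp
  hence "summable (\<lambda>q. Nz g (q + 9))" by (simp add: Nz_def)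
  thus ?thesis by (simp only: summable_iff_shift)
qed

definition Tl :: "real \<Rightarrow> nat \<Rightarrow> real" where "Tl g q = suminf (\<lambda>j. Nz g (j + q))"

lemma Tl_eq: "Tl g q = suminf (Nz g) - sum (Nz g) {..<q}"
  unfolding Tl_def by (rule suminf_minus_initial_segment[OF Nz_summable])

lemma Tl_lim: "Tl g \<longlonglongrightarrow> 0"
proof -
  have "(\<lambda>q. suminf (Nz g) - sum (Nz g) {..<q}) \<longlonglongrightarrow> suminf (Nz g) - suminf (Nz g)"
    by (intro tendsto_diff tendsto_const summable_LIMSEQ Nz_summable)
  thus ?thesis by (simp add: Tl_eq[abs_def])
qed

lemma Tl_nonneg: "0 \<le> Tl g q"
  unfolding Tl_def by (intro suminf_nonneg summable_ignore_initial_segment Nz_summable Nz_nonneg)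

lemma Tl_le: "Tl g q \<le> Tl g 0"
  unfolding Tl_eq using Nz_nonneg by (simp add: sum_nonneg)

text \<open>For g = 0 the Bernstein factor is 1: the first nine increments give 9 * 60 sqrt c, the
  others a constant. With c proportional to A this is the O(sqrt A) of the energy argument.\<close>

lemma Tl_0: "Tl 0 0 = 540 * sqrt c + 240 / (1 - theta)"
proof -
  have "suminf (Nz 0) = suminf (\<lambda>n. Nz 0 (n + 9)) + sum (Nz 0) {..<9}"
    by (rule suminf_split_initial_segment[OF Nz_summable])
  also have "suminf (\<lambda>n. Nz 0 (n + 9)) = suminf (\<lambda>q. 240 * theta^q)" by (simp add: Nz_def)
  also have "... = 240 / (1 - theta)"
    using theta by (subst suminf_mult) (auto simp: suminf_geometric intro: summable_geometric)
  also have "sum (Nz 0) {..<9} = (\<Sum>q<(9::nat). 60 * sqrt c)"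
  proof (rule sum.cong[OF refl])
    fix q :: nat assume "q \<in> {..<9}"
    moreover have "1 + 3 * (real (l (Suc q) ^ 13))\<^sup>2 \<noteq> 0" by (metis add_pos_nonneg less_numeral_extra(1,3) mult_nonneg_nonneg zero_le_numeral zero_le_power2)
    ultimately show "Nz 0 q = 60 * sqrt c" by (simp add: Nz_def)
  qed
  finally show ?thesis by (simp add: Tl_eq)
qed

lemma V_diff:
  assumes S: "finite S" "0 \<le> g" "g \<le> gam" and q: "q \<le> q'"
  shows "Hn g S (V q' t w - V q t w) \<le> Tl g q"
proof -
  have "Hn g S (V q' t w - V q t w) \<le> sum (Nz g) {q..<q'}" using q
  proof (induction q' rule: dec_induct)
    case (step n)
    have "Hn g S ((V (Suc n) t w - V n t w) + (V n t w - V q t w)) \<le> Nz g n + sum (Nz g) {q..<n}"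
      by (rule order_trans[OF Hn_triangle add_mono[OF V_step[OF S] step.IH]])
    moreover have "(V (Suc n) t w - V n t w) + (V n t w - V q t w) = V (Suc n) t w - V q t w" by (rule ext) simp
    ultimately have "Hn g S (V (Suc n) t w - V q t w) \<le> Nz g n + sum (Nz g) {q..<n}" by (simp only:)
    thus ?case using step(1) by (simp only: sum.atLeastLessThan_Suc add.commute)
  qed (simp add: Hn_def L2_set_def)
  also have "sum (Nz g) {q..<q'} = sum (Nz g) {..<q'} - sum (Nz g) {..<q}"
    using q by (simp add: lessThan_atLeast0 sum_diff_nat_ivl)
  also have "... \<le> Tl g q"
    unfolding Tl_eq using sum_le_suminf[OF Nz_summable, of "{..<q'}" g] Nz_nonneg by simp
  finally show ?thesis .
qed

text \<open>From stage \<open>qk k\<close> on the coefficient of k no longer changes. Defining the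
  limit through that stage makes its measurability that of an approximate solution.\<close>

definition qk :: "freq \<Rightarrow> nat" where "qk k = (LEAST q. k \<in> kbox ((l q)^12))"
definition uu :: "real \<Rightarrow> 'a \<Rightarrow> field" where "uu t w k = V (qk k) t w k"

lemma l_mono: "q \<le> q' \<Longrightarrow> l q \<le> l q'" by (rule lift_Suc_mono_le[of l, OF l_Suc_ge])

lemma qk: "k \<in> kbox ((l (qk k))^12)"
proof -
  obtain D where D: "{k} \<subseteq> kbox D" using exists_kbox[of "{k}"] by auto
  have "D \<le> (l D)^12" using l_gt(1)[of D] power_increasing[of 1 12 "l D"] l_gt(2)[of D] by simp
  hence "k \<in> kbox ((l D)^12)" using D kbox_mono by blast
  thus ?thesis unfolding qk_def by (rule LeastI)
qed

lemma uu_eq: "qk k \<le> q \<Longrightarrow> uu t w k = V q t w k"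
proof (induction q rule: dec_induct)
  case (step n)
  have "k \<in> kbox ((l n)^12)" using qk[of k] kbox_mono[OF power_mono[OF l_mono[OF step(1)]]] by auto
  thus ?case using step Ueq by (simp add: V_def vf_def)
qed (simp add: uu_def)

text \<open>On a finite set of frequencies the limit coincides with a single late stage,
  simultaneously for all times and all \<open>w\<close>.\<close>

lemma uu_eq_set:
  assumes "finite S"
  obtains q' where "q \<le> q'" "\<And>k t w. k \<in> S \<Longrightarrow> uu t w k = V q' t w k"
proof -
  have "qk k \<le> Max (insert q (qk ` S))" if "k \<in> S" for k using that assms by simp
  thus ?thesis using uu_eq assms by (intro that[of "Max (insert q (qk ` S))"]) auto
qed

lemma uu_diff:
  assumes S: "finite S" "0 \<le> g" "g \<le> gam"
  shows "Hn g S (uu t w - V q t w) \<le> Tl g q"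
proof -
  obtain q' where q': "q \<le> q'" "\<And>k t w. k \<in> S \<Longrightarrow> uu t w k = V q' t w k" using uu_eq_set[OF S(1)] by blast
  hence "Hn g S (uu t w - V q t w) = Hn g S (V q' t w - V q t w)"
    unfolding Hn_def by (intro L2_set_cong) auto
  thus ?thesis using V_diff[OF S q'(1)] by simp
qed

definition H0 :: "real \<Rightarrow> real" where "H0 g = (1 + 3 * (real ((l 0)^13))^2) powr (g/2) * (2 * real (l 0))"

lemma V0_bound: "finite S \<Longrightarrow> 0 \<le> g \<Longrightarrow> Hn g S (V 0 t w) \<le> H0 g"
  unfolding V_def H0_def using gp_dg[OF gpU] gp_an[OF gpU] by (intro Hn_vf sn_an) auto

lemma uu_bound:
  assumes S: "finite S" "0 \<le> g" "g \<le> gam"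
  shows "Hn g S (uu t w) \<le> H0 g + Tl g 0"
  using Hn_triangle[of g S "uu t w - V 0 t w" "V 0 t w"] uu_diff[OF S, of t w 0] V0_bound[OF S(1,2), of t w] by simp

lemma V_hold:
  assumes "finite S" "0 \<le> g"
  shows "Hn g S (V q s w - V q t w) \<le> (1 + 3 * (real ((l q)^13))^2) powr (g/2) * (2 * (real (l q) * \<bar>s - t\<bar> powr (1/8)))"
  unfolding V_def vf_diff using gp_dg[OF gpU] gp_hold[OF gpU] by (intro Hn_vf[OF assms(1) _ _ assms(2)] dg_diff sn_an) auto

text \<open>Uniform approximation by the stages \<open>V q\<close>, each of which is Hoelder in
  time.\<close>

lemma uu_cont:
  assumes "0 < \<epsilon>"
  shows "\<exists>\<delta>>0. \<forall>s. \<bar>s - t\<bar> < \<delta> \<longrightarrow> (\<forall>S. finite S \<longrightarrow> Hn gam S (uu s w - uu t w) \<le> \<epsilon>)"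
proof -
  have "\<forall>\<^sub>F q in sequentially. Tl gam q < \<epsilon> / 3"
    using Tl_lim by (rule order_tendstoD) (use assms in simp)
  then obtain q where q: "Tl gam q < \<epsilon> / 3" by (auto simp: eventually_sequentially)
  define H where "H = (1 + 3 * (real ((l q)^13))^2) powr (gam/2) * (2 * real (l q))"
  have H: "0 \<le> H" by (simp add: H_def)
  \<comment> \<open>The power 8 inverts the Hoelder exponent 1/8.\<close>
  define \<delta> where "\<delta> = (\<epsilon> / (3 * (H + 1))) powr 8"
  have x: "0 < \<epsilon> / (3 * (H + 1))" using assms H by simp
  have "Hn gam S (uu s w - uu t w) \<le> \<epsilon>" if s: "\<bar>s - t\<bar> < \<delta>" and S: "finite S" for s S
  proof -
    have "\<bar>s - t\<bar> powr (1/8) \<le> \<delta> powr (1/8)" using s by (intro powr_mono2) auto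
    also have "... = \<epsilon> / (3 * (H + 1))"
    proof -
      have "(y powr 8) powr (1/8) = y" if "0 < y" for y :: real using that by (simp only: powr_powr) simp
      thus ?thesis using x unfolding \<delta>_def by blast
    qed
    finally have "H * \<bar>s - t\<bar> powr (1/8) \<le> (H + 1) * (\<epsilon> / (3 * (H + 1)))" using H x by (intro mult_mono) auto
    also have "... = \<epsilon> / 3" using H by (simp add: field_simps)
    finally have "H * \<bar>s - t\<bar> powr (1/8) \<le> \<epsilon> / 3" .
    moreover have "Hn gam S (V q s w - V q t w) \<le> H * \<bar>s - t\<bar> powr (1/8)"
      using V_hold[OF S, of gam q s w t] gam by (simp add: H_def mult_ac)
    moreover have "Hn gam S ((uu s w - V q s w) + ((V q s w - V q t w) + (V q t w - uu t w)))
      \<le> Tl gam q + (Hn gam S (V q s w - V q t w) + Tl gam q)"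
      using uu_diff[OF S _ order_refl, of s w q] uu_diff[OF S _ order_refl, of t w q] gam Hn_minus_commute[of gam S "V q t w" "uu t w"]
      by (intro order_trans[OF Hn_triangle] add_mono) auto
    ultimately show ?thesis using q by simp
  qed
  moreover have "0 < \<delta>" unfolding \<delta>_def powr_gt_zero using x by (rule less_imp_neq[THEN not_sym])
  ultimately show ?thesis by blast
qed

lemma uu_meas: "(\<lambda>w. uu t w k $ m) \<in> borel_measurable (F t)"
  using gp_ad[OF gpU] unfolding uu_def V_def vf_def by (simp add: ad_def)

lemma uu_L2sigma: "uu t w \<in> L2sigma"
proof -
  have herm: "uu t w (- k) = (\<chi> i. cnj (uu t w k $ i))" for k
  proof -
    obtain q where q: "\<And>k' t w. k' \<in> {k, - k} \<Longrightarrow> uu t w k' = V q t w k'" using uu_eq_set[of "{k, - k}" 0] by auto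
    have "rl (U q m t w)" for m using stq by (simp add: st_def)
    thus ?thesis using q[of k] q[of "- k"] by (simp add: V_def vf_def vec_eq_iff rl_herm)
  qed
  have div: "(\<Sum>i\<in>UNIV. of_int (k $ i) * uu t w k $ i) = 0" for k
  proof -
    have "(\<Sum>l\<in>UNIV. dv l (U (qk k) l t w)) = 0" using stq by (simp add: st_def)
    hence "lk (\<Sum>l\<in>UNIV. dv l (U (qk k) l t w)) k = 0" by simp
    hence "\<i> * (\<Sum>i\<in>UNIV. of_int (k $ i) * lk (U (qk k) i t w) k) = 0"
      by (simp add: lookup_sum dsym_def sum_distrib_left mult.assoc)
    thus ?thesis by (simp add: uu_def V_def vf_def)
  qed
  have "(\<lambda>k. (norm (uu t w k))^2) summable_on UNIV"
  proof (rule nonneg_bdd_above_summable_on)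
    show "bdd_above (sum (\<lambda>k. (norm (uu t w k))^2) ` {F. F \<subseteq> UNIV \<and> finite F})"
    proof (rule bdd_aboveI2)
      fix S assume "S \<in> {F. F \<subseteq> (UNIV :: freq set) \<and> finite F}"
      hence S: "finite S" by simp
      have "(\<Sum>k\<in>S. (norm (uu t w k))^2) = (Hn 0 S (uu t w))^2" by (simp add: Hn_0 L2_set_def sum_nonneg)
      also have "... \<le> (H0 0 + Tl 0 0)^2" using uu_bound[OF S, of 0 t w] gam by (intro power_mono) auto
      finally show "(\<Sum>k\<in>S. (norm (uu t w k))^2) \<le> (H0 0 + Tl 0 0)^2" .
    qed
  qed simp
  thus ?thesis using herm div by (simp add: L2sigma_def)
qed

lemma uu_V_lb: "lb (Tl 0 q) (uu t w - V q t w)"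
  unfolding lb_def Hn_0[symmetric] using gam(1) by (intro allI impI uu_diff) auto

definition Yb :: real where "Yb = H0 0 + Tl 0 0 + Tl 0 0"

lemma uu_lb: "lb Yb (uu t w)" "lb Yb (V q t w)"
proof -
  have 1: "lb (H0 0 + Tl 0 0) (uu t w)" unfolding lb_def Hn_0[symmetric] using uu_bound gam by auto
  thus "lb Yb (uu t w)" by (rule lb_mono) (simp add: Yb_def Tl_nonneg)
  have "uu t w - (uu t w - V q t w) = V q t w" by (rule ext) simp
  moreover have "lb (H0 0 + Tl 0 0 + Tl 0 q) (uu t w - (uu t w - V q t w))" by (intro lb_diff 1 uu_V_lb)
  ultimately have "lb (H0 0 + Tl 0 0 + Tl 0 q) (V q t w)" by (simp only:)
  moreover have "H0 0 + Tl 0 0 + Tl 0 q \<le> Yb" unfolding Yb_def by (intro add_left_mono Tl_le)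
  ultimately show "lb Yb (V q t w)" by (rule lb_mono)
qed

lemma F_cont:
  assumes e: "tst E e"
  shows "continuous_on A (\<lambda>s. F_pair \<alpha> (uu s w) e)"
proof -
  have "isCont (\<lambda>s. F_pair \<alpha> (uu s w) e) t" for t
    unfolding continuous_at_eps_delta
  proof (intro allI impI)
    fix \<epsilon> :: real assume \<epsilon>: "0 < \<epsilon>"
    have E: "0 \<le> E" "0 \<le> Yb" using tst_nonneg[OF e] lb_nonneg[OF uu_lb(1)] by auto
    define M where "M = (18 * Yb + 3) * E"
    have M: "0 \<le> M" using E by (simp add: M_def)
    obtain \<delta> where \<delta>: "\<delta> > 0" "\<And>s S. \<bar>s - t\<bar> < \<delta> \<Longrightarrow> finite S \<Longrightarrow> Hn gam S (uu s w - uu t w) \<le> \<epsilon> / (M + 1)"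
      using uu_cont[of "\<epsilon> / (M + 1)" t w] \<epsilon> M by auto
    have "\<bar>F_pair \<alpha> (uu s w) e - F_pair \<alpha> (uu t w) e\<bar> < \<epsilon>" if "\<bar>s - t\<bar> < \<delta>" for s
    proof -
      have "lb (\<epsilon> / (M + 1)) (uu s w - uu t w)"
        unfolding lb_def
      proof (intro allI impI)
        fix S :: "freq set" assume S: "finite S"
        have "L2_set (\<lambda>k. norm ((uu s w - uu t w) k)) S \<le> Hn gam S (uu s w - uu t w)"
          unfolding Hn_def
        proof (rule L2_set_mono)
          fix k
          have "1 \<le> jb k powr (gam/2)" using gam by (intro ge_one_powr_ge_zero) auto
          thus "norm ((uu s w - uu t w) k) \<le> jb k powr (gam/2) * norm ((uu s w - uu t w) k)"
            using mult_right_mono[of 1 _ "norm ((uu s w - uu t w) k)"] by fastforce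
        qed simp
        thus "L2_set (\<lambda>k. norm ((uu s w - uu t w) k)) S \<le> \<epsilon> / (M + 1)" using \<delta>(2)[OF that S] by linarith
      qed
      from F_pair_diff[OF uu_lb(1) uu_lb(1) this e \<alpha>] have "\<bar>F_pair \<alpha> (uu s w) e - F_pair \<alpha> (uu t w) e\<bar> \<le> M * (\<epsilon> / (M + 1))"
        unfolding M_def .
      also have "... < \<epsilon>" using M \<epsilon> by (simp add: field_simps)
      finally show ?thesis .
    qed
    thus "\<exists>d>0. \<forall>x'. dist x' t < d \<longrightarrow> dist (F_pair \<alpha> (uu x' w) e) (F_pair \<alpha> (uu t w) e) < \<epsilon>"
      using \<delta>(1) by (auto simp: dist_real_def)
  qed
  thus ?thesis by (simp add: continuous_at_imp_continuous_on)
qed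

text \<open>Stage q satisfies the tested equation with integrand \<open>f q\<close> and increment
  \<open>I q\<close>. The integrands converge uniformly in time, because the stress tends to 0 and
  \<open>V q\<close> converges in L^2; the three terms of the increment converge separately.\<close>

lemma uu_equation:
  assumes e: "e \<in> Hs 3" and t: "0 \<le> t"
  shows "((\<lambda>r. F_pair \<alpha> (uu r w) e) has_integral inner_L2 (uu t w) e - inner_L2 (uu 0 w) e - inner_L2 (b t w) e) {0..t}"
proof -
  define E where "E = sqrt (enn2real (Hs_norm2 3 e)) * sqrt Clat"
  have E: "tst E e" unfolding E_def by (rule tst_Hs[OF e])
  have E0: "0 \<le> E" by (rule tst_nonneg[OF E])
  define h where "h s = F_pair \<alpha> (uu s w) e" for s
  have hi: "(h has_integral integral {0..t} h) {0..t}"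
    unfolding h_def by (intro integrable_integral integrable_continuous_real F_cont[OF E])
  define S where "S q = kbox (2 * (l q)^13)" for q
  have Sf: "finite (S q)" for q by (simp add: S_def finite_kbox)
  have sub: "kbox ((l q)^13) \<subseteq> S q" "kbox ((l q)^12) \<subseteq> S q" for q
  proof -
    show 1: "kbox ((l q)^13) \<subseteq> S q" unfolding S_def by (rule kbox_mono) simp
    have "kbox ((l q)^12) \<subseteq> kbox ((l q)^13)" using l_gt(2)[of q] by (intro kbox_mono power_increasing) auto
    thus "kbox ((l q)^12) \<subseteq> S q" using 1 by (rule order_trans)
  qed
  define f where "f q s = Re (\<Sum>n\<in>S q. \<Sum>m\<in>UNIV. cnj (e n $ m) * lk (rhs \<alpha> (\<lambda>m. U q m s w) (\<lambda>a d. R q a d s w) m) n)" for q s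
  define I where "I q = inner_L2 (V q t w) e - inner_L2 (V q 0 w) e - inner_L2 (vf (\<lambda>m. bt ((l q)^12) m t w)) e" for q
  have fI: "(f q has_integral I q) {0..t}" for q
  proof -
    have ed: "(\<Sum>m\<in>UNIV. cnj (e n $ m) * of_int (n $ m)) = 0" for n
    proof -
      have "(\<Sum>m\<in>UNIV. of_int (n $ m) * e n $ m) = 0" using e by (simp add: Hs_def L2sigma_def)
      hence "cnj (\<Sum>m\<in>UNIV. of_int (n $ m) * e n $ m) = 0" by simp
      thus ?thesis by (simp add: mult.commute)
    qed
    have "((\<lambda>s. \<Sum>m\<in>UNIV. cnj (e n $ m) * lk (rhs \<alpha> (\<lambda>m. U q m s w) (\<lambda>a d. R q a d s w) m) n) has_integral
      (\<Sum>m\<in>UNIV. cnj (e n $ m) * (lk (U q m t w) n - lk (U q m 0 w) n - lk (bt ((l q)^12) m t w) n))) {0..t}" for n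
      by (rule stq[of q, unfolded st_def, THEN conjunct2, THEN conjunct2, THEN conjunct2, THEN conjunct2, THEN conjunct2,
          THEN spec, THEN spec, THEN spec, THEN spec, THEN mp, THEN mp, OF ed t])
    hence "((\<lambda>s. \<Sum>n\<in>S q. \<Sum>m\<in>UNIV. cnj (e n $ m) * lk (rhs \<alpha> (\<lambda>m. U q m s w) (\<lambda>a d. R q a d s w) m) n) has_integral
      (\<Sum>n\<in>S q. \<Sum>m\<in>UNIV. cnj (e n $ m) * (lk (U q m t w) n - lk (U q m 0 w) n - lk (bt ((l q)^12) m t w) n))) {0..t}"
      by (rule has_integral_sum[OF Sf])
    from has_integral_linear[OF this bounded_linear_Re]
    have "(f q has_integral Re (\<Sum>n\<in>S q. \<Sum>m\<in>UNIV. cnj (e n $ m) * (lk (U q m t w) n - lk (U q m 0 w) n - lk (bt ((l q)^12) m t w) n))) {0..t}"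
      by (simp only: o_def f_def[abs_def])
    moreover have "Re (\<Sum>n\<in>S q. \<Sum>m\<in>UNIV. cnj (e n $ m) * (lk (U q m t w) n - lk (U q m 0 w) n - lk (bt ((l q)^12) m t w) n)) = I q"
    proof -
      have i: "inner_L2 (V q s w) e = Re (\<Sum>n\<in>S q. \<Sum>m\<in>UNIV. cnj (e n $ m) * lk (U q m s w) n)" for s
        unfolding V_def by (rule inner_vf[OF gp_dg[OF gpU] sub(1) Sf])
      have "inner_L2 (vf (\<lambda>m. bt ((l q)^12) m t w)) e = Re (\<Sum>n\<in>S q. \<Sum>m\<in>UNIV. cnj (e n $ m) * lk (bt ((l q)^12) m t w) n)"
        by (rule inner_vf[OF dg_bt sub(2) Sf])
      thus ?thesis
        unfolding I_def i by (simp only: minus_complex.sel(1)[symmetric] sum_subtractf[symmetric] right_diff_distrib)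
    qed
    ultimately show ?thesis by simp
  qed
  define d where "d q = 81 * (2 / real (l (q - 9)) * E) + (18 * Yb + 3) * E * Tl 0 q" for q
  have diff: "\<bar>f q s - h s\<bar> \<le> d q" if q: "9 \<le> q" for q s
  proof -
    have "\<bar>F_pair \<alpha> (uu s w) e - F_pair \<alpha> (V q s w) e\<bar> \<le> (18 * Yb + 3) * E * Tl 0 q"
      by (rule F_pair_diff[OF uu_lb uu_V_lb E \<alpha>])
    moreover have "\<bar>f q s - F_pair \<alpha> (V q s w) e\<bar> \<le> 81 * (2 / real (l (q - 9)) * E)"
    proof -
      have "F_pair \<alpha> (V q s w) e = Re (\<Sum>n\<in>S q. \<Sum>m\<in>UNIV. cnj (e n $ m) * lk (rhs \<alpha> (\<lambda>m. U q m s w) (\<lambda>a b. 0) m) n)"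
        unfolding V_def S_def by (rule F_pair_vf[OF gp_dg[OF gpU]])
      hence eq: "f q s - F_pair \<alpha> (V q s w) e = Re (\<Sum>n\<in>S q. \<Sum>m\<in>UNIV. cnj (e n $ m) *
         (lk (rhs \<alpha> (\<lambda>m. U q m s w) (\<lambda>a d. R q a d s w) m) n - lk (rhs \<alpha> (\<lambda>m. U q m s w) (\<lambda>a b. 0) m) n))"
        unfolding f_def by (simp only: minus_complex.sel(1)[symmetric] sum_subtractf[symmetric] right_diff_distrib)
      have bd: "cmod (lk (R q a d' s w) n) \<le> 2 / real (l (q - 9))" for a d' n
      proof -
        have "gp (real (l q)) ((l q)^13) (R q a d')" using stq by (simp add: st_def)
        thus ?thesis by (intro cmod_lk_le[OF gp_dg Rsm[OF q]])
      qed
      show ?thesis unfolding eq by (rule order_trans[OF abs_Re_le_cmod stress_pair[OF E Sf bd]])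
    qed
    ultimately show ?thesis by (simp add: d_def h_def)
  qed
  have l_lim: "(\<lambda>q. 2 / real (l (q - 9))) \<longlonglongrightarrow> 0"
  proof -
    have "filterlim (\<lambda>q. real (l q)) at_top sequentially"
      by (rule filterlim_at_top_mono[OF filterlim_real_sequentially]) (use l_gt(1) in \<open>auto intro!: always_eventually less_imp_le\<close>)
    hence "(\<lambda>q. 2 / real (l q)) \<longlonglongrightarrow> 0" by (intro tendsto_divide_0[OF tendsto_const] filterlim_at_top_imp_at_infinity)
    hence "(\<lambda>q. 2 / real (l (q + 9 - 9))) \<longlonglongrightarrow> 0" by simp
    thus ?thesis by (rule LIMSEQ_offset)
  qed
  have "d \<longlonglongrightarrow> 81 * (0 * E) + (18 * Yb + 3) * E * 0"
    unfolding d_def[abs_def] by (intro tendsto_intros l_lim Tl_lim)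
  hence dl: "d \<longlonglongrightarrow> 0" by simp
  have "I \<longlonglongrightarrow> integral {0..t} h"
  proof (rule LIM_zero_cancel, rule Lim_null_comparison)
    show "\<forall>\<^sub>F q in sequentially. norm (I q - integral {0..t} h) \<le> d q * t"
    proof (rule eventually_sequentiallyI[of 9])
      fix q :: nat assume q: "9 \<le> q"
      have "((\<lambda>s. f q s - h s) has_integral I q - integral {0..t} h) (cbox 0 t)"
        using has_integral_diff[OF fI[of q] hi] by simp
      from has_integral_bound[OF _ this, of "d q"] show "norm (I q - integral {0..t} h) \<le> d q * t"
        using diff[OF q] t by (auto intro: order_trans[OF abs_ge_zero])
    qed
    show "(\<lambda>q. d q * t) \<longlonglongrightarrow> 0" using tendsto_mult_left_zero[OF dl] by simp
  qed
  moreover have "I \<longlonglongrightarrow> inner_L2 (uu t w) e - inner_L2 (uu 0 w) e - inner_L2 (b t w) e"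
  proof -
    have lim: "(\<lambda>q. inner_L2 (g q) e) \<longlonglongrightarrow> inner_L2 y e"
      if "lb Y y" "\<And>q. lb Y (g q)" "\<And>q. lb (x q) (y - g q)" "x \<longlonglongrightarrow> 0" for g y Y x
    proof (rule LIM_zero_cancel, rule Lim_null_comparison)
      show "\<forall>\<^sub>F q in sequentially. norm (inner_L2 (g q) e - inner_L2 y e) \<le> 3 * (x q * E)"
      proof (rule always_eventually, rule allI)
        fix q
        show "norm (inner_L2 (g q) e - inner_L2 y e) \<le> 3 * (x q * E)"
          using inner_diff[OF that(2)[of q] that(1) lb_minus_commute[OF that(3)[of q]] E] by simp
      qed
      have "(\<lambda>q. 3 * (x q * E)) \<longlonglongrightarrow> 3 * (0 * E)" by (intro tendsto_intros that(4))
      thus "(\<lambda>q. 3 * (x q * E)) \<longlonglongrightarrow> 0" by simp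
    qed
    have N1: "1 \<le> (l q)^12" for q using l_gt(2)[of q] by simp
    have bl: "lb (Lb / real ((l q)^12)) (b t w - vf (\<lambda>m. bt ((l q)^12) m t w))" for q
      by (rule b_lb(2)[OF N1])
    have bl2: "lb (2 * Lb) (vf (\<lambda>m. bt ((l q)^12) m t w))" for q
    proof -
      have "Lb / real ((l q)^12) \<le> Lb / 1" using Lb N1[of q] by (intro divide_left_mono) linarith+
      hence "lb (Lb + Lb) (b t w - (b t w - vf (\<lambda>m. bt ((l q)^12) m t w)))"
        by (intro lb_diff b_lb(1) lb_mono[OF bl]) simp
      thus ?thesis by simp
    qed
    have "(\<lambda>q. Lb / real ((l q)^12)) \<longlonglongrightarrow> 0"
    proof (rule tendsto_divide_0[OF tendsto_const], rule filterlim_at_top_imp_at_infinity)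
      show "filterlim (\<lambda>q. real ((l q)^12)) at_top sequentially"
      proof (rule filterlim_at_top_mono[OF filterlim_real_sequentially], rule always_eventually, rule allI)
        fix q
        have "q \<le> (l q)^12" using l_gt[of q] power_increasing[of 1 12 "l q"] by simp
        thus "real q \<le> real ((l q)^12)" by linarith
      qed
    qed
    note lim[OF lb_mono[OF b_lb(1)] bl2 bl this]
    hence "(\<lambda>q. inner_L2 (vf (\<lambda>m. bt ((l q)^12) m t w)) e) \<longlonglongrightarrow> inner_L2 (b t w) e" using Lb by simp
    thus ?thesis
      unfolding I_def[abs_def] by (intro tendsto_diff lim[OF uu_lb uu_V_lb Tl_lim])
  qed
  ultimately have "integral {0..t} h = inner_L2 (uu t w) e - inner_L2 (uu 0 w) e - inner_L2 (b t w) e"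
    by (rule LIMSEQ_unique)
  thus ?thesis using hi unfolding h_def by simp
qed

end

context noise
begin

text \<open>The interface to the probabilistic part. The constant \<open>C\<close> precedes A in
  \<open>solution_exists\<close>, so A can be chosen last.\<close>

definition sol :: "real \<Rightarrow> real \<Rightarrow> real \<Rightarrow> real \<Rightarrow> (real \<Rightarrow> 'a \<Rightarrow> field) \<Rightarrow> bool" where
  "sol T A C g u \<longleftrightarrow> 0 < g \<and> g < 1 \<and> (\<forall>t k m. (\<lambda>w. u t w k $ m) \<in> borel_measurable (F t))
     \<and> (\<forall>t w. u t w \<in> L2sigma) \<and> (\<exists>H. \<forall>t w S. finite S \<longrightarrow> Hn g S (u t w) \<le> H)
     \<and> (\<forall>t w \<epsilon>. 0 < \<epsilon> \<longrightarrow> (\<exists>\<delta>>0. \<forall>s. \<bar>s - t\<bar> < \<delta> \<longrightarrow> (\<forall>S. finite S \<longrightarrow> Hn g S (u s w - u t w) \<le> \<epsilon>)))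
     \<and> (\<forall>w. \<forall>e\<in>Hs 3. \<forall>t\<ge>0. continuous_on {0..t} (\<lambda>r. F_pair \<alpha> (u r w) e) \<and>
          ((\<lambda>r. F_pair \<alpha> (u r w) e) has_integral inner_L2 (u t w) e - inner_L2 (u 0 w) e - inner_L2 (b t w) e) {0..t})
     \<and> (\<forall>t w. lb (C * sqrt A) (u t w - b t w - vf (\<lambda>m. v0 A T m t)))"

lemma solution_exists:
  assumes T: "0 < T"
  shows "\<exists>C\<ge>0. \<forall>A\<ge>1. \<exists>g u. sol T A C g u"
proof -
  obtain Be C where BC: "2 \<le> Be" "1 \<le> C"
    "\<forall>A\<ge>1. \<exists>L U R. 2 \<le> L \<and> C * A \<le> real L \<and> U 0 = ui L A T \<and> good_seq Be L (C * A) U R"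
    using sequence_exists[OF T] by (elim exE conjE)
  \<comment> \<open>The first two summands come from \<open>Tl_0\<close>, and \<open>Lb\<close> from
    the truncation of the path; sqrt A >= 1 lets them share the factor sqrt A.\<close>
  define C3 where "C3 = 540 * sqrt C + 240 / (1 - theta) + Lb"
  have C3: "0 \<le> C3" using BC(2) theta Lb by (simp add: C3_def)
  have "\<exists>g u. sol T A C3 g u" if A: "1 \<le> A" for A
  proof -
    obtain L U R where L: "2 \<le> L" "U 0 = ui L A T" and gs: "good_seq Be L (C * A) U R"
      using BC(3)[rule_format, OF A] by (elim exE conjE)
    have CA: "0 \<le> C * A" using BC(2) A by simp
    interpret S: limit F b Lb \<alpha> Be L "C * A" U R by unfold_locales (use gs BC L CA in auto)
    have dist: "lb (C3 * sqrt A) (S.uu t w - b t w - vf (\<lambda>m. v0 A T m t))" for t w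
    proof -
      let ?N = "L^12"
      have "Lq Be L 0 = L" by (simp add: Lq_def)
      hence "S.V 0 t w = vf (\<lambda>m. bt ?N m t w + v0 A T m t)" unfolding S.V_def L(2) ui_def by simp
      hence V0: "S.V 0 t w k = vf (\<lambda>m. bt ?N m t w) k + vf (\<lambda>m. v0 A T m t) k" for k
        by (simp add: vf_def vec_eq_iff lookup_add)
      have N: "1 \<le> ?N" using L(1) by simp
      have "lb (S.Tl 0 0 + Lb / real ?N) ((S.uu t w - S.V 0 t w) - (b t w - vf (\<lambda>m. bt ?N m t w)))"
        by (intro lb_diff S.uu_V_lb b_lb(2) N)
      also have "(S.uu t w - S.V 0 t w) - (b t w - vf (\<lambda>m. bt ?N m t w)) = S.uu t w - b t w - vf (\<lambda>m. v0 A T m t)"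
        by (rule ext) (simp add: V0 algebra_simps)
      finally show ?thesis
      proof (rule lb_mono)
        have "Lb / real ?N \<le> Lb / 1" using Lb N by (intro divide_left_mono) linarith+
        moreover have "1 \<le> sqrt A" using A by simp
        moreover have "0 \<le> 240 / (1 - theta)" using theta by simp
        ultimately have "S.Tl 0 0 + Lb / real ?N \<le> 540 * (sqrt C * sqrt A) + 240 / (1 - theta) * sqrt A + Lb * sqrt A"
          unfolding S.Tl_0 real_sqrt_mult using mult_left_mono[of 1 "sqrt A" "240 / (1 - theta)"] mult_left_mono[of 1 "sqrt A" Lb] Lb
          by linarith
        also have "... = C3 * sqrt A" by (simp add: C3_def algebra_simps)
        finally show "S.Tl 0 0 + Lb / real ?N \<le> C3 * sqrt A" .
      qed
    qed
    have "sol T A C3 S.gam S.uu"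
      unfolding sol_def
    proof (intro conjI allI ballI impI)
      show "\<exists>H. \<forall>t w S. finite S \<longrightarrow> Hn S.gam S (S.uu t w) \<le> H" using S.uu_bound S.gam by (meson less_imp_le order_refl)
      fix e w and t :: real assume e: "e \<in> Hs 3" and t: "0 \<le> t"
      show "continuous_on {0..t} (\<lambda>r. F_pair \<alpha> (S.uu r w) e)" by (rule S.F_cont[OF tst_Hs[OF e]])
      show "((\<lambda>r. F_pair \<alpha> (S.uu r w) e) has_integral inner_L2 (S.uu t w) e - inner_L2 (S.uu 0 w) e - inner_L2 (b t w) e) {0..t}"
        by (rule S.uu_equation[OF e t])
    qed (use S.gam S.uu_meas S.uu_L2sigma S.uu_cont dist in auto)
    thus ?thesis by blast
  qed
  thus ?thesis using C3 by blast
qed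

end

subsection \<open>Gaussian increments\<close>

text \<open>By uniqueness of characteristic functions the law is that of sqrt v times a standard
  normal variable; in this form v = 0 is no exception.\<close>

lemma gaussian_fourth_moment:
  assumes M: "prob_space M" and X: "X \<in> borel_measurable M" and v: "0 \<le> v"
    and ch: "\<And>x. char (distr M borel X) x = of_real (exp (- (v * x^2) / 2))"
  shows "integrable M (\<lambda>w. (X w)^4)" "(\<integral>w. (X w)^4 \<partial>M) = 3 * v^2"
proof -
  let ?N = "std_normal_distribution" and ?S = "\<lambda>x. sqrt v * x"
  interpret N: real_distribution ?N by (rule real_dist_normal_dist)
  interpret D: prob_space "distr M borel X" by (rule prob_space.prob_space_distr[OF M X])
  interpret E: prob_space "distr ?N borel ?S" by (rule N.prob_space_distr) simp
  have 1: "real_distribution (distr M borel X)" "real_distribution (distr ?N borel ?S)" by unfold_locales auto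
  have "char (distr ?N borel ?S) x = of_real (exp (- (v * x^2) / 2))" for x
  proof -
    have "char (distr ?N borel ?S) x = char ?N (x * sqrt v)"
      unfolding char_def by (subst integral_distr) (auto simp: mult.assoc)
    thus ?thesis using v by (simp add: char_std_normal_distribution power_mult_distrib mult.commute)
  qed
  hence eq: "distr M borel X = distr ?N borel ?S"
    by (intro Levy_uniqueness 1 ext) (simp add: ch)
  have m: "(\<lambda>x::real. x^4) \<in> borel_measurable borel" by simp
  have e: "(sqrt v * x)^4 = v^2 * x^4" for x
  proof -
    have "(sqrt v)^4 = ((sqrt v)^2)^2" by simp
    thus ?thesis using v by (simp add: power_mult_distrib)
  qed
  have "integrable ?N (\<lambda>x. v^2 * x^4)"
    using std_normal_distribution_even_moments(2)[of 2] by simp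
  hence "integrable (distr ?N borel ?S) (\<lambda>x. x^4)"
    by (subst integrable_distr_eq) (auto simp: e)
  hence "integrable (distr M borel X) (\<lambda>x. x^4)" unfolding eq .
  thus "integrable M (\<lambda>w. (X w)^4)" by (subst (asm) integrable_distr_eq[OF X m])
  have "(\<integral>w. (X w)^4 \<partial>M) = (\<integral>x. x^4 \<partial>distr M borel X)" by (rule integral_distr[OF X m, symmetric])
  also have "... = (\<integral>x. x^4 \<partial>distr ?N borel ?S)" unfolding eq ..
  also have "... = (\<integral>x. v^2 * x^4 \<partial>?N)" by (subst integral_distr) (auto simp: e)
  also have "... = v^2 * (\<integral>x. x^4 \<partial>?N)" by simp
  also have "(\<integral>x. x^4 \<partial>?N) = 3" using std_normal_distribution_even_moments(1)[of 2] by (simp add: fact_numeral)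
  finally show "(\<integral>w. (X w)^4 \<partial>M) = 3 * v^2" by simp
qed

text \<open>The divergence-free test field that reads off one component of one Fourier coefficient.\<close>

definition pr :: "freq \<Rightarrow> 3 \<Rightarrow> 3 \<Rightarrow> real" where
  "pr k i j = (if j = i then 1 else 0) - of_int (k $ i) * of_int (k $ j) / knorm2 k"

definition tm :: "complex \<Rightarrow> freq \<Rightarrow> 3 \<Rightarrow> field" where
  "tm c k i n = (\<chi> j. ((if n = k then c else 0) + (if n = - k then cnj c else 0)) * of_real (pr n i j))"

lemma knorm2_sum: "knorm2 k = (\<Sum>j\<in>UNIV. of_int (k $ j) * of_int (k $ j))"
  by (simp add: knorm2_def power2_eq_square)

lemma pr_div: "(\<Sum>j\<in>UNIV. of_int (k $ j) * pr k i j) = 0"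
proof (cases "k = 0")
  case False
  hence K: "knorm2 k \<noteq> 0" using knorm2_ge_one[OF False] by linarith
  have "of_int (k $ j) * pr k i j = (if j = i then of_int (k $ j) else 0) - of_int (k $ j) * of_int (k $ j) * (of_int (k $ i) / knorm2 k)" for j
    by (simp add: pr_def right_diff_distrib)
  hence "(\<Sum>j\<in>UNIV. of_int (k $ j) * pr k i j) = (\<Sum>j\<in>UNIV. (if j = i then of_int (k $ j) else 0)) - knorm2 k * (of_int (k $ i) / knorm2 k)"
    by (simp only: sum_subtractf sum_distrib_right[symmetric] knorm2_sum)
  thus ?thesis using K by simp
qed (simp add: pr_def)

lemma pr_id:
  fixes v :: "3 \<Rightarrow> complex"
  assumes "(\<Sum>j\<in>UNIV. of_int (k $ j) * v j) = 0"
  shows "(\<Sum>j\<in>UNIV. v j * of_real (pr k i j)) = v i"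
proof -
  have "v j * of_real (pr k i j) = (if j = i then v j else 0) - of_int (k $ j) * v j * (of_int (k $ i) / of_real (knorm2 k))" for j
    by (simp add: pr_def right_diff_distrib)
  hence "(\<Sum>j\<in>UNIV. v j * of_real (pr k i j)) = (\<Sum>j\<in>UNIV. (if j = i then v j else 0)) -
     (\<Sum>j\<in>UNIV. of_int (k $ j) * v j) * (of_int (k $ i) / of_real (knorm2 k))"
    by (simp only: sum_subtractf sum_distrib_right)
  thus ?thesis by (simp add: assms)
qed

lemma pr_minus [simp]: "pr (- k) i j = pr k i j" by (simp add: pr_def knorm2_def)

lemma tm_L2sigma: "tm c k i \<in> L2sigma"
proof -
  have h: "tm c k i (- n) = (\<chi> j. cnj (tm c k i n $ j))" for n
  proof -
    have "- n = k \<longleftrightarrow> n = - k" by (metis minus_minus)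
    thus ?thesis by (auto simp: tm_def vec_eq_iff)
  qed
  have d: "(\<Sum>j\<in>UNIV. of_int (n $ j) * tm c k i n $ j) = 0" for n
  proof -
    have "(\<Sum>j\<in>UNIV. of_int (n $ j) * (a * of_real (pr n i j))) = a * of_real (\<Sum>j\<in>UNIV. of_int (n $ j) * pr n i j)" for a :: complex
      by (simp add: sum_distrib_left mult_ac)
    thus ?thesis by (simp add: tm_def pr_div)
  qed
  have "(\<lambda>n. (norm (tm c k i n))^2) summable_on {k, - k}" by simp
  hence "(\<lambda>n. (norm (tm c k i n))^2) summable_on UNIV"
    by (rule summable_on_cong_neutral[THEN iffD1, rotated -1]) (auto simp: tm_def vec_eq_iff)
  thus ?thesis using h d by (simp add: L2sigma_def)
qed

text \<open>A divergence-free f does not see the projection in the test field, and the modes k and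
  -k give a number and its conjugate.\<close>

lemma inner_tm:
  assumes f: "f \<in> L2sigma"
  shows "inner_L2 f (tm c k i) = 2 * Re (cnj c * f k $ i)" "inner_L2 (tm c k i) f = 2 * Re (cnj c * f k $ i)"
proof -
  have div: "(\<Sum>j\<in>UNIV. of_int (n $ j) * f n $ j) = 0" and herm: "f (- n) $ j = cnj (f n $ j)" for n j
    using f by (auto simp: L2sigma_def)
  have pt: "(\<Sum>j\<in>UNIV. f n $ j * cnj (tm c k i n $ j)) =
     (if n = k then cnj c * f k $ i else 0) + (if n = - k then c * cnj (f k $ i) else 0)" for n
  proof -
    let ?c = "(if n = k then c else 0) + (if n = - k then cnj c else 0)"
    have "(\<Sum>j\<in>UNIV. f n $ j * cnj (tm c k i n $ j)) = cnj ?c * (\<Sum>j\<in>UNIV. f n $ j * of_real (pr n i j))"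
      unfolding sum_distrib_left tm_def by (intro sum.cong refl) (simp only: vec_lambda_beta complex_cnj_mult complex_cnj_complex_of_real mult_ac)
    also have "... = cnj ?c * f n $ i" by (simp only: pr_id[OF div])
    also have "cnj ?c * x = (if n = k then cnj c * x else 0) + (if n = - k then c * x else 0)" for x
      by (simp add: distrib_right)
    also have "(if n = k then cnj c * f n $ i else 0) = (if n = k then cnj c * f k $ i else 0)" by (rule if_cong[OF refl]) auto
    also have "(if n = - k then c * f n $ i else 0) = (if n = - k then c * f (- k) $ i else 0)" by (rule if_cong[OF refl]) auto
    finally show ?thesis by (simp only: herm)
  qed
  have "(\<Sum>\<^sub>\<infinity>n. (if n = k then cnj c * f k $ i else 0) + (if n = - k then c * cnj (f k $ i) else 0)) =
    (\<Sum>n\<in>{k, - k}. (if n = k then cnj c * f k $ i else 0) + (if n = - k then c * cnj (f k $ i) else 0))"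
    by (rule infsum_support) auto
  also have "... = cnj c * f k $ i + c * cnj (f k $ i)"
    by (simp add: sum.distrib)
  finally have I: "(\<Sum>\<^sub>\<infinity>n. \<Sum>j\<in>UNIV. f n $ j * cnj (tm c k i n $ j)) = cnj c * f k $ i + c * cnj (f k $ i)"
    by (simp add: pt)
  thus "inner_L2 f (tm c k i) = 2 * Re (cnj c * f k $ i)" by (simp add: inner_L2_def)
  have "(\<Sum>\<^sub>\<infinity>n. \<Sum>j\<in>UNIV. tm c k i n $ j * cnj (f n $ j)) = (\<Sum>\<^sub>\<infinity>n. cnj (\<Sum>j\<in>UNIV. f n $ j * cnj (tm c k i n $ j)))"
    by (simp add: mult.commute)
  also have "... = cnj (cnj c * f k $ i + c * cnj (f k $ i))" unfolding infsum_cnj I ..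
  finally show "inner_L2 (tm c k i) f = 2 * Re (cnj c * f k $ i)" by (simp add: inner_L2_def)
qed

lemma L2sigma_diff:
  assumes f: "f \<in> L2sigma" and h: "h \<in> L2sigma"
  shows "f - h \<in> L2sigma"
proof -
  have s: "(\<lambda>k. 2 * (norm (f k))^2 + 2 * (norm (h k))^2) summable_on UNIV"
    using f h by (intro summable_on_add summable_on_cmult_right) (auto simp: L2sigma_def)
  have "(norm ((f - h) k))^2 \<le> 2 * (norm (f k))^2 + 2 * (norm (h k))^2" for k
  proof -
    have "(norm (f k - h k))^2 \<le> (norm (f k) + norm (h k))^2" by (intro power_mono norm_triangle_ineq4) auto
    also have "... \<le> 2 * (norm (f k))^2 + 2 * (norm (h k))^2"
      using sum_squares_bound[of "norm (f k)" "norm (h k)"] by (simp add: power2_sum)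
    finally show ?thesis by simp
  qed
  hence "(\<lambda>k. (norm ((f - h) k))^2) summable_on UNIV"
    by (intro summable_on_comparison_test[OF s]) auto
  moreover have "(\<Sum>i\<in>UNIV. of_int (k $ i) * (f - h) k $ i) = 0" for k
    using f h by (simp add: L2sigma_def right_diff_distrib sum_subtractf)
  moreover have "(f - h) (- k) = (\<chi> i. cnj ((f - h) k $ i))" for k
    using f h by (simp add: L2sigma_def vec_eq_iff)
  ultimately show ?thesis by (simp add: L2sigma_def)
qed

lemma L2sigma_finite:
  assumes "f \<in> L2sigma" shows "Hs_norm2 0 f < \<infinity>"
proof -
  have s: "(\<lambda>k. (norm (f k))^2) summable_on UNIV" using assms by (simp add: L2sigma_def)
  have "Hn 0 S f \<le> sqrt (\<Sum>\<^sub>\<infinity>k. (norm (f k))^2)" if "finite S" for S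
    unfolding Hn_0 L2_set_def using s that by (intro real_sqrt_le_mono finite_sum_le_infsum) auto
  hence "Hs_norm2 0 f \<le> ennreal ((sqrt (\<Sum>\<^sub>\<infinity>k. (norm (f k))^2))^2)" by (rule Hs_norm2_le)
  also have "... < \<infinity>" by (rule ennreal_less_top[folded infinity_ennreal_def])
  finally show ?thesis .
qed

lemma L2norm2_ge:
  assumes "f \<in> L2sigma" "finite S" shows "(\<Sum>k\<in>S. (norm (f k))^2) \<le> L2norm2 f"
  using Hn_le_Hs[OF L2sigma_finite[OF assms(1)] assms(2)] by (simp add: L2norm2_def Hn_0 L2_set_def sum_nonneg)

lemma sum_le_infsum_ennreal:
  fixes f :: "'b \<Rightarrow> ennreal"
  assumes "finite A" shows "sum f A \<le> (\<Sum>\<^sub>\<infinity>k. f k)"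
  by (subst nonneg_infsum_complete) (auto intro!: SUP_upper simp: assms)

text \<open>The bound 2 <= \<alpha>\<rho> is what lets the trace condition control the noise in
  H^2.\<close>

locale qw = prob_space M for M :: "'a measure" +
  fixes g :: "nat \<Rightarrow> field" and B :: "real \<Rightarrow> 'a \<Rightarrow> field" and \<alpha> \<rho> :: real
  assumes HS: "HS_family g" and W: "q_wiener M (natF M B) g B"
    and tr: "trApow_GG \<alpha> \<rho> g < \<infinity>" and ar: "2 \<le> \<alpha> * \<rho>"
begin

lemma B_L2: "w \<in> space M \<Longrightarrow> B t w \<in> L2sigma"
proof -
  assume w: "w \<in> space M"
  have "B t \<in> measurable M L2meas" using W by (simp add: q_wiener_def)
  hence "B t w \<in> space L2meas" using w by (rule measurable_space)
  thus ?thesis by (simp add: L2meas_def space_measure_of_conv)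
qed

lemma coord_meas: "(\<lambda>f. f k $ i) \<in> borel_measurable L2meas"
proof (rule measurableI)
  fix A :: "complex set" assume A: "A \<in> sets borel"
  have sp: "space L2meas = L2sigma" by (simp add: L2meas_def space_measure_of_conv)
  have "{(\<lambda>f. f k $ i) -` A \<inter> L2sigma | k i A. A \<in> sets (borel :: complex measure)} \<subseteq> Pow L2sigma" by blast
  hence "sets L2meas = sigma_sets L2sigma {(\<lambda>f. f k $ i) -` A \<inter> L2sigma | k i A. A \<in> sets (borel :: complex measure)}"
    unfolding L2meas_def by (rule sets_measure_of)
  thus "(\<lambda>f. f k $ i) -` A \<inter> space L2meas \<in> sets L2meas" unfolding sp using A by auto
qed simp

lemma B_meas: "(\<lambda>w. B t w k $ i) \<in> borel_measurable M"
proof -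
  have "B t \<in> measurable M L2meas" using W by (simp add: q_wiener_def)
  from measurable_compose[OF this coord_meas] show ?thesis .
qed

text \<open>The trace of the 3 by 3 covariance block of the mode k.\<close>

definition Gam :: "freq \<Rightarrow> real" where "Gam k = suminf (\<lambda>n. (norm (g n k))^2)"

lemma g_L2: "g n \<in> L2sigma" "summable (\<lambda>n. L2norm2 (g n))" using HS by (auto simp: HS_family_def)

lemma Gam_summable: "summable (\<lambda>n. (norm (g n k))^2)"
proof (rule summable_comparison_test'[OF g_L2(2), of 0])
  fix n
  show "norm ((norm (g n k))^2) \<le> L2norm2 (g n)" using L2norm2_ge[OF g_L2(1), of "{k}" n] by simp
qed

lemma Gam_nonneg: "0 \<le> Gam k" unfolding Gam_def by (intro suminf_nonneg Gam_summable) simp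

text \<open>The values c = 1 and c = i select the real and the imaginary part. The factor 2 from
  \<open>inner_tm\<close> reappears as 1/16 in the fourth power.\<close>

lemma coeff_moment:
  assumes st: "0 \<le> s" "s \<le> t"
  shows "integrable M (\<lambda>w. (Re (cnj c * (B t w k $ i - B s w k $ i)))^4)"
    and "cmod c = 1 \<Longrightarrow> (\<integral>w. (Re (cnj c * (B t w k $ i - B s w k $ i)))^4 \<partial>M) \<le> 3 * ((t - s) * Gam k)^2"
proof -
  let ?f = "\<lambda>w. B t w k $ i - B s w k $ i"
  define X where "X w = 2 * Re (cnj c * ?f w)" for w
  define v where "v = (t - s) * suminf (\<lambda>n. (inner_L2 (tm c k i) (g n))^2)"
  have inn: "inner_L2 (B t w - B s w) (tm c k i) = X w" if "w \<in> space M" for w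
    using inner_tm(1)[OF L2sigma_diff[OF B_L2[OF that] B_L2[OF that]], of t s c k i] by (simp add: X_def)
  have Xm: "X \<in> borel_measurable M"
    unfolding X_def using B_meas
    by (intro borel_measurable_times borel_measurable_const measurable_compose[OF _ borel_measurable_Re] borel_measurable_diff)
  have sq: "(inner_L2 (tm c k i) (g n))^2 \<le> 4 * (cmod c)^2 * (norm (g n k))^2" for n
  proof -
    have "(inner_L2 (tm c k i) (g n))^2 = 4 * (Re (cnj c * g n k $ i))^2"
      unfolding inner_tm(2)[OF g_L2(1)] by (simp only: power_mult_distrib) simp
    also have "(Re (cnj c * g n k $ i))^2 \<le> (cmod c * norm (g n k))^2"
    proof (rule abs_le_square_iff[THEN iffD1])
      have "\<bar>Re (cnj c * g n k $ i)\<bar> \<le> cmod c * cmod (g n k $ i)"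
        using abs_Re_le_cmod[of "cnj c * g n k $ i"] by (simp add: norm_mult)
      also have "... \<le> cmod c * norm (g n k)" by (intro mult_left_mono cmod_nth_le) auto
      finally show "\<bar>Re (cnj c * g n k $ i)\<bar> \<le> \<bar>cmod c * norm (g n k)\<bar>" by simp
    qed
    finally show ?thesis by (simp add: power_mult_distrib)
  qed
  have sm: "summable (\<lambda>n. (inner_L2 (tm c k i) (g n))^2)"
    by (rule summable_comparison_test'[OF summable_mult[OF Gam_summable, of "4 * (cmod c)^2" k], of 0]) (use sq in simp)
  have v0: "0 \<le> v" unfolding v_def using st by (intro mult_nonneg_nonneg suminf_nonneg sm) auto
  have "char (distr M borel X) x = of_real (exp (- (v * x^2) / 2))" for x
  proof -
    have "distr M borel X = distr M borel (\<lambda>w. inner_L2 (B t w - B s w) (tm c k i))"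
      by (rule distr_cong) (auto simp: inn)
    thus ?thesis using W st tm_L2sigma unfolding q_wiener_def v_def by (simp add: algebra_simps)
  qed
  note gm = gaussian_fourth_moment[OF prob_space_axioms Xm v0 this]
  have e: "(Re (cnj c * ?f w))^4 = (1/16) * (X w)^4" for w by (simp only: X_def power_mult_distrib) simp
  show "integrable M (\<lambda>w. (Re (cnj c * ?f w))^4)" unfolding e using gm(1) by simp
  assume c: "cmod c = 1"
  have "suminf (\<lambda>n. (inner_L2 (tm c k i) (g n))^2) \<le> suminf (\<lambda>n. 4 * (norm (g n k))^2)"
    using sq c by (intro suminf_le sm summable_mult Gam_summable) simp
  also have "... = 4 * Gam k" unfolding Gam_def by (rule suminf_mult[OF Gam_summable])
  finally have "v \<le> (t - s) * (4 * Gam k)" unfolding v_def using st by (intro mult_left_mono) auto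
  hence "v^2 \<le> ((t - s) * (4 * Gam k))^2" using v0 by (intro power_mono) auto
  thus "(\<integral>w. (Re (cnj c * ?f w))^4 \<partial>M) \<le> 3 * ((t - s) * Gam k)^2"
    unfolding e using gm(2) by (simp add: power_mult_distrib)
qed

lemma norm_fourth_le: "(norm (v :: complex^3))^4 \<le> 6 * (\<Sum>i\<in>UNIV. (Re (v $ i))^4 + (Im (v $ i))^4)"
proof -
  have "(norm v)^4 = ((norm v)^2)^2" by simp
  also have "... = (\<Sum>i\<in>UNIV. (cmod (v $ i))^2)^2" by (simp only: norm2_vec3)
  also have "... \<le> 3 * (\<Sum>i\<in>UNIV. ((cmod (v $ i))^2)^2)"
    using sum_squared_le_sum_of_squares[where I="UNIV :: 3 set" and f="\<lambda>i. (cmod (v $ i))^2"] by simp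
  also have "... \<le> 3 * (\<Sum>i\<in>UNIV. 2 * ((Re (v $ i))^4 + (Im (v $ i))^4))"
  proof (intro mult_left_mono sum_mono)
    fix i
    have "(x + y)^2 \<le> 2 * (x^2 + y^2)" for x y :: real using sum_squares_bound[of x y] by (simp add: power2_sum)
    from this[of "(Re (v $ i))^2" "(Im (v $ i))^2"] show "((cmod (v $ i))^2)^2 \<le> 2 * ((Re (v $ i))^4 + (Im (v $ i))^4)"
      by (simp add: cmod_power2)
  qed simp
  finally show ?thesis by (simp add: sum_distrib_left)
qed

lemma norm_moment:
  assumes st: "0 \<le> s" "s \<le> t"
  shows "integrable M (\<lambda>w. (norm (B t w k - B s w k))^4)"
    and "(\<integral>w. (norm (B t w k - B s w k))^4 \<partial>M) \<le> 108 * ((t - s) * Gam k)^2"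
proof -
  let ?d = "\<lambda>w. B t w k - B s w k"
  let ?h = "\<lambda>w. 6 * (\<Sum>i\<in>UNIV. (Re (?d w $ i))^4 + (Im (?d w $ i))^4)"
  have i: "integrable M (\<lambda>w. (Re (?d w $ i))^4)" "integrable M (\<lambda>w. (Im (?d w $ i))^4)" for i
    using coeff_moment(1)[OF st, of 1 k i] coeff_moment(1)[OF st, of \<i> k i] by simp_all
  have le: "(\<integral>w. (Re (?d w $ i))^4 \<partial>M) \<le> 3 * ((t - s) * Gam k)^2" "(\<integral>w. (Im (?d w $ i))^4 \<partial>M) \<le> 3 * ((t - s) * Gam k)^2" for i
    using coeff_moment(2)[OF st, of 1 k i] coeff_moment(2)[OF st, of \<i> k i] by simp_all
  have h: "integrable M ?h" by (intro integrable_mult_right Bochner_Integration.integrable_sum Bochner_Integration.integrable_add i)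
  have m: "(\<lambda>w. (norm (?d w))^4) \<in> borel_measurable M"
  proof -
    have "(\<lambda>w. cmod (?d w $ i)) \<in> borel_measurable M" for i
      using B_meas[of t k i] B_meas[of s k i] by simp
    thus ?thesis unfolding norm_vec_def L2_set_def by simp
  qed
  have p: "norm ((norm (?d w))^4) \<le> norm (?h w)" for w
    using norm_fourth_le[of "?d w"] by simp
  show I: "integrable M (\<lambda>w. (norm (?d w))^4)" by (rule Bochner_Integration.integrable_bound[OF h m]) (use p in simp)
  have "(\<integral>w. (norm (?d w))^4 \<partial>M) \<le> (\<integral>w. ?h w \<partial>M)" using norm_fourth_le by (intro integral_mono I h)
  also have "... = 6 * (\<Sum>i\<in>UNIV. (\<integral>w. (Re (?d w $ i))^4 \<partial>M) + (\<integral>w. (Im (?d w $ i))^4 \<partial>M))"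
    using i by (subst integral_mult_right_zero, subst Bochner_Integration.integral_sum) (auto intro: Bochner_Integration.integrable_add)
  also have "... \<le> 6 * (\<Sum>i\<in>(UNIV::3 set). 3 * ((t - s) * Gam k)^2 + 3 * ((t - s) * Gam k)^2)"
    using le by (intro mult_left_mono sum_mono add_mono) auto
  finally show "(\<integral>w. (norm (?d w))^4 \<partial>M) \<le> 108 * ((t - s) * Gam k)^2" by simp
qed

text \<open>(1+|k|^2)^2 <= 4 |k|^(2\<alpha>\<rho>) + 1 splits the weight between the strengthened
  trace condition and the plain trace.\<close>

lemma Gam_weighted: "\<exists>W. \<forall>A. finite A \<longrightarrow> (\<Sum>k\<in>A. jb k^2 * Gam k) \<le> W"
proof -
  define TA where "TA = enn2real (trApow_GG \<alpha> \<rho> g)"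
  have fin: "(\<Sum>n<N. \<Sum>k\<in>A. knorm2 k powr (\<alpha> * \<rho>) * (norm (g n k))^2) \<le> TA" if A: "finite A" for A N
  proof -
    have "ennreal (\<Sum>n<N. \<Sum>k\<in>A. knorm2 k powr (\<alpha> * \<rho>) * (norm (g n k))^2)
      = (\<Sum>n<N. \<Sum>k\<in>A. ennreal (knorm2 k powr (\<alpha> * \<rho>) * (norm (g n k))^2))"
      by (simp add: sum_ennreal sum_nonneg)
    also have "... \<le> (\<Sum>n<N. \<Sum>\<^sub>\<infinity>k. ennreal (knorm2 k powr (\<alpha> * \<rho>) * (norm (g n k))^2))"
      by (intro sum_mono sum_le_infsum_ennreal A)
    also have "... \<le> trApow_GG \<alpha> \<rho> g"
      unfolding trApow_GG_def by (rule sum_le_infsum_ennreal) simp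
    also have "... = ennreal TA" using tr by (simp add: TA_def)
    finally show ?thesis by (simp add: TA_def)
  qed
  have pt: "jb k^2 \<le> 4 * knorm2 k powr (\<alpha> * \<rho>) + 1" for k
  proof (cases "k = 0")
    case False
    have 1: "1 \<le> knorm2 k" by (rule knorm2_ge_one[OF False])
    have "jb k^2 \<le> (2 * knorm2 k)^2" using 1 by (intro power_mono) auto
    also have "... = 4 * knorm2 k powr 2" using 1 by (simp add: power_mult_distrib)
    also have "... \<le> 4 * knorm2 k powr (\<alpha> * \<rho>)" using 1 ar by (intro mult_left_mono powr_mono) auto
    finally show ?thesis by simp
  qed (simp add: knorm2_def)
  have "(\<Sum>k\<in>A. jb k^2 * Gam k) \<le> 4 * TA + trGG g" if A: "finite A" for A
  proof -
    have "(\<Sum>k\<in>A. jb k^2 * Gam k) = (\<Sum>k\<in>A. suminf (\<lambda>n. jb k^2 * (norm (g n k))^2))"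
      unfolding Gam_def by (intro sum.cong refl suminf_mult[symmetric] Gam_summable)
    also have "... = suminf (\<lambda>n. \<Sum>k\<in>A. jb k^2 * (norm (g n k))^2)"
      by (intro suminf_sum[symmetric] summable_mult Gam_summable)
    also have "... \<le> 4 * TA + trGG g"
    proof (rule suminf_le_const)
      show "summable (\<lambda>n. \<Sum>k\<in>A. jb k^2 * (norm (g n k))^2)"
        by (intro summable_sum summable_mult Gam_summable)
      fix N
      have "(\<Sum>n<N. \<Sum>k\<in>A. jb k^2 * (norm (g n k))^2)
        \<le> (\<Sum>n<N. 4 * (\<Sum>k\<in>A. knorm2 k powr (\<alpha> * \<rho>) * (norm (g n k))^2) + L2norm2 (g n))"
      proof (rule sum_mono)
        fix n
        have "wS A (g n) \<le> (\<Sum>k\<in>A. (4 * knorm2 k powr (\<alpha> * \<rho>) + 1) * (norm (g n k))^2)"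
          using pt by (intro sum_mono mult_right_mono) auto
        also have "... = 4 * (\<Sum>k\<in>A. knorm2 k powr (\<alpha> * \<rho>) * (norm (g n k))^2) + (\<Sum>k\<in>A. (norm (g n k))^2)"
          by (simp add: distrib_right sum.distrib sum_distrib_left mult.assoc)
        also have "... \<le> 4 * (\<Sum>k\<in>A. knorm2 k powr (\<alpha> * \<rho>) * (norm (g n k))^2) + L2norm2 (g n)"
          using L2norm2_ge[OF g_L2(1) A] by simp
        finally show "wS A (g n) \<le> 4 * (\<Sum>k\<in>A. knorm2 k powr (\<alpha> * \<rho>) * (norm (g n k))^2) + L2norm2 (g n)" .
      qed
      also have "... = 4 * (\<Sum>n<N. \<Sum>k\<in>A. knorm2 k powr (\<alpha> * \<rho>) * (norm (g n k))^2) + (\<Sum>n<N. L2norm2 (g n))"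
        by (simp add: sum.distrib sum_distrib_left)
      also have "(\<Sum>n<N. L2norm2 (g n)) \<le> trGG g"
        unfolding trGG_def by (intro sum_le_suminf g_L2(2)) (auto simp: L2norm2_def)
      finally show "(\<Sum>n<N. \<Sum>k\<in>A. jb k^2 * (norm (g n k))^2) \<le> 4 * TA + trGG g" using fin[OF A, of N] by linarith
    qed
    finally show ?thesis .
  qed
  thus ?thesis by blast
qed

definition dB :: "freq set \<Rightarrow> real \<Rightarrow> real \<Rightarrow> 'a \<Rightarrow> real" where
  "dB A s t w = wS A (\<lambda>k. B t w k - B s w k)"

lemma dB_meas: "dB A s t \<in> borel_measurable M"
proof -
  have "(\<lambda>w. cmod ((B t w k - B s w k) $ i)) \<in> borel_measurable M" for k i
    using B_meas[of t k i] B_meas[of s k i] by simp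
  thus ?thesis unfolding dB_def norm_vec_def L2_set_def by simp
qed

text \<open>Cauchy-Schwarz over the modes turns the squared sum into fourth moments of single modes,
  each of order (t-s)^2 times the square of \<open>Gam\<close>. The power added in \<open>G\<close>
  keeps the denominators positive and is summable against the H^2 weight.\<close>

lemma dB_moment: "\<exists>C\<ge>0. \<forall>A s t. finite A \<longrightarrow> 0 \<le> s \<longrightarrow> s \<le> t \<longrightarrow>
   integrable M (\<lambda>w. (dB A s t w)^2) \<and> (\<integral>w. (dB A s t w)^2 \<partial>M) \<le> C * (t - s)^2"
proof -
  obtain W where W: "\<And>A. finite A \<Longrightarrow> (\<Sum>k\<in>A. jb k^2 * Gam k) \<le> W" using Gam_weighted by blast
  define G where "G k = Gam k + jb k powr (-15/4)" for k
  have p1: "0 < 1 + knorm2 k" for k by (simp add: add_pos_nonneg)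
  have G: "Gam k \<le> G k" "0 < G k" for k
    using Gam_nonneg[of k] p1[of k] by (auto simp: G_def intro: add_nonneg_pos)
  have GW: "(\<Sum>k\<in>A. jb k^2 * G k) \<le> W + Clat" if A: "finite A" for A
  proof -
    have "jb k^2 * jb k powr (-15/4) = jb k powr (-7/4)" for k
    proof -
      have "jb k^2 = jb k powr 2" using p1[of k] by simp
      thus ?thesis by (simp only: powr_add[symmetric]) simp
    qed
    hence "(\<Sum>k\<in>A. jb k^2 * G k) = (\<Sum>k\<in>A. jb k^2 * Gam k) + (\<Sum>k\<in>A. jb k powr (-7/4))"
      by (simp add: G_def distrib_left sum.distrib)
    thus ?thesis using W[OF A] Clat(2)[OF A] by linarith
  qed
  have "integrable M (\<lambda>w. (dB A s t w)^2) \<and> (\<integral>w. (dB A s t w)^2 \<partial>M) \<le> 108 * (W + Clat)^2 * (t - s)^2"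
    if A: "finite A" and st: "0 \<le> s" "s \<le> t" for A s t
  proof -
    let ?d = "\<lambda>w k. norm (B t w k - B s w k)"
    let ?w = "\<lambda>k. jb k^2"
    define SG where "SG = (\<Sum>k\<in>A. ?w k * G k)"
    have SG: "0 \<le> SG" "SG \<le> W + Clat" unfolding SG_def using less_imp_le[OF G(2)] GW[OF A] by (auto intro!: sum_nonneg mult_nonneg_nonneg simp del: mult_pos_pos)
    let ?h = "\<lambda>w. SG * (\<Sum>k\<in>A. ?w k / G k * (?d w k)^4)"
    have pt: "(dB A s t w)^2 \<le> ?h w" for w
    proof -
      have "(dB A s t w)^2 = (\<Sum>k\<in>A. sqrt (?w k * G k) * (sqrt (?w k / G k) * (?d w k)^2))^2"
      proof -
        have "sqrt (?w k * G k) * sqrt (?w k / G k) = ?w k" for k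
        proof -
          have "(?w k * G k) * (?w k / G k) = (?w k)^2" using G(2)[of k] by (simp add: power2_eq_square)
          hence "sqrt (?w k * G k) * sqrt (?w k / G k) = sqrt ((?w k)^2)" by (simp only: real_sqrt_mult[symmetric])
          thus ?thesis by (simp only: real_sqrt_abs) simp
        qed
        thus ?thesis unfolding dB_def by (simp only: mult.assoc[symmetric])
      qed
      also have "... \<le> (\<Sum>k\<in>A. (sqrt (?w k * G k))^2) * (\<Sum>k\<in>A. (sqrt (?w k / G k) * (?d w k)^2)^2)"
        by (rule Cauchy_Schwarz_ineq_sum)
      also have "(\<Sum>k\<in>A. (sqrt (?w k * G k))^2) = SG"
        unfolding SG_def using G(2) by (intro sum.cong refl) (simp add: less_imp_le)
      also have "(\<Sum>k\<in>A. (sqrt (?w k / G k) * (?d w k)^2)^2) = (\<Sum>k\<in>A. ?w k / G k * (?d w k)^4)"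
        using G(2) by (intro sum.cong refl) (simp add: power_mult_distrib less_imp_le)
      finally show ?thesis .
    qed
    have h: "integrable M ?h"
      using norm_moment(1)[OF st] by (intro integrable_mult_right Bochner_Integration.integrable_sum)
    have m: "(\<lambda>w. (dB A s t w)^2) \<in> borel_measurable M" using dB_meas by simp
    have I: "integrable M (\<lambda>w. (dB A s t w)^2)"
      by (rule Bochner_Integration.integrable_bound[OF h m]) (use pt in \<open>auto intro: order_trans[OF _ abs_ge_self]\<close>)
    have "(\<integral>w. (dB A s t w)^2 \<partial>M) \<le> (\<integral>w. ?h w \<partial>M)" using pt by (intro integral_mono I h)
    also have "... = SG * (\<Sum>k\<in>A. ?w k / G k * (\<integral>w. (?d w k)^4 \<partial>M))"
      using norm_moment(1)[OF st] by simp
    also have "... \<le> SG * (\<Sum>k\<in>A. 108 * (t - s)^2 * (?w k * G k))"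
    proof (intro mult_left_mono sum_mono SG(1))
      fix k
      have "(\<integral>w. (?d w k)^4 \<partial>M) \<le> 108 * ((t - s) * Gam k)^2" by (rule norm_moment(2)[OF st])
      also have "... \<le> 108 * ((t - s) * G k)^2"
        using G(1) Gam_nonneg st by (intro mult_left_mono power_mono) auto
      finally have "?w k / G k * (\<integral>w. (?d w k)^4 \<partial>M) \<le> ?w k / G k * (108 * ((t - s) * G k)^2)"
        using G(2)[of k] by (intro mult_left_mono) auto
      also have "... = 108 * (t - s)^2 * (?w k * G k)" using G(2)[of k] by (simp add: power_mult_distrib power2_eq_square)
      finally show "?w k / G k * (\<integral>w. (?d w k)^4 \<partial>M) \<le> 108 * (t - s)^2 * (?w k * G k)" .
    qed
    also have "... = 108 * SG^2 * (t - s)^2" by (simp add: SG_def sum_distrib_left[symmetric] power2_eq_square)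
    also have "... \<le> 108 * (W + Clat)^2 * (t - s)^2" using SG by (intro mult_left_mono mult_right_mono power_mono) auto
    finally show ?thesis using I by simp
  qed
  thus ?thesis by (intro exI[of _ "108 * (W + Clat)^2"]) auto
qed

end

subsection \<open>Filtrations\<close>

lemma space_natF [simp]: "space (natF M B t) = space M"
  by (simp add: natF_def space_measure_of_conv)

lemma space_augF [simp]: "space (augF M B t) = space M"
  by (simp add: augF_def space_measure_of_conv)

lemma sets_natF: "sets (natF M B t) = sigma_sets (space M) {B s -` E \<inter> space M | s E. 0 \<le> s \<and> s \<le> t \<and> E \<in> sets L2meas}"
  unfolding natF_def by (rule sets_measure_of) blast

lemma natF_mono: "s \<le> t \<Longrightarrow> sets (natF M B s) \<subseteq> sets (natF M B t)"
  unfolding sets_natF by (rule sigma_sets_mono') force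

lemma sets_comp: "sets (sigma (space M) (sets (natF M B r) \<union> null_sets M)) = sigma_sets (space M) (sets (natF M B r) \<union> null_sets M)"
proof (rule sets_measure_of)
  have "sets (natF M B r) \<subseteq> Pow (space M)" using sets.space_closed[of "natF M B r"] by simp
  moreover have "null_sets M \<subseteq> Pow (space M)" using sets.space_closed[of M] by (auto simp: null_sets_def)
  ultimately show "sets (natF M B r) \<union> null_sets M \<subseteq> Pow (space M)" by blast
qed

lemma sets_augF: "sets (augF M B t) = sigma_sets (space M) (\<Inter>r\<in>{t<..}. sets (sigma (space M) (sets (natF M B r) \<union> null_sets M)))"
  unfolding augF_def
proof (rule sets_measure_of)
  have "(\<Inter>r\<in>{t<..}. sets (sigma (space M) (sets (natF M B r) \<union> null_sets M))) \<subseteq> sets (sigma (space M) (sets (natF M B (t + 1)) \<union> null_sets M))"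
    by (rule INT_lower) simp
  also have "... \<subseteq> Pow (space M)"
    using sets.space_closed[of "sigma (space M) (sets (natF M B (t + 1)) \<union> null_sets M)"] by (simp add: space_measure_of_conv)
  finally show "(\<Inter>r\<in>{t<..}. sets (sigma (space M) (sets (natF M B r) \<union> null_sets M))) \<subseteq> Pow (space M)" .
qed

lemma augF_I: "(\<And>r. t < r \<Longrightarrow> A \<in> sets (natF M B r)) \<Longrightarrow> A \<in> sets (augF M B t)"
  unfolding sets_augF by (rule sigma_sets.Basic) (auto simp: sets_comp)

lemma augF_null: "A \<in> null_sets M \<Longrightarrow> A \<in> sets (augF M B t)"
  unfolding sets_augF by (rule sigma_sets.Basic) (auto simp: sets_comp)

lemma augF_mono: "s \<le> t \<Longrightarrow> sets (augF M B s) \<subseteq> sets (augF M B t)"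
  unfolding sets_augF by (rule sigma_sets_mono') auto

lemma natF_augF: "sets (natF M B t) \<subseteq> sets (augF M B t)"
  using natF_mono by (blast intro: augF_I less_imp_le)

lemma measurable_subset: "sets N \<subseteq> sets N' \<Longrightarrow> space N = space N' \<Longrightarrow> f \<in> measurable N K \<Longrightarrow> f \<in> measurable N' K"
  by (auto simp: measurable_def)

subsection \<open>Stopping the noise when it becomes irregular\<close>

text \<open>The factor by which a 1/8-Hoelder increment shrinks when a dyadic interval is
  halved.\<close>

definition rr :: real where "rr = 2 powr (-1/8)"

lemma rr: "0 < rr" "rr < 1"
  unfolding rr_def using powr_less_mono[of "-1/8" 0 2] by auto

locale qwT = qw M g B \<alpha> \<rho> for M :: "'a measure" and g B \<alpha> \<rho> +
  fixes T Lk :: real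
  assumes T: "0 < T" and Lk: "0 < Lk"
begin

definition grid :: "nat \<Rightarrow> nat \<Rightarrow> real" where "grid n j = T * real j / 2^n"

definition viol :: "nat \<Rightarrow> nat \<Rightarrow> 'a \<Rightarrow> bool" where
  "viol n j w \<longleftrightarrow> (\<exists>N. (Lk * rr^n)^2 < dB (kbox N) (grid n j) (grid n (Suc j)) w)"

text \<open>A violation counts from the right end point of its interval, when it is observable. All
  intervals that end strictly before \<open>tt\<close> are therefore regular.\<close>

definition tt :: "'a \<Rightarrow> real" where
  "tt w = Inf (insert T {grid n (Suc j) | n j. viol n j w})"

lemma grid_pos: "0 < grid n (Suc j)" "0 \<le> grid n j" "grid n j \<le> grid n (Suc j)"
  using T by (auto simp: grid_def divide_right_mono)

lemma tt_bdd: "bdd_below (insert T {grid n (Suc j) | n j. viol n j w})"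
  using T grid_pos(1) by (intro bdd_belowI[of _ 0]) (auto intro: less_imp_le)

lemma tt_less: "tt w < s \<longleftrightarrow> T < s \<or> (\<exists>n j. viol n j w \<and> grid n (Suc j) < s)"
  unfolding tt_def by (subst cInf_less_iff[OF _ tt_bdd]) auto

lemma tt_bounds: "0 \<le> tt w" "tt w \<le> T"
proof -
  show "0 \<le> tt w"
    unfolding tt_def using T grid_pos(1) by (intro cInf_greatest) (auto intro: less_imp_le)
  show "tt w \<le> T" unfolding tt_def by (rule cInf_lower[OF insertI1 tt_bdd])
qed

lemma no_viol: "grid n (Suc j) < tt w \<Longrightarrow> \<not> viol n j w"
  using tt_less[of w "tt w"] by blast

lemma B_natF:
  assumes "0 \<le> r" "r \<le> s"
  shows "(\<lambda>w. B r w k $ i) \<in> borel_measurable (natF M B s)"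
proof -
  have "B r \<in> measurable (natF M B r) L2meas" using W assms by (simp add: q_wiener_def)
  hence "B r \<in> measurable (natF M B s) L2meas" by (rule measurable_subset[rotated 2]) (simp_all add: natF_mono[OF assms(2)])
  from measurable_compose[OF this coord_meas] show ?thesis .
qed

lemma dB_natF:
  assumes "0 \<le> r" "r \<le> s" "s \<le> t"
  shows "dB A r s \<in> borel_measurable (natF M B t)"
proof -
  have "(\<lambda>w. cmod ((B s w k - B r w k) $ i)) \<in> borel_measurable (natF M B t)" for k i
    using B_natF[of s t k i] B_natF[of r t k i] assms by simp
  thus ?thesis unfolding dB_def norm_vec_def L2_set_def by simp
qed

definition Vi :: "nat \<Rightarrow> nat \<Rightarrow> 'a set" where "Vi n j = {w \<in> space M. viol n j w}"

lemma Vi_natF: "grid n (Suc j) \<le> t \<Longrightarrow> Vi n j \<in> sets (natF M B t)"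
proof -
  assume t: "grid n (Suc j) \<le> t"
  have "Vi n j = (\<Union>N. {w \<in> space (natF M B t). (Lk * rr^n)^2 < dB (kbox N) (grid n j) (grid n (Suc j)) w})"
    by (auto simp: Vi_def viol_def)
  also have "... \<in> sets (natF M B t)"
    by (rule sets.countable_UN, rule image_subsetI)
      (rule borel_measurable_less[OF borel_measurable_const dB_natF[OF grid_pos(2) grid_pos(3) t]])
  finally show ?thesis .
qed

lemma natF_M: "sets (natF M B t) \<subseteq> sets M"
  unfolding sets_natF
proof (rule sets.sigma_sets_subset, rule subsetI)
  fix X assume "X \<in> {B s -` E \<inter> space M |s E. 0 \<le> s \<and> s \<le> t \<and> E \<in> sets L2meas}"
  thus "X \<in> sets M" using W by (auto simp: q_wiener_def intro: measurable_sets)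
qed

lemma Vi_M: "Vi n j \<in> sets M" using Vi_natF[OF order_refl] natF_M by blast

lemma tt_less_set: "{w \<in> space M. tt w < s} = (if T < s then space M else (\<Union>n. \<Union>j\<in>{j. grid n (Suc j) < s}. Vi n j))"
  unfolding tt_less by (auto simp: Vi_def)

lemma tt_less_natF: "s \<le> t \<Longrightarrow> {w \<in> space M. tt w < s} \<in> sets (natF M B t)"
  unfolding tt_less_set using sets.top[of "natF M B t"]
  by (auto intro!: sets.countable_UN' Vi_natF)

text \<open>The event is an intersection of events tt < t + h, which are decided by an arbitrarily
  short look beyond t; right-continuity of \<open>augF\<close> then gives a stopping time.\<close>

lemma tt_le_natF:
  assumes "t < r" shows "{w \<in> space M. tt w \<le> t} \<in> sets (natF M B r)"
proof -
  have "{w \<in> space M. tt w \<le> t} = (\<Inter>m::nat. {w \<in> space M. tt w < t + (r - t) / (real m + 1)})"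
  proof (intro set_eqI iffI)
    fix w assume w: "w \<in> (\<Inter>m::nat. {w \<in> space M. tt w < t + (r - t) / (real m + 1)})"
    have "tt w \<le> t"
    proof (rule LIMSEQ_le_const)
      have "(\<lambda>m. t + (r - t) / real (Suc m)) \<longlonglongrightarrow> t + 0"
        by (intro tendsto_intros LIMSEQ_Suc[OF lim_const_over_n])
      thus "(\<lambda>m. t + (r - t) / (real m + 1)) \<longlonglongrightarrow> t" by (simp add: add.commute)
      show "\<exists>N. \<forall>n\<ge>N. tt w \<le> t + (r - t) / (real n + 1)" using w by (auto intro!: exI[of _ 0] less_imp_le)
    qed
    thus "w \<in> {w \<in> space M. tt w \<le> t}" using w by simp
  next
    fix w assume "w \<in> {w \<in> space M. tt w \<le> t}"
    thus "w \<in> (\<Inter>m::nat. {w \<in> space M. tt w < t + (r - t) / (real m + 1)})"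
      using assms by (auto intro!: le_less_trans[of "tt w" t] add_pos_nonneg divide_pos_pos)
  qed
  also have "... \<in> sets (natF M B r)"
  proof (rule sets.countable_INT, rule image_subsetI)
    fix m :: nat
    have "(r - t) / (real m + 1) \<le> (r - t) / 1" using assms by (intro divide_left_mono) auto
    thus "{w \<in> space M. tt w < t + (r - t) / (real m + 1)} \<in> sets (natF M B r)"
      by (intro tt_less_natF) simp
  qed simp
  finally show ?thesis .
qed

lemma tt_stopping: "stopping_time (augF M B) tt"
  unfolding stopping_time_def pred_def using tt_le_natF by (auto intro!: augF_I)

lemma tt_min_meas:
  shows "(\<lambda>w. min t (tt w)) \<in> borel_measurable (augF M B t)"
proof (rule borel_measurableI_le)
  fix a
  show "{w \<in> space (augF M B t). min t (tt w) \<le> a} \<in> sets (augF M B t)"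
  proof (cases "t \<le> a")
    case True
    hence "{w \<in> space (augF M B t). min t (tt w) \<le> a} = space (augF M B t)" by auto
    thus ?thesis using sets.top by metis
  next
    case False
    hence "{w \<in> space (augF M B t). min t (tt w) \<le> a} = {w \<in> space M. tt w \<le> a}" by auto
    moreover have "{w \<in> space M. tt w \<le> a} \<in> sets (augF M B a)" using tt_le_natF by (intro augF_I) auto
    ultimately show ?thesis using augF_mono[of a t M B] False by auto
  qed
qed

end

lemma finite_count_below:
  fixes x :: real assumes "0 \<le> x"
  shows "finite {j. real (Suc j) < x}" "real (card {j. real (Suc j) < x}) \<le> x"
proof -
  have sub: "{j. real (Suc j) < x} \<subseteq> {..<nat \<lfloor>x\<rfloor>}" by auto linarith
  thus "finite {j. real (Suc j) < x}" by (rule finite_subset) simp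
  have "card {j. real (Suc j) < x} \<le> nat \<lfloor>x\<rfloor>" using card_mono[OF _ sub] by simp
  hence "real (card {j. real (Suc j) < x}) \<le> real (nat \<lfloor>x\<rfloor>)" by simp
  also have "... \<le> x" using assms by linarith
  finally show "real (card {j. real (Suc j) < x}) \<le> x" .
qed

text \<open>About \<delta> 2^n / T intervals of level n end before \<delta>, and by Markov's
  inequality for the square of \<open>dB\<close> each violates with probability O(2^(-3n/2)); the
  levels form a geometric series. The factor \<delta> will give positivity of the stopping time, the
  power of \<open>Lk\<close> the probability of reaching T.\<close>

lemma (in qw) viol_prob:
  "\<exists>C\<ge>0. \<forall>T Lk \<delta>. 0 < T \<longrightarrow> 0 < Lk \<longrightarrow> 0 \<le> \<delta> \<longrightarrow> \<delta> \<le> T \<longrightarrow>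
     measure M {w \<in> space M. qwT.tt B T Lk w < \<delta>} \<le> C * \<delta> * T / Lk^4"
proof -
  obtain C where C: "0 \<le> C" "\<And>A s t. finite A \<Longrightarrow> 0 \<le> s \<Longrightarrow> s \<le> t \<Longrightarrow>
     integrable M (\<lambda>w. (dB A s t w)^2) \<and> (\<integral>w. (dB A s t w)^2 \<partial>M) \<le> C * (t - s)^2"
    using dB_moment by blast
  define y :: real where "y = 2 powr (-1/2)"
  have y: "0 < y" "y < 1" unfolding y_def using powr_less_mono[of "-1/2" 0 2] by auto
  have "measure M {w \<in> space M. qwT.tt B T Lk w < \<delta>} \<le> (C / (1 - y)) * \<delta> * T / Lk^4"
    if h: "0 < T" "0 < Lk" "0 \<le> \<delta>" "\<delta> \<le> T" for T Lk \<delta>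
  proof -
    interpret qwT M g B \<alpha> \<rho> T Lk by unfold_locales (use h in auto)
    have V: "measure M (Vi n j) \<le> C * T^2 / Lk^4 * (y/2)^n" for n j
    proof -
      let ?a = "(Lk * rr^n)^2"
      let ?A = "\<lambda>N. {w \<in> space M. ?a < dB (kbox N) (grid n j) (grid n (Suc j)) w}"
      have a: "0 < ?a" using h rr by simp
      have am: "?A N \<in> sets M" for N using dB_meas by (intro borel_measurable_less) auto
      have b: "measure M (?A N) \<le> C * T^2 / Lk^4 * (y/2)^n" for N
      proof -
        let ?D = "dB (kbox N) (grid n j) (grid n (Suc j))"
        have I: "integrable M (\<lambda>w. (?D w)^2)" "(\<integral>w. (?D w)^2 \<partial>M) \<le> C * (grid n (Suc j) - grid n j)^2"
          using C(2)[OF finite_kbox grid_pos(2) grid_pos(3), of N n j] by auto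
        have "?A N \<subseteq> {w \<in> space M. ?a^2 \<le> (?D w)^2}"
        proof
          fix w assume w: "w \<in> ?A N"
          hence "?a \<le> ?D w" by simp
          hence "?a^2 \<le> (?D w)^2" using a by (intro power_mono) auto
          thus "w \<in> {w \<in> space M. ?a^2 \<le> (?D w)^2}" using w by blast
        qed
        hence "measure M (?A N) \<le> measure M {w \<in> space M. ?a^2 \<le> (?D w)^2}"
          using dB_meas by (intro finite_measure_mono) auto
        also have "... \<le> (\<integral>w. (?D w)^2 \<partial>M) / ?a^2"
          using a by (intro integral_Markov_inequality_measure[OF I(1), of "{}"]) auto
        also have "... \<le> C * (grid n (Suc j) - grid n j)^2 / ?a^2" using I(2) by (intro divide_right_mono) auto
        also have "grid n (Suc j) - grid n j = T / 2^n" by (simp add: grid_def field_simps)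
        also have "C * (T / 2^n)^2 / ?a^2 = C * T^2 / Lk^4 * (y/2)^n"
        proof -
          have "(rr^n)^4 * y^n = (1/2)^n"
          proof -
            have "rr^4 = y"
            proof -
              have "rr^4 = rr powr 4" using rr by simp
              thus ?thesis by (simp only: rr_def y_def powr_powr) simp
            qed
            hence "(rr^n)^4 = y^n" by (metis mult.commute power_mult)
            moreover have yy: "y * y = 1/2" unfolding y_def by (simp flip: powr_add)
            moreover have "y^n * y^n = (1/2)^n" unfolding power_mult_distrib[symmetric] yy ..
            ultimately show ?thesis by simp
          qed
          hence "(rr^n)^4 * y^n * 2^n = 1 * 1" by (simp add: power_one_over)
          moreover have "?a^2 = Lk^4 * (rr^n)^4" by (simp add: power_mult_distrib)
          moreover have "(rr^n)^4 \<noteq> 0" using rr by simp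
          ultimately show ?thesis using h by (simp add: field_simps power2_eq_square)
        qed
        finally show ?thesis .
      qed
      have "incseq ?A"
      proof (rule incseq_SucI, rule subsetI)
        fix N w assume "w \<in> ?A N"
        moreover have "dB (kbox N) (grid n j) (grid n (Suc j)) w \<le> dB (kbox (Suc N)) (grid n j) (grid n (Suc j)) w"
          unfolding dB_def by (intro sum_mono2 finite_kbox kbox_mono) auto
        ultimately show "w \<in> ?A (Suc N)" by auto
      qed
      hence "(\<lambda>N. measure M (?A N)) \<longlonglongrightarrow> measure M (\<Union>N. ?A N)"
        using am by (intro finite_Lim_measure_incseq) auto
      moreover have "(\<Union>N. ?A N) = Vi n j" by (auto simp: Vi_def viol_def)
      ultimately show ?thesis using b by (intro LIMSEQ_le_const2[of "\<lambda>N. measure M (?A N)"]) auto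
    qed
    define J where "J n = {j. grid n (Suc j) < \<delta>}" for n
    have J: "finite (J n)" "real (card (J n)) \<le> \<delta> * 2^n / T" for n
    proof -
      have "J n = {j. real (Suc j) < \<delta> * 2^n / T}" unfolding J_def grid_def using h by (simp add: field_simps)
      thus "finite (J n)" "real (card (J n)) \<le> \<delta> * 2^n / T"
        using finite_count_below[of "\<delta> * 2^n / T"] h by auto
    qed
    have U: "measure M (\<Union>j\<in>J n. Vi n j) \<le> C * \<delta> * T / Lk^4 * y^n" for n
    proof -
      have "measure M (\<Union>j\<in>J n. Vi n j) \<le> (\<Sum>j\<in>J n. measure M (Vi n j))"
        using J Vi_M by (intro measure_UNION_le) auto
      also have "... \<le> (\<Sum>j\<in>J n. C * T^2 / Lk^4 * (y/2)^n)" by (intro sum_mono V)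
      also have "... = real (card (J n)) * (C * T^2 / Lk^4 * (y/2)^n)" by simp
      also have "... \<le> \<delta> * 2^n / T * (C * T^2 / Lk^4 * (y/2)^n)"
        using J(2) C h y by (intro mult_right_mono) auto
      also have "... = C * \<delta> * T / Lk^4 * y^n" using h by (simp add: power_divide power2_eq_square field_simps)
      finally show ?thesis .
    qed
    have Um: "(\<Union>j\<in>J n. Vi n j) \<in> sets M" for n using J Vi_M by auto
    have geo: "summable (\<lambda>n. C * \<delta> * T / Lk^4 * y^n)" using y by (intro summable_mult summable_geometric) simp
    have sm: "summable (\<lambda>n. measure M (\<Union>j\<in>J n. Vi n j))"
      by (rule summable_comparison_test'[OF geo, of 0]) (use U in simp)
    have "{w \<in> space M. tt w < \<delta>} = (\<Union>n. \<Union>j\<in>J n. Vi n j)" unfolding tt_less_set J_def using h by simp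
    hence "measure M {w \<in> space M. tt w < \<delta>} \<le> suminf (\<lambda>n. measure M (\<Union>j\<in>J n. Vi n j))"
      using Um by (simp only:) (intro finite_measure_subadditive_countably sm, auto)
    also have "... \<le> suminf (\<lambda>n. C * \<delta> * T / Lk^4 * y^n)" by (intro suminf_le U sm geo)
    also have "... = C * \<delta> * T / Lk^4 * (1 / (1 - y))"
      using y by (subst suminf_mult) (auto simp: suminf_geometric intro: summable_geometric)
    finally show ?thesis by (simp add: mult_ac)
  qed
  thus ?thesis using C(1) y by (intro exI[of _ "C / (1 - y)"]) auto
qed

subsection \<open>Regularity of the stopped noise\<close>

context qwT
begin

definition good :: "'a \<Rightarrow> bool" where
  "good w \<longleftrightarrow> w \<in> space M \<and> B 0 w = 0 \<and> (\<forall>t\<ge>0. ((\<lambda>s. L2norm2 (B s w - B t w)) \<longlongrightarrow> 0) (at t within {0..}))"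

lemma good_AE: "AE w in M. good w"
proof -
  have "AE w in M. B 0 w = 0 \<and> (\<forall>t\<ge>0. ((\<lambda>s. L2norm2 (B s w - B t w)) \<longlongrightarrow> 0) (at t within {0..}))"
    using W by (simp add: q_wiener_def)
  thus ?thesis by (auto simp: good_def elim: AE_mp)
qed

lemma B_cont: "good w \<Longrightarrow> continuous_on {0..} (\<lambda>s. B s w k)"
  unfolding continuous_on_def
proof
  fix t :: real assume g: "good w" and t: "t \<in> {0..}"
  have L: "B s w - B t w \<in> L2sigma" for s using g by (intro L2sigma_diff B_L2) (auto simp: good_def)
  show "((\<lambda>s. B s w k) \<longlongrightarrow> B t w k) (at t within {0..})"
  proof (rule LIM_zero_cancel, rule Lim_null_comparison)
    have "norm (B s w k - B t w k) \<le> sqrt (L2norm2 (B s w - B t w))" for s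
      using L2norm2_ge[OF L, of "{k}" s] by (intro real_le_rsqrt) simp
    thus "\<forall>\<^sub>F s in at t within {0..}. norm (B s w k - B t w k) \<le> sqrt (L2norm2 (B s w - B t w))"
      by (intro always_eventually allI)
    have "((\<lambda>s. L2norm2 (B s w - B t w)) \<longlongrightarrow> 0) (at t within {0..})" using g t by (auto simp: good_def)
    from tendsto_real_sqrt[OF this] show "((\<lambda>s. sqrt (L2norm2 (B s w - B t w))) \<longlongrightarrow> 0) (at t within {0..})" by simp
  qed
qed

text \<open>The square root of \<open>dB\<close>; as a norm it has the triangle inequality needed
  for chaining.\<close>

definition nB :: "freq set \<Rightarrow> real \<Rightarrow> real \<Rightarrow> 'a \<Rightarrow> real" where
  "nB A s t w = L2_set (\<lambda>k. (1 + knorm2 k) * norm (B t w k - B s w k)) A"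

lemma nB_triangle: "nB A s t w \<le> nB A s r w + nB A r t w"
proof -
  have "nB A s t w \<le> L2_set (\<lambda>k. (1 + knorm2 k) * norm (B r w k - B s w k) + (1 + knorm2 k) * norm (B t w k - B r w k)) A"
    unfolding nB_def
  proof (rule L2_set_mono)
    fix k
    have "norm (B t w k - B s w k) \<le> norm (B r w k - B s w k) + norm (B t w k - B r w k)"
      using norm_triangle_ineq[of "B r w k - B s w k" "B t w k - B r w k"] by simp
    thus "(1 + knorm2 k) * norm (B t w k - B s w k) \<le> (1 + knorm2 k) * norm (B r w k - B s w k) + (1 + knorm2 k) * norm (B t w k - B r w k)"
      unfolding distrib_left[symmetric] by (intro mult_left_mono) auto
  qed simp
  also have "... \<le> nB A s r w + nB A r t w" unfolding nB_def by (rule L2_set_triangle_ineq)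
  finally show ?thesis .
qed

lemma nB_commute: "nB A s t w = nB A t s w"
  unfolding nB_def by (simp add: norm_minus_commute)

lemma nB_same [simp]: "nB A t t w = 0" by (simp add: nB_def L2_set_def)

lemma nB_nonneg: "0 \<le> nB A s t w" by (simp add: nB_def L2_set_nonneg)

lemma nB_dB: "(nB A s t w)^2 = dB A s t w"
  by (simp add: nB_def dB_def L2_set_def power_mult_distrib sum_nonneg)

lemma nB_step:
  assumes "finite A" "grid n (Suc j) < tt w"
  shows "nB A (grid n j) (grid n (Suc j)) w \<le> Lk * rr^n"
proof -
  obtain N where N: "A \<subseteq> kbox N" using exists_kbox[OF assms(1)] by blast
  have "dB A (grid n j) (grid n (Suc j)) w \<le> dB (kbox N) (grid n j) (grid n (Suc j)) w"
    unfolding dB_def by (intro sum_mono2 finite_kbox N) auto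
  also have "... \<le> (Lk * rr^n)^2" using no_viol[OF assms(2)] by (auto simp: viol_def not_less)
  finally have "(nB A (grid n j) (grid n (Suc j)) w)^2 \<le> (Lk * rr^n)^2" by (simp only: nB_dB)
  thus ?thesis by (rule power2_le_imp_le) (use Lk rr in simp)
qed

text \<open>Ceiling minus one instead of a floor: for x > 0 the grid point lies strictly before x,
  so for x <= \<open>tt\<close> only intervals ending strictly before \<open>tt\<close> are used. At
  x = 0 truncated subtraction gives index 0.\<close>

definition idx :: "nat \<Rightarrow> real \<Rightarrow> nat" where "idx n x = nat \<lceil>x * 2^n / T\<rceil> - 1"
definition gr :: "nat \<Rightarrow> real \<Rightarrow> real" where "gr n x = grid n (idx n x)"

lemma idx_char:
  assumes "0 < x" shows "real (idx n x) < x * 2^n / T" "x * 2^n / T \<le> real (idx n x) + 1"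
proof -
  define y where "y = x * 2^n / T"
  have y: "0 < y" using assms T by (simp add: y_def)
  have "1 \<le> \<lceil>y\<rceil>" using y by simp
  moreover have "real (nat c - 1) = real_of_int c - 1" if "1 \<le> c" for c using that by (simp add: of_nat_diff)
  ultimately have "real (idx n x) = real_of_int \<lceil>y\<rceil> - 1" unfolding idx_def y_def[symmetric] by blast
  thus "real (idx n x) < x * 2^n / T" "x * 2^n / T \<le> real (idx n x) + 1"
    unfolding y_def[symmetric] by linarith+
qed

lemma gr_zero: "gr n 0 = 0" by (simp add: gr_def idx_def grid_def)

lemma gr_less:
  assumes "0 < x" shows "gr n x < x" "x - gr n x \<le> T / 2^n"
proof -
  show "gr n x < x" using idx_char(1)[OF assms, of n] T by (simp add: gr_def grid_def field_simps)
  have "x \<le> T * (real (idx n x) + 1) / 2^n" using idx_char(2)[OF assms, of n] T by (simp add: field_simps)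
  thus "x - gr n x \<le> T / 2^n" by (simp add: gr_def grid_def distrib_left add_divide_distrib)
qed

lemma gr_nonneg: "0 \<le> gr n x" by (simp add: gr_def grid_pos(2))

lemma idx_refine:
  assumes "0 < x" shows "idx (Suc n) x = 2 * idx n x \<or> idx (Suc n) x = Suc (2 * idx n x)"
proof -
  have "x * 2^Suc n / T = 2 * (x * 2^n / T)" by simp
  hence "real (idx (Suc n) x) < 2 * real (idx n x) + 2" "2 * real (idx n x) < real (idx (Suc n) x) + 1"
    using idx_char[OF assms, of n] idx_char[OF assms, of "Suc n"] by linarith+
  thus ?thesis by linarith
qed

lemma grid_double: "grid (Suc n) (2 * j) = grid n j" by (simp add: grid_def)

lemma gr_step:
  assumes A: "finite A" and x: "0 < x" "x \<le> tt w"
  shows "nB A (gr n x) (gr (Suc n) x) w \<le> Lk * rr^Suc n"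
proof -
  have lt: "gr (Suc n) x < tt w" using gr_less(1)[OF x(1), of "Suc n"] x by linarith
  show ?thesis using idx_refine[OF x(1), of n]
  proof
    assume "idx (Suc n) x = 2 * idx n x"
    hence "gr (Suc n) x = gr n x" by (simp add: gr_def grid_double)
    thus ?thesis using Lk rr by simp
  next
    assume i: "idx (Suc n) x = Suc (2 * idx n x)"
    have "nB A (grid (Suc n) (2 * idx n x)) (grid (Suc n) (Suc (2 * idx n x))) w \<le> Lk * rr^Suc n"
      using lt i by (intro nB_step A) (simp add: gr_def)
    thus ?thesis by (simp only: gr_def i grid_double)
  qed
qed

definition RR :: real where "RR = 1 / (1 - rr)"

lemma RR: "0 < RR" using rr by (simp add: RR_def)

lemma gr_chain:
  assumes A: "finite A" and x: "0 < x" "x \<le> tt w"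
  shows "nB A (gr n x) (gr (n + m) x) w \<le> Lk * rr^n * RR"
proof -
  have "nB A (gr n x) (gr (n + m) x) w \<le> (\<Sum>i<m. Lk * rr^Suc (n + i))"
  proof (induction m)
    case (Suc m)
    have "nB A (gr n x) (gr (n + Suc m) x) w \<le> nB A (gr n x) (gr (n + m) x) w + nB A (gr (n + m) x) (gr (Suc (n + m)) x) w"
      using nB_triangle[of A "gr n x" "gr (n + Suc m) x" w "gr (n + m) x"] by simp
    thus ?case using Suc gr_step[OF A x, of "n + m"] by simp
  qed simp
  also have "... \<le> (\<Sum>i<m. Lk * rr^n * rr^i)"
  proof (rule sum_mono)
    fix i
    have "rr * rr^(n + i) \<le> 1 * rr^(n + i)" using rr by (intro mult_right_mono) auto
    thus "Lk * rr^Suc (n + i) \<le> Lk * rr^n * rr^i" using Lk by (simp add: power_add)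
  qed
  also have "... = Lk * rr^n * (\<Sum>i<m. rr^i)" by (simp only: sum_distrib_left)
  also have "... \<le> Lk * rr^n * RR"
  proof (rule mult_left_mono)
    have "(\<Sum>i<m. rr^i) \<le> suminf (\<lambda>i. rr^i)" using rr by (intro sum_le_suminf summable_geometric) auto
    also have "... = RR" using rr by (simp add: RR_def suminf_geometric)
    finally show "(\<Sum>i<m. rr^i) \<le> RR" .
  qed (use Lk rr in simp)
  finally show ?thesis .
qed

lemma gr_lim:
  assumes "0 \<le> x" shows "(\<lambda>n. gr n x) \<longlonglongrightarrow> x"
proof (cases "x = 0")
  case False
  hence x: "0 < x" using assms by simp
  show ?thesis
  proof (rule LIM_zero_cancel, rule Lim_null_comparison)
    show "\<forall>\<^sub>F n in sequentially. norm (gr n x - x) \<le> T * (1/2)^n"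
      using gr_less[OF x] by (intro always_eventually allI) (simp add: power_one_over less_imp_le abs_if)
    have "(\<lambda>n. T * (1/2)^n) \<longlonglongrightarrow> T * 0" by (intro tendsto_mult tendsto_const LIMSEQ_power_zero) simp
    thus "(\<lambda>n. T * (1/2)^n) \<longlonglongrightarrow> 0" by simp
  qed
qed (simp add: gr_zero)

lemma B_gr_lim:
  assumes "good w" "0 \<le> x" shows "(\<lambda>n. B (gr n x) w k) \<longlonglongrightarrow> B x w k"
  using continuous_on_tendsto_compose[OF B_cont[OF assms(1)] gr_lim[OF assms(2)]] assms(2) gr_nonneg by simp

text \<open>Continuity of each coefficient lets the chain of grid points end at x itself.\<close>

lemma gr_tail:
  assumes g: "good w" and A: "finite A" and x: "0 \<le> x" "x \<le> tt w"
  shows "nB A (gr n x) x w \<le> Lk * rr^n * RR"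
proof (cases "x = 0")
  case True
  thus ?thesis using Lk rr RR by (simp add: gr_zero)
next
  case False
  hence x0: "0 < x" using x by simp
  have "(\<lambda>m. nB A (gr n x) (gr (m + n) x) w) \<longlonglongrightarrow> nB A (gr n x) x w"
    unfolding nB_def L2_set_def
    by (intro tendsto_intros LIMSEQ_ignore_initial_segment[OF B_gr_lim[OF g x(1)]])
  thus ?thesis
    by (rule LIMSEQ_le_const2) (use gr_chain[OF A x0 x(2), of n] in \<open>simp add: add.commute\<close>)
qed

lemma dyadic_scale:
  fixes y :: real
  assumes "0 < y" "y \<le> 1"
  obtains n where "y \<le> 1 / 2^n" "1 / 2^Suc n < y"
proof -
  have "\<exists>n. 1 / 2^Suc n < y"
  proof -
    obtain n where "(1/2::real)^n < y" using real_arch_pow_inv[of y "1/2"] assms by auto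
    moreover have "(1/2::real)^Suc n \<le> (1/2)^n" by simp
    ultimately have "(1/2)^Suc n < y" by linarith
    thus ?thesis by (auto simp: power_one_over)
  qed
  define n where "n = (LEAST n. 1 / 2^Suc n < y)"
  have 1: "1 / 2^Suc n < y" unfolding n_def by (rule LeastI_ex) fact
  have "y \<le> 1 / 2^n"
  proof (cases n)
    case (Suc m)
    hence "\<not> 1 / 2^Suc m < y" using not_less_Least[of m "\<lambda>n. 1 / 2^Suc n < y"] unfolding n_def by simp
    thus ?thesis using Suc by simp
  qed (use assms in simp)
  thus ?thesis using 1 that by blast
qed

definition HC :: real where "HC = Lk * (2 * RR + 1) / rr"

lemma HC: "0 < HC" using Lk RR rr by (simp add: HC_def)

text \<open>At the level whose mesh is comparable to t - s the left grid points of s and t coincide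
  or are neighbours; the two remaining tails are geometric.\<close>

lemma nB_holder_scaled:
  assumes g: "good w" and A: "finite A" and s: "0 \<le> s" "s < t" and t: "t \<le> tt w"
  shows "nB A s t w \<le> HC * ((t - s) / T) powr (1/8)"
proof -
  define y where "y = (t - s) / T"
  have y: "0 < y" "y \<le> 1" using s t tt_bounds[of w] T by (auto simp: y_def)
  obtain n where n: "y \<le> 1 / 2^n" "1 / 2^Suc n < y" using dyadic_scale[OF y] by blast
  have ts: "(t - s) * 2^n / T \<le> 1" using n(1) T by (simp add: y_def field_simps)
  have t0: "0 < t" using s by simp
  have mid: "nB A (gr n s) (gr n t) w \<le> Lk * rr^n"
  proof -
    have "idx n t = idx n s \<or> idx n t = Suc (idx n s)"
    proof (cases "s = 0")
      case True
      hence "real (idx n t) < 1" using idx_char(1)[OF t0, of n] ts by simp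
      thus ?thesis using True by (simp add: idx_def)
    next
      case False
      hence s0: "0 < s" using s by simp
      have e: "t * 2^n / T = s * 2^n / T + (t - s) * 2^n / T" by (simp add: add_divide_distrib[symmetric] algebra_simps)
      have "0 \<le> (t - s) * 2^n / T" using s T by simp
      hence "real (idx n t) < real (idx n s) + 2" "real (idx n s) < real (idx n t) + 1"
        using idx_char[OF s0, of n] idx_char[OF t0, of n] ts e by linarith+
      thus ?thesis by linarith
    qed
    thus ?thesis
    proof
      assume "idx n t = idx n s"
      thus ?thesis using Lk rr by (simp add: gr_def)
    next
      assume i: "idx n t = Suc (idx n s)"
      have "grid n (Suc (idx n s)) < tt w" using gr_less(1)[OF t0, of n] t i by (simp add: gr_def)
      from nB_step[OF A this] show ?thesis by (simp add: gr_def i)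
    qed
  qed
  have "nB A s t w \<le> nB A s (gr n s) w + (nB A (gr n s) (gr n t) w + nB A (gr n t) t w)"
    using nB_triangle[of A s t w "gr n s"] nB_triangle[of A "gr n s" t w "gr n t"] by linarith
  also have "... \<le> Lk * rr^n * RR + (Lk * rr^n + Lk * rr^n * RR)"
    using gr_tail[OF g A, of s n] gr_tail[OF g A, of t n] s t t0 mid by (intro add_mono) (auto simp: nB_commute[of A s])
  also have "... = HC * rr^Suc n" using rr by (simp add: HC_def field_simps)
  also have "rr^Suc n \<le> y powr (1/8)"
  proof -
    have "rr^Suc n = (1 / 2^Suc n) powr (1/8)"
    proof -
      have "rr^Suc n = 2 powr (-1/8 * real (Suc n))" unfolding rr_def by (simp only: powr_realpow[symmetric] powr_gt_zero powr_powr)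
      moreover have "1 / 2^Suc n = 2 powr (- real (Suc n))" by (simp only: powr_minus_divide powr_realpow zero_less_numeral)
      moreover have "-1/8 * real (Suc n) = - real (Suc n) * (1/8)" by linarith
      ultimately show ?thesis by (simp only: powr_powr)
    qed
    also have "... \<le> y powr (1/8)" using n(2) by (intro powr_mono2) auto
    finally show ?thesis .
  qed
  finally show ?thesis using HC by (simp add: y_def)
qed

text \<open>The summand T^(-1/8) undoes the scaling of time by T; the summand 1 covers the uniform
  bound on [0, T].\<close>

definition Lb :: real where "Lb = HC * (1 + T powr (-1/8))"

lemma Lb_nonneg: "0 \<le> Lb" using HC by (simp add: Lb_def)

lemma nB_holder:
  assumes g: "good w" and A: "finite A" and s: "0 \<le> s" "s \<le> tt w" and t: "0 \<le> t" "t \<le> tt w"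
  shows "nB A s t w \<le> Lb * \<bar>t - s\<bar> powr (1/8)" "nB A s t w \<le> Lb"
proof -
  have main: "nB A s t w \<le> HC * (\<bar>t - s\<bar> / T) powr (1/8)"
  proof (cases s t rule: linorder_cases)
    case less
    thus ?thesis using nB_holder_scaled[OF g A s(1) less t(2)] by simp
  next
    case greater
    thus ?thesis using nB_holder_scaled[OF g A t(1) greater s(2)] nB_commute[of A s t w] by simp
  qed simp
  have "(\<bar>t - s\<bar> / T) powr (1/8) = \<bar>t - s\<bar> powr (1/8) * T powr (-1/8)"
    using T by (simp add: powr_divide powr_minus_divide)
  hence "HC * (\<bar>t - s\<bar> / T) powr (1/8) = HC * T powr (-1/8) * \<bar>t - s\<bar> powr (1/8)" by simp
  also have "... \<le> Lb * \<bar>t - s\<bar> powr (1/8)" using HC by (intro mult_right_mono) (auto simp: Lb_def)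
  finally show "nB A s t w \<le> Lb * \<bar>t - s\<bar> powr (1/8)" using main by linarith
  have "\<bar>t - s\<bar> / T \<le> 1" using s t tt_bounds(2)[of w] T by (simp add: abs_if)
  hence "(\<bar>t - s\<bar> / T) powr (1/8) \<le> 1 powr (1/8)" using T by (intro powr_mono2) auto
  hence "HC * (\<bar>t - s\<bar> / T) powr (1/8) \<le> HC * 1" using HC by (intro mult_left_mono) auto
  also have "... \<le> Lb" using HC by (simp add: Lb_def)
  finally show "nB A s t w \<le> Lb" using main by linarith
qed

text \<open>Constant after \<open>tt\<close>, zero before time 0 by B 0 = 0, and zero on the
  exceptional null set, so that the bounds of the locale \<open>noise\<close> hold for every
  \<open>w\<close>.\<close>

definition bs :: "'a set \<Rightarrow> real \<Rightarrow> 'a \<Rightarrow> field" where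
  "bs N0 t w = (if w \<in> space M - N0 then B (min (max t 0) (tt w)) w else 0)"

text \<open>The filtration is trivial at time 0, which makes the initial value deterministic.\<close>

definition FF :: "real \<Rightarrow> 'a measure" where
  "FF t = (if t \<le> 0 then sigma (space M) {} else augF M B t)"

lemma space_FF [simp]: "space (FF t) = space M" by (simp add: FF_def space_measure_of_conv)

lemma FF_le_augF: "sets (FF t) \<subseteq> sets (augF M B t)"
proof (cases "t \<le> 0")
  case True
  hence "sets (FF t) = {{}, space M}" by (simp add: FF_def sigma_sets_empty_eq)
  thus ?thesis using sets.top[of "augF M B t"] by simp
qed (simp add: FF_def)

lemma noise_bs:
  assumes N0: "N0 \<in> null_sets M" "\<And>w. w \<in> space M - N0 \<Longrightarrow> good w" and a: "0 < a" "a < 1/2"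
  shows "noise FF (bs N0) Lb a"
proof
  let ?x = "\<lambda>t w. min (max t 0) (tt w)"
  have x: "0 \<le> ?x t w" "?x t w \<le> tt w" for t w using tt_bounds[of w] by auto
  show "sets (FF s) \<subseteq> sets (FF t)" if "s \<le> t" for s t
  proof (cases "s \<le> 0")
    case True
    hence "sets (FF s) = {{}, space M}" by (simp add: FF_def sigma_sets_empty_eq)
    thus ?thesis using sets.top[of "FF t"] by simp
  next
    case False
    thus ?thesis using that augF_mono[OF that, of M B] by (simp add: FF_def)
  qed
  show "space (FF s) = space (FF t)" for s t by simp
  show neg: "bs N0 t w = 0" if "t \<le> 0" for t w
    using that N0(2)[of w] tt_bounds[of w] by (auto simp: bs_def good_def max_def min_def)
  show "(\<lambda>w. bs N0 t w k $ m) \<in> borel_measurable (FF t)" for t k m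
  proof (cases "t \<le> 0")
    case True
    thus ?thesis using neg by simp
  next
    case False
    let ?G = "augF M B t"
    \<comment> \<open>Values at the last dyadic point before min t tt: the random index takes
      countably many values and each of them looks only at times up to t. The null set belongs to
      the augmented filtration.\<close>
    let ?f = "\<lambda>n w. if w \<in> N0 then 0 else (if grid n (idx n (min t (tt w))) \<le> t then B (grid n (idx n (min t (tt w)))) w k $ m else 0)"
    have "(\<lambda>w. bs N0 t w k $ m) \<in> borel_measurable ?G"
    proof (rule borel_measurable_LIMSEQ_metric)
      fix n
      have i: "(\<lambda>w. idx n (min t (tt w))) \<in> measurable ?G (count_space UNIV)"
        unfolding idx_def using tt_min_meas[of t] by measurable
      have h: "(\<lambda>w. if grid n j \<le> t then B (grid n j) w k $ m else 0) \<in> borel_measurable ?G" for j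
      proof (cases "grid n j \<le> t")
        case True
        have "(\<lambda>w. B (grid n j) w k $ m) \<in> borel_measurable ?G"
          by (rule measurable_subset[OF natF_augF _ B_natF[OF grid_pos(2) True]]) simp
        thus ?thesis using True by simp
      qed simp
      have "(\<lambda>w. if grid n (idx n (min t (tt w))) \<le> t then B (grid n (idx n (min t (tt w)))) w k $ m else 0) \<in> borel_measurable ?G"
        by (rule measurable_compose_countable[OF h i])
      thus "?f n \<in> borel_measurable ?G"
        by (intro measurable_If_set measurable_const sets.Int augF_null N0(1) sets.top) auto
    next
      fix w assume w: "w \<in> space ?G"
      show "(\<lambda>n. ?f n w) \<longlonglongrightarrow> bs N0 t w k $ m"
      proof (cases "w \<in> N0")
        case False
        hence g: "good w" using N0(2) w by simp
        let ?y = "min t (tt w)"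
        have y: "0 \<le> ?y" using tt_bounds[of w] \<open>\<not> t \<le> 0\<close> by simp
        have "gr n ?y \<le> t" for n
        proof (cases "?y = 0")
          case True
          thus ?thesis using \<open>\<not> t \<le> 0\<close> by (simp add: gr_zero)
        next
          case False
          hence "gr n ?y < ?y" using y gr_less(1)[of ?y n] by linarith
          thus ?thesis by simp
        qed
        hence "(\<lambda>n. ?f n w) = (\<lambda>n. B (gr n ?y) w k $ m)" using False by (simp add: gr_def)
        moreover have "bs N0 t w = B ?y w" using False w \<open>\<not> t \<le> 0\<close> by (simp add: bs_def max_def)
        ultimately show ?thesis using tendsto_vec_nth[OF B_gr_lim[OF g y]] by simp
      qed (simp add: bs_def)
    qed
    thus ?thesis using False by (simp add: FF_def)
  qed
  show "bs N0 t w (- k) $ m = cnj (bs N0 t w k $ m)" for t w k m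
    using B_L2[of w "?x t w"] by (simp add: bs_def L2sigma_def)
  show "(\<Sum>m\<in>UNIV. of_int (k $ m) * bs N0 t w k $ m) = 0" for t w k
    using B_L2[of w "?x t w"] by (simp add: bs_def L2sigma_def)
  have sq: "wS A (\<lambda>k. bs N0 t w k - bs N0 s w k) \<le> c^2"
    if "0 \<le> c" "good w \<Longrightarrow> nB A (?x s w) (?x t w) w \<le> c" for A s t w c
  proof (cases "w \<in> space M - N0")
    case True
    have "wS A (\<lambda>k. bs N0 t w k - bs N0 s w k) = (nB A (?x s w) (?x t w) w)^2"
      using True by (simp only: nB_dB) (simp add: dB_def bs_def)
    thus ?thesis using that(2)[OF N0(2)[OF True]] by (simp add: nB_nonneg power_mono)
  next
    case False
    hence "bs N0 r w = 0" for r unfolding bs_def by (rule if_not_P)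
    thus ?thesis by simp
  qed
  show "wS A (bs N0 t w) \<le> Lb^2" if A: "finite A" for A t w
  proof -
    have "wS A (\<lambda>k. bs N0 t w k - bs N0 0 w k) \<le> Lb^2"
      using nB_holder(2)[OF _ A x x] Lb_nonneg by (intro sq)
    thus ?thesis by (simp add: neg)
  qed
  show "wS A (\<lambda>k. bs N0 t w k - bs N0 s w k) \<le> (Lb * \<bar>t - s\<bar> powr (1/8))^2" if A: "finite A" for A t s w
  proof (rule sq)
    assume g: "good w"
    have "\<bar>?x t w - ?x s w\<bar> powr (1/8) \<le> \<bar>t - s\<bar> powr (1/8)" by (intro powr_mono2) auto
    hence "Lb * \<bar>?x t w - ?x s w\<bar> powr (1/8) \<le> Lb * \<bar>t - s\<bar> powr (1/8)" using Lb_nonneg by (intro mult_left_mono)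
    thus "nB A (?x s w) (?x t w) w \<le> Lb * \<bar>t - s\<bar> powr (1/8)"
      using nB_holder(1)[OF g A x x, of s t] by linarith
  qed (simp add: Lb_nonneg)
qed (use Lb_nonneg a in auto)

end

section \<open>Choice of the amplitude and conclusion\<close>

lemma L2norm2_le:
  assumes "lb c f" shows "L2norm2 f \<le> c^2"
proof -
  have "Hs_norm2 0 f \<le> ennreal (c^2)"
    by (rule Hs_norm2_le) (use assms in \<open>simp add: lb_def Hn_0\<close>)
  thus ?thesis unfolding L2norm2_def by (intro enn2real_leI) auto
qed

lemma Hs_norm2_tendsto_zero:
  assumes "\<And>\<epsilon>. 0 < \<epsilon> \<Longrightarrow> \<forall>\<^sub>F s in F. \<forall>S. finite S \<longrightarrow> Hn g S (f s) \<le> \<epsilon>"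
  shows "((\<lambda>s. Hs_norm2 g (f s)) \<longlongrightarrow> 0) F"
proof (rule order_tendstoI)
  fix a :: ennreal assume "0 < a"
  then obtain y where y: "0 < y" "y < a" using dense by blast
  then obtain r where r: "y = ennreal r" "0 \<le> r" by (cases y) (auto simp: top_unique)
  hence r0: "0 < sqrt r" using y by (cases "r = 0") auto
  show "\<forall>\<^sub>F s in F. Hs_norm2 g (f s) < a"
    using assms[OF r0]
  proof (rule eventually_mono)
    fix s assume "\<forall>S. finite S \<longrightarrow> Hn g S (f s) \<le> sqrt r"
    hence "Hs_norm2 g (f s) \<le> ennreal ((sqrt r)^2)" by (intro Hs_norm2_le) auto
    thus "Hs_norm2 g (f s) < a" using r y by simp
  qed
qed simp

text \<open>With A = x^2 the initial energy is of order x^2 and the final one of order x^4. The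
  summands in the choice of x make the lower bound at least x^2/8 and its square large
  enough.\<close>

lemma large_amplitude:
  fixes K C D E :: real
  assumes "0 \<le> K" "0 \<le> C" "0 \<le> D" "0 \<le> E"
  obtains x where "1 \<le> x" "K * (C^2 * x^2 + E) < (x^2 / 4 - D - C * x)^2" "0 \<le> x^2 / 4 - D - C * x"
proof -
  define x where "x = 1 + 8 * (C + D) + 64 * (K * (C^2 + E))"
  have nn: "0 \<le> K * (C^2 + E)" using assms by simp
  have x: "1 \<le> x" "8 * (C + D) \<le> x" "64 * (K * (C^2 + E)) < x" using assms nn by (auto simp: x_def)
  have xx: "x \<le> x^2" using x(1) by (simp add: power2_eq_square mult_le_cancel_left1)
  have "8 * (C + D) * x \<le> x * x" using x by (intro mult_right_mono) auto
  moreover have "D * 1 \<le> D * x" using x assms by (intro mult_left_mono) auto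
  ultimately have 1: "x^2 / 8 \<le> x^2 / 4 - D - C * x" by (simp add: power2_eq_square algebra_simps)
  have "E * 1 \<le> E * x^2" using x xx assms by (intro mult_left_mono) auto
  hence "K * (C^2 * x^2 + E) \<le> K * ((C^2 + E) * x^2)" using assms by (intro mult_left_mono) (auto simp: algebra_simps)
  also have "... = K * (C^2 + E) * x^2" by simp
  also have "... < x^2 / 64 * x^2" using x xx by (intro mult_strict_right_mono) auto
  also have "... = (x^2 / 8)^2" by (simp add: power2_eq_square)
  also have "... \<le> (x^2 / 4 - D - C * x)^2" using 1 by (intro power_mono) auto
  finally have "K * (C^2 * x^2 + E) < (x^2 / 4 - D - C * x)^2" .
  moreover have "0 \<le> x^2 / 8" by simp
  hence "0 \<le> x^2 / 4 - D - C * x" using 1 by linarith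
  ultimately show ?thesis using x(1) that by blast
qed

context noise
begin

lemma lk_Y0: "lk Y0 (pj 2 1 1) = 1"
proof -
  have "pj 2 1 (-1) $ 2 \<noteq> pj 2 1 1 $ 2" by (simp add: pj_def)
  hence "pj 2 1 (-1) \<noteq> pj 2 1 1" by metis
  thus ?thesis by (simp add: Y0_def lookup_add lookup_single when_def)
qed

text \<open>At time T the time factor is sin 1 >= sin(pi/6) = 1/2, and the coefficient of cos x_2
  contributes another 1/2.\<close>

lemma vf_v0_end: "T \<noteq> 0 \<Longrightarrow> 0 \<le> A \<Longrightarrow> A / 4 \<le> norm (vf (\<lambda>m. v0 A T m T) (pj 2 1 1))"
proof -
  assume T: "T \<noteq> 0" and A: "0 \<le> A"
  have "vf (\<lambda>m. v0 A T m T) (pj 2 1 1) $ 1 = of_real (A * sin 1 / 2)"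
    using T by (simp only: vf_def v0_def vec_lambda_beta refl if_True lk_cst_mult lk_Y0) simp
  moreover have "1/2 \<le> sin (1::real)"
  proof -
    have "sin (pi/6) \<le> sin (1::real)" using pi_gt3 pi_less_4 by (intro sin_monotone_2pi_le) auto
    thus ?thesis by (simp add: sin_30)
  qed
  moreover have "A / 4 \<le> cmod (of_real (A * sin 1 / 2))" if "1/2 \<le> sin (1::real)"
    using A mult_left_mono[OF that A] unfolding norm_of_real by linarith
  ultimately have "A / 4 \<le> cmod (vf (\<lambda>m. v0 A T m T) (pj 2 1 1) $ 1)" by (simp only:)
  also have "... \<le> norm (vf (\<lambda>m. v0 A T m T) (pj 2 1 1))" by (rule cmod_nth_le)
  finally show ?thesis .
qed

lemma vf_v0_zero: "vf (\<lambda>m. v0 A T m 0) = 0"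
proof -
  have "v0 A T m 0 = 0" for m by (rule poly_mapping_eqI) (simp add: v0_def)
  thus ?thesis by (simp add: vf_def fun_eq_iff vec_eq_iff)
qed

end

theorem mainTheorem3:
  fixes M :: "'a measure" and g :: "nat \<Rightarrow> field" and B :: "real \<Rightarrow> 'a \<Rightarrow> field"
    and \<alpha> \<sigma> T K :: real
  assumes "prob_space M"
    and "HS_family g"
    and "q_wiener M (natF M B) g B"
    and "0 < \<alpha>" and "\<alpha> < 1/2" and "\<sigma> > 0"
    and "trApow_GG \<alpha> ((5 + 2*\<sigma> - 2*\<alpha>) / (2*\<alpha>)) g < \<infinity>"
    and "T > 0" and "K > 1"
  shows "\<exists>\<gamma> (\<t>::'a \<Rightarrow> real) (u::real \<Rightarrow> 'a \<Rightarrow> field).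
           0 < \<gamma> \<and> \<gamma> < 1
         \<and> stopping_time (augF M B) \<t>
         \<and> (AE \<omega> in M. \<t> \<omega> > 0)
         \<and> measure M {\<omega>\<in>space M. \<t> \<omega> \<ge> T} > 1/2
         \<and> (\<forall>t\<ge>0. u t \<in> measurable (augF M B t) L2meas)
         \<and> weak_solution M \<alpha> B u \<t>
         \<and> (AE \<omega> in M. (\<forall>t\<ge>0. u (min t (\<t> \<omega>)) \<omega> \<in> Hs \<gamma>)
               \<and> (\<forall>t\<ge>0. ((\<lambda>s. Hs_norm2 \<gamma> (u (min s (\<t> \<omega>)) \<omega> - u (min t (\<t> \<omega>)) \<omega>))
                            \<longlongrightarrow> 0) (at t within {0..})))
         \<and> (\<exists>u0\<in>L2sigma. \<forall>\<omega>\<in>space M. u 0 \<omega> = u0)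
         \<and> (\<exists>C::real. AE \<omega> in M. \<forall>t\<ge>0. Hs_norm2 \<gamma> (u (min t (\<t> \<omega>)) \<omega>) \<le> ennreal C)
         \<and> (\<forall>\<omega>\<in>space M. \<t> \<omega> \<ge> T \<longrightarrow>
               L2norm2 (u T \<omega>) > K * (L2norm2 (u 0 \<omega>) + T * trGG g))"
proof -
  define \<rho> where "\<rho> = (5 + 2*\<sigma> - 2*\<alpha>) / (2*\<alpha>)"
  \<comment> \<open>Here (5 + 2\<sigma> - 2\<alpha>)/2 exceeds 2 because \<alpha> < 1/2 and \<sigma>
    > 0.\<close>
  have ar: "2 \<le> \<alpha> * \<rho>"
  proof -
    have "\<alpha> * \<rho> = (5 + 2*\<sigma> - 2*\<alpha>) / 2" using assms(4) by (simp add: \<rho>_def)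
    thus ?thesis using assms(5,6) by simp
  qed
  interpret Q: qw M g B \<alpha> \<rho>
    by (intro qw.intro qw_axioms.intro) (use assms ar in \<open>auto simp: \<rho>_def\<close>)
  obtain C where C: "0 \<le> C" "\<And>T Lk \<delta>. 0 < T \<Longrightarrow> 0 < Lk \<Longrightarrow> 0 \<le> \<delta> \<Longrightarrow> \<delta> \<le> T \<Longrightarrow>
     measure M {w \<in> space M. qwT.tt B T Lk w < \<delta>} \<le> C * \<delta> * T / Lk^4"
    using Q.viol_prob by blast
  \<comment> \<open>Makes C T^2 / Lk^4 smaller than 1/2.\<close>
  define Lk where "Lk = 2 * (C * T * T) + 1"
  have CT: "0 \<le> C * T * T" using C(1) assms(8) by simp
  have Lk: "1 \<le> Lk" "2 * (C * T * T) < Lk" using CT by (auto simp: Lk_def)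
  interpret Q: qwT M g B \<alpha> \<rho> T Lk by unfold_locales (use assms(8) Lk in auto)
  let ?t = "Q.tt"
  have PT: "measure M {w \<in> space M. ?t w < \<delta>} \<le> C * \<delta> * T / Lk^4" if "0 \<le> \<delta>" "\<delta> \<le> T" for \<delta>
    by (rule C(2)) (use that assms(8) Lk in auto)
  obtain N0 where N0: "\<And>w. w \<in> space M - N0 \<Longrightarrow> Q.good w" "N0 \<in> null_sets M"
    using AE_E3[OF Q.good_AE] by blast
  have AEN: "AE w in M. w \<in> space M - N0"
    using AE_not_in[OF N0(2)] AE_space by eventually_elim auto
  let ?b = "Q.bs N0"
  interpret N: noise Q.FF ?b Q.Lb \<alpha> by (rule Q.noise_bs[OF N0(2,1) assms(4,5)])
  obtain C3 where C3: "0 \<le> C3" "\<And>A. 1 \<le> A \<Longrightarrow> \<exists>ga u. N.sol T A C3 ga u"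
    using N.solution_exists[OF assms(8)] by blast
  have tr0: "0 \<le> T * trGG g"
    unfolding trGG_def using assms(8) Q.g_L2(2) by (intro mult_nonneg_nonneg suminf_nonneg) (auto simp: L2norm2_def)
  obtain x where x: "1 \<le> x" "K * (C3^2 * x^2 + T * trGG g) < (x^2 / 4 - Q.Lb - C3 * x)^2" "0 \<le> x^2 / 4 - Q.Lb - C3 * x"
    using large_amplitude[of K C3 Q.Lb "T * trGG g"] assms(9) C3(1) Q.Lb_nonneg tr0 by auto
  define A where "A = x^2"
  have A: "1 \<le> A" "sqrt A = x" "0 \<le> A" using x(1) by (auto simp: A_def one_le_power)
  obtain ga u where sol: "N.sol T A C3 ga u" using C3(2)[OF A(1)] by blast
  note sol5 = sol[unfolded N.sol_def, THEN conjunct2, THEN conjunct2, THEN conjunct2, THEN conjunct2]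
  note sol6 = sol5[THEN conjunct2] and sol7 = sol5[THEN conjunct2, THEN conjunct2]
  have ga: "0 < ga" "ga < 1" using sol by (auto simp: N.sol_def)
  have um: "(\<lambda>w. u t w k $ m) \<in> borel_measurable (Q.FF t)" for t k m using sol by (simp add: N.sol_def)
  have uL: "u t w \<in> L2sigma" for t w using sol by (simp add: N.sol_def)
  obtain H where H: "\<And>t w S. finite S \<Longrightarrow> Hn ga S (u t w) \<le> H" using sol5[THEN conjunct1] by blast
  have uc: "\<exists>\<delta>>0. \<forall>s. \<bar>s - t\<bar> < \<delta> \<longrightarrow> (\<forall>S. finite S \<longrightarrow> Hn ga S (u s w - u t w) \<le> \<epsilon>)" if "0 < \<epsilon>" for t w \<epsilon>
    using sol6[THEN conjunct1] that by blast
  have ue: "continuous_on {0..t} (\<lambda>r. F_pair \<alpha> (u r w) e)"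
      "((\<lambda>r. F_pair \<alpha> (u r w) e) has_integral inner_L2 (u t w) e - inner_L2 (u 0 w) e - inner_L2 (?b t w) e) {0..t}"
    if "e \<in> Hs 3" "0 \<le> t" for e w t
    using sol7[THEN conjunct1] that by blast+
  have ud: "lb (C3 * x) (u t w - ?b t w - vf (\<lambda>m. N.v0 A T m t))" for t w
    using sol7[THEN conjunct2] unfolding A(2) by blast
  have Hb: "Hs_norm2 ga (u t w) \<le> ennreal (H^2)" for t w by (rule Hs_norm2_le[OF H])
  have "stopping_time (augF M B) ?t" by (rule Q.tt_stopping)
  \<comment> \<open>The bound is linear in \<delta>; take \<delta> = T/(n+1) and let n tend to
    infinity.\<close>
  moreover have "AE w in M. ?t w > 0"
  proof (rule AE_I)
    let ?Z = "{w \<in> space M. ?t w \<le> 0}"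
    show "{w \<in> space M. \<not> 0 < ?t w} \<subseteq> ?Z" by auto
    show Zm: "?Z \<in> sets M" using Q.tt_le_natF[of 0 1] Q.natF_M by auto
    have "measure M ?Z \<le> 0"
    proof (rule LIMSEQ_le_const)
      have "(\<lambda>n. C * T * T / Lk^4 / real (Suc n)) \<longlonglongrightarrow> 0"
        by (rule LIMSEQ_Suc[OF lim_const_over_n])
      thus "(\<lambda>n. C * (T / real (Suc n)) * T / Lk^4) \<longlonglongrightarrow> 0" by (simp add: field_simps)
      have "measure M ?Z \<le> C * (T / real (Suc n)) * T / Lk^4" for n
      proof -
        have d: "0 < T / real (Suc n)" "T / real (Suc n) \<le> T" using assms(8) by (auto simp: divide_le_eq)
        have "{w \<in> space M. ?t w < T / real (Suc n)} \<in> sets M" using Q.tt_less_natF[OF order_refl] Q.natF_M by blast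
        hence "measure M ?Z \<le> measure M {w \<in> space M. ?t w < T / real (Suc n)}"
          using d by (intro Q.finite_measure_mono) auto
        also have "... \<le> C * (T / real (Suc n)) * T / Lk^4" using d by (intro PT) auto
        finally show ?thesis .
      qed
      thus "\<exists>N. \<forall>n\<ge>N. measure M ?Z \<le> C * (T / real (Suc n)) * T / Lk^4" by blast
    qed
    thus "emeasure M ?Z = 0" by (simp add: Q.emeasure_eq_measure measure_le_0_iff)
  qed
  moreover have "measure M {w \<in> space M. ?t w \<ge> T} > 1/2"
  proof -
    let ?Y = "{w \<in> space M. ?t w < T}"
    have Ym: "?Y \<in> sets M" using Q.tt_less_natF[OF order_refl] Q.natF_M by blast
    have "measure M ?Y \<le> C * T * T / Lk^4" using assms(8) by (intro PT) auto
    also have "... \<le> C * T * T / Lk^1"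
      using CT Lk(1) power_increasing[of 1 4 Lk] by (intro divide_left_mono) auto
    also have "... < 1/2" using Lk by (simp add: field_simps)
    finally have "measure M ?Y < 1/2" .
    moreover have "{w \<in> space M. ?t w \<ge> T} = space M - ?Y" by auto
    ultimately show ?thesis using Q.prob_compl[OF Ym] by simp
  qed
  moreover have "\<forall>t\<ge>0. u t \<in> measurable (augF M B t) L2meas"
    unfolding L2meas_def
  proof (intro allI impI measurable_measure_of)
    fix t :: real and y
    assume "y \<in> {(\<lambda>f. f k $ i) -` A \<inter> L2sigma |k i A. A \<in> sets (borel :: complex measure)}"
    then obtain k i E where y: "y = (\<lambda>f. f k $ i) -` E \<inter> L2sigma" "E \<in> sets (borel :: complex measure)" by blast
    have "u t -` y \<inter> space (augF M B t) = (\<lambda>w. u t w k $ i) -` E \<inter> space (Q.FF t)"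
      unfolding y using uL by auto
    also have "... \<in> sets (Q.FF t)" by (rule measurable_sets[OF um y(2)])
    finally show "u t -` y \<inter> space (augF M B t) \<in> sets (augF M B t)" using Q.FF_le_augF by blast
  qed (use uL in auto)
  moreover have "weak_solution M \<alpha> B u ?t"
    unfolding weak_solution_def using AEN
  proof eventually_elim
    fix w assume w: "w \<in> space M - N0"
    show "\<forall>e\<in>Hs 3. \<forall>t. 0 \<le> t \<and> t \<le> ?t w \<longrightarrow>
        set_integrable lborel {0..t} (\<lambda>r. F_pair \<alpha> (u r w) e)
      \<and> inner_L2 (u t w) e = inner_L2 (u 0 w) e + (LINT r:{0..t}|lborel. F_pair \<alpha> (u r w) e) + inner_L2 (B t w) e"
    proof (intro ballI allI impI conjI)
      fix e t assume e: "e \<in> Hs 3" and t: "0 \<le> t \<and> t \<le> ?t w"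
      show I: "set_integrable lborel {0..t} (\<lambda>r. F_pair \<alpha> (u r w) e)"
        using ue(1)[OF e] t by (intro borel_integrable_atLeastAtMost') auto
      have "?b t w = B t w" using w t by (simp add: Q.bs_def)
      moreover have "(LINT r:{0..t}|lborel. F_pair \<alpha> (u r w) e) = integral {0..t} (\<lambda>r. F_pair \<alpha> (u r w) e)"
        by (rule set_borel_integral_eq_integral(2)[OF I])
      moreover have "integral {0..t} (\<lambda>r. F_pair \<alpha> (u r w) e) = inner_L2 (u t w) e - inner_L2 (u 0 w) e - inner_L2 (?b t w) e"
        using ue(2)[OF e] t by (intro integral_unique) auto
      ultimately show "inner_L2 (u t w) e = inner_L2 (u 0 w) e + (LINT r:{0..t}|lborel. F_pair \<alpha> (u r w) e) + inner_L2 (B t w) e"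
        by simp
    qed
  qed
  moreover have "AE w in M. (\<forall>t\<ge>0. u (min t (?t w)) w \<in> Hs ga) \<and>
     (\<forall>t\<ge>0. ((\<lambda>s. Hs_norm2 ga (u (min s (?t w)) w - u (min t (?t w)) w)) \<longlongrightarrow> 0) (at t within {0..}))"
  proof (rule AE_I2, intro conjI allI impI)
    fix w t
    show "u (min t (?t w)) w \<in> Hs ga"
      using uL le_less_trans[OF Hb ennreal_less_top] by (simp add: Hs_def)
    show "((\<lambda>s. Hs_norm2 ga (u (min s (?t w)) w - u (min t (?t w)) w)) \<longlongrightarrow> 0) (at t within {0..})"
    proof (rule Hs_norm2_tendsto_zero)
      fix \<epsilon> :: real assume "0 < \<epsilon>"
      then obtain \<delta> where \<delta>: "0 < \<delta>" "\<And>s S. \<bar>s - min t (?t w)\<bar> < \<delta> \<Longrightarrow> finite S \<Longrightarrow> Hn ga S (u s w - u (min t (?t w)) w) \<le> \<epsilon>"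
        using uc by blast
      have "\<forall>\<^sub>F s in at t within {0..}. dist s t < \<delta>" using \<delta>(1) eventually_at by blast
      thus "\<forall>\<^sub>F s in at t within {0..}. \<forall>S. finite S \<longrightarrow> Hn ga S (u (min s (?t w)) w - u (min t (?t w)) w) \<le> \<epsilon>"
      proof (rule eventually_mono)
        fix s assume "dist s t < \<delta>"
        hence "\<bar>min s (?t w) - min t (?t w)\<bar> < \<delta>" by (auto simp: dist_real_def min_def abs_if split: if_splits)
        thus "\<forall>S. finite S \<longrightarrow> Hn ga S (u (min s (?t w)) w - u (min t (?t w)) w) \<le> \<epsilon>" using \<delta>(2) by blast
      qed
    qed
  qed
  \<comment> \<open>At time 0 the filtration \<open>Q.FF\<close> consists of the empty set and the
    whole space, so every coefficient of u 0 is constant.\<close>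
  moreover have "\<exists>u0\<in>L2sigma. \<forall>w\<in>space M. u 0 w = u0"
  proof -
    obtain w0 where w0: "w0 \<in> space M" using Q.not_empty by blast
    have "u 0 w = u 0 w0" if w: "w \<in> space M" for w
    proof (rule ext, subst vec_eq_iff, rule allI)
      fix k m
      have "(\<lambda>w. u 0 w k $ m) -` {u 0 w0 k $ m} \<inter> space (Q.FF 0) \<in> sets (Q.FF 0)"
        by (rule measurable_sets[OF um]) simp
      hence "(\<lambda>w. u 0 w k $ m) -` {u 0 w0 k $ m} \<inter> space M \<in> {{}, space M}"
        by (simp add: Q.FF_def sigma_sets_empty_eq)
      thus "u 0 w k $ m = u 0 w0 k $ m" using w w0 by auto
    qed
    thus ?thesis using uL by blast
  qed
  moreover have "\<exists>C::real. AE w in M. \<forall>t\<ge>0. Hs_norm2 ga (u (min t (?t w)) w) \<le> ennreal C"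
    using Hb by (intro exI[of _ "H^2"]) simp
  moreover have "\<forall>w\<in>space M. ?t w \<ge> T \<longrightarrow> L2norm2 (u T w) > K * (L2norm2 (u 0 w) + T * trGG g)"
  proof (intro ballI impI)
    fix w
    let ?k = "pj 2 1 1" and ?v = "vf (\<lambda>m. N.v0 A T m T)"
    \<comment> \<open>A single Fourier mode of the shear flow already gives a lower bound of order
      A; path and waves change it by at most Lb + C3 x. These bounds hold for every w, also on the
      exceptional null set.\<close>
    have "norm (?v ?k) \<le> norm (u T w ?k) + norm (?b T w ?k) + norm ((u T w - ?b T w - ?v) ?k)"
    proof -
      have "?v ?k = u T w ?k - ?b T w ?k - (u T w - ?b T w - ?v) ?k" by simp
      hence "norm (?v ?k) = norm (u T w ?k - ?b T w ?k - (u T w - ?b T w - ?v) ?k)" by (rule arg_cong)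
      thus ?thesis using norm_triangle_ineq4[of "u T w ?k - ?b T w ?k" "(u T w - ?b T w - ?v) ?k"]
        norm_triangle_ineq4[of "u T w ?k" "?b T w ?k"] by linarith
    qed
    moreover have "A / 4 \<le> norm (?v ?k)" using assms(8) A by (intro N.vf_v0_end) auto
    moreover have "norm (?b T w ?k) \<le> Q.Lb" by (rule lb_pt[OF N.b_lb(1)])
    moreover have "norm ((u T w - ?b T w - ?v) ?k) \<le> C3 * x" by (rule lb_pt[OF ud])
    ultimately have "x^2 / 4 - Q.Lb - C3 * x \<le> norm (u T w ?k)" by (simp add: A_def)
    hence "(x^2 / 4 - Q.Lb - C3 * x)^2 \<le> (norm (u T w ?k))^2" using x(3) by (intro power_mono)
    also have "... \<le> L2norm2 (u T w)" using L2norm2_ge[OF uL, of "{?k}"] by simp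
    finally have 1: "K * (C3^2 * x^2 + T * trGG g) < L2norm2 (u T w)" using x(2) by linarith
    \<comment> \<open>At time 0 shear flow and path vanish, so only the contribution of size C3 sqrt
      A remains.\<close>
    have "lb (C3 * x) (u 0 w)" using ud[of 0 w] N.b_neg[of 0 w] N.vf_v0_zero by simp
    hence "L2norm2 (u 0 w) \<le> C3^2 * x^2" using L2norm2_le by (metis power_mult_distrib)
    hence "K * (L2norm2 (u 0 w) + T * trGG g) \<le> K * (C3^2 * x^2 + T * trGG g)"
      using assms(9) by (intro mult_left_mono) auto
    thus "K * (L2norm2 (u 0 w) + T * trGG g) < L2norm2 (u T w)" using 1 by linarith
  qed
  ultimately show ?thesis using ga by blast
qed

end
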